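(* Let $N\ge 2$, let $\omega\subset\mathbb{R}^{N-1}$ be a nonempty bounded open set with Lipschitz boundary, and let $\Omega=(0,1)\times\omega$, with generic point $X=(x,x_1,\dots,x_{N-1})$, $x\in(0,1)$. Let $a>0$ and $b,c,d\in L^\infty(0,1)$ be real-valued. Suppose there are $0\le\alpha_1<\alpha_2<\alpha_3<\alpha_4\le 1$ and constants $b_0,c_0,d_0>0$ such that $$b\ge b_0 \text{ in }(\alpha_1,\alpha_4),\quad b\ge 0\text{ in }(0,1)\setminus(\alpha_1,\alpha_4),\quad |c|\ge c_0\text{ in }(\alpha_2,\alpha_3),\quad c=0\text{ in }(0,1)\setminus(\alpha_2,\alpha_3),$$ $$d\ge d_0\text{ in }(\alpha_1,\alpha_4),\quad d\ge0\text{ in }(0,1)\setminus(\alpha_1,\alpha_4).$$ Let $\mathcal{A}$ be the operator defined in the context, and for $\Phi_0=(\phi_0,\phi_1,\psi_0,\psi_1)^\top\in D(\mathcal{A})$ let $(\phi,\phi_t,\psi,\psi_t)^\top=e^{t\mathcal{A}}\Phi_0$ be the corresponding solution of the coupled wave system in the context, with energy $E(t)$. Then there exists a constant $C>0$, independent of $\Phi_0$, such that $$E(t)\le \frac{C}{t}\,\|\Phi_0\|_{D(\mathcal{A})}^2,\qquad \forall t>0,\ \forall \Phi_0\in D(\mathcal{A}).$$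
   Context: Inequalities for $L^\infty$ functions are understood almost everywhere. The coefficients $b,c,d$ are regarded as functions on $\Omega$ depending only on the first variable $x$. System: $$\begin{cases}\phi_{tt}-\Delta\phi+b(x)\phi_t+c(x)\psi_t=0 &\text{in }\Omega\times(0,\infty),\\ \psi_{tt}-a\Delta\psi+d(x)\psi_t-c(x)\phi_t=0&\text{in }\Omega\times(0,\infty),\\ \phi=\psi=0&\text{on }\partial\Omega\times(0,\infty),\\ (\phi,\phi_t)(\cdot,0)=(\phi_0,\phi_1),\ (\psi,\psi_t)(\cdot,0)=(\psi_0,\psi_1)&\text{in }\Omega.\end{cases}$$ Energy: $E(t)=\frac12\int_\Omega\left(|\nabla\phi|^2+|\phi_t|^2+a|\nabla\psi|^2+|\psi_t|^2\right)dX$. Energy space (complex-valued functions): $\mathcal{H}=(H_0^1(\Omega)\times L^2(\Omega))^2$ with inner product $$\langle(\phi,v,\psi,z),(\tilde\phi,\tilde v,\tilde\psi,\tilde z)\rangle_{\mathcal H}=\int_\Omega\left(\nabla\phi\cdot\nabla\overline{\tilde\phi}+v\overline{\tilde v}+a\nabla\psi\cdot\nabla\overline{\tilde\psi}+z\overline{\tilde z}\right)dX.$$ Operator: $D(\mathcal{A})=[D(\Delta_{\rm Dir})\times H_0^1(\Omega)]^2$, where $D(\Delta_{\rm Dir})=\{u\in H_0^1(\Omega):\Delta u\in L^2(\Omega)\}$, and $$\mathcal{A}(\phi,v,\psi,z)^\top=(v,\ \Delta\phi-bv-cz,\ z,\ a\Delta\psi-dz+cv)^\top.$$ $\mathcal{A}$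 generates a $C_0$-semigroup of contractions $(e^{t\mathcal{A}})_{t\ge0}$ on $\mathcal{H}$; the solution of the system with initial state $\Phi_0$ is $\Phi(t)=(\phi,\phi_t,\psi,\psi_t)^\top=e^{t\mathcal{A}}\Phi_0$. $\|\cdot\|_{D(\mathcal{A})}$ is the graph norm, $\|\Phi\|_{D(\mathcal A)}^2=\|\Phi\|_{\mathcal H}^2+\|\mathcal{A}\Phi\|_{\mathcal H}^2$. *)

theory Defs
  imports "HOL-Analysis.Analysis"
begin

definition partial :: "'a::euclidean_space \<Rightarrow> ('a \<Rightarrow> complex) \<Rightarrow> 'a \<Rightarrow> complex" where
  "partial i f = (\<lambda>x. frechet_derivative f (at x) i)"

fun Ck :: "nat \<Rightarrow> ('a::euclidean_space \<Rightarrow> complex) \<Rightarrow> bool" where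
  "Ck 0 f \<longleftrightarrow> continuous_on UNIV f"
| "Ck (Suc k) f \<longleftrightarrow> f differentiable_on UNIV \<and> (\<forall>i\<in>Basis. Ck k (partial i f))"

text \<open>Elements of \<open>C\<^sub>c\<^sup>\<infinity>(\<Omega>)\<close> are extended by zero to the whole space.\<close>

definition test_fun :: "'a::euclidean_space set \<Rightarrow> ('a \<Rightarrow> complex) \<Rightarrow> bool" where
  "test_fun \<Omega> f \<longleftrightarrow>
     (\<forall>k. Ck k f) \<and> compact (closure {x. f x \<noteq> 0}) \<and> closure {x. f x \<noteq> 0} \<subseteq> \<Omega>"

definition laplacian :: "('a::euclidean_space \<Rightarrow> complex) \<Rightarrow> 'a \<Rightarrow> complex" where
  "laplacian f = (\<lambda>x. \<Sum>i\<in>Basis. partial i (partial i f) x)"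

text \<open>
  Elements of \<open>L\<^sup>2(\<Omega>)\<close> and of the spaces built on it are represented by functions on the whole
  space, of which only the values almost everywhere in \<open>\<Omega>\<close> matter. No quotient is formed;
  equality in these spaces is almost everywhere equality on \<open>\<Omega>\<close>.
\<close>

definition L2 :: "'a::euclidean_space set \<Rightarrow> ('a \<Rightarrow> complex) set" where
  "L2 \<Omega> = {u. u \<in> borel_measurable (lebesgue_on \<Omega>) \<and>
              integrable (lebesgue_on \<Omega>) (\<lambda>x. (norm (u x))\<^sup>2)}"

definition Linf :: "'a::euclidean_space set \<Rightarrow> ('a \<Rightarrow> real) set" where
  "Linf \<Omega> = {u. u \<in> borel_measurable (lebesgue_on \<Omega>) \<and>
                (\<exists>M. AE x in lebesgue_on \<Omega>. \<bar>u x\<bar> \<le> M)}"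

definition has_weak_partial ::
    "'a::euclidean_space set \<Rightarrow> 'a \<Rightarrow> ('a \<Rightarrow> complex) \<Rightarrow> ('a \<Rightarrow> complex) \<Rightarrow> bool" where
  "has_weak_partial \<Omega> i u g \<longleftrightarrow> g \<in> L2 \<Omega> \<and>
     (\<forall>f. test_fun \<Omega> f \<longrightarrow>
        (\<integral>x. u x * partial i f x \<partial>lebesgue_on \<Omega>) = - (\<integral>x. g x * f x \<partial>lebesgue_on \<Omega>))"

definition weak_partial ::
    "'a::euclidean_space set \<Rightarrow> 'a \<Rightarrow> ('a \<Rightarrow> complex) \<Rightarrow> 'a \<Rightarrow> complex" where
  "weak_partial \<Omega> i u = (SOME g. has_weak_partial \<Omega> i u g)"

definition has_weak_laplacian ::
    "'a::euclidean_space set \<Rightarrow> ('a \<Rightarrow> complex) \<Rightarrow> ('a \<Rightarrow> complex) \<Rightarrow> bool" where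
  "has_weak_laplacian \<Omega> u g \<longleftrightarrow> g \<in> L2 \<Omega> \<and>
     (\<forall>f. test_fun \<Omega> f \<longrightarrow>
        (\<integral>x. u x * laplacian f x \<partial>lebesgue_on \<Omega>) = (\<integral>x. g x * f x \<partial>lebesgue_on \<Omega>))"

definition weak_laplacian ::
    "'a::euclidean_space set \<Rightarrow> ('a \<Rightarrow> complex) \<Rightarrow> 'a \<Rightarrow> complex" where
  "weak_laplacian \<Omega> u = (SOME g. has_weak_laplacian \<Omega> u g)"

definition H1 :: "'a::euclidean_space set \<Rightarrow> ('a \<Rightarrow> complex) set" where
  "H1 \<Omega> = {u \<in> L2 \<Omega>. \<forall>i\<in>Basis. \<exists>g. has_weak_partial \<Omega> i u g}"

text \<open>\<open>\<nabla>u \<cdot> \<nabla>v\<^sup>*\<close> with \<open>v\<^sup>*\<close> the complex conjugate of \<open>v\<close>.\<close>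

definition grad_dot ::
    "'a::euclidean_space set \<Rightarrow> ('a \<Rightarrow> complex) \<Rightarrow> ('a \<Rightarrow> complex) \<Rightarrow> 'a \<Rightarrow> complex" where
  "grad_dot \<Omega> u v x = (\<Sum>i\<in>Basis. weak_partial \<Omega> i u x * cnj (weak_partial \<Omega> i v x))"

definition grad_norm :: "'a::euclidean_space set \<Rightarrow> ('a \<Rightarrow> complex) \<Rightarrow> 'a \<Rightarrow> real" where
  "grad_norm \<Omega> u x = sqrt (\<Sum>i\<in>Basis. (norm (weak_partial \<Omega> i u x))\<^sup>2)"

definition H1_norm :: "'a::euclidean_space set \<Rightarrow> ('a \<Rightarrow> complex) \<Rightarrow> real" where
  "H1_norm \<Omega> u = sqrt (\<integral>x. (norm (u x))\<^sup>2 + (grad_norm \<Omega> u x)\<^sup>2 \<partial>lebesgue_on \<Omega>)"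

definition H10 :: "'a::euclidean_space set \<Rightarrow> ('a \<Rightarrow> complex) set" where
  "H10 \<Omega> = {u \<in> H1 \<Omega>. \<exists>f. (\<forall>n. test_fun \<Omega> (f n)) \<and>
               (\<lambda>n::nat. H1_norm \<Omega> (\<lambda>x. u x - f n x)) \<longlonglongrightarrow> 0}"

definition dom_laplacian :: "'a::euclidean_space set \<Rightarrow> ('a \<Rightarrow> complex) set" where
  "dom_laplacian \<Omega> = {u \<in> H10 \<Omega>. \<exists>g. has_weak_laplacian \<Omega> u g}"

text \<open>
  Near every boundary point, \<open>S\<close> is the strict epigraph, in the direction of some unit vector \<open>e\<close>,
  of a Lipschitz function on the hyperplane orthogonal to \<open>e\<close>. Since \<open>U\<close> is open, the boundary
  of \<open>S\<close> within \<open>U\<close> is then the graph, with \<open>S\<close> on one side of it only.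
\<close>

definition lipschitz_boundary :: "'a::euclidean_space set \<Rightarrow> bool" where
  "lipschitz_boundary S \<longleftrightarrow>
     (\<forall>p\<in>frontier S. \<exists>U e g L.
        open U \<and> p \<in> U \<and> norm e = 1 \<and> L-lipschitz_on {y. y \<bullet> e = 0} (g :: 'a \<Rightarrow> real) \<and>
        S \<inter> U = {x \<in> U. g (x - (x \<bullet> e) *\<^sub>R e) < x \<bullet> e})"

type_synonym 'a state =
  "('a \<Rightarrow> complex) \<times> ('a \<Rightarrow> complex) \<times> ('a \<Rightarrow> complex) \<times> ('a \<Rightarrow> complex)"

definition energy_space :: "'a::euclidean_space set \<Rightarrow> 'a state set" where
  "energy_space \<Omega> = H10 \<Omega> \<times> L2 \<Omega> \<times> H10 \<Omega> \<times> L2 \<Omega>"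

fun state_eq :: "'a::euclidean_space set \<Rightarrow> 'a state \<Rightarrow> 'a state \<Rightarrow> bool" where
  "state_eq \<Omega> (\<phi>, v, \<psi>, z) (\<phi>', v', \<psi>', z') \<longleftrightarrow>
     (AE x in lebesgue_on \<Omega>. \<phi> x = \<phi>' x \<and> v x = v' x \<and> \<psi> x = \<psi>' x \<and> z x = z' x)"

fun state_add :: "'a state \<Rightarrow> 'a state \<Rightarrow> 'a state" where
  "state_add (\<phi>, v, \<psi>, z) (\<phi>', v', \<psi>', z') =
     (\<lambda>x. \<phi> x + \<phi>' x, \<lambda>x. v x + v' x, \<lambda>x. \<psi> x + \<psi>' x, \<lambda>x. z x + z' x)"

fun state_scale :: "complex \<Rightarrow> 'a state \<Rightarrow> 'a state" where
  "state_scale k (\<phi>, v, \<psi>, z) = (\<lambda>x. k * \<phi> x, \<lambda>x. k * v x, \<lambda>x. k * \<psi> x, \<lambda>x. k * z x)"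

definition state_diff :: "'a state \<Rightarrow> 'a state \<Rightarrow> 'a state" where
  "state_diff U V = state_add U (state_scale (-1) V)"

fun energy_inner ::
    "'a::euclidean_space set \<Rightarrow> real \<Rightarrow> 'a state \<Rightarrow> 'a state \<Rightarrow> complex" where
  "energy_inner \<Omega> a (\<phi>, v, \<psi>, z) (\<phi>', v', \<psi>', z') =
     (\<integral>x. grad_dot \<Omega> \<phi> \<phi>' x + v x * cnj (v' x)
          + of_real a * grad_dot \<Omega> \<psi> \<psi>' x + z x * cnj (z' x) \<partial>lebesgue_on \<Omega>)"

definition energy_norm :: "'a::euclidean_space set \<Rightarrow> real \<Rightarrow> 'a state \<Rightarrow> real" where
  "energy_norm \<Omega> a U = sqrt (Re (energy_inner \<Omega> a U U))"

fun energy :: "'a::euclidean_space set \<Rightarrow> real \<Rightarrow> 'a state \<Rightarrow> real" where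
  "energy \<Omega> a (\<phi>, v, \<psi>, z) =
     1/2 * (\<integral>x. (grad_norm \<Omega> \<phi> x)\<^sup>2 + (norm (v x))\<^sup>2
                + a * (grad_norm \<Omega> \<psi> x)\<^sup>2 + (norm (z x))\<^sup>2 \<partial>lebesgue_on \<Omega>)"

definition wave_dom :: "'a::euclidean_space set \<Rightarrow> 'a state set" where
  "wave_dom \<Omega> = dom_laplacian \<Omega> \<times> H10 \<Omega> \<times> dom_laplacian \<Omega> \<times> H10 \<Omega>"

text \<open>The coefficients are functions of the first coordinate \<open>fst X\<close> of \<open>X = (x, x\<^sub>1, \<dots>)\<close>.\<close>

fun wave_op ::
    "(real \<times> 'b::euclidean_space) set \<Rightarrow> real \<Rightarrow> (real \<Rightarrow> real) \<Rightarrow> (real \<Rightarrow> real) \<Rightarrow> (real \<Rightarrow> real)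
      \<Rightarrow> (real \<times> 'b) state \<Rightarrow> (real \<times> 'b) state" where
  "wave_op \<Omega> a b c d (\<phi>, v, \<psi>, z) =
     (v,
      \<lambda>X. weak_laplacian \<Omega> \<phi> X - of_real (b (fst X)) * v X - of_real (c (fst X)) * z X,
      z,
      \<lambda>X. of_real a * weak_laplacian \<Omega> \<psi> X - of_real (d (fst X)) * z X
            + of_real (c (fst X)) * v X)"

definition wave_graph_norm ::
    "(real \<times> 'b::euclidean_space) set \<Rightarrow> real \<Rightarrow> (real \<Rightarrow> real) \<Rightarrow> (real \<Rightarrow> real) \<Rightarrow> (real \<Rightarrow> real)
      \<Rightarrow> (real \<times> 'b) state \<Rightarrow> real" where
  "wave_graph_norm \<Omega> a b c d U =
     sqrt ((energy_norm \<Omega> a U)\<^sup>2 + (energy_norm \<Omega> a (wave_op \<Omega> a b c d U))\<^sup>2)"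

text \<open>
  \<open>T\<close> is a strongly continuous semigroup of bounded complex-linear operators on the energy space.
  The second clause says that each \<open>T t\<close> is well defined modulo almost everywhere equality.
\<close>

definition C0_semigroup ::
    "'a::euclidean_space set \<Rightarrow> real \<Rightarrow> (real \<Rightarrow> 'a state \<Rightarrow> 'a state) \<Rightarrow> bool" where
  "C0_semigroup \<Omega> a T \<longleftrightarrow>
     (\<forall>t\<ge>0. \<forall>U\<in>energy_space \<Omega>. T t U \<in> energy_space \<Omega>) \<and>
     (\<forall>t\<ge>0. \<forall>U\<in>energy_space \<Omega>. \<forall>V\<in>energy_space \<Omega>.
        state_eq \<Omega> U V \<longrightarrow> state_eq \<Omega> (T t U) (T t V)) \<and>
     (\<forall>t\<ge>0. \<forall>U\<in>energy_space \<Omega>. \<forall>V\<in>energy_space \<Omega>.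
        state_eq \<Omega> (T t (state_add U V)) (state_add (T t U) (T t V))) \<and>
     (\<forall>t\<ge>0. \<forall>k. \<forall>U\<in>energy_space \<Omega>.
        state_eq \<Omega> (T t (state_scale k U)) (state_scale k (T t U))) \<and>
     (\<forall>t\<ge>0. \<exists>K. \<forall>U\<in>energy_space \<Omega>. energy_norm \<Omega> a (T t U) \<le> K * energy_norm \<Omega> a U) \<and>
     (\<forall>U\<in>energy_space \<Omega>. state_eq \<Omega> (T 0 U) U) \<and>
     (\<forall>s\<ge>0. \<forall>t\<ge>0. \<forall>U\<in>energy_space \<Omega>. state_eq \<Omega> (T (s + t) U) (T s (T t U))) \<and>
     (\<forall>U\<in>energy_space \<Omega>. ((\<lambda>t. energy_norm \<Omega> a (state_diff (T t U) U)) \<longlongrightarrow> 0) (at_right 0))"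

text \<open>\<open>V\<close> is the value at \<open>U\<close> of the infinitesimal generator of \<open>T\<close>.\<close>

definition has_generator_value ::
    "'a::euclidean_space set \<Rightarrow> real \<Rightarrow> (real \<Rightarrow> 'a state \<Rightarrow> 'a state) \<Rightarrow> 'a state \<Rightarrow> 'a state \<Rightarrow> bool"
  where
  "has_generator_value \<Omega> a T U V \<longleftrightarrow>
     ((\<lambda>h. energy_norm \<Omega> a
             (state_diff (state_scale (of_real (1 / h)) (state_diff (T h U) U)) V)) \<longlongrightarrow> 0)
       (at_right 0)"

text \<open>\<open>T t = e\<^bsup>tA\<^esup>\<close> for the wave operator \<open>A\<close>: the generator of \<open>T\<close> is \<open>A\<close>, domain included.\<close>

definition wave_semigroup ::
    "(real \<times> 'b::euclidean_space) set \<Rightarrow> real \<Rightarrow> (real \<Rightarrow> real) \<Rightarrow> (real \<Rightarrow> real) \<Rightarrow> (real \<Rightarrow> real)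
      \<Rightarrow> (real \<Rightarrow> (real \<times> 'b) state \<Rightarrow> (real \<times> 'b) state) \<Rightarrow> bool" where
  "wave_semigroup \<Omega> a b c d T \<longleftrightarrow>
     C0_semigroup \<Omega> a T \<and>
     (\<forall>U\<in>energy_space \<Omega>. \<forall>V\<in>energy_space \<Omega>.
        has_generator_value \<Omega> a T U V \<longleftrightarrow>
          U \<in> wave_dom \<Omega> \<and> state_eq \<Omega> V (wave_op \<Omega> a b c d U))"

end

theory Submission
  imports Defs
begin

text \<open>
  Let \<open>q x = x - \<beta> x\<close> vanish at both ends of the interval, with \<open>q' = 1 - \<rho>\<close> and \<open>\<rho> \<ge> 0\<close> supported in
  the damped strip. Testing the equations with \<open>q \<partial>\<^sub>x u + (1 + \<rho>) / 2 u\<close> gives a Lyapunov functional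
  whose derivative along an orbit is at most \<open>- (\<parallel>\<partial>\<^sub>x \<phi>\<parallel>\<^sup>2 + a \<parallel>\<partial>\<^sub>x \<psi>\<parallel>\<^sup>2) / 2\<close>, plus multiples of the dissipation
  \<open>\<integral> b \<bar>\<phi>\<^sub>t\<bar>\<^sup>2 + d \<bar>\<psi>\<^sub>t\<bar>\<^sup>2\<close> and of the lower order term \<open>\<integral> b \<bar>\<phi>\<bar>\<^sup>2 + d \<bar>\<psi>\<bar>\<^sup>2\<close>; the coupling is controlled
  by the dissipation because \<open>c\<close> lives in the damped strip. For the time derivative of an orbit
  \<open>(\<phi>, \<phi>\<^sub>t, \<psi>, \<psi>\<^sub>t)\<close> the lower order term is the dissipation of the orbit itself, so that
  \<open>\<integral> \<parallel>\<partial>\<^sub>x \<phi>\<^sub>t\<parallel>\<^sup>2 + \<parallel>\<partial>\<^sub>x \<psi>\<^sub>t\<parallel>\<^sup>2 dt\<close> is bounded by the squared graph norm. The Poincare inequality in \<open>x\<close>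
  then bounds the time integral of the kinetic energy, equipartition that of the whole energy, and
  \<open>t E(t) \<le> \<integral> E\<close> because the energy decreases.
\<close>

section \<open>Smooth functions and test functions\<close>

text \<open>Waves running across the axis outside the damped strip may never meet the damping, and
  there the multiplier balance contains neither the transverse gradient nor the velocities: it
  controls axial derivatives only. Velocities are recovered by reading them as displacements of the
  differentiated orbit; the derivative spent on this is what brings the graph norm into the bound.

  Two obstacles shape the details. The function \<open>q\<close> times the axial derivative of
  \<open>u\<close> need not lie in \<open>H10\<close>, so its pairing with the Laplacian is
  estimated from one side, by sliding test functions along the axis.

  As only right derivatives in time are at hand, no time integral is formed:
  \<open>decay_step\<close> shows one function of time to be nonincreasing, with the summand
  \<open>s * (1/2 * sq (T s U))\<close> built in.\<close>

lemma partial_eq: "(f has_derivative f') (at x) \<Longrightarrow> partial i f x = f' i"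
  unfolding partial_def using frechet_derivative_at by metis

lemma Ck_Suc_imp: "Ck (Suc k) f \<Longrightarrow> Ck k f"
proof (induction k arbitrary: f)
  case 0
  then show ?case by (auto intro: differentiable_imp_continuous_on)
next
  case (Suc k)
  then show ?case by auto
qed

lemma Ck_differentiable: "Ck (Suc k) f \<Longrightarrow> f differentiable (at x)"
  by (simp add: differentiable_on_def)

lemma Ck_has_derivative: "Ck (Suc k) f \<Longrightarrow> (f has_derivative frechet_derivative f (at x)) (at x)"
  using Ck_differentiable frechet_derivative_works by blast

lemma Ck_SucI:
  assumes "\<And>x. (f has_derivative f' x) (at x)" "\<And>i. i \<in> Basis \<Longrightarrow> Ck k (\<lambda>x. f' x i)"
  shows "Ck (Suc k) f"
proof -
  have "partial i f = (\<lambda>x. f' x i)" for i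
    using partial_eq[OF assms(1)] by blast
  moreover have "f differentiable_on UNIV"
    using assms(1) by (meson differentiable_def differentiable_at_imp_differentiable_on)
  ultimately show ?thesis using assms(2) by simp
qed

lemma Ck_const: "Ck k (\<lambda>x. c)"
proof (induction k arbitrary: c)
  case (Suc k)
  show ?case by (rule Ck_SucI[where f'="\<lambda>_ _. 0"]) (auto intro: Suc)
qed auto

lemma Ck_add: "Ck k f \<Longrightarrow> Ck k g \<Longrightarrow> Ck k (\<lambda>x. f x + g x)"
proof (induction k arbitrary: f g)
  case 0
  then show ?case by (simp add: continuous_on_add)
next
  case (Suc k)
  show ?case
  proof (rule Ck_SucI)
    show "((\<lambda>x. f x + g x) has_derivative
        (\<lambda>h. frechet_derivative f (at x) h + frechet_derivative g (at x) h)) (at x)" for x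
      by (rule has_derivative_add[OF Ck_has_derivative[OF Suc.prems(1)] Ck_has_derivative[OF Suc.prems(2)]])
    show "Ck k (\<lambda>x. frechet_derivative f (at x) i + frechet_derivative g (at x) i)"
      if "i \<in> Basis" for i
      using Suc.IH[of "partial i f" "partial i g"] Suc.prems that by (simp add: partial_def)
  qed
qed

lemma Ck_mult: "Ck k f \<Longrightarrow> Ck k g \<Longrightarrow> Ck k (\<lambda>x. f x * g x)"
proof (induction k arbitrary: f g)
  case 0
  then show ?case by (simp add: continuous_on_mult)
next
  case (Suc k)
  show ?case
  proof (rule Ck_SucI)
    show "((\<lambda>x. f x * g x) has_derivative
        (\<lambda>h. f x * frechet_derivative g (at x) h + frechet_derivative f (at x) h * g x)) (at x)" for x
      by (rule has_derivative_mult[OF Ck_has_derivative[OF Suc.prems(1)] Ck_has_derivative[OF Suc.prems(2)]])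
    show "Ck k (\<lambda>x. f x * frechet_derivative g (at x) i + frechet_derivative f (at x) i * g x)"
      if "i \<in> Basis" for i
    proof (rule Ck_add)
      show "Ck k (\<lambda>x. f x * frechet_derivative g (at x) i)"
        using Suc.IH[of f "partial i g"] Suc.prems Ck_Suc_imp[OF Suc.prems(1)] that
        by (simp add: partial_def)
      show "Ck k (\<lambda>x. frechet_derivative f (at x) i * g x)"
        using Suc.IH[of "partial i f" g] Suc.prems Ck_Suc_imp[OF Suc.prems(2)] that
        by (simp add: partial_def)
    qed
  qed
qed

lemma Ck_prod: "(\<And>i. i \<in> A \<Longrightarrow> Ck k (f i)) \<Longrightarrow> Ck k (\<lambda>x. \<Prod>i\<in>A. f i x)"
  by (induction A rule: infinite_finite_induct) (auto intro: Ck_const Ck_mult)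

lemma Ck_cnj: "Ck k f \<Longrightarrow> Ck k (\<lambda>x. cnj (f x))"
proof (induction k arbitrary: f)
  case 0
  then show ?case by (simp add: continuous_on_cnj)
next
  case (Suc k)
  show ?case
  proof (rule Ck_SucI)
    show "((\<lambda>x. cnj (f x)) has_derivative (\<lambda>h. cnj (frechet_derivative f (at x) h))) (at x)" for x
      by (rule has_derivative_cnj[OF Ck_has_derivative[OF Suc.prems]])
    show "Ck k (\<lambda>x. cnj (frechet_derivative f (at x) i))" if "i \<in> Basis" for i
      using Suc.IH[of "partial i f"] Suc.prems that by (simp add: partial_def)
  qed
qed

text \<open>One induction serves three purposes: affine rescaling on the line, the one-dimensional
  factors of bumps on boxes, and functions of the axial variable, which is the case
  \<open>w = (1, 0)\<close>.\<close>

lemma Ck_inner: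
  fixes f :: "real \<Rightarrow> complex" and w :: "'a::euclidean_space"
  shows "Ck k f \<Longrightarrow> Ck k (\<lambda>X. f (X \<bullet> w + c))"
proof (induction k arbitrary: f)
  case 0
  then have "continuous_on UNIV f" by simp
  then have "continuous_on UNIV (\<lambda>X. f (X \<bullet> w + c))"
    by (rule continuous_on_compose2) (intro continuous_intros, simp)
  then show ?case by simp
next
  case (Suc k)
  show ?case
  proof (rule Ck_SucI)
    show "((\<lambda>X. f (X \<bullet> w + c)) has_derivative
        (\<lambda>h. frechet_derivative f (at (x \<bullet> w + c)) (h \<bullet> w))) (at x)" for x
    proof (rule has_derivative_compose[where f="\<lambda>X. X \<bullet> w + c"])
      show "((\<lambda>X. X \<bullet> w + c) has_derivative (\<lambda>h. h \<bullet> w)) (at x)"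
        by (auto intro!: derivative_eq_intros)
      show "(f has_derivative frechet_derivative f (at (x \<bullet> w + c))) (at (x \<bullet> w + c))"
        by (rule Ck_has_derivative[OF Suc.prems])
    qed
    show "Ck k (\<lambda>x. frechet_derivative f (at (x \<bullet> w + c)) (i \<bullet> w))" for i
    proof -
      have "frechet_derivative f (at y) (i \<bullet> w) = of_real (i \<bullet> w) * partial 1 f y" for y
      proof -
        have "linear (frechet_derivative f (at y))"
          using Ck_differentiable[OF Suc.prems] linear_frechet_derivative by blast
        then have "frechet_derivative f (at y) ((i \<bullet> w) *\<^sub>R 1)
            = (i \<bullet> w) *\<^sub>R frechet_derivative f (at y) 1"
          by (rule linear_scale)
        then show ?thesis by (simp add: partial_def scaleR_conv_of_real)
      qed
      moreover have "Ck k (\<lambda>x. partial 1 f (x \<bullet> w + c))"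
        using Suc.prems by (intro Suc.IH) simp
      ultimately show ?thesis by (simp add: Ck_mult Ck_const)
    qed
  qed
qed

text \<open>The weights multiply quadratic expressions and have to be real, whereas
  \<open>Ck\<close> speaks of complex values; hence the embedding.\<close>

definition smooth1 :: "(real \<Rightarrow> real) \<Rightarrow> bool" where
  "smooth1 p \<longleftrightarrow> (\<forall>k. Ck k (\<lambda>x. complex_of_real (p x)))"

lemma smooth1_const: "smooth1 (\<lambda>_. c)"
  by (simp add: smooth1_def Ck_const)

lemma smooth1_add: "smooth1 p \<Longrightarrow> smooth1 r \<Longrightarrow> smooth1 (\<lambda>x. p x + r x)"
  by (simp add: smooth1_def Ck_add)

lemma smooth1_mult: "smooth1 p \<Longrightarrow> smooth1 r \<Longrightarrow> smooth1 (\<lambda>x. p x * r x)"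
  by (simp add: smooth1_def Ck_mult)

lemma smooth1_affine: "smooth1 p \<Longrightarrow> smooth1 (\<lambda>x. p (m * x + c))"
  using Ck_inner[where 'a=real and w=m and f="\<lambda>x. complex_of_real (p x)" and c=c]
  by (simp add: smooth1_def mult.commute)

lemma smooth1_antiderivative:
  assumes "\<And>x. (p has_real_derivative p' x) (at x)" "smooth1 p'"
  shows "smooth1 p"
  unfolding smooth1_def
proof
  fix k
  have "Ck (Suc k) (\<lambda>x. complex_of_real (p x))"
  proof (rule Ck_SucI)
    show "((\<lambda>x. complex_of_real (p x)) has_derivative (\<lambda>h. complex_of_real (p' x * h))) (at x)" for x
      using assms(1)[of x] by (intro has_derivative_of_real) (simp add: has_field_derivative_def)
    show "Ck k (\<lambda>x. complex_of_real (p' x * i))" if "i \<in> Basis" for i :: real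
      using assms(2) that by (simp add: smooth1_def)
  qed
  then show "Ck k (\<lambda>x. complex_of_real (p x))" by (rule Ck_Suc_imp)
qed

lemma smooth1_ident: "smooth1 (\<lambda>x. x)"
  by (rule smooth1_antiderivative[where p'="\<lambda>_. 1"]) (auto intro: smooth1_const)

lemma smooth1_derivative:
  assumes "smooth1 p"
  obtains p' where "\<And>x. (p has_real_derivative p' x) (at x)" "smooth1 p'"
proof -
  let ?f = "\<lambda>x. complex_of_real (p x)"
  define F where "F x = frechet_derivative ?f (at x)" for x
  have C: "Ck k ?f" for k using assms by (simp add: smooth1_def)
  have D: "(?f has_derivative F x) (at x)" for x
    unfolding F_def by (rule Ck_has_derivative[OF C])
  have d: "(p has_derivative (\<lambda>h. Re (F x h))) (at x)" for x
    using has_derivative_Re[OF D[of x]] by simp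
  \<comment> \<open>Both sides are derivatives of the same embedded function, so the derivative
    takes real values and can be read back as one of \<open>p\<close>.\<close>
  have im: "F x = (\<lambda>h. of_real (Re (F x h)))" for x
    by (rule has_derivative_unique[OF D has_derivative_of_real[OF d]])
  have lin: "(\<lambda>h. Re (F x h)) = (*) (Re (F x 1))" for x
  proof
    fix h
    show "Re (F x h) = Re (F x 1) * h"
      using linear_scale[OF bounded_linear.linear[OF has_derivative_bounded_linear[OF d[of x]]], of h 1]
      by (simp only: real_scaleR_def mult_1_right mult_1_left mult.commute)
  qed
  have "(p has_real_derivative Re (F x 1)) (at x)" for x
    using d[of x] by (simp only: has_field_derivative_def lin)
  moreover have "smooth1 (\<lambda>x. Re (F x 1))"
  proof -
    have "(\<lambda>x. complex_of_real (Re (F x 1))) = partial 1 ?f"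
      unfolding partial_def F_def[symmetric] by (rule ext, subst (2) im, rule refl)
    then show ?thesis
      using C[of "Suc _"] by (simp add: smooth1_def)
  qed
  ultimately show ?thesis by (rule that)
qed

section \<open>Smooth bumps on the line built from exp(-1/x)\<close>

definition flat :: "real poly \<Rightarrow> real \<Rightarrow> real" where
  "flat P x = (if x > 0 then poly P (1 / x) * exp (- (1 / x)) else 0)"

lemma poly_exp_tendsto_0: "((\<lambda>y. poly P y * exp (- y)) \<longlongrightarrow> (0::real)) at_top"
proof -
  have "((\<lambda>y. \<Sum>i\<le>degree P. coeff P i * (y ^ i / exp y)) \<longlongrightarrow> (\<Sum>i\<le>degree P. coeff P i * 0)) at_top"
    by (intro tendsto_intros tendsto_power_div_exp_0)
  then show ?thesis
    by (simp add: poly_altdef sum_distrib_right exp_minus divide_inverse mult.assoc)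
qed

lemma flat_tendsto_0: "(flat P \<longlongrightarrow> 0) (at 0)"
proof (rule filterlim_split_at)
  show "(flat P \<longlongrightarrow> 0) (at_left 0)"
    by (rule tendsto_eventually) (auto simp: flat_def eventually_at_filter)
  have "((\<lambda>x. poly P (inverse x) * exp (- inverse x)) \<longlongrightarrow> 0) (at_right 0)"
    by (rule filterlim_compose[OF poly_exp_tendsto_0 filterlim_inverse_at_top_right])
  then show "(flat P \<longlongrightarrow> 0) (at_right 0)"
    by (rule Lim_transform_eventually)
       (auto simp: flat_def eventually_at_filter inverse_eq_divide)
qed

lemma has_real_derivative_cong_open:
  assumes "(g has_real_derivative D) (at x)" "open S" "x \<in> S" "\<And>y. y \<in> S \<Longrightarrow> f y = g y"
  shows "(f has_real_derivative D) (at x)"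
  using has_field_derivative_transform_within_open[OF assms(1-3)] assms(4) by simp

text \<open>With y = 1/x, the derivative of P(y) exp(-y) with respect to x is y^2 (P - P')(y)
  exp(-y), and \<open>[:0, 0, 1:]\<close> is y^2. The family indexed by polynomials is therefore
  closed under differentiation, which turns smoothness into a single induction.\<close>

lemma flat_has_derivative:
  "(flat P has_real_derivative flat ([:0, 0, 1:] * (P - pderiv P)) x) (at x)"
proof (cases x "0::real" rule: linorder_cases)
  case less
  show ?thesis
    by (rule has_real_derivative_cong_open[where g="\<lambda>_. 0" and S="{..<0}"])
       (use less in \<open>auto simp: flat_def\<close>)
next
  case equal
  \<comment> \<open>Dividing by h multiplies the polynomial factor by 1/h, so the difference
    quotient at 0 is the flat function of \<open>pCons 0 P\<close> and tends to 0 like every flat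
    function.\<close>
  have "((\<lambda>h. (flat P (0 + h) - flat P 0) / h) \<longlongrightarrow> 0) (at 0)"
    by (rule Lim_transform_eventually[OF flat_tendsto_0[of "pCons 0 P"]])
       (auto simp: flat_def eventually_at_filter)
  then show ?thesis
    using equal by (simp add: DERIV_def flat_def)
next
  case greater
  have "((\<lambda>x. poly P (1 / x) * exp (- (1 / x))) has_real_derivative
      poly P (1 / x) * (exp (- (1 / x)) * (1 / (x * x)))
       + poly (pderiv P) (1 / x) * (- (1 / (x * x))) * exp (- (1 / x))) (at x)"
    using greater
    by (auto intro!: derivative_eq_intros DERIV_chain2[OF poly_DERIV])
  also have "poly P (1 / x) * (exp (- (1 / x)) * (1 / (x * x)))
       + poly (pderiv P) (1 / x) * (- (1 / (x * x))) * exp (- (1 / x))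
       = flat ([:0, 0, 1:] * (P - pderiv P)) x"
    using greater by (simp add: flat_def field_simps)
  finally show ?thesis
    by (rule has_real_derivative_cong_open[where S="{0<..}"])
       (use greater in \<open>auto simp: flat_def\<close>)
qed

lemma smooth1_flat: "smooth1 (flat P)"
proof -
  have "Ck k (\<lambda>x. complex_of_real (flat P x))" for k
  proof (induction k arbitrary: P)
    case 0
    have "continuous_on UNIV (flat P)"
      using flat_has_derivative DERIV_isCont continuous_at_imp_continuous_on by blast
    then have "continuous_on UNIV (\<lambda>x. complex_of_real (flat P x))"
      by (intro continuous_intros)
    then show ?case by simp
  next
    case (Suc k)
    show ?case
    proof (rule Ck_SucI)
      show "((\<lambda>x. complex_of_real (flat P x)) has_derivative
          (\<lambda>h. complex_of_real (flat ([:0, 0, 1:] * (P - pderiv P)) x * h))) (at x)" for x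
        using flat_has_derivative[of P x]
        by (intro has_derivative_of_real) (simp add: has_field_derivative_def)
      show "Ck k (\<lambda>x. complex_of_real (flat ([:0, 0, 1:] * (P - pderiv P)) x * i))"
        if "i \<in> Basis" for i :: real
        using Suc that by simp
    qed
  qed
  then show ?thesis by (simp add: smooth1_def)
qed

text \<open>The slope m serves a limit: on (l, r) both factors tend to 1 as m grows, while off the
  interval the product stays 0, so bumps with values in [0, 1] converge to the indicator of the open
  interval.\<close>

definition bump :: "real \<Rightarrow> real \<Rightarrow> real \<Rightarrow> real \<Rightarrow> real" where
  "bump m l r x = flat 1 (m * (x - l)) * flat 1 (m * (r - x))"

lemma smooth1_bump: "smooth1 (bump m l r)"
proof -
  have "smooth1 (\<lambda>x. flat 1 (m * x + (- (m * l))) * flat 1 ((- m) * x + m * r))"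
    by (intro smooth1_mult smooth1_affine smooth1_flat)
  then show ?thesis
    by (simp add: bump_def[abs_def] algebra_simps)
qed

lemma flat_bounds: "0 \<le> flat 1 x" "flat 1 x \<le> 1" "flat 1 x > 0 \<longleftrightarrow> x > 0" "x \<le> 0 \<Longrightarrow> flat 1 x = 0"
  by (auto simp: flat_def)

lemma bump_bounds: "0 \<le> bump m l r x" "bump m l r x \<le> 1"
  by (auto simp: bump_def flat_bounds mult_le_one)

lemma bump_pos: "m > 0 \<Longrightarrow> l < x \<Longrightarrow> x < r \<Longrightarrow> bump m l r x > 0"
  by (simp add: bump_def flat_bounds)

lemma bump_eq_0: "m > 0 \<Longrightarrow> \<not> (l < x \<and> x < r) \<Longrightarrow> bump m l r x = 0"
  by (auto simp: bump_def flat_bounds mult_le_0_iff)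

lemma bump_tendsto: "(\<lambda>n. bump (real (Suc n)) l r x) \<longlonglongrightarrow> indicator {l<..<r} x"
proof (cases "l < x \<and> x < r")
  case True
  have *: "(\<lambda>n. flat 1 (real (Suc n) * y)) \<longlonglongrightarrow> 1" if "y > 0" for y
  proof -
    have "(\<lambda>n. exp (- (inverse (real (Suc n)) * inverse y))) \<longlonglongrightarrow> exp (- (0 * inverse y))"
      by (intro tendsto_intros LIMSEQ_inverse_real_of_nat)
    moreover have "flat 1 (real (Suc n) * y) = exp (- (inverse (real (Suc n)) * inverse y))" for n
      using that by (simp add: flat_def inverse_eq_divide)
    ultimately show ?thesis by simp
  qed
  have "(\<lambda>n. bump (real (Suc n)) l r x) \<longlonglongrightarrow> 1 * 1"
    unfolding bump_def using True by (intro tendsto_mult *) auto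
  then show ?thesis using True by simp
next
  case False
  then show ?thesis using bump_eq_0[of "real (Suc _)" l x r] by auto
qed

text \<open>The pair below is used as the multiplier \<open>x - \<beta> x\<close>, which vanishes at both ends of
  the interval and has slope 1 away from the support of \<open>\<rho>\<close>.\<close>

lemma exists_smooth_step:
  assumes "0 \<le> l" "l < r" "r \<le> (1::real)"
  obtains \<rho> \<beta> where "smooth1 \<rho>" "smooth1 \<beta>" "\<And>x. (\<beta> has_real_derivative \<rho> x) (at x)"
    "\<And>x. \<rho> x \<ge> 0" "\<And>x. x \<notin> {l<..<r} \<Longrightarrow> \<rho> x = 0" "\<beta> 0 = 0" "\<beta> 1 = 1"
proof -
  have cont: "continuous_on S (bump 1 l r)" for S
  proof -
    obtain p' where "\<And>x. (bump 1 l r has_real_derivative p' x) (at x)"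
      using smooth1_derivative[OF smooth1_bump] by blast
    then show ?thesis using DERIV_isCont continuous_at_imp_continuous_on by blast
  qed
  \<comment> \<open>The lower limit -1 lies to the left of \<open>l\<close>, so the fundamental
    theorem yields a two-sided derivative wherever the bump can be nonzero; further left
    \<open>B\<close> vanishes identically.\<close>
  define B where "B x = integral {-1..x} (bump 1 l r)" for x
  have B0: "B x = 0" if "x \<le> l" for x
    unfolding B_def using that by (subst integral_cong[where g="\<lambda>_. 0"]) (auto simp: bump_eq_0)
  have dB: "(B has_real_derivative bump 1 l r x) (at x)" for x
  proof (cases "x > -1")
    case True
    have "(B has_real_derivative bump 1 l r x) (at x within {-1..x+1})"
      unfolding B_def using True by (intro integral_has_real_derivative cont) auto
    moreover have "at x within {-1..x+1} = at x"
      using True by (intro at_within_interior) auto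
    ultimately show ?thesis by simp
  next
    case False
    have "((\<lambda>_. 0::real) has_real_derivative bump 1 l r x) (at x)"
      using False assms by (simp add: bump_eq_0)
    moreover have "\<forall>\<^sub>F y in nhds x. B y = 0"
      using False assms by (intro eventually_mono[OF eventually_nhds_in_open[of "{..<0}"]] B0) auto
    ultimately show ?thesis
      using DERIV_cong_ev[of x x B "\<lambda>_. 0"] by blast
  qed
  have contB: "continuous_on S B" for S
    using dB DERIV_isCont continuous_at_imp_continuous_on by blast
  have "B l < B r"
  proof (rule DERIV_pos_imp_increasing_open[OF \<open>l < r\<close>])
    show "\<exists>y. (B has_real_derivative y) (at x) \<and> 0 < y" if "l < x" "x < r" for x
      using dB bump_pos[of 1 l x r] that by auto
  qed (rule contB)
  then have Br: "B r > 0" using B0 by simp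
  have "B 1 = B r" 
  proof (cases "r = 1")
    case False
    show ?thesis
    proof (rule DERIV_isconst_end[where f=B and a=r and b=1])
      show "r < 1" using False assms by simp
      show "(B has_real_derivative 0) (at x)" if "r < x" "x < 1" for x
        using dB[of x] that by (simp add: bump_eq_0)
    qed (rule contB)
  qed simp
  note const = this
  show ?thesis
  proof
    show "smooth1 (\<lambda>x. (1 / B r) * bump 1 l r x)"
      by (intro smooth1_mult smooth1_const smooth1_bump)
    show "smooth1 (\<lambda>x. (1 / B r) * B x)"
      by (intro smooth1_mult smooth1_const smooth1_antiderivative[OF dB smooth1_bump])
    show "((\<lambda>x. (1 / B r) * B x) has_real_derivative (1 / B r) * bump 1 l r x) (at x)" for x
      by (intro DERIV_cmult dB)
  qed (use Br B0 const assms bump_bounds in \<open>auto simp: bump_eq_0\<close>)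
qed

section \<open>Differential calculus of products, axial weights and axial substitutions\<close>

lemma partial_add:
  "Ck (Suc k) f \<Longrightarrow> Ck (Suc k) g \<Longrightarrow> partial i (\<lambda>x. f x + g x) = (\<lambda>x. partial i f x + partial i g x)"
  unfolding partial_def[of i f] partial_def[of i g]
  by (rule ext, rule partial_eq[OF has_derivative_add[OF Ck_has_derivative Ck_has_derivative]])

lemma partial_mult:
  "Ck (Suc k) f \<Longrightarrow> Ck (Suc k) g \<Longrightarrow>
    partial i (\<lambda>x. f x * g x) = (\<lambda>x. f x * partial i g x + partial i f x * g x)"
  unfolding partial_def[of i f] partial_def[of i g]
  by (rule ext, rule partial_eq[OF has_derivative_mult[OF Ck_has_derivative Ck_has_derivative]])

lemma partial_cnj: "Ck (Suc k) f \<Longrightarrow> partial i (\<lambda>x. cnj (f x)) = (\<lambda>x. cnj (partial i f x))"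
  unfolding partial_def[of i f]
  by (rule ext, rule partial_eq[OF has_derivative_cnj[OF Ck_has_derivative]])

lemma partial_const: "partial i (\<lambda>x. c) = (\<lambda>x. 0)"
  by (rule ext, rule partial_eq[where f'="\<lambda>_. 0"]) simp

lemma partial_fst:
  assumes "\<And>x. (p has_real_derivative p' x) (at x)"
  shows "partial i (\<lambda>X::real \<times> 'b::euclidean_space. complex_of_real (p (fst X))) = (\<lambda>X. complex_of_real (p' (fst X) * fst i))"
proof (rule ext, rule partial_eq)
  fix X :: "real \<times> 'b"
  have "((\<lambda>X. p (fst X)) has_derivative (\<lambda>h. p' (fst X) * fst h)) (at X)"
    using has_derivative_compose[OF has_derivative_fst[OF has_derivative_ident]
        assms[of "fst X", unfolded has_field_derivative_def]]
    by simp
  then show "((\<lambda>X. complex_of_real (p (fst X))) has_derivative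
      (\<lambda>h. complex_of_real (p' (fst X) * fst h))) (at X)"
    by (rule has_derivative_of_real)
qed

lemma Ck_fst:
  assumes "smooth1 p"
  shows "Ck k (\<lambda>X::real \<times> 'b::euclidean_space. complex_of_real (p (fst X)))"
  using Ck_inner[of k "\<lambda>x. complex_of_real (p x)" "(1, 0) :: real \<times> 'b" 0] assms
  by (simp add: smooth1_def inner_prod_def)

text \<open>It is used with \<theta> the map \<open>flow s\<close>, along which test functions are
  slid in the axial direction.\<close>

definition shear :: "(real \<Rightarrow> real) \<Rightarrow> real \<times> 'b \<Rightarrow> real \<times> 'b" where
  "shear \<theta> X = (\<theta> (fst X), snd X)"

lemma Ck_shear_has_derivative:
  fixes f :: "real \<times> 'b::euclidean_space \<Rightarrow> complex"
  assumes "Ck (Suc k) f" "\<And>x. (\<theta> has_real_derivative \<theta>' x) (at x)"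
  shows "((\<lambda>X. f (shear \<theta> X)) has_derivative
      (\<lambda>h. frechet_derivative f (at (shear \<theta> X)) (\<theta>' (fst X) * fst h, snd h))) (at X)"
proof -
  have "((\<lambda>X. \<theta> (fst X)) has_derivative (\<lambda>h. \<theta>' (fst X) * fst h)) (at X)"
    using has_derivative_compose[OF has_derivative_fst[OF has_derivative_ident]
        assms(2)[of "fst X", unfolded has_field_derivative_def]]
    by simp
  then have "(shear \<theta> has_derivative (\<lambda>h. (\<theta>' (fst X) * fst h, snd h))) (at X)"
    unfolding shear_def[abs_def]
    by (intro has_derivative_Pair has_derivative_snd has_derivative_ident)
  from has_derivative_compose[OF this Ck_has_derivative[OF assms(1)]] show ?thesis .
qed

lemma partial_shear:
  fixes f :: "real \<times> 'b::euclidean_space \<Rightarrow> complex"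
  assumes "Ck (Suc k) f" "\<And>x. (\<theta> has_real_derivative \<theta>' x) (at x)"
  shows "partial (1, 0) (\<lambda>X. f (shear \<theta> X))
          = (\<lambda>X. complex_of_real (\<theta>' (fst X)) * partial (1, 0) f (shear \<theta> X))"
    and "partial (0, j) (\<lambda>X. f (shear \<theta> X)) = (\<lambda>X. partial (0, j) f (shear \<theta> X))"
proof -
  have lin: "linear (frechet_derivative f (at y))" for y
    using Ck_differentiable[OF assms(1)] linear_frechet_derivative by blast
  have scale: "frechet_derivative f (at y) (t, 0) = complex_of_real t * partial (1, 0) f y" for y t
    unfolding partial_def
    using linear_scale[OF lin, of y t "(1, 0)"] by (simp only: scaleR_conv_of_real scaleR_Pair) simp
  show "partial (1, 0) (\<lambda>X. f (shear \<theta> X))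
          = (\<lambda>X. complex_of_real (\<theta>' (fst X)) * partial (1, 0) f (shear \<theta> X))"
  proof
    fix X
    have "partial (1, 0) (\<lambda>X. f (shear \<theta> X)) X
        = frechet_derivative f (at (shear \<theta> X)) (\<theta>' (fst X) * fst (1, 0 :: 'b), snd (1 :: real, 0))"
      by (rule partial_eq[OF Ck_shear_has_derivative[OF assms]])
    then show "partial (1, 0) (\<lambda>X. f (shear \<theta> X)) X
        = complex_of_real (\<theta>' (fst X)) * partial (1, 0) f (shear \<theta> X)"
      by (simp add: scale)
  qed
  show "partial (0, j) (\<lambda>X. f (shear \<theta> X)) = (\<lambda>X. partial (0, j) f (shear \<theta> X))"
  proof
    fix X
    have "partial (0, j) (\<lambda>X. f (shear \<theta> X)) X
        = frechet_derivative f (at (shear \<theta> X)) (\<theta>' (fst X) * fst (0 :: real, j), snd (0 :: real, j))"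
      by (rule partial_eq[OF Ck_shear_has_derivative[OF assms]])
    then show "partial (0, j) (\<lambda>X. f (shear \<theta> X)) X = partial (0, j) f (shear \<theta> X)"
      by (simp add: partial_def)
  qed
qed

lemma Basis_prod_cases:
  fixes i :: "real \<times> 'b::euclidean_space"
  assumes "i \<in> Basis"
  obtains "i = (1, 0)" | j where "j \<in> Basis" "i = (0, j)"
  using assms by (auto simp: Basis_prod_def)

lemma continuous_on_shear:
  fixes \<theta> :: "real \<Rightarrow> real"
  assumes "continuous_on UNIV \<theta>"
  shows "continuous_on UNIV (shear \<theta> :: real \<times> 'b::euclidean_space \<Rightarrow> _)"
proof -
  have "continuous_on UNIV (\<lambda>X::real \<times> 'b. \<theta> (fst X))"
    by (rule continuous_on_compose2[OF assms continuous_on_fst[OF continuous_on_id]]) simp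
  then show ?thesis
    unfolding shear_def[abs_def] by (intro continuous_on_Pair continuous_on_snd continuous_on_id)
qed

text \<open>The chain rule produces only factors \<theta>' of the axial variable and partials of f
  at the sheared point, so the induction on k, with f arbitrary, closes on functions of the same
  shape.\<close>

lemma Ck_shear:
  fixes f :: "real \<times> 'b::euclidean_space \<Rightarrow> complex"
  assumes "Ck k f" "\<And>x. (\<theta> has_real_derivative \<theta>' x) (at x)" "smooth1 \<theta>'"
  shows "Ck k (\<lambda>X. f (shear \<theta> X))"
  using assms(1)
proof (induction k arbitrary: f)
  case 0
  have "continuous_on UNIV \<theta>"
    using assms(2) DERIV_isCont continuous_at_imp_continuous_on by blast
  then have "continuous_on UNIV (shear \<theta> :: real \<times> 'b \<Rightarrow> _)"
    by (rule continuous_on_shear)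
  with 0 show ?case
    using continuous_on_compose2[of UNIV f UNIV "shear \<theta>"] by simp
next
  case (Suc k)
  have IH: "Ck k (\<lambda>X. partial i f (shear \<theta> X))" if "i \<in> Basis" for i
    using Suc.prems that by (intro Suc.IH) simp
  have "Ck k (partial i (\<lambda>X. f (shear \<theta> X)))" if i: "i \<in> Basis" for i
    using i
  proof (cases rule: Basis_prod_cases)
    case 1
    show ?thesis
      using Ck_mult[OF Ck_fst[OF assms(3)] IH[OF i]] unfolding 1
      by (simp only: partial_shear(1)[OF Suc.prems assms(2)])
  next
    case (2 j)
    show ?thesis
      using IH[OF i] unfolding 2 by (simp only: partial_shear(2)[OF Suc.prems assms(2)])
  qed
  moreover have "(\<lambda>X. f (shear \<theta> X)) differentiable_on UNIV"
    using Ck_shear_has_derivative[OF Suc.prems assms(2)]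
    unfolding differentiable_on_def differentiable_def by blast
  ultimately show ?case by simp
qed

section \<open>Test functions and the operations that preserve them\<close>

lemma test_funI:
  assumes "\<And>k. Ck k f" "compact K" "K \<subseteq> \<Omega>" "\<And>x. x \<notin> K \<Longrightarrow> f x = 0"
  shows "test_fun \<Omega> f"
proof -
  have "{x. f x \<noteq> 0} \<subseteq> K" using assms(4) by auto
  then have "closure {x. f x \<noteq> 0} \<subseteq> K" "bounded {x. f x \<noteq> 0}"
    using closure_minimal compact_imp_closed[OF assms(2)]
      bounded_subset[OF compact_imp_bounded[OF assms(2)]] by auto
  with assms(1,3) show ?thesis
    by (simp add: test_fun_def compact_closure)
qed

lemma test_fun_Ck: "test_fun \<Omega> f \<Longrightarrow> Ck k f"
  by (simp add: test_fun_def)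

lemma test_fun_cont: "test_fun \<Omega> f \<Longrightarrow> continuous_on S f"
  using test_fun_Ck[of \<Omega> f 0] continuous_on_subset by auto

lemma test_fun_support:
  assumes "test_fun \<Omega> f"
  shows "\<exists>K. compact K \<and> K \<subseteq> \<Omega> \<and> (\<forall>x. x \<notin> K \<longrightarrow> f x = 0) \<and> (\<forall>x i. x \<notin> K \<longrightarrow> partial i f x = 0)"
proof (intro exI conjI allI impI)
  let ?K = "closure {x. f x \<noteq> 0}"
  show "compact ?K" "?K \<subseteq> \<Omega>" using assms by (auto simp: test_fun_def)
  show f0: "f x = 0" if "x \<notin> ?K" for x using that closure_subset[of "{x. f x \<noteq> 0}"] by auto
  show "partial i f x = 0" if "x \<notin> ?K" for x i
  proof -
    have "(f has_derivative (\<lambda>_. 0)) (at x)"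
    proof (rule has_derivative_transform_within_open)
      show "((\<lambda>_. 0) has_derivative (\<lambda>_. 0)) (at x)" by simp
      show "open (- ?K)" by (intro open_Compl closed_closure)
      show "x \<in> - ?K" using that by blast
      show "0 = f y" if "y \<in> - ?K" for y using f0[THEN sym] that by blast
    qed
    then show ?thesis by (rule partial_eq)
  qed
qed

lemma test_fun_outside: "test_fun \<Omega> f \<Longrightarrow> x \<notin> \<Omega> \<Longrightarrow> f x = 0"
  using test_fun_support by blast

lemma test_fun_partial:
  assumes "test_fun \<Omega> f" "i \<in> Basis" shows "test_fun \<Omega> (partial i f)"
proof -
  obtain K where K: "compact K" "K \<subseteq> \<Omega>" "\<And>x. x \<notin> K \<Longrightarrow> partial i f x = 0"
    using test_fun_support[OF assms(1)] by blast
  have "Ck k (partial i f)" for k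
    using test_fun_Ck[OF assms(1), of "Suc k"] assms(2) by simp
  then show ?thesis using K by (rule test_funI)
qed

lemma test_fun_mult:
  assumes "\<And>k. Ck k p" "test_fun \<Omega> f" shows "test_fun \<Omega> (\<lambda>x. p x * f x)"
proof -
  obtain K where K: "compact K" "K \<subseteq> \<Omega>" "\<And>x. x \<notin> K \<Longrightarrow> f x = 0"
    using test_fun_support[OF assms(2)] by blast
  show ?thesis
    by (rule test_funI[OF Ck_mult[OF assms(1) test_fun_Ck[OF assms(2)]] K(1,2)]) (simp add: K)
qed

lemma test_fun_cmult: "test_fun \<Omega> f \<Longrightarrow> test_fun \<Omega> (\<lambda>x. c * f x)"
  by (rule test_fun_mult[OF Ck_const])

lemma test_fun_cnj:
  assumes "test_fun \<Omega> f" shows "test_fun \<Omega> (\<lambda>x. cnj (f x))"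
proof -
  obtain K where K: "compact K" "K \<subseteq> \<Omega>" "\<And>x. x \<notin> K \<Longrightarrow> f x = 0"
    using test_fun_support[OF assms] by blast
  show ?thesis
    by (rule test_funI[OF Ck_cnj[OF test_fun_Ck[OF assms]] K(1,2)]) (simp add: K)
qed

lemma test_fun_add:
  assumes "test_fun \<Omega> f" "test_fun \<Omega> g" shows "test_fun \<Omega> (\<lambda>x. f x + g x)"
proof -
  obtain K L where "compact K" "K \<subseteq> \<Omega>" "\<And>x. x \<notin> K \<Longrightarrow> f x = 0"
    "compact L" "L \<subseteq> \<Omega>" "\<And>x. x \<notin> L \<Longrightarrow> g x = 0"
    using test_fun_support[OF assms(1)] test_fun_support[OF assms(2)] by blast
  then show ?thesis
    by (intro test_funI[where K="K \<union> L"] Ck_add[OF test_fun_Ck[OF assms(1)] test_fun_Ck[OF assms(2)]]) auto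
qed

lemma test_fun_bounded:
  assumes "test_fun \<Omega> f" shows "\<exists>B\<ge>0. \<forall>x. cmod (f x) \<le> B"
proof -
  obtain K where K: "compact K" "\<And>x. x \<notin> K \<Longrightarrow> f x = 0"
    using test_fun_support[OF assms] by blast
  have "bounded (f ` K)"
    using compact_imp_bounded[OF compact_continuous_image[OF test_fun_cont[OF assms] K(1)]] .
  then obtain B where "\<And>x. x \<in> K \<Longrightarrow> cmod (f x) \<le> B" by (auto simp: bounded_iff)
  then have "cmod (f x) \<le> max B 0" for x using K(2)[of x] by (cases "x \<in> K") (auto simp: le_max_iff_disj)
  then show ?thesis by (intro exI[of _ "max B 0"]) simp
qed

text \<open>The preimage of the support is closed by continuity; it is bounded because a point
  mapped into \<Omega> must itself lie in \<Omega>.\<close>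

lemma test_fun_shear:
  fixes f :: "real \<times> 'b::euclidean_space \<Rightarrow> complex"
  assumes "test_fun \<Omega> f" "\<And>x. (\<theta> has_real_derivative \<theta>' x) (at x)" "smooth1 \<theta>'"
    and "bounded \<Omega>" "\<And>X. shear \<theta> X \<in> \<Omega> \<Longrightarrow> X \<in> \<Omega>"
  shows "test_fun \<Omega> (\<lambda>X. f (shear \<theta> X))"
proof -
  obtain K where K: "compact K" "K \<subseteq> \<Omega>" "\<And>x. x \<notin> K \<Longrightarrow> f x = 0"
    using test_fun_support[OF assms(1)] by blast
  have "continuous_on UNIV \<theta>"
    using assms(2) DERIV_isCont continuous_at_imp_continuous_on by blast
  then have "continuous_on UNIV (shear \<theta> :: real \<times> 'b \<Rightarrow> _)"
    by (rule continuous_on_shear)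
  then have "closed (shear \<theta> -` K)"
    using compact_imp_closed[OF K(1)] by (simp add: continuous_on_closed_vimage)
  moreover have sub: "shear \<theta> -` K \<subseteq> \<Omega>" using K(2) assms(5) by auto
  ultimately have "compact (shear \<theta> -` K)"
    using assms(4) bounded_subset compact_eq_bounded_closed by blast
  then show ?thesis
    using sub K(3) Ck_shear[OF test_fun_Ck[OF assms(1)] assms(2,3)]
    by (intro test_funI[where K="shear \<theta> -` K"]) auto
qed

section \<open>Square integrable functions and differentiable curves of them\<close>

text \<open>Only the real part of the complex inner product: this form is symmetric and real
  bilinear, which is what the energy identities use.\<close>

definition ip :: "'a::euclidean_space set \<Rightarrow> ('a \<Rightarrow> complex) \<Rightarrow> ('a \<Rightarrow> complex) \<Rightarrow> real" where
  "ip \<Omega> u v = (\<integral>x. Re (u x * cnj (v x)) \<partial>lebesgue_on \<Omega>)"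

definition nrm :: "'a::euclidean_space set \<Rightarrow> ('a \<Rightarrow> complex) \<Rightarrow> real" where
  "nrm \<Omega> u = sqrt (ip \<Omega> u u)"

lemma L2_measurable: "u \<in> L2 \<Omega> \<Longrightarrow> u \<in> borel_measurable (lebesgue_on \<Omega>)"
  by (simp add: L2_def)

lemma L2_integrable: "u \<in> L2 \<Omega> \<Longrightarrow> integrable (lebesgue_on \<Omega>) (\<lambda>x. (cmod (u x))\<^sup>2)"
  by (simp add: L2_def)

lemma L2I_bound:
  assumes "u \<in> borel_measurable (lebesgue_on \<Omega>)" "integrable (lebesgue_on \<Omega>) w"
    "AE x in lebesgue_on \<Omega>. (cmod (u x))\<^sup>2 \<le> w x"
  shows "u \<in> L2 \<Omega>"
proof -
  have "integrable (lebesgue_on \<Omega>) (\<lambda>x. (cmod (u x))\<^sup>2)"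
    using assms(2)
  proof (rule Bochner_Integration.integrable_bound)
    show "AE x in lebesgue_on \<Omega>. norm ((cmod (u x))\<^sup>2) \<le> norm (w x)"
      using assms(3) by eventually_elim auto
  qed (use assms(1) in measurable)
  then show ?thesis using assms(1) by (simp add: L2_def)
qed

lemma L2_integrable_mult:
  assumes "u \<in> L2 \<Omega>" "v \<in> L2 \<Omega>"
  shows "integrable (lebesgue_on \<Omega>) (\<lambda>x. u x * v x)"
proof -
  have "integrable (lebesgue_on \<Omega>) (\<lambda>x. (cmod (u x))\<^sup>2 + (cmod (v x))\<^sup>2)"
    using assms by (intro Bochner_Integration.integrable_add L2_integrable)
  then show ?thesis
  proof (rule Bochner_Integration.integrable_bound)
    show "AE x in lebesgue_on \<Omega>. norm (u x * v x) \<le> norm ((cmod (u x))\<^sup>2 + (cmod (v x))\<^sup>2)"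
    proof (rule AE_I2)
      fix x
      have "2 * (cmod (u x) * cmod (v x)) \<le> (cmod (u x))\<^sup>2 + (cmod (v x))\<^sup>2"
        using sum_squares_bound[of "cmod (u x)" "cmod (v x)"] by simp
      moreover have "0 \<le> cmod (u x) * cmod (v x)" by simp
      ultimately have "cmod (u x) * cmod (v x) \<le> (cmod (u x))\<^sup>2 + (cmod (v x))\<^sup>2"
        by linarith
      then show "norm (u x * v x) \<le> norm ((cmod (u x))\<^sup>2 + (cmod (v x))\<^sup>2)"
        by (simp add: norm_mult)
    qed
  qed (use assms L2_measurable in measurable)
qed

lemma L2_cnj: "u \<in> L2 \<Omega> \<Longrightarrow> (\<lambda>x. cnj (u x)) \<in> L2 \<Omega>"
  using measurable_compose[OF L2_measurable borel_measurable_continuous_onI[OF continuous_on_cnj[OF continuous_on_id]]]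
  by (simp add: L2_def)

lemma L2_integrable_ip:
  assumes "u \<in> L2 \<Omega>" "v \<in> L2 \<Omega>"
  shows "integrable (lebesgue_on \<Omega>) (\<lambda>x. u x * cnj (v x))"
    and "integrable (lebesgue_on \<Omega>) (\<lambda>x. Re (u x * cnj (v x)))"
  using L2_integrable_mult[OF assms(1) L2_cnj[OF assms(2)]] integrable_Re by blast+

lemma L2_add:
  assumes "u \<in> L2 \<Omega>" "v \<in> L2 \<Omega>" shows "(\<lambda>x. u x + v x) \<in> L2 \<Omega>"
proof (rule L2I_bound)
  show "(\<lambda>x. u x + v x) \<in> borel_measurable (lebesgue_on \<Omega>)"
    using assms[THEN L2_measurable] by measurable
  show "integrable (lebesgue_on \<Omega>) (\<lambda>x. 2 * (cmod (u x))\<^sup>2 + 2 * (cmod (v x))\<^sup>2)"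
    using assms by (intro Bochner_Integration.integrable_add integrable_mult_right L2_integrable)
  show "AE x in lebesgue_on \<Omega>. (cmod (u x + v x))\<^sup>2 \<le> 2 * (cmod (u x))\<^sup>2 + 2 * (cmod (v x))\<^sup>2"
  proof (rule AE_I2)
    fix x
    have "(cmod (u x + v x))\<^sup>2 \<le> (cmod (u x) + cmod (v x))\<^sup>2"
      by (intro power_mono norm_triangle_ineq) simp
    also have "\<dots> \<le> 2 * (cmod (u x))\<^sup>2 + 2 * (cmod (v x))\<^sup>2"
      using sum_squares_bound[of "cmod (u x)" "cmod (v x)"] by (simp add: power2_sum)
    finally show "(cmod (u x + v x))\<^sup>2 \<le> 2 * (cmod (u x))\<^sup>2 + 2 * (cmod (v x))\<^sup>2" .
  qed
qed

lemma L2_mult_bounded: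
  assumes "u \<in> L2 \<Omega>" "m \<in> borel_measurable (lebesgue_on \<Omega>)" "AE x in lebesgue_on \<Omega>. cmod (m x) \<le> K"
  shows "(\<lambda>x. m x * u x) \<in> L2 \<Omega>"
proof (rule L2I_bound)
  show "(\<lambda>x. m x * u x) \<in> borel_measurable (lebesgue_on \<Omega>)"
    using assms(2) L2_measurable[OF assms(1)] by measurable
  show "integrable (lebesgue_on \<Omega>) (\<lambda>x. K\<^sup>2 * (cmod (u x))\<^sup>2)"
    using assms by (intro integrable_mult_right L2_integrable)
  show "AE x in lebesgue_on \<Omega>. (cmod (m x * u x))\<^sup>2 \<le> K\<^sup>2 * (cmod (u x))\<^sup>2"
    using assms(3) by eventually_elim (auto simp: norm_mult power_mult_distrib intro!: mult_right_mono power_mono)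
qed

lemma L2_cmult: "u \<in> L2 \<Omega> \<Longrightarrow> (\<lambda>x. c * u x) \<in> L2 \<Omega>"
  by (rule L2_mult_bounded[where K="cmod c"]) auto

lemma L2_diff: "u \<in> L2 \<Omega> \<Longrightarrow> v \<in> L2 \<Omega> \<Longrightarrow> (\<lambda>x. u x - v x) \<in> L2 \<Omega>"
  using L2_add[of u \<Omega> "\<lambda>x. (-1) * v x"] L2_cmult[of v \<Omega> "-1"] by simp

lemma ip_commute: "ip \<Omega> u v = ip \<Omega> v u"
  unfolding ip_def by (rule Bochner_Integration.integral_cong) (auto simp: algebra_simps)

lemma ip_cong_AE:
  assumes "u \<in> L2 \<Omega>" "v \<in> L2 \<Omega>" "u' \<in> L2 \<Omega>" "v' \<in> L2 \<Omega>"
    "AE x in lebesgue_on \<Omega>. u x = u' x" "AE x in lebesgue_on \<Omega>. v x = v' x"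
  shows "ip \<Omega> u v = ip \<Omega> u' v'"
  unfolding ip_def
proof (rule integral_cong_AE)
  show "AE x in lebesgue_on \<Omega>. Re (u x * cnj (v x)) = Re (u' x * cnj (v' x))"
    using assms(5,6) by eventually_elim simp
qed (use L2_integrable_ip assms borel_measurable_integrable in blast)+

lemma ip_add_left:
  "u \<in> L2 \<Omega> \<Longrightarrow> v \<in> L2 \<Omega> \<Longrightarrow> w \<in> L2 \<Omega> \<Longrightarrow> ip \<Omega> (\<lambda>x. u x + v x) w = ip \<Omega> u w + ip \<Omega> v w"
  unfolding ip_def
  by (subst Bochner_Integration.integral_add[symmetric])
    (auto simp: algebra_simps intro!: L2_integrable_ip(2) Bochner_Integration.integral_cong simp del: times_complex.sel)

lemma ip_scale_left: "ip \<Omega> (\<lambda>x. of_real r * u x) w = r * ip \<Omega> u w"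
proof -
  have "ip \<Omega> (\<lambda>x. of_real r * u x) w = (\<integral>x. r * Re (u x * cnj (w x)) \<partial>lebesgue_on \<Omega>)"
    unfolding ip_def by (rule Bochner_Integration.integral_cong) (auto simp: algebra_simps)
  then show ?thesis by (simp add: ip_def)
qed

lemma ip_diff_left:
  "u \<in> L2 \<Omega> \<Longrightarrow> v \<in> L2 \<Omega> \<Longrightarrow> w \<in> L2 \<Omega> \<Longrightarrow> ip \<Omega> (\<lambda>x. u x - v x) w = ip \<Omega> u w - ip \<Omega> v w"
  unfolding ip_def
  by (subst Bochner_Integration.integral_diff[symmetric])
    (auto simp: algebra_simps intro!: L2_integrable_ip(2) Bochner_Integration.integral_cong simp del: times_complex.sel)

lemma ip_add_right:
  "u \<in> L2 \<Omega> \<Longrightarrow> v \<in> L2 \<Omega> \<Longrightarrow> w \<in> L2 \<Omega> \<Longrightarrow> ip \<Omega> w (\<lambda>x. u x + v x) = ip \<Omega> w u + ip \<Omega> w v"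
  using ip_add_left[of u \<Omega> v w] by (simp add: ip_commute[of \<Omega> w])

lemma ip_diff_right:
  "u \<in> L2 \<Omega> \<Longrightarrow> v \<in> L2 \<Omega> \<Longrightarrow> w \<in> L2 \<Omega> \<Longrightarrow> ip \<Omega> w (\<lambda>x. u x - v x) = ip \<Omega> w u - ip \<Omega> w v"
  using ip_diff_left[of u \<Omega> v w] by (simp add: ip_commute[of \<Omega> w])

lemma ip_scale_right: "ip \<Omega> w (\<lambda>x. of_real r * u x) = r * ip \<Omega> w u"
  using ip_scale_left[of \<Omega> r u w] by (simp add: ip_commute[of \<Omega> w])

lemma ip_mult_swap: "ip \<Omega> (\<lambda>x. of_real (m x) * u x) w = ip \<Omega> u (\<lambda>x. of_real (m x) * w x)"
  unfolding ip_def by (rule Bochner_Integration.integral_cong) (auto simp: algebra_simps)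

lemma ip_self: "ip \<Omega> u u = (\<integral>x. (cmod (u x))\<^sup>2 \<partial>lebesgue_on \<Omega>)"
  unfolding ip_def by (rule Bochner_Integration.integral_cong) (auto simp: complex_mult_cnj cmod_power2)

lemma ip_self_nonneg: "ip \<Omega> u u \<ge> 0"
  unfolding ip_self by simp

lemma nrm_nonneg: "nrm \<Omega> u \<ge> 0"
  by (simp add: nrm_def ip_self_nonneg)

lemma nrm_sq: "(nrm \<Omega> u)\<^sup>2 = ip \<Omega> u u"
  by (simp add: nrm_def ip_self_nonneg)

lemma nrm_sq_integral: "(nrm \<Omega> u)\<^sup>2 = (\<integral>x. (cmod (u x))\<^sup>2 \<partial>lebesgue_on \<Omega>)"
  by (simp add: nrm_sq ip_self)

lemma ip_diff_self:
  assumes "u \<in> L2 \<Omega>" "v \<in> L2 \<Omega>"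
  shows "ip \<Omega> (\<lambda>x. u x - v x) (\<lambda>x. u x - v x) = ip \<Omega> u u - 2 * ip \<Omega> u v + ip \<Omega> v v"
  using assms ip_commute[of \<Omega> u v] by (simp add: ip_diff_left ip_diff_right L2_diff)

lemma ip_add_self:
  assumes "u \<in> L2 \<Omega>" "v \<in> L2 \<Omega>"
  shows "ip \<Omega> (\<lambda>x. u x + v x) (\<lambda>x. u x + v x) = ip \<Omega> u u + 2 * ip \<Omega> u v + ip \<Omega> v v"
  using assms ip_commute[of \<Omega> u v] by (simp add: ip_add_left ip_add_right L2_add)

lemma ip_Cauchy_Schwarz:
  assumes "u \<in> L2 \<Omega>" "v \<in> L2 \<Omega>"
  shows "\<bar>ip \<Omega> u v\<bar> \<le> nrm \<Omega> u * nrm \<Omega> v"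
proof -
  have q: "0 \<le> ip \<Omega> u u - 2 * t * ip \<Omega> u v + t\<^sup>2 * ip \<Omega> v v" for t
    using ip_self_nonneg[of \<Omega> "\<lambda>x. u x - of_real t * v x"]
      ip_diff_self[OF assms(1) L2_cmult[OF assms(2)], of "of_real t"]
    by (simp add: ip_scale_left ip_scale_right power2_eq_square mult.assoc)
  have "(ip \<Omega> u v)\<^sup>2 \<le> ip \<Omega> u u * ip \<Omega> v v"
  proof (cases "ip \<Omega> v v = 0")
    case True
    have "ip \<Omega> u v = 0"
    proof (rule ccontr)
      assume "ip \<Omega> u v \<noteq> 0"
      \<comment> \<open>A function of norm zero need not be the zero function here. For such a v the
        quadratic in t degenerates to a linear one, and at this t it takes the value -1.\<close>
      then show False
        using q[of "(ip \<Omega> u u + 1) / (2 * ip \<Omega> u v)"] True by simp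
    qed
    then show ?thesis using True by simp
  next
    case False
    then have p: "ip \<Omega> v v > 0" using ip_self_nonneg[of \<Omega> v] by simp
    show ?thesis using q[of "ip \<Omega> u v / ip \<Omega> v v"] p
      by (simp add: field_simps power2_eq_square)
  qed
  then have "sqrt ((ip \<Omega> u v)\<^sup>2) \<le> sqrt (ip \<Omega> u u * ip \<Omega> v v)" by (rule real_sqrt_le_mono)
  then show ?thesis by (simp add: nrm_def real_sqrt_mult)
qed

lemma nrm_triangle:
  assumes "u \<in> L2 \<Omega>" "v \<in> L2 \<Omega>"
  shows "nrm \<Omega> (\<lambda>x. u x + v x) \<le> nrm \<Omega> u + nrm \<Omega> v"
proof -
  have "(nrm \<Omega> (\<lambda>x. u x + v x))\<^sup>2 = (nrm \<Omega> u)\<^sup>2 + 2 * ip \<Omega> u v + (nrm \<Omega> v)\<^sup>2"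
    by (simp add: nrm_sq ip_add_self[OF assms])
  also have "\<dots> \<le> (nrm \<Omega> u + nrm \<Omega> v)\<^sup>2"
    using ip_Cauchy_Schwarz[OF assms] by (simp add: power2_sum)
  finally show ?thesis
    using nrm_nonneg by (metis add_nonneg_nonneg power2_le_imp_le)
qed

lemma nrm_cmult: "nrm \<Omega> (\<lambda>x. c * u x) = cmod c * nrm \<Omega> u"
  by (simp add: nrm_def ip_self norm_mult power_mult_distrib real_sqrt_mult)

lemma nrm_minus_commute: "nrm \<Omega> (\<lambda>x. u x - v x) = nrm \<Omega> (\<lambda>x. v x - u x)"
  by (simp add: nrm_def ip_self norm_minus_commute)

lemma nrm_le_add_diff:
  assumes "u \<in> L2 \<Omega>" "v \<in> L2 \<Omega>"
  shows "nrm \<Omega> u \<le> nrm \<Omega> v + nrm \<Omega> (\<lambda>x. u x - v x)"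
  using nrm_triangle[OF assms(2) L2_diff[OF assms]] by simp

lemma nrm_cong_AE:
  assumes "u \<in> L2 \<Omega>" "v \<in> L2 \<Omega>" "AE x in lebesgue_on \<Omega>. u x = v x"
  shows "nrm \<Omega> u = nrm \<Omega> v"
  unfolding nrm_def using ip_cong_AE[OF assms(1,1,2,2,3,3)] by simp

lemma nrm_mult_bounded:
  assumes "u \<in> L2 \<Omega>" "m \<in> borel_measurable (lebesgue_on \<Omega>)" "AE x in lebesgue_on \<Omega>. cmod (m x) \<le> K"
    "K \<ge> 0"
  shows "nrm \<Omega> (\<lambda>x. m x * u x) \<le> K * nrm \<Omega> u"
proof -
  have "(nrm \<Omega> (\<lambda>x. m x * u x))\<^sup>2 \<le> (\<integral>x. K\<^sup>2 * (cmod (u x))\<^sup>2 \<partial>lebesgue_on \<Omega>)"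
    unfolding nrm_sq_integral
  proof (rule integral_mono_AE)
    show "integrable (lebesgue_on \<Omega>) (\<lambda>x. (cmod (m x * u x))\<^sup>2)"
      by (rule L2_integrable[OF L2_mult_bounded[OF assms(1-3)]])
    show "integrable (lebesgue_on \<Omega>) (\<lambda>x. K\<^sup>2 * (cmod (u x))\<^sup>2)"
      by (intro integrable_mult_right L2_integrable assms(1))
    show "AE x in lebesgue_on \<Omega>. (cmod (m x * u x))\<^sup>2 \<le> K\<^sup>2 * (cmod (u x))\<^sup>2"
      using assms(3) by eventually_elim
        (auto simp: norm_mult power_mult_distrib intro!: mult_right_mono power_mono)
  qed
  also have "\<dots> = (K * nrm \<Omega> u)\<^sup>2" by (simp add: power_mult_distrib nrm_sq_integral)
  finally show ?thesis
    using assms(4) nrm_nonneg by (metis mult_nonneg_nonneg power2_le_imp_le)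
qed

text \<open>Membership in \<open>L2\<close> is asked for eventually, since the curves include
  difference quotients in time, for which it is known for h > 0 only.\<close>

lemma ip_tendsto:
  assumes "\<forall>\<^sub>F h in F. u h \<in> L2 \<Omega>" "\<forall>\<^sub>F h in F. v h \<in> L2 \<Omega>" "u0 \<in> L2 \<Omega>" "v0 \<in> L2 \<Omega>"
    and u: "((\<lambda>h. nrm \<Omega> (\<lambda>x. u h x - u0 x)) \<longlongrightarrow> 0) F"
    and v: "((\<lambda>h. nrm \<Omega> (\<lambda>x. v h x - v0 x)) \<longlongrightarrow> 0) F"
  shows "((\<lambda>h. ip \<Omega> (u h) (v h)) \<longlongrightarrow> ip \<Omega> u0 v0) F"
proof (rule Lim_null[THEN iffD2], rule Lim_null_comparison)
  let ?U = "\<lambda>h. nrm \<Omega> (\<lambda>x. u h x - u0 x)" and ?V = "\<lambda>h. nrm \<Omega> (\<lambda>x. v h x - v0 x)"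
  show "((\<lambda>h. ?U h * (nrm \<Omega> v0 + ?V h) + nrm \<Omega> u0 * ?V h) \<longlongrightarrow> 0) F"
    using tendsto_add[OF tendsto_mult[OF u tendsto_add[OF tendsto_const v]] tendsto_mult[OF tendsto_const v]]
    by simp
  show "\<forall>\<^sub>F h in F. norm (ip \<Omega> (u h) (v h) - ip \<Omega> u0 v0)
      \<le> ?U h * (nrm \<Omega> v0 + ?V h) + nrm \<Omega> u0 * ?V h"
    using assms(1,2)
  proof eventually_elim
    case (elim h)
    have "ip \<Omega> (u h) (v h) - ip \<Omega> u0 v0
        = ip \<Omega> (\<lambda>x. u h x - u0 x) (v h) + ip \<Omega> u0 (\<lambda>x. v h x - v0 x)"
      using elim assms(3,4) by (simp add: ip_diff_left ip_diff_right)
    moreover have "\<bar>ip \<Omega> (\<lambda>x. u h x - u0 x) (v h)\<bar> \<le> ?U h * nrm \<Omega> (v h)"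
      using elim assms(3,4) by (intro ip_Cauchy_Schwarz L2_diff)
    moreover have "?U h * nrm \<Omega> (v h) \<le> ?U h * (nrm \<Omega> v0 + ?V h)"
      using elim assms(3,4) by (intro mult_left_mono nrm_le_add_diff nrm_nonneg)
    moreover have "\<bar>ip \<Omega> u0 (\<lambda>x. v h x - v0 x)\<bar> \<le> nrm \<Omega> u0 * ?V h"
      using elim assms(3,4) by (intro ip_Cauchy_Schwarz L2_diff)
    ultimately show ?case by simp
  qed
qed

text \<open>A right derivative in the L2 norm, matching the one-sided limit in
  \<open>has_generator_value\<close>; requiring \<open>L2\<close> at all later times puts every
  difference quotient into \<open>L2\<close>.\<close>

definition rder ::
    "'a::euclidean_space set \<Rightarrow> (real \<Rightarrow> 'a \<Rightarrow> complex) \<Rightarrow> ('a \<Rightarrow> complex) \<Rightarrow> real \<Rightarrow> bool" where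
  "rder \<Omega> u u' t \<longleftrightarrow> (\<forall>s\<ge>t. u s \<in> L2 \<Omega>) \<and> u' \<in> L2 \<Omega> \<and>
     ((\<lambda>h. nrm \<Omega> (\<lambda>x. of_real (1 / h) * (u (t + h) x - u t x) - u' x)) \<longlongrightarrow> 0) (at_right 0)"

lemma rder_L2: "rder \<Omega> u u' t \<Longrightarrow> t \<le> s \<Longrightarrow> u s \<in> L2 \<Omega>" "rder \<Omega> u u' t \<Longrightarrow> u' \<in> L2 \<Omega>"
  by (auto simp: rder_def)

lemma eventually_at_right_0: "\<forall>\<^sub>F h::real in at_right 0. 0 < h"
  by (simp add: eventually_at_filter)

lemma rder_right_continuous:
  assumes "rder \<Omega> u u' t"
  shows "((\<lambda>h. nrm \<Omega> (\<lambda>x. u (t + h) x - u t x)) \<longlongrightarrow> 0) (at_right 0)"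
proof (rule Lim_null_comparison)
  let ?Q = "\<lambda>h. nrm \<Omega> (\<lambda>x. of_real (1 / h) * (u (t + h) x - u t x) - u' x)"
  have "((\<lambda>h. h * (nrm \<Omega> u' + ?Q h)) \<longlongrightarrow> 0 * (nrm \<Omega> u' + 0)) (at_right 0)"
    using assms unfolding rder_def by (intro tendsto_intros) auto
  then show "((\<lambda>h. h * (nrm \<Omega> u' + ?Q h)) \<longlongrightarrow> 0) (at_right 0)" by simp
  show "\<forall>\<^sub>F h in at_right 0. norm (nrm \<Omega> (\<lambda>x. u (t + h) x - u t x)) \<le> h * (nrm \<Omega> u' + ?Q h)"
    using eventually_at_right_0
  proof eventually_elim
    case (elim h)
    let ?D = "\<lambda>x. of_real (1 / h) * (u (t + h) x - u t x)"
    have L: "?D \<in> L2 \<Omega>" using assms elim by (intro L2_cmult L2_diff rder_L2[OF assms]) auto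
    have "nrm \<Omega> (\<lambda>x. u (t + h) x - u t x) = nrm \<Omega> (\<lambda>x. of_real h * ?D x)"
      using elim by simp
    also have "\<dots> = h * nrm \<Omega> ?D" unfolding nrm_cmult using elim by simp
    also have "\<dots> \<le> h * (nrm \<Omega> u' + ?Q h)"
      using elim L rder_L2(2)[OF assms] by (intro mult_left_mono nrm_le_add_diff) auto
    finally show ?case by (simp add: nrm_nonneg)
  qed
qed

lemma rder_ip:
  assumes u: "rder \<Omega> u u' t" and v: "rder \<Omega> v v' t"
  shows "((\<lambda>s. ip \<Omega> (u s) (v s)) has_real_derivative ip \<Omega> u' (v t) + ip \<Omega> (u t) v') (at_right t)"
proof -
  let ?U = "\<lambda>h x. of_real (1 / h) * (u (t + h) x - u t x)"
    and ?V = "\<lambda>h x. of_real (1 / h) * (v (t + h) x - v t x)"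
  have Lu: "\<forall>\<^sub>F h in at_right 0. u (t + h) \<in> L2 \<Omega>" and Lv: "\<forall>\<^sub>F h in at_right 0. v (t + h) \<in> L2 \<Omega>"
    using rder_L2(1)[OF u] rder_L2(1)[OF v]
    by (auto intro: eventually_mono[OF eventually_at_right_0])
  have LU: "\<forall>\<^sub>F h in at_right 0. ?U h \<in> L2 \<Omega>"
    using Lu by (rule eventually_mono) (intro L2_cmult L2_diff rder_L2(1)[OF u order_refl])
  have LV: "\<forall>\<^sub>F h in at_right 0. ?V h \<in> L2 \<Omega>"
    using Lv by (rule eventually_mono) (intro L2_cmult L2_diff rder_L2(1)[OF v order_refl])
  \<comment> \<open>With v taken at t + h in the first term and u at t in the second, the sum is
    exactly the difference quotient of the product; right continuity of v gives the limit.\<close>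
  have "((\<lambda>h. ip \<Omega> (?U h) (v (t + h)) + ip \<Omega> (u t) (?V h)) \<longlongrightarrow> ip \<Omega> u' (v t) + ip \<Omega> (u t) v') (at_right 0)"
  proof (intro tendsto_add ip_tendsto)
    show "((\<lambda>h. nrm \<Omega> (\<lambda>x. ?U h x - u' x)) \<longlongrightarrow> 0) (at_right 0)"
      "((\<lambda>h. nrm \<Omega> (\<lambda>x. ?V h x - v' x)) \<longlongrightarrow> 0) (at_right 0)"
      using u v by (auto simp: rder_def)
    show "((\<lambda>h. nrm \<Omega> (\<lambda>x. v (t + h) x - v t x)) \<longlongrightarrow> 0) (at_right 0)"
      by (rule rder_right_continuous[OF v])
    show "((\<lambda>h. nrm \<Omega> (\<lambda>x. u t x - u t x)) \<longlongrightarrow> 0) (at_right 0)"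
      by (simp add: nrm_def ip_def)
  qed (use Lu Lv LU LV rder_L2[OF u] rder_L2[OF v] in auto)
  then have "((\<lambda>h. (ip \<Omega> (u (t + h)) (v (t + h)) - ip \<Omega> (u t) (v t)) / h)
      \<longlongrightarrow> ip \<Omega> u' (v t) + ip \<Omega> (u t) v') (at_right 0)"
  proof (rule Lim_transform_eventually)
    show "\<forall>\<^sub>F h in at_right 0. ip \<Omega> (?U h) (v (t + h)) + ip \<Omega> (u t) (?V h)
        = (ip \<Omega> (u (t + h)) (v (t + h)) - ip \<Omega> (u t) (v t)) / h"
      using Lu Lv
    proof eventually_elim
      case (elim h)
      then show ?case
        using rder_L2(1)[OF u order_refl] rder_L2(1)[OF v order_refl]
        unfolding ip_scale_left ip_scale_right
        by (simp add: ip_diff_left ip_diff_right diff_divide_distrib)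
    qed
  qed
  then show ?thesis
    unfolding has_field_derivative_iff
    by (subst at_right_to_0) (simp add: filterlim_filtermap add.commute)
qed

lemma L2_cmod: "u \<in> L2 \<Omega> \<Longrightarrow> (\<lambda>x. complex_of_real (cmod (u x))) \<in> L2 \<Omega>"
  using measurable_compose[OF measurable_compose[OF L2_measurable borel_measurable_norm] borel_measurable_of_real]
  by (simp add: L2_def)

text \<open>Weak derivatives are defined through the pairing without conjugation; passing to moduli
  brings the bound back to \<open>ip\<close>.\<close>

lemma norm_integral_mult_le:
  assumes "u \<in> L2 \<Omega>" "v \<in> L2 \<Omega>"
  shows "cmod (\<integral>x. u x * v x \<partial>lebesgue_on \<Omega>) \<le> nrm \<Omega> u * nrm \<Omega> v"
proof -
  have "cmod (\<integral>x. u x * v x \<partial>lebesgue_on \<Omega>)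
      \<le> ip \<Omega> (\<lambda>x. complex_of_real (cmod (u x))) (\<lambda>x. complex_of_real (cmod (v x)))"
    unfolding ip_def by (rule order_trans[OF integral_norm_bound]) (simp add: norm_mult)
  also have "\<dots> \<le> nrm \<Omega> (\<lambda>x. complex_of_real (cmod (u x))) * nrm \<Omega> (\<lambda>x. complex_of_real (cmod (v x)))"
    using ip_Cauchy_Schwarz[OF L2_cmod L2_cmod] assms by fastforce
  also have "\<dots> = nrm \<Omega> u * nrm \<Omega> v" by (simp add: nrm_def ip_self)
  finally show ?thesis .
qed

lemma integral_mult_tendsto:
  assumes "\<And>n. u n \<in> L2 \<Omega>" "u0 \<in> L2 \<Omega>" "v \<in> L2 \<Omega>"
    "((\<lambda>n. nrm \<Omega> (\<lambda>x. u0 x - u n x)) \<longlongrightarrow> 0) F"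
  shows "((\<lambda>n. \<integral>x. u n x * v x \<partial>lebesgue_on \<Omega>) \<longlongrightarrow> (\<integral>x. u0 x * v x \<partial>lebesgue_on \<Omega>)) F"
proof (rule Lim_null[THEN iffD2], rule Lim_null_comparison)
  show "((\<lambda>n. nrm \<Omega> (\<lambda>x. u0 x - u n x) * nrm \<Omega> v) \<longlongrightarrow> 0) F"
    using assms(4) by (intro tendsto_mult_left_zero)
  show "\<forall>\<^sub>F n in F. norm ((\<integral>x. u n x * v x \<partial>lebesgue_on \<Omega>) - (\<integral>x. u0 x * v x \<partial>lebesgue_on \<Omega>))
      \<le> nrm \<Omega> (\<lambda>x. u0 x - u n x) * nrm \<Omega> v"
  proof (rule always_eventually, rule allI)
    fix n
    have "(\<integral>x. u n x * v x \<partial>lebesgue_on \<Omega>) - (\<integral>x. u0 x * v x \<partial>lebesgue_on \<Omega>)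
        = (\<integral>x. (u n x - u0 x) * v x \<partial>lebesgue_on \<Omega>)"
      using L2_integrable_mult[OF assms(1,3)] L2_integrable_mult[OF assms(2,3)]
      by (simp add: left_diff_distrib)
    then show "norm ((\<integral>x. u n x * v x \<partial>lebesgue_on \<Omega>) - (\<integral>x. u0 x * v x \<partial>lebesgue_on \<Omega>))
        \<le> nrm \<Omega> (\<lambda>x. u0 x - u n x) * nrm \<Omega> v"
      using norm_integral_mult_le[OF L2_diff[OF assms(1,2)] assms(3)]
      by (simp add: nrm_minus_commute)
  qed
qed

section \<open>Integration by parts and the fundamental lemma\<close>

lemma norm_diff_le_of_vector_derivative:
  fixes f :: "real \<Rightarrow> 'a::real_normed_vector"
  assumes "convex S" "\<And>s. s \<in> S \<Longrightarrow> (f has_vector_derivative f' s) (at s)"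
    "\<And>s. s \<in> S \<Longrightarrow> norm (f' s) \<le> B" "s \<in> S" "t \<in> S"
  shows "norm (f s - f t) \<le> B * \<bar>s - t\<bar>"
proof -
  have "norm (f s - f t) \<le> B * norm (s - t)"
  proof (rule differentiable_bound[OF assms(1) _ _ assms(4,5)])
    show "(f has_derivative (\<lambda>h. h *\<^sub>R f' x)) (at x within S)" if "x \<in> S" for x
      using assms(2)[OF that] has_derivative_at_withinI unfolding has_vector_derivative_def by blast
    show "onorm (\<lambda>h. h *\<^sub>R f' x) \<le> B" if "x \<in> S" for x
      using mult_right_mono[OF assms(3)[OF that] abs_ge_zero] by (intro onorm_le) (simp add: mult.commute)
  qed
  then show ?thesis by simp
qed

lemma has_vector_derivative_iff_quotient:
  fixes f :: "real \<Rightarrow> 'a::real_normed_vector"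
  shows "(f has_vector_derivative v) (at x) \<longleftrightarrow> ((\<lambda>h. (f (x + h) - f x) /\<^sub>R h) \<longlongrightarrow> v) (at 0)"
proof -
  have ev: "\<forall>\<^sub>F h in at 0. norm ((f (x + h) - f x) /\<^sub>R h - v) = norm (f (x + h) - f x - h *\<^sub>R v) / norm h"
    unfolding eventually_at_filter
  proof (rule always_eventually, intro allI impI)
    fix h :: real assume "h \<noteq> 0"
    then have "(f (x + h) - f x) /\<^sub>R h - v = (f (x + h) - f x - h *\<^sub>R v) /\<^sub>R h"
      by (simp add: scaleR_diff_right)
    then show "norm ((f (x + h) - f x) /\<^sub>R h - v) = norm (f (x + h) - f x - h *\<^sub>R v) / norm h"
      by (simp add: divide_inverse)
  qed
  have "((\<lambda>h. (f (x + h) - f x) /\<^sub>R h) \<longlongrightarrow> v) (at 0)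
      \<longleftrightarrow> ((\<lambda>h. norm ((f (x + h) - f x) /\<^sub>R h - v)) \<longlongrightarrow> 0) (at 0)"
    by (simp only: LIM_zero_iff tendsto_norm_zero_iff)
  also have "\<dots> \<longleftrightarrow> ((\<lambda>h. norm (f (x + h) - f x - h *\<^sub>R v) / norm h) \<longlongrightarrow> 0) (at 0)"
    by (rule tendsto_cong[OF ev])
  finally show ?thesis
    by (simp add: has_vector_derivative_def has_derivative_at bounded_linear_scaleR_left)
qed

lemma integral_has_vector_derivative_parameter:
  fixes f :: "real \<Rightarrow> 'a \<Rightarrow> complex"
  assumes "\<delta> > 0"
    and int: "\<And>s. \<bar>s - s0\<bar> < \<delta> \<Longrightarrow> integrable M (f s)"
    and der: "\<And>s x. \<bar>s - s0\<bar> < \<delta> \<Longrightarrow> x \<in> space M \<Longrightarrow>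
        ((\<lambda>s. f s x) has_vector_derivative f' s x) (at s)"
    and bnd: "\<And>s x. \<bar>s - s0\<bar> < \<delta> \<Longrightarrow> x \<in> space M \<Longrightarrow> cmod (f' s x) \<le> w x"
    and w: "integrable M w"
  shows "((\<lambda>s. \<integral>x. f s x \<partial>M) has_vector_derivative (\<integral>x. f' s0 x \<partial>M)) (at s0)"
proof -
  \<comment> \<open>Setting the quotient to 0 for large h makes it integrable and dominated for
    every h, so dominated convergence applies to any sequence tending to 0 without dropping
    terms.\<close>
  define Q where "Q h x = (if \<bar>h\<bar> < \<delta> then (f (s0 + h) x - f s0 x) /\<^sub>R h else 0)" for h x
  have lim: "((\<lambda>h. Q h x) \<longlongrightarrow> f' s0 x) (at 0)" if "x \<in> space M" for x
  proof -
    have "((\<lambda>h. (f (s0 + h) x - f s0 x) /\<^sub>R h) \<longlongrightarrow> f' s0 x) (at 0)"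
      using der[of s0 x] that \<open>\<delta> > 0\<close> by (simp add: has_vector_derivative_iff_quotient)
    moreover have "\<forall>\<^sub>F h in at 0. (f (s0 + h) x - f s0 x) /\<^sub>R h = Q h x"
      unfolding eventually_at Q_def using \<open>\<delta> > 0\<close> by (intro exI[of _ \<delta>]) (auto simp: dist_real_def)
    ultimately show ?thesis by (rule Lim_transform_eventually)
  qed
  have Qint: "integrable M (Q h)" for h
    unfolding Q_def[abs_def] using int[of "s0 + h"] int[of s0] \<open>\<delta> > 0\<close> by (cases "\<bar>h\<bar> < \<delta>") auto
  have Qbnd: "cmod (Q h x) \<le> w x" if "x \<in> space M" for h x
  proof (cases "\<bar>h\<bar> < \<delta> \<and> h \<noteq> 0")
    case True
    have "cmod (f (s0 + h) x - f s0 x) \<le> w x * \<bar>s0 + h - s0\<bar>"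
      by (rule norm_diff_le_of_vector_derivative[where S="{s0 - \<delta><..<s0 + \<delta>}" and f'="\<lambda>s. f' s x"])
         (use True that \<open>\<delta> > 0\<close> in \<open>auto intro!: der bnd simp: abs_less_iff\<close>)
    moreover have "cmod (Q h x) = cmod (f (s0 + h) x - f s0 x) / \<bar>h\<bar>"
      using True by (simp add: Q_def divide_inverse mult.commute)
    ultimately show ?thesis using True by (simp add: pos_divide_le_eq)
  next
    case False
    then show ?thesis
      using bnd[of s0 x] that \<open>\<delta> > 0\<close> norm_ge_zero[of "f' s0 x"] by (auto simp: Q_def simp del: norm_ge_zero)
  qed
  have "((\<lambda>h. \<integral>x. Q h x \<partial>M) \<longlongrightarrow> (\<integral>x. f' s0 x \<partial>M)) (at 0)"
    unfolding tendsto_at_iff_sequentially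
  proof (intro allI impI)
    fix X :: "nat \<Rightarrow> real"
    assume X: "\<forall>i. X i \<in> UNIV - {0}" "X \<longlonglongrightarrow> 0"
    show "((\<lambda>h. \<integral>x. Q h x \<partial>M) \<circ> X) \<longlonglongrightarrow> (\<integral>x. f' s0 x \<partial>M)"
      unfolding comp_def
    proof (rule integral_dominated_convergence[OF _ _ w])
      have lims: "(\<lambda>i. Q (X i) x) \<longlonglongrightarrow> f' s0 x" if "x \<in> space M" for x
        using lim[OF that] X unfolding tendsto_at_iff_sequentially comp_def by blast
      show "f' s0 \<in> borel_measurable M"
        by (rule borel_measurable_LIMSEQ_metric[OF _ lims]) (use Qint in auto)
      show "AE x in M. (\<lambda>i. Q (X i) x) \<longlonglongrightarrow> f' s0 x" using lims by (rule AE_I2)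
      show "AE x in M. norm (Q (X i) x) \<le> w x" for i using Qbnd by (rule AE_I2)
    qed (use Qint in auto)
  qed
  moreover have "\<forall>\<^sub>F h in at 0. (\<integral>x. Q h x \<partial>M) = ((\<integral>x. f (s0 + h) x \<partial>M) - (\<integral>x. f s0 x \<partial>M)) /\<^sub>R h"
    unfolding eventually_at
  proof (intro exI[of _ \<delta>] conjI ballI impI)
    fix h :: real assume "h \<noteq> 0 \<and> dist h 0 < \<delta>"
    then have "\<bar>h\<bar> < \<delta>" by (simp add: dist_real_def)
    then show "(\<integral>x. Q h x \<partial>M) = ((\<integral>x. f (s0 + h) x \<partial>M) - (\<integral>x. f s0 x \<partial>M)) /\<^sub>R h"
      using int[of "s0 + h"] int[of s0] \<open>\<delta> > 0\<close> by (simp add: Q_def)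
  qed (rule \<open>\<delta> > 0\<close>)
  ultimately have "((\<lambda>h. ((\<integral>x. f (s0 + h) x \<partial>M) - (\<integral>x. f s0 x \<partial>M)) /\<^sub>R h) \<longlongrightarrow> (\<integral>x. f' s0 x \<partial>M)) (at 0)"
    by (rule Lim_transform_eventually)
  then show ?thesis by (simp add: has_vector_derivative_iff_quotient)
qed

lemma lborel_integral_translation:
  fixes f :: "'a::euclidean_space \<Rightarrow> complex"
  assumes "continuous_on UNIV f"
  shows "(\<integral>x. f (x + c) \<partial>lborel) = (\<integral>x. f x \<partial>lborel)"
proof -
  have "(\<integral>x. f x \<partial>lborel) = (\<integral>x. f x \<partial>distr lborel borel ((+) c))"
    by (simp add: lborel_distr_plus)
  also have "\<dots> = (\<integral>x. f (c + x) \<partial>lborel)"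
    using assms by (intro integral_distr) (auto intro: borel_measurable_continuous_onI)
  finally show ?thesis by (simp add: add.commute)
qed

lemma integrable_lborel_compact_support:
  fixes f :: "'a::euclidean_space \<Rightarrow> complex"
  assumes "continuous_on UNIV f" "bounded S" "\<And>x. x \<notin> S \<Longrightarrow> f x = 0" "\<And>x. cmod (f x) \<le> B"
  shows "integrable lborel f"
proof -
  obtain r where r: "S \<subseteq> cball 0 r" using assms(2) by (auto simp: bounded_iff subset_iff)
  show ?thesis
  proof (rule Bochner_Integration.integrable_bound)
    show "integrable lborel (\<lambda>x::'a. B * indicator (cball 0 r) x)"
      by (intro integrable_mult_right integrable_real_indicator) (auto intro!: emeasure_bounded_finite[OF bounded_cball, unfolded infinity_ennreal_def])
    show "f \<in> borel_measurable lborel" using borel_measurable_continuous_onI[OF assms(1)] by simp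
    show "AE x in lborel. norm (f x) \<le> norm (B * indicator (cball 0 r) x)"
    proof (rule AE_I2)
      fix x
      show "norm (f x) \<le> norm (B * indicator (cball 0 r) x)"
      proof (cases "x \<in> S")
        case True
        then have "x \<in> cball 0 r" using r by blast
        then show ?thesis using assms(4)[of x] by simp
      qed (simp add: assms(3))
    qed
  qed
qed

text \<open>By translation invariance the integral of f(x + s i) does not depend on s; its
  derivative at s = 0, taken under the integral sign, is the integral of the partial
  derivative.\<close>

lemma integral_partial_lborel:
  fixes f :: "'a::euclidean_space \<Rightarrow> complex"
  assumes "test_fun \<Omega> f" "i \<in> Basis"
  shows "(\<integral>x. partial i f x \<partial>lborel) = 0"
proof -
  obtain K where K: "compact K" "\<And>x. x \<notin> K \<Longrightarrow> f x = 0" "\<And>x. x \<notin> K \<Longrightarrow> partial i f x = 0"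
    using test_fun_support[OF assms(1)] by blast
  obtain B where B: "B \<ge> 0" "\<And>x. cmod (partial i f x) \<le> B"
    using test_fun_bounded[OF test_fun_partial[OF assms]] by blast
  obtain B' where B': "B' \<ge> 0" "\<And>x. cmod (f x) \<le> B'"
    using test_fun_bounded[OF assms(1)] by blast
  obtain r where r: "K \<subseteq> cball 0 r" using compact_imp_bounded[OF K(1)] by (auto simp: bounded_iff subset_iff)
  have der: "((\<lambda>s. f (x + s *\<^sub>R i)) has_vector_derivative partial i f (x + s *\<^sub>R i)) (at s)" for x s
  proof -
    have "(f has_derivative frechet_derivative f (at (x + s *\<^sub>R i))) (at (x + s *\<^sub>R i))"
      by (rule Ck_has_derivative[OF test_fun_Ck[OF assms(1)]])
    moreover have "((\<lambda>s. x + s *\<^sub>R i) has_derivative (\<lambda>h. h *\<^sub>R i)) (at s)"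
      by (auto intro!: derivative_eq_intros)
    ultimately have "((\<lambda>s. f (x + s *\<^sub>R i)) has_derivative (\<lambda>h. frechet_derivative f (at (x + s *\<^sub>R i)) (h *\<^sub>R i))) (at s)"
      by (rule has_derivative_compose[rotated])
    moreover have "(\<lambda>h. frechet_derivative f (at (x + s *\<^sub>R i)) (h *\<^sub>R i))
        = (\<lambda>h. h *\<^sub>R frechet_derivative f (at (x + s *\<^sub>R i)) i)"
      by (rule ext) (rule linear_scale[OF linear_frechet_derivative[OF Ck_differentiable[OF test_fun_Ck[OF assms(1)]]]])
    ultimately show ?thesis
      by (simp only: has_vector_derivative_def partial_def)
  qed
  have cont: "continuous_on UNIV (\<lambda>x. f (x + c))" for c
    by (rule continuous_on_compose2[OF test_fun_cont[OF assms(1), of UNIV]])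
       (auto intro!: continuous_on_add continuous_on_id continuous_on_const)
  have "((\<lambda>s. \<integral>x. f (x + s *\<^sub>R i) \<partial>lborel) has_vector_derivative (\<integral>x. partial i f (x + 0 *\<^sub>R i) \<partial>lborel)) (at 0)"
  proof (rule integral_has_vector_derivative_parameter[where \<delta>=1])
    show "integrable lborel (\<lambda>x. f (x + s *\<^sub>R i))" for s
    proof (rule integrable_lborel_compact_support[OF cont _ _ B'(2)])
      show "bounded (cball 0 (r + norm (s *\<^sub>R i)))" by simp
      fix x :: 'a assume x: "x \<notin> cball 0 (r + norm (s *\<^sub>R i))"
      have "norm x \<le> norm (x + s *\<^sub>R i) + norm (s *\<^sub>R i)"
        using norm_triangle_ineq4[of "x + s *\<^sub>R i" "s *\<^sub>R i"] by simp
      with x have "x + s *\<^sub>R i \<notin> K" using r by auto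
      then show "f (x + s *\<^sub>R i) = 0" by (rule K)
    qed
    \<comment> \<open>For |s| < 1 all translates of the support stay in the ball of radius r + 1,
      which gives an integrable bound independent of s.\<close>
    show "integrable lborel (\<lambda>x::'a. B * indicator (cball 0 (r + 1)) x)"
      by (intro integrable_mult_right integrable_real_indicator) (auto intro!: emeasure_bounded_finite[OF bounded_cball, unfolded infinity_ennreal_def])
    show "cmod (partial i f (x + s *\<^sub>R i)) \<le> B * indicator (cball 0 (r + 1)) x" if "\<bar>s - 0\<bar> < 1" for s x
    proof (cases "x \<in> cball 0 (r + 1)")
      case False
      have "norm x \<le> norm (x + s *\<^sub>R i) + norm (s *\<^sub>R i)"
        using norm_triangle_ineq4[of "x + s *\<^sub>R i" "s *\<^sub>R i"] by simp
      moreover have "norm (s *\<^sub>R i) \<le> 1" using that assms(2) by simp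
      ultimately have "x + s *\<^sub>R i \<notin> K" using r False by auto
      then show ?thesis using K(3) False by simp
    qed (use B in simp)
  qed (simp_all only: der zero_less_one)
  moreover have "(\<lambda>s. \<integral>x. f (x + s *\<^sub>R i) \<partial>lborel) = (\<lambda>s. \<integral>x. f x \<partial>lborel)"
    by (rule ext) (rule lborel_integral_translation[OF test_fun_cont[OF assms(1)]])
  ultimately have "((\<lambda>s::real. \<integral>x. f x \<partial>lborel) has_vector_derivative (\<integral>x. partial i f x \<partial>lborel)) (at 0)"
    by simp
  then show ?thesis
    by (rule vector_derivative_unique_at[OF _ has_vector_derivative_const])
qed

lemma test_fun_integral_eq:
  assumes "open \<Omega>" "test_fun \<Omega> f"
  shows "(\<integral>x. f x \<partial>lebesgue_on \<Omega>) = (\<integral>x. f x \<partial>lborel)"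
proof -
  have "(\<integral>x. f x \<partial>lebesgue_on \<Omega>) = (\<integral>x. indicator \<Omega> x *\<^sub>R f x \<partial>lebesgue)"
    using assms(1) by (intro integral_restrict_space) auto
  also have "(\<lambda>x. indicator \<Omega> x *\<^sub>R f x) = f"
    using test_fun_outside[OF assms(2)] by (auto simp: indicator_def)
  also have "(\<integral>x. f x \<partial>lebesgue) = (\<integral>x. f x \<partial>lborel)"
    using borel_measurable_continuous_onI[OF test_fun_cont[OF assms(2)]]
    by (intro integral_completion) simp
  finally show ?thesis .
qed

lemma integral_partial_eq_0:
  assumes "open \<Omega>" "test_fun \<Omega> f" "i \<in> Basis"
  shows "(\<integral>x. partial i f x \<partial>lebesgue_on \<Omega>) = 0"
  using test_fun_integral_eq[OF assms(1) test_fun_partial[OF assms(2,3)]]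
    integral_partial_lborel[OF assms(2,3)] by simp

lemma integrable_const_bounded:
  assumes "open \<Omega>" "bounded \<Omega>"
  shows "integrable (lebesgue_on \<Omega>) (\<lambda>x. c :: real)"
proof -
  have "finite_measure (lebesgue_on \<Omega>)"
    using assms by (intro finite_measure_lebesgue_on lmeasurable_open)
  then show ?thesis by (rule finite_measure.integrable_const)
qed

lemma continuous_measurable_lebesgue_on:
  assumes "open \<Omega>" "continuous_on \<Omega> f"
  shows "f \<in> borel_measurable (lebesgue_on \<Omega>)"
  using assms by (intro continuous_imp_measurable_on_sets_lebesgue) auto

lemma test_fun_L2:
  assumes "open \<Omega>" "bounded \<Omega>" "test_fun \<Omega> f"
  shows "f \<in> L2 \<Omega>"
proof -
  obtain B where B: "B \<ge> 0" "\<And>x. cmod (f x) \<le> B" using test_fun_bounded[OF assms(3)] by blast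
  show ?thesis
  proof (rule L2I_bound)
    show "f \<in> borel_measurable (lebesgue_on \<Omega>)"
      by (rule continuous_measurable_lebesgue_on[OF assms(1) test_fun_cont[OF assms(3)]])
    show "AE x in lebesgue_on \<Omega>. (cmod (f x))\<^sup>2 \<le> B\<^sup>2"
      using B(2) by (intro AE_I2 power_mono) auto
  qed (rule integrable_const_bounded[OF assms(1,2)])
qed

lemma L2_integrable_self:
  assumes "open \<Omega>" "bounded \<Omega>" "u \<in> L2 \<Omega>"
  shows "integrable (lebesgue_on \<Omega>) u"
proof -
  have "(\<lambda>x. 1) \<in> L2 \<Omega>"
    by (rule L2I_bound[OF _ integrable_const_bounded[OF assms(1,2), of 1]]) auto
  from L2_integrable_mult[OF this assms(3)] show ?thesis by simp
qed

lemma integral_by_parts_test: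
  assumes "open \<Omega>" "bounded \<Omega>" "\<And>k. Ck k f" "test_fun \<Omega> g" "i \<in> Basis"
  shows "(\<integral>x. f x * partial i g x \<partial>lebesgue_on \<Omega>) = - (\<integral>x. partial i f x * g x \<partial>lebesgue_on \<Omega>)"
proof -
  have 1: "test_fun \<Omega> (\<lambda>x. f x * partial i g x)"
    by (rule test_fun_mult[OF assms(3) test_fun_partial[OF assms(4,5)]])
  have Cp: "Ck k (partial i f)" for k using assms(3)[of "Suc k"] assms(5) by simp
  have 2: "test_fun \<Omega> (\<lambda>x. partial i f x * g x)"
    by (rule test_fun_mult[OF Cp assms(4)])
  have "0 = (\<integral>x. partial i (\<lambda>x. f x * g x) x \<partial>lebesgue_on \<Omega>)"
    using integral_partial_eq_0[OF assms(1) test_fun_mult[OF assms(3,4)] assms(5)] by simp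
  also have "\<dots> = (\<integral>x. f x * partial i g x + partial i f x * g x \<partial>lebesgue_on \<Omega>)"
    unfolding partial_mult[OF assms(3) test_fun_Ck[OF assms(4)]] ..
  also have "\<dots> = (\<integral>x. f x * partial i g x \<partial>lebesgue_on \<Omega>) + (\<integral>x. partial i f x * g x \<partial>lebesgue_on \<Omega>)"
    by (intro Bochner_Integration.integral_add L2_integrable_self[OF assms(1,2)] test_fun_L2[OF assms(1,2)] 1 2)
  finally show ?thesis by (simp add: eq_neg_iff_add_eq_0)
qed

text \<open>Products of one-dimensional bumps approximate the indicator of a box.\<close>

lemma integral_box_eq_0:
  fixes g :: "'a::euclidean_space \<Rightarrow> complex"
  assumes \<Omega>: "open \<Omega>" "bounded \<Omega>" and g: "g \<in> L2 \<Omega>"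
    and 0: "\<And>f. test_fun \<Omega> f \<Longrightarrow> (\<integral>x. g x * f x \<partial>lebesgue_on \<Omega>) = 0"
    and sub: "cbox a b \<subseteq> \<Omega>"
  shows "(\<integral>x. g x * indicator (box a b) x \<partial>lebesgue_on \<Omega>) = 0"
proof -
  define F where "F n x = (\<Prod>i\<in>Basis. complex_of_real (bump (real (Suc n)) (a \<bullet> i) (b \<bullet> i) (x \<bullet> i)))"
    for n and x :: 'a
  have test: "test_fun \<Omega> (F n)" for n
  proof (rule test_funI[OF _ compact_cbox sub])
    show "Ck k (F n)" for k
    proof -
      have "Ck k (\<lambda>x::'a. complex_of_real (bump (real (Suc n)) (a \<bullet> i) (b \<bullet> i) (x \<bullet> i)))" for i
        using Ck_inner[of k "\<lambda>t. complex_of_real (bump (real (Suc n)) (a \<bullet> i) (b \<bullet> i) t)" i 0]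
          smooth1_bump[unfolded smooth1_def] by simp
      then show ?thesis unfolding F_def by (rule Ck_prod)
    qed
    fix x assume "x \<notin> cbox a b"
    then obtain i where "i \<in> Basis" "\<not> (a \<bullet> i < x \<bullet> i \<and> x \<bullet> i < b \<bullet> i)"
      unfolding mem_box by (meson less_imp_le)
    then show "F n x = 0"
      unfolding F_def by (intro prod_zero) (auto intro!: bexI[of _ i] bump_eq_0)
  qed
  have bnd: "cmod (F n x) \<le> 1" for n x
    unfolding F_def prod_norm[symmetric]
    by (auto simp: bump_bounds abs_of_nonneg intro!: prod_le_1)
  have lim: "(\<lambda>n. F n x) \<longlonglongrightarrow> indicator (box a b) x" for x
  proof -
    have "(\<lambda>n. F n x) \<longlonglongrightarrow> (\<Prod>i\<in>Basis. complex_of_real (indicator {a \<bullet> i<..<b \<bullet> i} (x \<bullet> i)))"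
      unfolding F_def by (intro tendsto_prod tendsto_of_real bump_tendsto)
    also have "(\<Prod>i\<in>Basis. complex_of_real (indicator {a \<bullet> i<..<b \<bullet> i} (x \<bullet> i)))
        = (indicator (box a b) x :: complex)"
    proof (cases "x \<in> box a b")
      case True
      then show ?thesis by (auto simp: mem_box intro!: prod.neutral)
    next
      case False
      then obtain i where "i \<in> Basis" "\<not> (a \<bullet> i < x \<bullet> i \<and> x \<bullet> i < b \<bullet> i)"
        unfolding mem_box by blast
      then have "(\<Prod>i\<in>Basis. complex_of_real (indicator {a \<bullet> i<..<b \<bullet> i} (x \<bullet> i))) = 0"
        by (intro prod_zero) (auto intro!: bexI[of _ i])
      then show ?thesis using False by simp
    qed
    finally show ?thesis .
  qed
  have gi: "integrable (lebesgue_on \<Omega>) g" by (rule L2_integrable_self[OF \<Omega> g])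
  have "(\<lambda>n. \<integral>x. g x * F n x \<partial>lebesgue_on \<Omega>) \<longlonglongrightarrow> (\<integral>x. g x * indicator (box a b) x \<partial>lebesgue_on \<Omega>)"
  proof (rule integral_dominated_convergence)
    show "integrable (lebesgue_on \<Omega>) (\<lambda>x. cmod (g x))" using gi by (rule integrable_norm)
    have meas: "(\<lambda>x. g x * F n x) \<in> borel_measurable (lebesgue_on \<Omega>)" for n
      by (intro borel_measurable_times borel_measurable_integrable[OF gi]
          continuous_measurable_lebesgue_on[OF \<Omega>(1) test_fun_cont[OF test]])
    then show "(\<lambda>x. g x * F n x) \<in> borel_measurable (lebesgue_on \<Omega>)" for n .
    have lims: "(\<lambda>n. g x * F n x) \<longlonglongrightarrow> g x * indicator (box a b) x" for x
      by (intro tendsto_mult tendsto_const lim)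
    show "(\<lambda>x. g x * indicator (box a b) x) \<in> borel_measurable (lebesgue_on \<Omega>)"
      by (rule borel_measurable_LIMSEQ_metric[OF meas lims])
    show "AE x in lebesgue_on \<Omega>. (\<lambda>n. g x * F n x) \<longlonglongrightarrow> g x * indicator (box a b) x"
      by (intro AE_I2 lims)
    show "AE x in lebesgue_on \<Omega>. norm (g x * F n x) \<le> cmod (g x)" for n
      using bnd by (intro AE_I2) (simp add: norm_mult mult_left_le)
  qed
  then have "(\<lambda>n. 0) \<longlonglongrightarrow> (\<integral>x. g x * indicator (box a b) x \<partial>lebesgue_on \<Omega>)"
    using 0[OF test] by simp
  then show ?thesis by (simp add: LIMSEQ_const_iff)
qed

text \<open>Since \<open>ennreal\<close> cuts off negative values, the two densities are the
  positive and the negative part of h. The measures agree on open boxes, which are stable under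
  intersection and generate the Borel sets; hence they agree, and so do the densities almost
  everywhere.\<close>

lemma AE_eq_0_if_box_integrals_eq_0:
  fixes h :: "'a::euclidean_space \<Rightarrow> real"
  assumes h: "integrable lborel h"
    and 0: "\<And>a b. (\<integral>x. h x * indicator (box a b) x \<partial>lborel) = 0"
  shows "AE x in lborel. h x = 0"
proof -
  have [measurable]: "h \<in> borel_measurable borel" using h by auto
  let ?P = "density lborel (\<lambda>x. ennreal (h x))" and ?N = "density lborel (\<lambda>x. ennreal (- h x))"
  let ?E = "range (\<lambda>(a, b). box a b::'a set)"
  have eq: "emeasure ?P (box a b) = emeasure ?N (box a b)" for a b
  proof -
    let ?k = "\<lambda>x. h x * indicator (box a b) x"
    have k: "integrable lborel ?k" "integrable lborel (\<lambda>x. - ?k x)"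
      using integrable_mult_indicator[of "box a b" lborel h] h
      by (auto simp: mult.commute)
    have "(\<integral>x. max 0 (?k x) \<partial>lborel) - (\<integral>x. max 0 (- ?k x) \<partial>lborel)
        = (\<integral>x. max 0 (?k x) - max 0 (- ?k x) \<partial>lborel)"
      using k by (intro Bochner_Integration.integral_diff[symmetric] integrable_max integrable_zero)
    also have "(\<lambda>x. max 0 (?k x) - max 0 (- ?k x)) = ?k" by (auto simp: max_def)
    finally have "(\<integral>x. max 0 (?k x) \<partial>lborel) = (\<integral>x. max 0 (- ?k x) \<partial>lborel)"
      using 0 by simp
    moreover have "(\<integral>\<^sup>+x. ennreal (max 0 (?k x)) \<partial>lborel) = (\<integral>x. max 0 (?k x) \<partial>lborel)"
      "(\<integral>\<^sup>+x. ennreal (max 0 (- ?k x)) \<partial>lborel) = (\<integral>x. max 0 (- ?k x) \<partial>lborel)"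
      using k by (intro nn_integral_eq_integral integrable_max integrable_zero; simp)+
    moreover have "(\<integral>\<^sup>+x. ennreal (h x) * indicator (box a b) x \<partial>lborel) = (\<integral>\<^sup>+x. ennreal (max 0 (?k x)) \<partial>lborel)"
      "(\<integral>\<^sup>+x. ennreal (- h x) * indicator (box a b) x \<partial>lborel) = (\<integral>\<^sup>+x. ennreal (max 0 (- ?k x)) \<partial>lborel)"
      by (intro nn_integral_cong; auto simp: indicator_def max_def ennreal_neg)+
    ultimately show ?thesis by (simp add: emeasure_density)
  qed
  have fin: "(\<integral>\<^sup>+x. ennreal (h x) \<partial>lborel) \<noteq> \<infinity>"
  proof -
    have "(\<integral>\<^sup>+x. ennreal (h x) \<partial>lborel) \<le> (\<integral>\<^sup>+x. ennreal (norm (h x)) \<partial>lborel)"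
      by (intro nn_integral_mono ennreal_leI) auto
    also have "\<dots> < \<infinity>" using h by (simp add: integrable_iff_bounded)
    finally show ?thesis by simp
  qed
  have "?P = ?N"
  proof (rule measure_eqI_generator_eq)
    show "Int_stable ?E"
      by (auto simp: Int_stable_def box_Int_box)
    show "?E \<subseteq> Pow UNIV" "sets ?P = sigma_sets UNIV ?E" "sets ?N = sigma_sets UNIV ?E"
      by (simp_all add: borel_eq_box)
    let ?A = "\<lambda>n::nat. box (- (real n *\<^sub>R One)) (real n *\<^sub>R One) :: 'a set"
    show "range ?A \<subseteq> ?E" "(\<Union>i. ?A i) = UNIV"
      unfolding UN_box_eq_UNIV by auto
    show "emeasure ?P (?A i) \<noteq> \<infinity>" for i
    proof -
      have "emeasure ?P (?A i) \<le> emeasure ?P (space ?P)" by (intro emeasure_mono) auto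
      also have "emeasure ?P (space ?P) = (\<integral>\<^sup>+x. ennreal (h x) \<partial>lborel)"
        by (simp add: emeasure_density)
      finally show ?thesis using fin by (auto simp: top_unique)
    qed
    show "emeasure ?P X = emeasure ?N X" if "X \<in> ?E" for X using that eq by auto
  qed
  \<comment> \<open>At each such point the two parts of h coincide while one of them is zero, so
    both vanish.\<close>
  then have "AE x in lborel. ennreal (h x) = ennreal (- h x)"
    using fin by (subst (asm) finite_density_unique) auto
  then show ?thesis
  proof eventually_elim
    case (elim x)
    show ?case
    proof (cases "h x \<ge> 0")
      case True
      then show ?thesis using elim by (simp add: ennreal_neg ennreal_eq_0_iff)
    next
      case False
      then have "ennreal (- h x) = 0" using elim by (simp add: ennreal_neg)
      then show ?thesis using False by (simp add: ennreal_eq_0_iff)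
    qed
  qed
qed

text \<open>Vanishing box integrals are given inside \<Omega> only. An intersection of boxes is a
  box, so h cut down to a box inside \<Omega> meets the global criterion, and countably many such
  boxes exhaust \<Omega>.\<close>

lemma AE_eq_0_if_local_box_integrals_eq_0:
  fixes h :: "'a::euclidean_space \<Rightarrow> real"
  assumes \<Omega>: "open \<Omega>" and h: "integrable (lebesgue_on \<Omega>) h"
    and 0: "\<And>a b. cbox a b \<subseteq> \<Omega> \<Longrightarrow> (\<integral>x. h x * indicator (box a b) x \<partial>lebesgue_on \<Omega>) = 0"
  shows "AE x in lebesgue_on \<Omega>. h x = 0"
proof -
  have S: "\<Omega> \<inter> space lebesgue \<in> sets lebesgue" using \<Omega> by auto
  have hm: "(\<lambda>x. indicator \<Omega> x *\<^sub>R h x) \<in> borel_measurable lebesgue"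
    using h by (simp add: integrable_restrict_space[OF S] borel_measurable_integrable)
  \<comment> \<open>The global criterion is stated for \<open>lborel\<close>, hence the Borel
    representative \<open>H\<close> of h extended by zero.\<close>
  then obtain H where H: "H \<in> borel_measurable lborel" "AE x in lborel. indicator \<Omega> x *\<^sub>R h x = H x"
    using completion_ex_borel_measurable_real by blast
  have H': "AE x in lebesgue. indicator \<Omega> x *\<^sub>R h x = H x" using H(2) by (rule AE_completion)
  have [measurable]: "H \<in> borel_measurable borel" using H by simp
  have "integrable lebesgue (\<lambda>x. indicator \<Omega> x *\<^sub>R h x)"
    using h by (simp add: integrable_restrict_space[OF S])
  then have "integrable lebesgue H"
    by (rule integrable_cong_AE_imp) (use H' in \<open>auto simp: measurable_completion elim: eventually_mono\<close>)
  then have Hi: "integrable lborel H" by (simp add: integrable_completion H)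
  have box0: "(\<integral>x. H x * indicator (box a b) x \<partial>lborel) = 0" if "cbox a b \<subseteq> \<Omega>" for a b
  proof -
    have "(\<integral>x. H x * indicator (box a b) x \<partial>lborel) = (\<integral>x. H x * indicator (box a b) x \<partial>lebesgue)"
      by (rule integral_completion[symmetric]) simp
    also have "\<dots> = (\<integral>x. indicator \<Omega> x *\<^sub>R (h x * indicator (box a b) x) \<partial>lebesgue)"
    proof (rule integral_cong_AE)
      show "(\<lambda>x. H x * indicator (box a b) x) \<in> borel_measurable lebesgue"
        by (rule measurable_completion) simp
      have "(\<lambda>x. (indicator \<Omega> x *\<^sub>R h x) * indicator (box a b) x) \<in> borel_measurable lebesgue"
        by (intro borel_measurable_times[OF hm] measurable_completion) simp
      then show "(\<lambda>x. indicator \<Omega> x *\<^sub>R (h x * indicator (box a b) x)) \<in> borel_measurable lebesgue"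
        by (simp add: mult.assoc)
      show "AE x in lebesgue. H x * indicator (box a b) x = indicator \<Omega> x *\<^sub>R (h x * indicator (box a b) x)"
        using H' by eventually_elim auto
    qed
    also have "\<dots> = (\<integral>x. h x * indicator (box a b) x \<partial>lebesgue_on \<Omega>)"
      by (rule integral_restrict_space[OF S, symmetric])
    finally show ?thesis using 0[OF that] by simp
  qed
  have loc: "AE x in lborel. x \<in> cbox c d \<longrightarrow> H x = 0" if cd: "cbox c d \<subseteq> \<Omega>" for c d
  proof -
    have "AE x in lborel. H x * indicator (box c d) x = 0"
    proof (rule AE_eq_0_if_box_integrals_eq_0)
      show "integrable lborel (\<lambda>x. H x * indicator (box c d) x)"
        using integrable_mult_indicator[of "box c d" lborel H] Hi by (auto simp: mult.commute)
      fix a b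
      obtain a' b' where ab: "box a b \<inter> box c d = box a' b'" using box_Int_box by blast
      have "(\<integral>x. H x * indicator (box a' b') x \<partial>lborel) = 0"
      proof (cases "box a' b' = {}")
        case False
        have "cbox a' b' = closure (box a' b')" by (simp add: closure_box[OF False])
        also have "\<dots> \<subseteq> cbox c d"
          using ab box_subset_cbox by (intro closure_minimal) auto
        finally show ?thesis using cd by (intro box0) auto
      qed simp
      then show "(\<integral>x. H x * indicator (box c d) x * indicator (box a b) x \<partial>lborel) = 0"
        unfolding mult.assoc indicator_inter_arith[symmetric] using ab by (simp add: Int_commute)
    qed
    \<comment> \<open>The cut-off was made with the open box, while the cover below consists of
      closed ones; the difference is a null set.\<close>
    moreover have "AE x in lborel. x \<notin> cbox c d - box c d"
    proof (rule AE_not_in)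
      show "cbox c d - box c d \<in> null_sets lborel"
        using negligible_frontier_interval[of c d]
        by (auto simp: negligible_iff_null_sets null_sets_completion_iff)
    qed
    ultimately show ?thesis by eventually_elim (auto simp: indicator_def)
  qed
  have "\<exists>\<D>. countable \<D> \<and> \<D> \<subseteq> Pow \<Omega> \<and> (\<forall>X\<in>\<D>. \<exists>a b. X = cbox a b) \<and> \<Union>\<D> = \<Omega>"
    by (rule open_countable_Union_open_cbox[OF \<Omega>], rule exI, intro conjI ballI) (assumption | blast)+
  then obtain \<D> where D: "countable \<D>" "\<D> \<subseteq> Pow \<Omega>" "\<forall>X\<in>\<D>. \<exists>a b. X = cbox a b" "\<Union>\<D> = \<Omega>"
    by blast
  have "AE x in lborel. \<forall>X\<in>\<D>. x \<in> X \<longrightarrow> H x = 0"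
  proof (subst AE_ball_countable[OF D(1)], rule ballI)
    fix X assume "X \<in> \<D>"
    moreover then obtain c d where "X = cbox c d" using D(3) by blast
    ultimately show "AE x in lborel. x \<in> X \<longrightarrow> H x = 0" using loc[of c d] D(2) by auto
  qed
  then have "AE x in lborel. x \<in> \<Omega> \<longrightarrow> h x = 0"
    using H(2)
  proof eventually_elim
    case (elim x)
    show ?case
    proof
      assume x: "x \<in> \<Omega>"
      then obtain X where "X \<in> \<D>" "x \<in> X" using D(4) by blast
      then have "H x = 0" using elim(1) by blast
      then show "h x = 0" using elim(2) x by simp
    qed
  qed
  then have "AE x in lebesgue. x \<in> \<Omega> \<longrightarrow> h x = 0" by (rule AE_completion)
  then show ?thesis using S by (simp add: AE_restrict_space_iff)
qed

lemma fundamental_lemma: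
  fixes g :: "'a::euclidean_space \<Rightarrow> complex"
  assumes \<Omega>: "open \<Omega>" "bounded \<Omega>" and g: "g \<in> L2 \<Omega>"
    and 0: "\<And>f. test_fun \<Omega> f \<Longrightarrow> (\<integral>x. g x * f x \<partial>lebesgue_on \<Omega>) = 0"
  shows "AE x in lebesgue_on \<Omega>. g x = 0"
proof -
  have gi: "integrable (lebesgue_on \<Omega>) g" by (rule L2_integrable_self[OF \<Omega> g])
  have box: "(\<integral>x. g x * indicator (box a b) x \<partial>lebesgue_on \<Omega>) = 0"
      "integrable (lebesgue_on \<Omega>) (\<lambda>x. g x * indicator (box a b) x)" if "cbox a b \<subseteq> \<Omega>" for a b
  proof -
    show "(\<integral>x. g x * indicator (box a b) x \<partial>lebesgue_on \<Omega>) = 0"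
      by (rule integral_box_eq_0[OF \<Omega> g 0 that])
    have "box a b \<subseteq> \<Omega>" using that box_subset_cbox by blast
    then have "box a b \<in> sets (lebesgue_on \<Omega>)"
      using \<Omega> by (simp add: sets_restrict_space_iff)
    then show "integrable (lebesgue_on \<Omega>) (\<lambda>x. g x * indicator (box a b) x)"
      using integrable_mult_indicator[OF _ gi, of "box a b"]
      by (simp add: scaleR_conv_of_real mult.commute of_real_indicator)
  qed
  have "AE x in lebesgue_on \<Omega>. Re (g x) = 0"
  proof (rule AE_eq_0_if_local_box_integrals_eq_0[OF \<Omega>(1) integrable_Re[OF gi]])
    fix a b :: 'a assume ab: "cbox a b \<subseteq> \<Omega>"
    have "(\<integral>x. Re (g x) * indicator (box a b) x \<partial>lebesgue_on \<Omega>)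
        = (\<integral>x. Re (g x * indicator (box a b) x) \<partial>lebesgue_on \<Omega>)"
      by (rule Bochner_Integration.integral_cong) (auto simp: indicator_def)
    then show "(\<integral>x. Re (g x) * indicator (box a b) x \<partial>lebesgue_on \<Omega>) = 0"
      using integral_Re[OF box(2)[OF ab]] box(1)[OF ab] by simp
  qed
  moreover have "AE x in lebesgue_on \<Omega>. Im (g x) = 0"
  proof (rule AE_eq_0_if_local_box_integrals_eq_0[OF \<Omega>(1) integrable_Im[OF gi]])
    fix a b :: 'a assume ab: "cbox a b \<subseteq> \<Omega>"
    have "(\<integral>x. Im (g x) * indicator (box a b) x \<partial>lebesgue_on \<Omega>)
        = (\<integral>x. Im (g x * indicator (box a b) x) \<partial>lebesgue_on \<Omega>)"
      by (rule Bochner_Integration.integral_cong) (auto simp: indicator_def)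
    then show "(\<integral>x. Im (g x) * indicator (box a b) x \<partial>lebesgue_on \<Omega>) = 0"
      using integral_Im[OF box(2)[OF ab]] box(1)[OF ab] by simp
  qed
  ultimately show ?thesis by eventually_elim (simp add: complex_eq_iff)
qed

section \<open>Weak derivatives\<close>

lemma ip_eq_Re: "u \<in> L2 \<Omega> \<Longrightarrow> v \<in> L2 \<Omega> \<Longrightarrow> ip \<Omega> u v = Re (\<integral>x. u x * cnj (v x) \<partial>lebesgue_on \<Omega>)"
  unfolding ip_def by (rule integral_Re[OF L2_integrable_ip(1)])

lemma grad_norm_sq: "(grad_norm \<Omega> u x)\<^sup>2 = (\<Sum>i\<in>Basis. (cmod (weak_partial \<Omega> i u x))\<^sup>2)"
  by (simp add: grad_norm_def sum_nonneg)

locale bounded_open =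
  fixes \<Omega> :: "'a::euclidean_space set"
  assumes open_dom: "open \<Omega>" and bounded_dom: "bounded \<Omega>"
begin

lemmas test_L2 = test_fun_L2[OF open_dom bounded_dom]

lemma test_partial_L2: "test_fun \<Omega> f \<Longrightarrow> i \<in> Basis \<Longrightarrow> partial i f \<in> L2 \<Omega>"
  by (rule test_L2[OF test_fun_partial])

lemma has_weak_partial_L2: "has_weak_partial \<Omega> i u g \<Longrightarrow> g \<in> L2 \<Omega>"
  by (simp add: has_weak_partial_def)

text \<open>Two candidates differ by a function that integrates to zero against all test functions.
  This makes the choice by \<open>SOME\<close> in \<open>weak_partial\<close> irrelevant up to null
  sets.\<close>

lemma has_weak_partial_unique:
  assumes "has_weak_partial \<Omega> i u g" "has_weak_partial \<Omega> i u g'"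
  shows "AE x in lebesgue_on \<Omega>. g x = g' x"
proof -
  have g: "g \<in> L2 \<Omega>" "g' \<in> L2 \<Omega>" using assms by (simp_all add: has_weak_partial_def)
  have "AE x in lebesgue_on \<Omega>. g x - g' x = 0"
  proof (rule fundamental_lemma[OF open_dom bounded_dom L2_diff[OF g]])
    fix f assume f: "test_fun \<Omega> f"
    have "(\<integral>x. g x * f x \<partial>lebesgue_on \<Omega>) = (\<integral>x. g' x * f x \<partial>lebesgue_on \<Omega>)"
      using assms f unfolding has_weak_partial_def by (metis neg_equal_iff_equal)
    then show "(\<integral>x. (g x - g' x) * f x \<partial>lebesgue_on \<Omega>) = 0"
      using L2_integrable_mult[OF g(1) test_L2[OF f]] L2_integrable_mult[OF g(2) test_L2[OF f]]
      by (simp add: left_diff_distrib)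
  qed
  then show ?thesis by simp
qed

lemma has_weak_partial_weak_partial:
  "has_weak_partial \<Omega> i u g \<Longrightarrow> has_weak_partial \<Omega> i u (weak_partial \<Omega> i u)"
  unfolding weak_partial_def by (rule someI[of "\<lambda>g. has_weak_partial \<Omega> i u g"])

lemma weak_partial_AE:
  "has_weak_partial \<Omega> i u g \<Longrightarrow> AE x in lebesgue_on \<Omega>. weak_partial \<Omega> i u x = g x"
  using has_weak_partial_unique has_weak_partial_weak_partial by blast

lemma H1_weak_partial: "u \<in> H1 \<Omega> \<Longrightarrow> i \<in> Basis \<Longrightarrow> has_weak_partial \<Omega> i u (weak_partial \<Omega> i u)"
  unfolding H1_def using has_weak_partial_weak_partial by blast

lemma H1_L2: "u \<in> H1 \<Omega> \<Longrightarrow> u \<in> L2 \<Omega>"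
  by (simp add: H1_def)

lemma H10_H1: "u \<in> H10 \<Omega> \<Longrightarrow> u \<in> H1 \<Omega>"
  by (simp add: H10_def)

lemma H10_L2: "u \<in> H10 \<Omega> \<Longrightarrow> u \<in> L2 \<Omega>"
  by (simp add: H10_def H1_def)

lemma weak_partial_L2: "u \<in> H1 \<Omega> \<Longrightarrow> i \<in> Basis \<Longrightarrow> weak_partial \<Omega> i u \<in> L2 \<Omega>"
  using H1_weak_partial by (auto simp: has_weak_partial_def)

lemmas H10_weak_partial_L2 = weak_partial_L2[OF H10_H1]

lemma has_weak_partial_add:
  assumes "u \<in> L2 \<Omega>" "v \<in> L2 \<Omega>" "has_weak_partial \<Omega> i u g" "has_weak_partial \<Omega> i v h" "i \<in> Basis"
  shows "has_weak_partial \<Omega> i (\<lambda>x. u x + v x) (\<lambda>x. g x + h x)"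
  unfolding has_weak_partial_def
proof (intro conjI allI impI)
  have gh: "g \<in> L2 \<Omega>" "h \<in> L2 \<Omega>" using assms by (simp_all add: has_weak_partial_def)
  then show "(\<lambda>x. g x + h x) \<in> L2 \<Omega>" by (rule L2_add)
  fix f assume f: "test_fun \<Omega> f"
  note fL = test_L2[OF f] and dfL = test_partial_L2[OF f assms(5)]
  have "(\<integral>x. (u x + v x) * partial i f x \<partial>lebesgue_on \<Omega>)
      = (\<integral>x. u x * partial i f x \<partial>lebesgue_on \<Omega>) + (\<integral>x. v x * partial i f x \<partial>lebesgue_on \<Omega>)"
    using L2_integrable_mult[OF assms(1) dfL] L2_integrable_mult[OF assms(2) dfL]
    by (simp add: distrib_right)
  also have "\<dots> = - (\<integral>x. g x * f x \<partial>lebesgue_on \<Omega>) - (\<integral>x. h x * f x \<partial>lebesgue_on \<Omega>)"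
    using assms(3,4) f by (simp add: has_weak_partial_def)
  also have "\<dots> = - (\<integral>x. (g x + h x) * f x \<partial>lebesgue_on \<Omega>)"
    using L2_integrable_mult[OF gh(1) fL] L2_integrable_mult[OF gh(2) fL]
    by (simp add: distrib_right)
  finally show "(\<integral>x. (u x + v x) * partial i f x \<partial>lebesgue_on \<Omega>)
      = - (\<integral>x. (g x + h x) * f x \<partial>lebesgue_on \<Omega>)" .
qed

lemma has_weak_partial_cmult:
  assumes "has_weak_partial \<Omega> i u g"
  shows "has_weak_partial \<Omega> i (\<lambda>x. c * u x) (\<lambda>x. c * g x)"
  using assms by (simp add: has_weak_partial_def L2_cmult mult.assoc)

lemma has_weak_partial_test:
  assumes "test_fun \<Omega> f" "i \<in> Basis"
  shows "has_weak_partial \<Omega> i f (partial i f)"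
  using integral_by_parts_test[OF open_dom bounded_dom test_fun_Ck[OF assms(1)] _ assms(2)]
    test_partial_L2[OF assms]
  by (simp add: has_weak_partial_def)

text \<open>For a fixed test function both sides of the defining identity are continuous in the L2
  norm.\<close>

lemma has_weak_partial_limit:
  assumes "u \<in> L2 \<Omega>" "g \<in> L2 \<Omega>" "i \<in> Basis" "\<And>n::nat. v n \<in> L2 \<Omega>" "\<And>n. has_weak_partial \<Omega> i (v n) (h n)"
    "(\<lambda>n. nrm \<Omega> (\<lambda>x. u x - v n x)) \<longlonglongrightarrow> 0" "(\<lambda>n. nrm \<Omega> (\<lambda>x. g x - h n x)) \<longlonglongrightarrow> 0"
  shows "has_weak_partial \<Omega> i u g"
  unfolding has_weak_partial_def
proof (intro conjI allI impI assms(2))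
  fix f assume f: "test_fun \<Omega> f"
  have hL: "h n \<in> L2 \<Omega>" for n using assms(5) by (rule has_weak_partial_L2)
  have "(\<lambda>n. \<integral>x. v n x * partial i f x \<partial>lebesgue_on \<Omega>) \<longlonglongrightarrow> (\<integral>x. u x * partial i f x \<partial>lebesgue_on \<Omega>)"
    by (rule integral_mult_tendsto[OF assms(4,1) test_partial_L2[OF f assms(3)] assms(6)])
  moreover have "(\<lambda>n. \<integral>x. v n x * partial i f x \<partial>lebesgue_on \<Omega>)
      = (\<lambda>n. - (\<integral>x. h n x * f x \<partial>lebesgue_on \<Omega>))"
    using assms(5) f by (auto simp: has_weak_partial_def)
  moreover have "(\<lambda>n. - (\<integral>x. h n x * f x \<partial>lebesgue_on \<Omega>)) \<longlonglongrightarrow> - (\<integral>x. g x * f x \<partial>lebesgue_on \<Omega>)"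
    by (intro tendsto_minus integral_mult_tendsto[OF hL assms(2) test_L2[OF f] assms(7)])
  ultimately show "(\<integral>x. u x * partial i f x \<partial>lebesgue_on \<Omega>) = - (\<integral>x. g x * f x \<partial>lebesgue_on \<Omega>)"
    using LIMSEQ_unique by simp
qed

lemma H1_norm_sq:
  assumes "u \<in> H1 \<Omega>"
  shows "(H1_norm \<Omega> u)\<^sup>2 = (nrm \<Omega> u)\<^sup>2 + (\<Sum>i\<in>Basis. (nrm \<Omega> (weak_partial \<Omega> i u))\<^sup>2)"
proof -
  have D: "integrable (lebesgue_on \<Omega>) (\<lambda>x. (cmod (weak_partial \<Omega> i u x))\<^sup>2)" if "i \<in> Basis" for i
    by (rule L2_integrable[OF weak_partial_L2[OF assms that]])
  have "(\<integral>x. (cmod (u x))\<^sup>2 + (grad_norm \<Omega> u x)\<^sup>2 \<partial>lebesgue_on \<Omega>)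
      = (nrm \<Omega> u)\<^sup>2 + (\<Sum>i\<in>Basis. (nrm \<Omega> (weak_partial \<Omega> i u))\<^sup>2)"
    unfolding grad_norm_sq nrm_sq_integral
    by (subst Bochner_Integration.integral_add)
       (auto simp: Bochner_Integration.integral_sum D intro!: L2_integrable[OF H1_L2[OF assms]] Bochner_Integration.integrable_sum D)
  moreover have "0 \<le> (\<integral>x. (cmod (u x))\<^sup>2 + (grad_norm \<Omega> u x)\<^sup>2 \<partial>lebesgue_on \<Omega>)"
    by (intro integral_nonneg_AE AE_I2) simp
  ultimately show ?thesis by (simp add: H1_norm_def)
qed

lemma H1_diff_test:
  assumes "u \<in> H1 \<Omega>" "test_fun \<Omega> f"
  shows "(\<lambda>x. u x - f x) \<in> H1 \<Omega>"
    and "i \<in> Basis \<Longrightarrow>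
      nrm \<Omega> (weak_partial \<Omega> i (\<lambda>x. u x - f x)) = nrm \<Omega> (\<lambda>x. weak_partial \<Omega> i u x - partial i f x)"
proof -
  have w: "has_weak_partial \<Omega> i (\<lambda>x. u x - f x) (\<lambda>x. weak_partial \<Omega> i u x - partial i f x)" if "i \<in> Basis" for i
    using has_weak_partial_add[OF H1_L2[OF assms(1)] L2_cmult[OF test_L2[OF assms(2)], of "-1"]
        H1_weak_partial[OF assms(1) that]
        has_weak_partial_cmult[OF has_weak_partial_test[OF assms(2) that], of "-1"] that]
    by simp
  show "(\<lambda>x. u x - f x) \<in> H1 \<Omega>"
    using w L2_diff[OF H1_L2[OF assms(1)] test_L2[OF assms(2)]] unfolding H1_def by blast
  show "nrm \<Omega> (weak_partial \<Omega> i (\<lambda>x. u x - f x)) = nrm \<Omega> (\<lambda>x. weak_partial \<Omega> i u x - partial i f x)"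
    if "i \<in> Basis"
    by (rule nrm_cong_AE[OF has_weak_partial_L2[OF has_weak_partial_weak_partial[OF w[OF that]]]
          has_weak_partial_L2[OF w[OF that]] weak_partial_AE[OF w[OF that]]])
qed

text \<open>The working form of membership in \<open>H10\<close>: convergence of each component in
  \<open>nrm\<close>, instead of the \<open>H1_norm\<close> of a difference, whose gradient involves
  a choice. \<open>H10I\<close> is the converse.\<close>

lemma H10_approx:
  assumes "u \<in> H10 \<Omega>"
  shows "\<exists>f. (\<forall>n::nat. test_fun \<Omega> (f n)) \<and> (\<lambda>n. nrm \<Omega> (\<lambda>x. u x - f n x)) \<longlonglongrightarrow> 0 \<and>
    (\<forall>i\<in>Basis. (\<lambda>n. nrm \<Omega> (\<lambda>x. weak_partial \<Omega> i u x - partial i (f n) x)) \<longlonglongrightarrow> 0)"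
proof -
  obtain f where f: "\<And>n::nat. test_fun \<Omega> (f n)" "(\<lambda>n. H1_norm \<Omega> (\<lambda>x. u x - f n x)) \<longlonglongrightarrow> 0"
    using assms by (auto simp: H10_def)
  have u: "u \<in> H1 \<Omega>" using assms by (rule H10_H1)
  note eq = H1_norm_sq[OF H1_diff_test(1)[OF u f(1)]]
  have nonneg: "0 \<le> H1_norm \<Omega> w" for w
    by (simp add: H1_norm_def integral_nonneg_AE)
  have "nrm \<Omega> (\<lambda>x. u x - f n x) \<le> H1_norm \<Omega> (\<lambda>x. u x - f n x)" for n
    by (rule power2_le_imp_le[OF _ nonneg]) (simp add: eq sum_nonneg)
  then have "(\<lambda>n. nrm \<Omega> (\<lambda>x. u x - f n x)) \<longlonglongrightarrow> 0"
    by (intro Lim_null_comparison[OF _ f(2)] always_eventually) (simp add: nrm_nonneg)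
  moreover have "(\<lambda>n. nrm \<Omega> (\<lambda>x. weak_partial \<Omega> i u x - partial i (f n) x)) \<longlonglongrightarrow> 0" if i: "i \<in> Basis" for i
  proof (rule Lim_null_comparison[OF always_eventually f(2)], rule allI)
    fix n
    have "(nrm \<Omega> (weak_partial \<Omega> i (\<lambda>x. u x - f n x)))\<^sup>2
        \<le> (\<Sum>i\<in>Basis. (nrm \<Omega> (weak_partial \<Omega> i (\<lambda>x. u x - f n x)))\<^sup>2)"
      by (rule member_le_sum[OF i]) auto
    also have "\<dots> \<le> (H1_norm \<Omega> (\<lambda>x. u x - f n x))\<^sup>2" by (simp add: eq)
    finally have "nrm \<Omega> (weak_partial \<Omega> i (\<lambda>x. u x - f n x)) \<le> H1_norm \<Omega> (\<lambda>x. u x - f n x)"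
      by (rule power2_le_imp_le[OF _ nonneg])
    then show "norm (nrm \<Omega> (\<lambda>x. weak_partial \<Omega> i u x - partial i (f n) x)) \<le> H1_norm \<Omega> (\<lambda>x. u x - f n x)"
      by (simp add: H1_diff_test(2)[OF u f(1) i] nrm_nonneg)
  qed
  ultimately show ?thesis using f(1) by blast
qed

text \<open>The limits \<open>g i\<close> of the gradients enter as mere \<open>L2\<close>
  functions; closedness of the weak derivative identifies them.\<close>

lemma H10I:
  assumes "u \<in> L2 \<Omega>" "\<And>i. i \<in> Basis \<Longrightarrow> g i \<in> L2 \<Omega>" "\<And>n::nat. test_fun \<Omega> (f n)"
    "(\<lambda>n. nrm \<Omega> (\<lambda>x. u x - f n x)) \<longlonglongrightarrow> 0"
    "\<And>i. i \<in> Basis \<Longrightarrow> (\<lambda>n. nrm \<Omega> (\<lambda>x. g i x - partial i (f n) x)) \<longlonglongrightarrow> 0"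
  shows "u \<in> H10 \<Omega>" "\<And>i. i \<in> Basis \<Longrightarrow> has_weak_partial \<Omega> i u (g i)"
proof -
  show w: "has_weak_partial \<Omega> i u (g i)" if "i \<in> Basis" for i
    by (rule has_weak_partial_limit[OF assms(1,2) _ test_L2[OF assms(3)] has_weak_partial_test[OF assms(3)] assms(4,5)])
       (rule that)+
  then have u: "u \<in> H1 \<Omega>" using assms(1) by (auto simp: H1_def)
  have "nrm \<Omega> (\<lambda>x. weak_partial \<Omega> i u x - partial i (f n) x) = nrm \<Omega> (\<lambda>x. g i x - partial i (f n) x)"
    if i: "i \<in> Basis" for i n
  proof (rule nrm_cong_AE)
    show "AE x in lebesgue_on \<Omega>. weak_partial \<Omega> i u x - partial i (f n) x = g i x - partial i (f n) x"
      using weak_partial_AE[OF w[OF i]] by eventually_elim simp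
  qed (intro L2_diff weak_partial_L2[OF u i] assms(2)[OF i] test_partial_L2[OF assms(3) i])+
  then have "(\<lambda>n. (H1_norm \<Omega> (\<lambda>x. u x - f n x))\<^sup>2)
      = (\<lambda>n. (nrm \<Omega> (\<lambda>x. u x - f n x))\<^sup>2 + (\<Sum>i\<in>Basis. (nrm \<Omega> (\<lambda>x. g i x - partial i (f n) x))\<^sup>2))"
    using H1_norm_sq[OF H1_diff_test(1)[OF u assms(3)]] H1_diff_test(2)[OF u assms(3)] by simp
  moreover have "\<dots> \<longlonglongrightarrow> 0\<^sup>2 + (\<Sum>i\<in>(Basis::'a set). 0\<^sup>2)"
    by (intro tendsto_add tendsto_power tendsto_sum assms(4,5))
  ultimately have "(\<lambda>n. (H1_norm \<Omega> (\<lambda>x. u x - f n x))\<^sup>2) \<longlonglongrightarrow> 0" by simp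
  then have "(\<lambda>n. sqrt ((H1_norm \<Omega> (\<lambda>x. u x - f n x))\<^sup>2)) \<longlonglongrightarrow> sqrt 0" by (rule tendsto_real_sqrt)
  moreover have "0 \<le> H1_norm \<Omega> w" for w
    by (simp add: H1_norm_def integral_nonneg_AE)
  ultimately show "u \<in> H10 \<Omega>" using u assms(3) by (auto simp: H10_def)
qed

lemma H10_add:
  assumes "u \<in> H10 \<Omega>" "v \<in> H10 \<Omega>"
  shows "(\<lambda>x. u x + v x) \<in> H10 \<Omega>"
proof -
  obtain f where f: "\<forall>n::nat. test_fun \<Omega> (f n)" "(\<lambda>n. nrm \<Omega> (\<lambda>x. u x - f n x)) \<longlonglongrightarrow> 0"
    "\<forall>i\<in>Basis. (\<lambda>n. nrm \<Omega> (\<lambda>x. weak_partial \<Omega> i u x - partial i (f n) x)) \<longlonglongrightarrow> 0"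
    using H10_approx[OF assms(1)] by blast
  obtain g where g: "\<forall>n::nat. test_fun \<Omega> (g n)" "(\<lambda>n. nrm \<Omega> (\<lambda>x. v x - g n x)) \<longlonglongrightarrow> 0"
    "\<forall>i\<in>Basis. (\<lambda>n. nrm \<Omega> (\<lambda>x. weak_partial \<Omega> i v x - partial i (g n) x)) \<longlonglongrightarrow> 0"
    using H10_approx[OF assms(2)] by blast
  have *: "(\<lambda>n. nrm \<Omega> (\<lambda>x. (a x + b x) - (A n x + B n x))) \<longlonglongrightarrow> 0"
    if "a \<in> L2 \<Omega>" "b \<in> L2 \<Omega>" "\<And>n. A n \<in> L2 \<Omega>" "\<And>n. B n \<in> L2 \<Omega>"
      "(\<lambda>n. nrm \<Omega> (\<lambda>x. a x - A n x)) \<longlonglongrightarrow> 0" "(\<lambda>n. nrm \<Omega> (\<lambda>x. b x - B n x)) \<longlonglongrightarrow> 0"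
    for a b and A B :: "nat \<Rightarrow> _"
  proof (rule Lim_null_comparison[OF always_eventually tendsto_add_zero[OF that(5,6)]], rule allI)
    fix n
    show "norm (nrm \<Omega> (\<lambda>x. (a x + b x) - (A n x + B n x)))
        \<le> nrm \<Omega> (\<lambda>x. a x - A n x) + nrm \<Omega> (\<lambda>x. b x - B n x)"
      using nrm_triangle[OF L2_diff[OF that(1,3)] L2_diff[OF that(2,4)], of n n]
      by (simp add: nrm_nonneg algebra_simps)
  qed
  show ?thesis
  proof (rule H10I(1)[where f="\<lambda>n x. f n x + g n x" and g="\<lambda>i x. weak_partial \<Omega> i u x + weak_partial \<Omega> i v x"])
    show "(\<lambda>x. u x + v x) \<in> L2 \<Omega>" by (intro L2_add H10_L2 assms)
    show "(\<lambda>x. weak_partial \<Omega> i u x + weak_partial \<Omega> i v x) \<in> L2 \<Omega>" if "i \<in> Basis" for i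
      by (intro L2_add H10_weak_partial_L2 assms that)
    show "test_fun \<Omega> (\<lambda>x. f n x + g n x)" for n using f(1) g(1) by (intro test_fun_add) auto
    show "(\<lambda>n. nrm \<Omega> (\<lambda>x. (u x + v x) - (f n x + g n x))) \<longlonglongrightarrow> 0"
      using f(1) g(1) by (intro * H10_L2 assms test_L2 f(2) g(2)) auto
    show "(\<lambda>n. nrm \<Omega> (\<lambda>x. (weak_partial \<Omega> i u x + weak_partial \<Omega> i v x) - partial i (\<lambda>x. f n x + g n x) x)) \<longlonglongrightarrow> 0"
      if i: "i \<in> Basis" for i
    proof -
      have "partial i (\<lambda>x. f n x + g n x) = (\<lambda>x. partial i (f n) x + partial i (g n) x)" for n
        using f(1) g(1) by (intro partial_add[of 0] test_fun_Ck) auto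
      then show ?thesis
        using f(1,3) g(1,3) i by (simp only:) (intro * H10_weak_partial_L2 assms i test_partial_L2; simp)
    qed
  qed
qed

lemma H10_cmult:
  assumes "u \<in> H10 \<Omega>"
  shows "(\<lambda>x. c * u x) \<in> H10 \<Omega>"
proof -
  obtain f where f: "\<forall>n::nat. test_fun \<Omega> (f n)" "(\<lambda>n. nrm \<Omega> (\<lambda>x. u x - f n x)) \<longlonglongrightarrow> 0"
    "\<forall>i\<in>Basis. (\<lambda>n. nrm \<Omega> (\<lambda>x. weak_partial \<Omega> i u x - partial i (f n) x)) \<longlonglongrightarrow> 0"
    using H10_approx[OF assms] by blast
  have *: "(\<lambda>n. nrm \<Omega> (\<lambda>x. c * a x - c * A n x)) \<longlonglongrightarrow> 0"
    if "(\<lambda>n. nrm \<Omega> (\<lambda>x. a x - A n x)) \<longlonglongrightarrow> 0" for a and A :: "nat \<Rightarrow> _"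
    using tendsto_mult_right_zero[OF that, of "cmod c"] nrm_cmult[of \<Omega> c]
    by (simp flip: right_diff_distrib)
  show ?thesis
  proof (rule H10I(1)[where f="\<lambda>n x. c * f n x" and g="\<lambda>i x. c * weak_partial \<Omega> i u x"])
    show "(\<lambda>x. c * u x) \<in> L2 \<Omega>" by (intro L2_cmult H10_L2 assms)
    show "(\<lambda>x. c * weak_partial \<Omega> i u x) \<in> L2 \<Omega>" if "i \<in> Basis" for i
      by (intro L2_cmult H10_weak_partial_L2 assms that)
    show "test_fun \<Omega> (\<lambda>x. c * f n x)" for n using f(1) by (intro test_fun_cmult) auto
    show "(\<lambda>n. nrm \<Omega> (\<lambda>x. c * u x - c * f n x)) \<longlonglongrightarrow> 0" by (intro * f(2))
    show "(\<lambda>n. nrm \<Omega> (\<lambda>x. c * weak_partial \<Omega> i u x - partial i (\<lambda>x. c * f n x) x)) \<longlonglongrightarrow> 0"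
      if i: "i \<in> Basis" for i
    proof -
      have "partial i (\<lambda>x. c * f n x) = (\<lambda>x. c * partial i (f n) x)" for n
        using f(1) partial_mult[OF Ck_const[of "Suc 0"] test_fun_Ck, of \<Omega> "f n" i c] by (simp add: partial_const)
      then show ?thesis using f(3) i by (simp only:) (intro *, simp)
    qed
  qed
qed

lemma weak_partial_add:
  assumes "u \<in> H1 \<Omega>" "v \<in> H1 \<Omega>" "i \<in> Basis"
  shows "AE x in lebesgue_on \<Omega>. weak_partial \<Omega> i (\<lambda>x. u x + v x) x = weak_partial \<Omega> i u x + weak_partial \<Omega> i v x"
  by (rule weak_partial_AE[OF has_weak_partial_add[OF H1_L2[OF assms(1)] H1_L2[OF assms(2)]
        H1_weak_partial[OF assms(1,3)] H1_weak_partial[OF assms(2,3)] assms(3)]])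

lemma weak_partial_cmult:
  assumes "u \<in> H1 \<Omega>" "i \<in> Basis"
  shows "AE x in lebesgue_on \<Omega>. weak_partial \<Omega> i (\<lambda>x. c * u x) x = c * weak_partial \<Omega> i u x"
  by (rule weak_partial_AE[OF has_weak_partial_cmult[OF H1_weak_partial[OF assms]]])

text \<open>States are functions and not classes, and \<open>weak_partial\<close> chooses separately
  for each function, so passing to another representative has to be justified.\<close>

lemma weak_partial_cong_AE:
  assumes "u \<in> H1 \<Omega>" "v \<in> H1 \<Omega>" "i \<in> Basis" "AE x in lebesgue_on \<Omega>. u x = v x"
  shows "AE x in lebesgue_on \<Omega>. weak_partial \<Omega> i u x = weak_partial \<Omega> i v x"
proof -
  have "has_weak_partial \<Omega> i u (weak_partial \<Omega> i v)"
    unfolding has_weak_partial_def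
  proof (intro conjI allI impI weak_partial_L2[OF assms(2,3)])
    fix f assume f: "test_fun \<Omega> f"
    have "(\<integral>x. u x * partial i f x \<partial>lebesgue_on \<Omega>) = (\<integral>x. v x * partial i f x \<partial>lebesgue_on \<Omega>)"
    proof (rule integral_cong_AE)
      show "AE x in lebesgue_on \<Omega>. u x * partial i f x = v x * partial i f x"
        using assms(4) by eventually_elim simp
    qed (intro borel_measurable_times L2_measurable H1_L2 assms test_partial_L2 f)+
    then show "(\<integral>x. u x * partial i f x \<partial>lebesgue_on \<Omega>)
        = - (\<integral>x. weak_partial \<Omega> i v x * f x \<partial>lebesgue_on \<Omega>)"
      using H1_weak_partial[OF assms(2,3)] f by (simp add: has_weak_partial_def)
  qed
  then show ?thesis by (rule weak_partial_AE)
qed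

section \<open>Domain of the Dirichlet Laplacian and Green's formula\<close>

lemma dom_laplacian_H10: "u \<in> dom_laplacian \<Omega> \<Longrightarrow> u \<in> H10 \<Omega>"
  by (simp add: dom_laplacian_def)

lemma has_weak_laplacian_weak_laplacian:
  "u \<in> dom_laplacian \<Omega> \<Longrightarrow> has_weak_laplacian \<Omega> u (weak_laplacian \<Omega> u)"
  unfolding weak_laplacian_def dom_laplacian_def
  using someI_ex[of "\<lambda>g. has_weak_laplacian \<Omega> u g"] by simp

lemma weak_laplacian_L2: "u \<in> dom_laplacian \<Omega> \<Longrightarrow> weak_laplacian \<Omega> u \<in> L2 \<Omega>"
  using has_weak_laplacian_weak_laplacian by (auto simp: has_weak_laplacian_def)

lemma test_laplacian: "test_fun \<Omega> f \<Longrightarrow> laplacian f \<in> L2 \<Omega>"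
proof -
  assume f: "test_fun \<Omega> f"
  have "(\<lambda>x. \<Sum>i\<in>A. partial i (partial i f) x) \<in> L2 \<Omega>" if "A \<subseteq> Basis" for A
    using finite_subset[OF that finite_Basis] that
  proof (induction A rule: finite_induct)
    case empty
    then show ?case using L2_cmult[OF test_L2[OF f], of 0] by simp
  next
    case (insert i A)
    then show ?case using L2_add[OF test_partial_L2[OF test_fun_partial[OF f], of i i]] by simp
  qed
  then show ?thesis unfolding laplacian_def by blast
qed

lemma dom_laplacian_add:
  assumes "u \<in> dom_laplacian \<Omega>" "v \<in> dom_laplacian \<Omega>"
  shows "(\<lambda>x. u x + v x) \<in> dom_laplacian \<Omega>"
proof -
  obtain g h where gh: "has_weak_laplacian \<Omega> u g" "has_weak_laplacian \<Omega> v h"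
    using assms by (auto simp: dom_laplacian_def)
  have "has_weak_laplacian \<Omega> (\<lambda>x. u x + v x) (\<lambda>x. g x + h x)"
    unfolding has_weak_laplacian_def
  proof (intro conjI allI impI)
    have L: "g \<in> L2 \<Omega>" "h \<in> L2 \<Omega>" using gh by (simp_all add: has_weak_laplacian_def)
    then show "(\<lambda>x. g x + h x) \<in> L2 \<Omega>" by (rule L2_add)
    fix f assume f: "test_fun \<Omega> f"
    show "(\<integral>x. (u x + v x) * laplacian f x \<partial>lebesgue_on \<Omega>) = (\<integral>x. (g x + h x) * f x \<partial>lebesgue_on \<Omega>)"
      using L2_integrable_mult[OF H10_L2[OF dom_laplacian_H10[OF assms(1)]] test_laplacian[OF f]]
        L2_integrable_mult[OF H10_L2[OF dom_laplacian_H10[OF assms(2)]] test_laplacian[OF f]]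
        L2_integrable_mult[OF L(1) test_L2[OF f]] L2_integrable_mult[OF L(2) test_L2[OF f]] gh f
      by (simp add: distrib_right has_weak_laplacian_def)
  qed
  then show ?thesis using H10_add[OF dom_laplacian_H10[OF assms(1)] dom_laplacian_H10[OF assms(2)]]
    by (auto simp: dom_laplacian_def)
qed

lemma dom_laplacian_cmult:
  assumes "u \<in> dom_laplacian \<Omega>"
  shows "(\<lambda>x. c * u x) \<in> dom_laplacian \<Omega>"
proof -
  obtain g where g: "has_weak_laplacian \<Omega> u g" using assms by (auto simp: dom_laplacian_def)
  then have "has_weak_laplacian \<Omega> (\<lambda>x. c * u x) (\<lambda>x. c * g x)"
    by (simp add: has_weak_laplacian_def L2_cmult mult.assoc)
  then show ?thesis using H10_cmult[OF dom_laplacian_H10[OF assms]] by (auto simp: dom_laplacian_def)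
qed

text \<open>The definition of the weak Laplacian puts both derivatives on the conjugate of f, again
  a test function; the weak gradient of u then takes one of them back.\<close>

lemma green_test:
  assumes u: "u \<in> dom_laplacian \<Omega>" and f: "test_fun \<Omega> f"
  shows "ip \<Omega> (weak_laplacian \<Omega> u) f = - (\<Sum>i\<in>Basis. ip \<Omega> (weak_partial \<Omega> i u) (partial i f))"
proof -
  have fc: "test_fun \<Omega> (\<lambda>x. cnj (f x))" by (rule test_fun_cnj[OF f])
  have uH: "u \<in> H1 \<Omega>" using u dom_laplacian_H10 H10_H1 by blast
  have pc: "partial i (\<lambda>x. cnj (f x)) = (\<lambda>x. cnj (partial i f x))" for i
    by (rule partial_cnj[OF test_fun_Ck[OF f]])
  have pp: "test_fun \<Omega> (partial i (\<lambda>x. cnj (f x)))" if "i \<in> Basis" for i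
    by (rule test_fun_partial[OF fc that])
  have "(\<integral>x. weak_laplacian \<Omega> u x * cnj (f x) \<partial>lebesgue_on \<Omega>)
      = (\<integral>x. u x * laplacian (\<lambda>x. cnj (f x)) x \<partial>lebesgue_on \<Omega>)"
    using has_weak_laplacian_weak_laplacian[OF u] fc by (simp add: has_weak_laplacian_def)
  also have "\<dots> = (\<Sum>i\<in>Basis. \<integral>x. u x * partial i (partial i (\<lambda>x. cnj (f x))) x \<partial>lebesgue_on \<Omega>)"
    unfolding laplacian_def sum_distrib_left
    by (intro Bochner_Integration.integral_sum L2_integrable_mult[OF H1_L2[OF uH]] test_partial_L2[OF pp]; assumption)
  also have "\<dots> = (\<Sum>i\<in>Basis. - (\<integral>x. weak_partial \<Omega> i u x * cnj (partial i f x) \<partial>lebesgue_on \<Omega>))"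
    using H1_weak_partial[OF uH] pp by (intro sum.cong refl) (simp add: has_weak_partial_def pc)
  finally have "Re (\<integral>x. weak_laplacian \<Omega> u x * cnj (f x) \<partial>lebesgue_on \<Omega>)
      = - (\<Sum>i\<in>Basis. Re (\<integral>x. weak_partial \<Omega> i u x * cnj (partial i f x) \<partial>lebesgue_on \<Omega>))"
    by (simp add: sum_negf Re_sum)
  then show ?thesis
    by (simp add: ip_eq_Re weak_laplacian_L2[OF u] test_L2[OF f] weak_partial_L2[OF uH] test_partial_L2[OF f] cong: sum.cong)
qed

lemma nrm_const_tendsto: "((\<lambda>n. nrm \<Omega> (\<lambda>x. u x - u x)) \<longlongrightarrow> 0) F"
  by (simp add: nrm_def ip_def)

lemma ip_right_tendsto:
  assumes "v \<in> L2 \<Omega>" "u0 \<in> L2 \<Omega>" "\<And>n::nat. u n \<in> L2 \<Omega>"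
    "(\<lambda>n. nrm \<Omega> (\<lambda>x. u0 x - u n x)) \<longlonglongrightarrow> 0"
  shows "(\<lambda>n. ip \<Omega> v (u n)) \<longlonglongrightarrow> ip \<Omega> v u0"
  using assms by (intro ip_tendsto nrm_const_tendsto) (auto simp: nrm_minus_commute[of _ _ u0])

lemma green:
  assumes u: "u \<in> dom_laplacian \<Omega>" and w: "w \<in> H10 \<Omega>"
  shows "ip \<Omega> (weak_laplacian \<Omega> u) w = - (\<Sum>i\<in>Basis. ip \<Omega> (weak_partial \<Omega> i u) (weak_partial \<Omega> i w))"
proof -
  obtain f where f: "\<forall>n::nat. test_fun \<Omega> (f n)" "(\<lambda>n. nrm \<Omega> (\<lambda>x. w x - f n x)) \<longlonglongrightarrow> 0"
    "\<forall>i\<in>Basis. (\<lambda>n. nrm \<Omega> (\<lambda>x. weak_partial \<Omega> i w x - partial i (f n) x)) \<longlonglongrightarrow> 0"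
    using H10_approx[OF w] by blast
  have uH: "u \<in> H1 \<Omega>" using u dom_laplacian_H10 H10_H1 by blast
  have "(\<lambda>n. ip \<Omega> (weak_laplacian \<Omega> u) (f n)) \<longlonglongrightarrow> ip \<Omega> (weak_laplacian \<Omega> u) w"
    using f by (intro ip_right_tendsto weak_laplacian_L2 u H10_L2 w test_L2) auto
  moreover have "(\<lambda>n. - (\<Sum>i\<in>Basis. ip \<Omega> (weak_partial \<Omega> i u) (partial i (f n))))
      \<longlonglongrightarrow> - (\<Sum>i\<in>Basis. ip \<Omega> (weak_partial \<Omega> i u) (weak_partial \<Omega> i w))"
    using f by (intro tendsto_minus tendsto_sum ip_right_tendsto weak_partial_L2 uH H10_weak_partial_L2 w test_partial_L2) auto
  ultimately show ?thesis using green_test[OF u] f(1) LIMSEQ_unique by simp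
qed

end

section \<open>Multiplication by functions of the axial variable\<close>

definition mul :: "(real \<Rightarrow> real) \<Rightarrow> (real \<times> 'b \<Rightarrow> complex) \<Rightarrow> real \<times> 'b \<Rightarrow> complex" where
  "mul p u X = complex_of_real (p (fst X)) * u X"

locale cylinder =
  fixes \<omega> :: "'b::euclidean_space set" and \<Omega> :: "(real \<times> 'b) set"
  assumes open_base: "open \<omega>" and bounded_base: "bounded \<omega>"
    and cylinder_eq: "\<Omega> = {0<..<1} \<times> \<omega>"

sublocale cylinder \<subseteq> bounded_open \<Omega>
  by unfold_locales
    (auto simp: cylinder_eq intro!: open_Times bounded_Times open_base bounded_base)

context cylinder
begin

abbreviation e :: "real \<times> 'b" where "e \<equiv> (1, 0)"

lemma e_Basis: "e \<in> Basis"
  by (simp add: Basis_prod_def)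

text \<open>The gradient of a weight in the axial variable points along the axis, so of a sum over
  all directions only the term along \<open>e\<close> survives.\<close>

lemma sum_fst_Basis: "(\<Sum>i\<in>Basis. fst i * G i) = G e"
proof -
  have "(\<Sum>i\<in>Basis. fst i * G i) = (\<Sum>i\<in>{e}. fst i * G i)"
  proof (rule sum.mono_neutral_right)
    show "\<forall>i\<in>Basis - {e}. fst i * G i = 0"
      by (auto elim!: Basis_prod_cases)
  qed (use e_Basis in auto)
  then show ?thesis by simp
qed

lemma fst_dom: "X \<in> \<Omega> \<Longrightarrow> 0 < fst X \<and> fst X < 1"
  by (auto simp: cylinder_eq)

lemma smooth1_bounded:
  assumes "smooth1 p"
  shows "\<exists>K\<ge>0. \<forall>x\<in>{0..1}. \<bar>p x\<bar> \<le> K"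
proof -
  obtain p' where "\<And>x. (p has_real_derivative p' x) (at x)"
    using smooth1_derivative[OF assms] by metis
  then have "continuous_on {0..1} p"
    using DERIV_isCont continuous_at_imp_continuous_on by blast
  then have "bounded (p ` {0..1})"
    by (intro compact_imp_bounded compact_continuous_image) auto
  then obtain K where K: "\<forall>x\<in>{0..1}. \<bar>p x\<bar> \<le> K" by (auto simp: bounded_iff)
  then have "\<bar>p 0\<bar> \<le> K" by simp
  then have "K \<ge> 0" by simp
  then show ?thesis using K by blast
qed

lemma smooth1_measurable:
  "smooth1 p \<Longrightarrow> (\<lambda>X. complex_of_real (p (fst X))) \<in> borel_measurable (lebesgue_on \<Omega>)"
  using Ck_fst[of p 0] continuous_on_subset
  by (intro continuous_measurable_lebesgue_on[OF open_dom]) auto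

lemma smooth1_AE_bounded:
  assumes "smooth1 p"
  shows "\<exists>K\<ge>0. AE X in lebesgue_on \<Omega>. cmod (complex_of_real (p (fst X))) \<le> K"
proof -
  obtain K where K: "K \<ge> 0" "\<forall>x\<in>{0..1}. \<bar>p x\<bar> \<le> K" using smooth1_bounded[OF assms] by blast
  have "AE X in lebesgue_on \<Omega>. cmod (complex_of_real (p (fst X))) \<le> K"
    using K(2) fst_dom by (intro AE_I2) (auto simp: less_imp_le)
  then show ?thesis using K(1) by blast
qed

lemma mul_L2: "smooth1 p \<Longrightarrow> u \<in> L2 \<Omega> \<Longrightarrow> mul p u \<in> L2 \<Omega>"
  unfolding mul_def[abs_def]
  using smooth1_AE_bounded[of p] L2_mult_bounded[OF _ smooth1_measurable] by blast

lemma mul_tendsto: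
  assumes "smooth1 p" "u \<in> L2 \<Omega>" "\<And>n::nat. v n \<in> L2 \<Omega>" "(\<lambda>n. nrm \<Omega> (\<lambda>x. u x - v n x)) \<longlonglongrightarrow> 0"
  shows "(\<lambda>n. nrm \<Omega> (\<lambda>x. mul p u x - mul p (v n) x)) \<longlonglongrightarrow> 0"
proof -
  obtain K where K: "K \<ge> 0" "AE X in lebesgue_on \<Omega>. cmod (complex_of_real (p (fst X))) \<le> K"
    using smooth1_AE_bounded[OF assms(1)] by blast
  show ?thesis
  proof (rule Lim_null_comparison[OF always_eventually], rule allI)
    show "(\<lambda>n. K * nrm \<Omega> (\<lambda>x. u x - v n x)) \<longlonglongrightarrow> 0"
      using tendsto_mult_right_zero[OF assms(4)] .
    show "norm (nrm \<Omega> (\<lambda>x. mul p u x - mul p (v n) x)) \<le> K * nrm \<Omega> (\<lambda>x. u x - v n x)" for n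
      using nrm_mult_bounded[OF L2_diff[OF assms(2,3)] smooth1_measurable[OF assms(1)] K(2,1)]
      by (simp add: mul_def nrm_nonneg right_diff_distrib)
  qed
qed

lemma mul_swap: "ip \<Omega> (mul p u) v = ip \<Omega> u (mul p v)"
  unfolding mul_def by (rule ip_mult_swap)

lemma test_mul: "smooth1 p \<Longrightarrow> test_fun \<Omega> f \<Longrightarrow> test_fun \<Omega> (mul p f)"
  unfolding mul_def[abs_def] by (intro test_fun_mult Ck_fst)

lemma partial_mul:
  assumes "smooth1 p" "\<And>x. (p has_real_derivative p' x) (at x)" "test_fun \<Omega> f"
  shows "partial i (mul p f) = (\<lambda>X. mul p (partial i f) X + complex_of_real (fst i) * mul p' f X)"
  unfolding mul_def[abs_def]
  by (subst partial_mult[OF Ck_fst[OF assms(1)] test_fun_Ck[OF assms(3)], of i])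
     (simp add: partial_fst[OF assms(2)] mult_ac)

lemma ip_tendsto_seq:
  assumes "u0 \<in> L2 \<Omega>" "v0 \<in> L2 \<Omega>" "\<And>n::nat. u n \<in> L2 \<Omega>" "\<And>n::nat. v n \<in> L2 \<Omega>"
    "(\<lambda>n. nrm \<Omega> (\<lambda>x. u0 x - u n x)) \<longlonglongrightarrow> 0" "(\<lambda>n. nrm \<Omega> (\<lambda>x. v0 x - v n x)) \<longlonglongrightarrow> 0"
  shows "(\<lambda>n. ip \<Omega> (u n) (v n)) \<longlonglongrightarrow> ip \<Omega> u0 v0"
  using assms by (intro ip_tendsto) (auto simp: nrm_minus_commute[of _ _ u0] nrm_minus_commute[of _ _ v0])

text \<open>Green's formula against p u. The product rule is applied to test functions, where it is
  classical, and the limit is taken afterwards, so that p u itself is never differentiated.\<close>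

lemma green_mult:
  assumes u: "u \<in> dom_laplacian \<Omega>" and p: "smooth1 p" "smooth1 p'" "\<And>x. (p has_real_derivative p' x) (at x)"
  shows "ip \<Omega> (weak_laplacian \<Omega> u) (mul p u)
    = - (\<Sum>i\<in>Basis. ip \<Omega> (weak_partial \<Omega> i u) (mul p (weak_partial \<Omega> i u))) - ip \<Omega> (weak_partial \<Omega> e u) (mul p' u)"
proof -
  have uH: "u \<in> H10 \<Omega>" by (rule dom_laplacian_H10[OF u])
  note D = H10_weak_partial_L2[OF uH]
  obtain f where f: "\<forall>n::nat. test_fun \<Omega> (f n)" "(\<lambda>n. nrm \<Omega> (\<lambda>x. u x - f n x)) \<longlonglongrightarrow> 0"
    "\<forall>i\<in>Basis. (\<lambda>n. nrm \<Omega> (\<lambda>x. weak_partial \<Omega> i u x - partial i (f n) x)) \<longlonglongrightarrow> 0"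
    using H10_approx[OF uH] by blast
  have fL: "f n \<in> L2 \<Omega>" "i \<in> Basis \<Longrightarrow> partial i (f n) \<in> L2 \<Omega>" for n i
    using f(1) test_L2 test_partial_L2 by auto
  have "ip \<Omega> (weak_laplacian \<Omega> u) (mul p (f n))
      = - (\<Sum>i\<in>Basis. ip \<Omega> (weak_partial \<Omega> i u) (mul p (partial i (f n))) + fst i * ip \<Omega> (weak_partial \<Omega> i u) (mul p' (f n)))" for n
  proof -
    have "ip \<Omega> (weak_partial \<Omega> i u) (partial i (mul p (f n)))
        = ip \<Omega> (weak_partial \<Omega> i u) (mul p (partial i (f n))) + fst i * ip \<Omega> (weak_partial \<Omega> i u) (mul p' (f n))"
      if i: "i \<in> Basis" for i
      using f(1) by (subst partial_mul[OF p(1,3)])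
        (simp_all add: ip_add_right mul_L2 p fL i D L2_cmult ip_scale_right)
    then show ?thesis
      using f(1) by (simp add: green_test[OF u test_mul[OF p(1)]])
  qed
  then have eq: "ip \<Omega> (weak_laplacian \<Omega> u) (mul p (f n))
      = - (\<Sum>i\<in>Basis. ip \<Omega> (weak_partial \<Omega> i u) (mul p (partial i (f n)))) - ip \<Omega> (weak_partial \<Omega> e u) (mul p' (f n))" for n
    by (simp add: sum.distrib sum_fst_Basis)
  have "(\<lambda>n. ip \<Omega> (weak_laplacian \<Omega> u) (mul p (f n))) \<longlonglongrightarrow> ip \<Omega> (weak_laplacian \<Omega> u) (mul p u)"
    by (intro ip_right_tendsto mul_tendsto mul_L2 weak_laplacian_L2 u p H10_L2 uH fL f)
  moreover have "(\<lambda>n. - (\<Sum>i\<in>Basis. ip \<Omega> (weak_partial \<Omega> i u) (mul p (partial i (f n)))) - ip \<Omega> (weak_partial \<Omega> e u) (mul p' (f n)))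
      \<longlonglongrightarrow> - (\<Sum>i\<in>Basis. ip \<Omega> (weak_partial \<Omega> i u) (mul p (weak_partial \<Omega> i u))) - ip \<Omega> (weak_partial \<Omega> e u) (mul p' u)"
    by (intro tendsto_minus tendsto_diff tendsto_sum ip_right_tendsto mul_tendsto mul_L2 p H10_L2 uH fL f D e_Basis f(3)[rule_format]; assumption)
  ultimately show ?thesis unfolding eq using LIMSEQ_unique by blast
qed

text \<open>The axial derivative of q times the squared modulus of f integrates to zero. Whatever
  the end values of q, there is no boundary contribution, because f has compact support.\<close>

lemma ip_mult_partial_test:
  assumes f: "test_fun \<Omega> f" and q: "smooth1 q" "smooth1 q'" "\<And>x. (q has_real_derivative q' x) (at x)"
  shows "2 * ip \<Omega> f (mul q (partial e f)) = - ip \<Omega> f (mul q' f)"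
proof -
  let ?c = "\<lambda>X. cnj (f X)"
  have fc: "test_fun \<Omega> ?c" by (rule test_fun_cnj[OF f])
  have pc: "partial e ?c = (\<lambda>X. cnj (partial e f X))" by (rule partial_cnj[OF test_fun_Ck[OF f]])
  note L = test_L2[OF f] test_partial_L2[OF f e_Basis]
  have "(\<integral>X. f X * partial e (mul q ?c) X \<partial>lebesgue_on \<Omega>) = - (\<integral>X. partial e f X * mul q ?c X \<partial>lebesgue_on \<Omega>)"
    by (rule integral_by_parts_test[OF open_dom bounded_dom test_fun_Ck[OF f] test_mul[OF q(1) fc] e_Basis])
  moreover have "partial e (mul q ?c) = (\<lambda>X. cnj (mul q (partial e f) X) + cnj (mul q' f X))"
    by (simp add: partial_mul[OF q(1,3) fc] pc mul_def fun_eq_iff)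
  ultimately have "(\<integral>X. f X * (cnj (mul q (partial e f) X) + cnj (mul q' f X)) \<partial>lebesgue_on \<Omega>)
      = - (\<integral>X. partial e f X * cnj (mul q f X) \<partial>lebesgue_on \<Omega>)"
    by (simp add: mul_def)
  also have "(\<integral>X. f X * (cnj (mul q (partial e f) X) + cnj (mul q' f X)) \<partial>lebesgue_on \<Omega>)
      = (\<integral>X. f X * cnj (mul q (partial e f) X) \<partial>lebesgue_on \<Omega>) + (\<integral>X. f X * cnj (mul q' f X) \<partial>lebesgue_on \<Omega>)"
    unfolding distrib_left
    by (intro Bochner_Integration.integral_add L2_integrable_ip mul_L2 q L)
  finally have "ip \<Omega> f (mul q (partial e f)) + ip \<Omega> f (mul q' f) = - ip \<Omega> (partial e f) (mul q f)"
    unfolding ip_eq_Re[OF L(1) mul_L2[OF q(1) L(2)]] ip_eq_Re[OF L(1) mul_L2[OF q(2) L(1)]]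
      ip_eq_Re[OF L(2) mul_L2[OF q(1) L(1)]]
    by (metis plus_complex.sel(1) uminus_complex.sel(1))
  moreover have "ip \<Omega> (partial e f) (mul q f) = ip \<Omega> f (mul q (partial e f))"
    using mul_swap[of q "partial e f" f] ip_commute by metis
  ultimately show ?thesis by simp
qed

lemma ip_mult_partial:
  assumes u: "u \<in> H10 \<Omega>" and q: "smooth1 q" "smooth1 q'" "\<And>x. (q has_real_derivative q' x) (at x)"
  shows "2 * ip \<Omega> u (mul q (weak_partial \<Omega> e u)) = - ip \<Omega> u (mul q' u)"
proof -
  note D = H10_weak_partial_L2[OF u]
  obtain f where f: "\<forall>n::nat. test_fun \<Omega> (f n)" "(\<lambda>n. nrm \<Omega> (\<lambda>x. u x - f n x)) \<longlonglongrightarrow> 0"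
    "\<forall>i\<in>Basis. (\<lambda>n. nrm \<Omega> (\<lambda>x. weak_partial \<Omega> i u x - partial i (f n) x)) \<longlonglongrightarrow> 0"
    using H10_approx[OF u] by blast
  have fL: "f n \<in> L2 \<Omega>" "i \<in> Basis \<Longrightarrow> partial i (f n) \<in> L2 \<Omega>" for n i
    using f(1) test_L2 test_partial_L2 by auto
  have "(\<lambda>n. 2 * ip \<Omega> (f n) (mul q (partial e (f n)))) \<longlonglongrightarrow> 2 * ip \<Omega> u (mul q (weak_partial \<Omega> e u))"
    by (intro tendsto_mult tendsto_const ip_tendsto_seq mul_tendsto mul_L2 H10_L2 u q D fL f e_Basis f(3)[rule_format])
  moreover have "(\<lambda>n. - ip \<Omega> (f n) (mul q' (f n))) \<longlonglongrightarrow> - ip \<Omega> u (mul q' u)"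
    by (intro tendsto_minus ip_tendsto_seq mul_tendsto mul_L2 H10_L2 u q fL f)
  ultimately show ?thesis
    using ip_mult_partial_test[OF f(1)[rule_format] q] LIMSEQ_unique by simp
qed

text \<open>The multiplier identity for \<open>q = x\<close>.\<close>

lemma poincare:
  assumes u: "u \<in> H10 \<Omega>"
  shows "nrm \<Omega> u \<le> 2 * nrm \<Omega> (weak_partial \<Omega> e u)"
proof -
  note D = H10_weak_partial_L2[OF u e_Basis]
  have 1: "2 * ip \<Omega> u (mul (\<lambda>x. x) (weak_partial \<Omega> e u)) = - ip \<Omega> u (mul (\<lambda>_. 1) u)"
    by (rule ip_mult_partial[OF u]) (auto intro: smooth1_ident smooth1_const)
  have "ip \<Omega> u (mul (\<lambda>_. 1) u) = (nrm \<Omega> u)\<^sup>2"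
    by (simp add: nrm_sq mul_def[abs_def])
  then have "(nrm \<Omega> u)\<^sup>2 \<le> 2 * \<bar>ip \<Omega> u (mul (\<lambda>x. x) (weak_partial \<Omega> e u))\<bar>"
    using 1 by simp
  also have "\<dots> \<le> 2 * (nrm \<Omega> u * nrm \<Omega> (mul (\<lambda>x. x) (weak_partial \<Omega> e u)))"
    by (intro mult_left_mono ip_Cauchy_Schwarz H10_L2 u mul_L2 smooth1_ident D) simp
  also have "\<dots> \<le> 2 * (nrm \<Omega> u * (1 * nrm \<Omega> (weak_partial \<Omega> e u)))"
    unfolding mul_def[abs_def]
    by (intro mult_left_mono nrm_mult_bounded[OF D smooth1_measurable[OF smooth1_ident]] nrm_nonneg)
       (use fst_dom in \<open>auto intro!: AE_I2 simp: less_imp_le\<close>)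
  finally have "(nrm \<Omega> u)\<^sup>2 \<le> nrm \<Omega> u * (2 * nrm \<Omega> (weak_partial \<Omega> e u))" by simp
  then show ?thesis
    using nrm_nonneg[of \<Omega> u] nrm_nonneg[of \<Omega> "weak_partial \<Omega> e u"]
    by (cases "nrm \<Omega> u = 0") (auto simp: power2_eq_square)
qed

end

section \<open>The multiplier identity by flowing along the axis\<close>

text \<open>With q zero at both ends, sliding along q maps the interval onto itself. The bound on q'
  is required on the whole line, because monotonicity of the slide is also used outside [0, 1], to
  see that no outside point enters; the bounds on q and q'' serve points of \<Omega>.\<close>

locale cylinder_flow = cylinder \<omega> \<Omega>
  for \<omega> :: "'b::euclidean_space set" and \<Omega> :: "(real \<times> 'b) set" +
  fixes q q' q'' :: "real \<Rightarrow> real" and K :: real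
  assumes dq: "\<And>x. (q has_real_derivative q' x) (at x)"
    and dq': "\<And>x. (q' has_real_derivative q'' x) (at x)"
    and smooth_q'': "smooth1 q''"
    and q0: "q 0 = 0" and q1: "q 1 = 0"
    and K_pos: "K > 0" and q'_bound: "\<And>x. \<bar>q' x\<bar> \<le> K"
    and q_bound: "\<And>x. x \<in> {0..1} \<Longrightarrow> \<bar>q x\<bar> \<le> K"
    and q''_bound: "\<And>x. x \<in> {0..1} \<Longrightarrow> \<bar>q'' x\<bar> \<le> K"
begin

lemma smooth_q': "smooth1 q'"
  by (rule smooth1_antiderivative[OF dq' smooth_q''])

lemma smooth_q: "smooth1 q"
  by (rule smooth1_antiderivative[OF dq smooth_q'])

text \<open>Not the flow of the field q itself but its first order approximation: the velocity at s
  = 0 is the same, which is what the limit sees, and the Jacobian 1 + s q' is explicit.\<close>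

definition flow :: "real \<Rightarrow> real \<Rightarrow> real" where
  "flow s x = x + s * q x"

abbreviation \<Theta> :: "real \<Rightarrow> real \<times> 'b \<Rightarrow> real \<times> 'b" where
  "\<Theta> s \<equiv> shear (flow s)"

text \<open>For |s| below this value the Jacobian stays between 1/2 and 3/2.\<close>

definition \<delta> :: real where "\<delta> = 1 / (2 * K)"

lemma \<delta>_pos: "\<delta> > 0"
  using K_pos by (simp add: \<delta>_def)

lemma flow_deriv: "(flow s has_real_derivative 1 + s * q' x) (at x)"
  unfolding flow_def by (auto intro!: derivative_eq_intros dq)

lemma smooth_flow': "smooth1 (\<lambda>x. 1 + s * q' x)"
  by (intro smooth1_add smooth1_mult smooth1_const smooth_q')

lemma small: "\<bar>s\<bar> < \<delta> \<Longrightarrow> \<bar>s * q' x\<bar> \<le> 1 / 2"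
proof -
  assume s: "\<bar>s\<bar> < \<delta>"
  have "\<bar>s * q' x\<bar> \<le> \<delta> * K"
    unfolding abs_mult using s q'_bound[of x] \<delta>_pos by (intro mult_mono) auto
  then show ?thesis using K_pos by (simp add: \<delta>_def)
qed

lemma flow'_pos: "\<bar>s\<bar> < \<delta> \<Longrightarrow> 1 / 2 \<le> 1 + s * q' x"
  using small[of s x] by (simp add: abs_le_iff)

lemma flow_mono:
  assumes s: "\<bar>s\<bar> < \<delta>" and "x < y" shows "flow s x < flow s y"
proof (rule DERIV_pos_imp_increasing[OF \<open>x < y\<close>])
  fix z
  have "0 < 1 + s * q' z" using flow'_pos[OF s, of z] by simp
  then show "\<exists>d. (flow s has_real_derivative d) (at z) \<and> 0 < d" using flow_deriv by blast
qed

lemma flow_interval: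
  assumes s: "\<bar>s\<bar> < \<delta>" shows "0 < flow s x \<and> flow s x < 1 \<longleftrightarrow> 0 < x \<and> x < 1"
proof -
  have "flow s 0 = 0" "flow s 1 = 1" by (simp_all add: flow_def q0 q1)
  then show ?thesis
    using flow_mono[OF s, of 0 x] flow_mono[OF s, of x 0] flow_mono[OF s, of x 1] flow_mono[OF s, of 1 x]
    by (cases x "0::real" rule: linorder_cases; cases x "1::real" rule: linorder_cases) auto
qed

lemma \<Theta>_dom: "\<bar>s\<bar> < \<delta> \<Longrightarrow> \<Theta> s X \<in> \<Omega> \<longleftrightarrow> X \<in> \<Omega>"
  using flow_interval[of s "fst X"] by (cases X) (auto simp: shear_def cylinder_eq)

lemma test_flow: "test_fun \<Omega> f \<Longrightarrow> \<bar>s\<bar> < \<delta> \<Longrightarrow> test_fun \<Omega> (\<lambda>X. f (\<Theta> s X))"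
  using test_fun_shear[OF _ flow_deriv smooth_flow' bounded_dom] \<Theta>_dom by blast

lemma flow_param_deriv:
  assumes "test_fun \<Omega> f"
  shows "((\<lambda>s. f (\<Theta> s X)) has_vector_derivative of_real (q (fst X)) * partial e f (\<Theta> s X)) (at s)"
proof -
  have "((\<lambda>s. \<Theta> s X) has_derivative (\<lambda>h. (h * q (fst X), 0))) (at s)"
    unfolding shear_def flow_def
    by (auto intro!: derivative_eq_intros has_derivative_Pair)
  from has_derivative_compose[OF this Ck_has_derivative[OF test_fun_Ck[OF assms]]]
  have "((\<lambda>s. f (\<Theta> s X)) has_derivative (\<lambda>h. frechet_derivative f (at (\<Theta> s X)) (h * q (fst X), 0))) (at s)" .
  moreover have "(\<lambda>h. frechet_derivative f (at (\<Theta> s X)) (h * q (fst X), 0))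
      = (\<lambda>h. h *\<^sub>R (of_real (q (fst X)) * partial e f (\<Theta> s X)))"
  proof
    fix h
    have "frechet_derivative f (at (\<Theta> s X)) ((h * q (fst X)) *\<^sub>R e) = (h * q (fst X)) *\<^sub>R partial e f (\<Theta> s X)"
      unfolding partial_def
      by (rule linear_scale[OF linear_frechet_derivative[OF Ck_differentiable[OF test_fun_Ck[OF assms]]]])
    then show "frechet_derivative f (at (\<Theta> s X)) (h * q (fst X), 0)
        = h *\<^sub>R (of_real (q (fst X)) * partial e f (\<Theta> s X))"
      by (simp add: scaleR_conv_of_real mult.assoc)
  qed
  ultimately show ?thesis by (simp add: has_vector_derivative_def)
qed

lemma dom_bounds: "X \<in> \<Omega> \<Longrightarrow> \<bar>q (fst X)\<bar> \<le> K" "X \<in> \<Omega> \<Longrightarrow> \<bar>q'' (fst X)\<bar> \<le> K"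
  using fst_dom[of X] q_bound q''_bound by auto

text \<open>Substitution as a conservation law: the s-derivative of the integrand on the left is the
  axial derivative of the test function q (g o \<Theta> s), so the integral is constant in s and may
  be evaluated at s = 0.\<close>

lemma change_of_variables:
  assumes g: "test_fun \<Omega> g" and s: "\<bar>s\<bar> < \<delta>"
  shows "(\<integral>X. g (\<Theta> s X) * of_real (1 + s * q' (fst X)) \<partial>lebesgue_on \<Omega>) = (\<integral>X. g X \<partial>lebesgue_on \<Omega>)"
proof -
  let ?F = "\<lambda>s X. g (\<Theta> s X) * of_real (1 + s * q' (fst X))"
  let ?F' = "\<lambda>s X. of_real (q (fst X)) * partial e g (\<Theta> s X) * of_real (1 + s * q' (fst X))
      + g (\<Theta> s X) * of_real (q' (fst X))"
  obtain B0 where B0: "B0 \<ge> 0" "\<And>x. cmod (g x) \<le> B0" using test_fun_bounded[OF g] by blast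
  obtain B1 where B1: "B1 \<ge> 0" "\<And>x. cmod (partial e g x) \<le> B1"
    using test_fun_bounded[OF test_fun_partial[OF g e_Basis]] by blast
  have der: "((\<lambda>s. \<integral>X. ?F s X \<partial>lebesgue_on \<Omega>) has_vector_derivative (\<integral>X. ?F' t X \<partial>lebesgue_on \<Omega>)) (at t)"
    if t: "\<bar>t\<bar> < \<delta>" for t
  proof (rule integral_has_vector_derivative_parameter[where \<delta>="\<delta> - \<bar>t\<bar>"])
    show "\<delta> - \<bar>t\<bar> > 0" using t by simp
    fix s assume "\<bar>s - t\<bar> < \<delta> - \<bar>t\<bar>"
    then have s: "\<bar>s\<bar> < \<delta>" by linarith
    have "test_fun \<Omega> (mul (\<lambda>x. 1 + s * q' x) (\<lambda>X. g (\<Theta> s X)))"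
      by (rule test_mul[OF smooth_flow' test_flow[OF g s]])
    then have "integrable (lebesgue_on \<Omega>) (mul (\<lambda>x. 1 + s * q' x) (\<lambda>X. g (\<Theta> s X)))"
      by (intro L2_integrable_self[OF open_dom bounded_dom] test_L2)
    then show "integrable (lebesgue_on \<Omega>) (?F s)" by (simp add: mul_def[abs_def] mult.commute)
    fix X assume "X \<in> space (lebesgue_on \<Omega>)"
    then have X: "X \<in> \<Omega>" by simp
    have "((\<lambda>s. of_real (1 + s * q' (fst X)) :: complex) has_vector_derivative of_real (q' (fst X))) (at s)"
      by (auto intro!: derivative_eq_intros simp: has_vector_derivative_def scaleR_conv_of_real)
    from has_vector_derivative_mult[OF flow_param_deriv[OF g] this]
    show "((\<lambda>s. ?F s X) has_vector_derivative ?F' s X) (at s)" by (simp add: add.commute)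
    have "cmod (?F' s X) \<le> cmod (of_real (q (fst X)) * partial e g (\<Theta> s X) * of_real (1 + s * q' (fst X)))
        + cmod (g (\<Theta> s X) * of_real (q' (fst X)))"
      by (rule norm_triangle_ineq)
    also have "\<dots> \<le> K * B1 * 2 + B0 * K"
    proof (rule add_mono)
      have "\<bar>1 + s * q' (fst X)\<bar> \<le> 2" using small[OF s, of "fst X"] by linarith
      then show "cmod (of_real (q (fst X)) * partial e g (\<Theta> s X) * of_real (1 + s * q' (fst X))) \<le> K * B1 * 2"
        unfolding norm_mult norm_of_real using K_pos B1 dom_bounds[OF X]
        by (intro mult_mono) auto
      show "cmod (g (\<Theta> s X) * of_real (q' (fst X))) \<le> B0 * K"
        unfolding norm_mult norm_of_real using K_pos B0 q'_bound by (intro mult_mono) auto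
    qed
    finally show "cmod (?F' s X) \<le> K * B1 * 2 + B0 * K" .
  qed (rule integrable_const_bounded[OF open_dom bounded_dom])
  have zero: "(\<integral>X. ?F' t X \<partial>lebesgue_on \<Omega>) = 0" if t: "\<bar>t\<bar> < \<delta>" for t
  proof -
    have "?F' t = partial e (mul q (\<lambda>X. g (\<Theta> t X)))"
      unfolding partial_mul[OF smooth_q dq test_flow[OF g t]] partial_shear(1)[OF test_fun_Ck[OF g] flow_deriv]
      by (simp add: mul_def fun_eq_iff mult_ac)
    then show ?thesis
      using integral_partial_eq_0[OF open_dom test_mul[OF smooth_q test_flow[OF g t]] e_Basis] by simp
  qed
  have "norm ((\<integral>X. ?F s X \<partial>lebesgue_on \<Omega>) - (\<integral>X. ?F 0 X \<partial>lebesgue_on \<Omega>)) \<le> 0 * \<bar>s - 0\<bar>"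
  proof (rule norm_diff_le_of_vector_derivative[where S="{-\<delta><..<\<delta>}"])
    show "((\<lambda>s. \<integral>X. ?F s X \<partial>lebesgue_on \<Omega>) has_vector_derivative 0) (at t)" if "t \<in> {-\<delta><..<\<delta>}" for t
      using der[of t] zero[of t] that by (simp add: abs_less_iff)
  qed (use s \<delta>_pos in \<open>auto simp: abs_less_iff\<close>)
  then show ?thesis by (simp add: flow_def shear_def)
qed

lemma change_of_variables_sq:
  assumes h: "test_fun \<Omega> h" and s: "\<bar>s\<bar> < \<delta>" and p: "smooth1 p"
  shows "(\<integral>X. p (fst (\<Theta> s X)) * (cmod (h (\<Theta> s X)))\<^sup>2 * (1 + s * q' (fst X)) \<partial>lebesgue_on \<Omega>) = ip \<Omega> h (mul p h)"
    and "integrable (lebesgue_on \<Omega>) (\<lambda>X. p (fst (\<Theta> s X)) * (cmod (h (\<Theta> s X)))\<^sup>2 * (1 + s * q' (fst X)))"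
proof -
  let ?g = "mul p (\<lambda>X. cnj (h X) * h X)"
  have g: "test_fun \<Omega> ?g"
    by (intro test_mul p test_fun_mult[OF test_fun_Ck[OF test_fun_cnj[OF h]] h])
  have eq: "?g X = complex_of_real (p (fst X) * (cmod (h X))\<^sup>2)" for X
    using complex_norm_square[of "h X"] by (simp add: mul_def mult.commute)
  have "(\<integral>X. complex_of_real (p (fst (\<Theta> s X)) * (cmod (h (\<Theta> s X)))\<^sup>2 * (1 + s * q' (fst X))) \<partial>lebesgue_on \<Omega>)
      = (\<integral>X. complex_of_real (p (fst X) * (cmod (h X))\<^sup>2) \<partial>lebesgue_on \<Omega>)"
    using change_of_variables[OF g s] unfolding eq by simp
  then have "(\<integral>X. p (fst (\<Theta> s X)) * (cmod (h (\<Theta> s X)))\<^sup>2 * (1 + s * q' (fst X)) \<partial>lebesgue_on \<Omega>)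
      = (\<integral>X. p (fst X) * (cmod (h X))\<^sup>2 \<partial>lebesgue_on \<Omega>)"
    unfolding integral_complex_of_real of_real_eq_iff .
  also have "\<dots> = ip \<Omega> h (mul p h)"
    unfolding ip_def mul_def
    by (rule Bochner_Integration.integral_cong)
       (auto simp: cmod_power2 distrib_left power2_eq_square[of "Re _"] power2_eq_square[of "Im _"])
  finally show "(\<integral>X. p (fst (\<Theta> s X)) * (cmod (h (\<Theta> s X)))\<^sup>2 * (1 + s * q' (fst X)) \<partial>lebesgue_on \<Omega>) = ip \<Omega> h (mul p h)" .
  have "test_fun \<Omega> (mul (\<lambda>x. 1 + s * q' x) (\<lambda>X. ?g (\<Theta> s X)))"
    by (rule test_mul[OF smooth_flow' test_flow[OF g s]])
  then have "integrable (lebesgue_on \<Omega>) (mul (\<lambda>x. 1 + s * q' x) (\<lambda>X. ?g (\<Theta> s X)))"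
    by (intro L2_integrable_self[OF open_dom bounded_dom] test_L2)
  then have "integrable (lebesgue_on \<Omega>) (\<lambda>X. Re (mul (\<lambda>x. 1 + s * q' x) (\<lambda>X. ?g (\<Theta> s X)) X))"
    by (rule integrable_Re)
  then show "integrable (lebesgue_on \<Omega>) (\<lambda>X. p (fst (\<Theta> s X)) * (cmod (h (\<Theta> s X)))\<^sup>2 * (1 + s * q' (fst X)))"
    unfolding eq by (simp add: mul_def mult_ac)
qed

lemma nrm_flow_le:
  assumes h: "test_fun \<Omega> h" and s: "\<bar>s\<bar> < \<delta>"
  shows "nrm \<Omega> (\<lambda>X. h (\<Theta> s X)) \<le> 2 * nrm \<Omega> h"
proof -
  have "(nrm \<Omega> (\<lambda>X. h (\<Theta> s X)))\<^sup>2
      \<le> (\<integral>X. 4 * (cmod (h (\<Theta> s X)))\<^sup>2 * (1 + s * q' (fst X)) \<partial>lebesgue_on \<Omega>)"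
    unfolding nrm_sq_integral
  proof (rule integral_mono)
    \<comment> \<open>A Jacobian of at least 1/2 would do with the factor 2; the factor 4 makes the
      bound a perfect square.\<close>
    show "(cmod (h (\<Theta> s X)))\<^sup>2 \<le> 4 * (cmod (h (\<Theta> s X)))\<^sup>2 * (1 + s * q' (fst X))" for X
    proof -
      have "(cmod (h (\<Theta> s X)))\<^sup>2 * 1 \<le> (cmod (h (\<Theta> s X)))\<^sup>2 * (4 * (1 + s * q' (fst X)))"
        using flow'_pos[OF s, of "fst X"] by (intro mult_left_mono) auto
      then show ?thesis by (simp add: algebra_simps)
    qed
  qed (use change_of_variables_sq(2)[OF h s smooth1_const] L2_integrable[OF test_L2[OF test_flow[OF h s]]] in auto)
  also have "\<dots> = (2 * nrm \<Omega> h)\<^sup>2"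
    using change_of_variables_sq(1)[OF h s smooth1_const, of 4]
    unfolding mul_def by (simp only: ip_scale_right power_mult_distrib nrm_sq) simp
  finally show ?thesis by (rule power2_le_imp_le) (simp add: nrm_nonneg)
qed

lemma q'_flow_diff:
  assumes X: "X \<in> \<Omega>" and s: "\<bar>s\<bar> < \<delta>"
  shows "\<bar>q' (fst (\<Theta> s X)) - q' (fst X)\<bar> \<le> K * K * \<bar>s\<bar>"
proof -
  have in01: "fst X \<in> {0..1}" "fst (\<Theta> s X) \<in> {0..1}"
    using fst_dom[OF X] fst_dom[of "\<Theta> s X"] X \<Theta>_dom[OF s] by auto
  have "norm (q' (fst (\<Theta> s X)) - q' (fst X)) \<le> K * \<bar>fst (\<Theta> s X) - fst X\<bar>"
    by (rule norm_diff_le_of_vector_derivative[where S="{0..1}"])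
       (use in01 q''_bound dq' in \<open>auto simp: has_real_derivative_iff_has_vector_derivative\<close>)
  also have "\<dots> = K * (\<bar>s\<bar> * \<bar>q (fst X)\<bar>)"
    by (simp add: shear_def flow_def abs_mult)
  also have "\<dots> \<le> K * (\<bar>s\<bar> * K)"
    using K_pos dom_bounds[OF X] by (intro mult_left_mono) auto
  finally show ?thesis by (simp add: mult_ac)
qed

text \<open>On basis vectors this is +1 along the axis and -1 across it. It is the sign with which s
  q' enters the squared partial derivatives of f o \<Theta> s after substitution, whose factors are
  (1 + s q')^2 / (1 + s q') along the axis and 1 / (1 + s q') across.\<close>

definition \<sigma> :: "real \<times> 'b \<Rightarrow> real" where "\<sigma> i = 2 * fst i - 1"

text \<open>Chosen for the transverse case of \<open>nrm_partial_flow\<close>: with the Jacobian at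
  least 1/2, C s^2 contributes 2 K^2 s^2, which pays for two errors of size K^2 s^2 each.\<close>

definition C :: real where "C = 4 * K * K"

text \<open>An expansion in s of which only the upper bound is kept. The remainder comes from
  expanding the Jacobian factor and from evaluating q' at \<Theta> s X, where the substitution wants
  it, instead of at X.\<close>

lemma nrm_partial_flow:
  assumes f: "test_fun \<Omega> f" and s: "\<bar>s\<bar> < \<delta>" and i: "i \<in> Basis"
  shows "(nrm \<Omega> (partial i (\<lambda>X. f (\<Theta> s X))))\<^sup>2
    \<le> (1 + C * s\<^sup>2) * (nrm \<Omega> (partial i f))\<^sup>2 + s * \<sigma> i * ip \<Omega> (partial i f) (mul q' (partial i f))"
proof -
  let ?p = "\<lambda>x. (1 + C * s\<^sup>2) + (s * \<sigma> i) * q' x"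
  let ?h = "partial i f"
  have p: "smooth1 ?p" by (intro smooth1_add smooth1_mult smooth1_const smooth_q')
  have h: "test_fun \<Omega> ?h" by (rule test_fun_partial[OF f i])
  have "(nrm \<Omega> (partial i (\<lambda>X. f (\<Theta> s X))))\<^sup>2
      \<le> (\<integral>X. ?p (fst (\<Theta> s X)) * (cmod (?h (\<Theta> s X)))\<^sup>2 * (1 + s * q' (fst X)) \<partial>lebesgue_on \<Omega>)"
    unfolding nrm_sq_integral
  proof (rule integral_mono)
    show "integrable (lebesgue_on \<Omega>) (\<lambda>X. (cmod (partial i (\<lambda>X. f (\<Theta> s X)) X))\<^sup>2)"
      by (rule L2_integrable[OF test_partial_L2[OF test_flow[OF f s] i]])
    show "integrable (lebesgue_on \<Omega>) (\<lambda>X. ?p (fst (\<Theta> s X)) * (cmod (?h (\<Theta> s X)))\<^sup>2 * (1 + s * q' (fst X)))"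
      by (rule change_of_variables_sq(2)[OF h s p])
    fix X assume "X \<in> space (lebesgue_on \<Omega>)"
    then have X: "X \<in> \<Omega>" by simp
    let ?a = "q' (fst X)" and ?b = "q' (fst (\<Theta> s X))"
    have "\<bar>s * (?b - ?a)\<bar> \<le> \<bar>s\<bar> * (K * K * \<bar>s\<bar>)"
      unfolding abs_mult by (intro mult_left_mono q'_flow_diff[OF X s]) simp
    then have ab: "\<bar>s * (?b - ?a)\<bar> \<le> K * K * s\<^sup>2"
      by (simp add: power2_eq_square mult_ac abs_mult_self_eq)
    have half: "1 / 2 \<le> 1 + s * ?a" by (rule flow'_pos[OF s])
    from i show "(cmod (partial i (\<lambda>X. f (\<Theta> s X)) X))\<^sup>2 \<le> ?p (fst (\<Theta> s X)) * (cmod (?h (\<Theta> s X)))\<^sup>2 * (1 + s * ?a)"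
    proof (cases rule: Basis_prod_cases)
      case 1
      \<comment> \<open>One Jacobian factor of the squared axial derivative is the one in the
        substitution formula; the other has to be compared with its first order value at the slid
        point.\<close>
      have "1 + s * ?a \<le> 1 + C * s\<^sup>2 + s * ?b"
      proof -
        have "s * ?a - s * ?b \<le> K * K * s\<^sup>2" using ab by (simp add: abs_le_iff right_diff_distrib)
        moreover have "K * K * s\<^sup>2 \<le> C * s\<^sup>2" using K_pos by (intro mult_right_mono) (auto simp: C_def)
        ultimately show ?thesis by linarith
      qed
      then have "(1 + s * ?a) * ((cmod (?h (\<Theta> s X)))\<^sup>2 * (1 + s * ?a))
          \<le> (1 + C * s\<^sup>2 + s * ?b) * ((cmod (?h (\<Theta> s X)))\<^sup>2 * (1 + s * ?a))"
        using half by (intro mult_right_mono) auto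
      then show ?thesis
        unfolding 1 partial_shear(1)[OF test_fun_Ck[OF f] flow_deriv] norm_mult norm_of_real power_mult_distrib power2_abs
        by (simp add: \<sigma>_def power2_eq_square mult_ac)
    next
      case (2 j)
      have *: "s\<^sup>2 * (?a * ?b) \<le> s\<^sup>2 * (K * K)"
      proof (rule mult_left_mono)
        have "\<bar>?a * ?b\<bar> \<le> K * K"
          unfolding abs_mult using q'_bound K_pos by (intro mult_mono) auto
        then show "?a * ?b \<le> K * K" by simp
      qed simp
      have **: "C * s\<^sup>2 * (1 / 2) \<le> C * s\<^sup>2 * (1 + s * ?a)"
        using K_pos by (intro mult_left_mono half) (simp add: C_def)
      have ***: "(1 + C * s\<^sup>2 - s * ?b) * (1 + s * ?a)
          = 1 - s * (?b - ?a) - s\<^sup>2 * (?a * ?b) + C * s\<^sup>2 * (1 + s * ?a)"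
        by (simp add: algebra_simps power2_eq_square)
      have "1 \<le> (1 + C * s\<^sup>2 - s * ?b) * (1 + s * ?a)"
      proof -
        have "C * s\<^sup>2 * (1 / 2) = K * K * s\<^sup>2 + K * K * s\<^sup>2" "s\<^sup>2 * (K * K) = K * K * s\<^sup>2"
          by (simp_all add: C_def)
        with * ** *** abs_le_D1[OF ab] show ?thesis by linarith
      qed
      then have "(cmod (?h (\<Theta> s X)))\<^sup>2 * 1 \<le> (cmod (?h (\<Theta> s X)))\<^sup>2 * ((1 + C * s\<^sup>2 - s * ?b) * (1 + s * ?a))"
        by (intro mult_left_mono) auto
      then show ?thesis
        unfolding 2 partial_shear(2)[OF test_fun_Ck[OF f] flow_deriv]
        by (simp add: \<sigma>_def mult_ac)
    qed
  qed
  also have "\<dots> = ip \<Omega> ?h (mul ?p ?h)"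
    by (rule change_of_variables_sq(1)[OF h s p])
  also have "mul ?p ?h = (\<lambda>X. of_real (1 + C * s\<^sup>2) * ?h X + of_real (s * \<sigma> i) * mul q' ?h X)"
    by (simp add: mul_def fun_eq_iff algebra_simps)
  also have "ip \<Omega> ?h \<dots> = (1 + C * s\<^sup>2) * (nrm \<Omega> ?h)\<^sup>2 + s * \<sigma> i * ip \<Omega> ?h (mul q' ?h)"
    using test_L2[OF h] mul_L2[OF smooth_q' test_L2[OF h]]
    by (simp add: ip_add_right L2_cmult ip_scale_right nrm_sq del: of_real_add of_real_mult)
  finally show ?thesis .
qed

lemma partial_cmult:
  assumes "test_fun \<Omega> f" shows "partial i (\<lambda>x. c * f x) = (\<lambda>x. c * partial i f x)"
  using partial_mult[OF Ck_const[of "Suc 0"] test_fun_Ck[OF assms], of i c] by (simp add: partial_const)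

lemma ip_flow_deriv:
  assumes g: "g \<in> L2 \<Omega>" and f: "test_fun \<Omega> f" and t: "\<bar>t\<bar> < \<delta>"
  shows "((\<lambda>s. ip \<Omega> g (\<lambda>X. f (\<Theta> s X))) has_vector_derivative
      ip \<Omega> g (mul q (\<lambda>X. partial e f (\<Theta> t X)))) (at t)"
proof -
  let ?G = "\<lambda>s X. g X * cnj (f (\<Theta> s X))"
  let ?G' = "\<lambda>s X. g X * cnj (mul q (\<lambda>X. partial e f (\<Theta> s X)) X)"
  have pf: "test_fun \<Omega> (partial e f)" by (rule test_fun_partial[OF f e_Basis])
  obtain B1 where B1: "B1 \<ge> 0" "\<And>x. cmod (partial e f x) \<le> B1"
    using test_fun_bounded[OF pf] by blast
  have "((\<lambda>s. \<integral>X. ?G s X \<partial>lebesgue_on \<Omega>) has_vector_derivative (\<integral>X. ?G' t X \<partial>lebesgue_on \<Omega>)) (at t)"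
  proof (rule integral_has_vector_derivative_parameter[where \<delta>="\<delta> - \<bar>t\<bar>"])
    show "\<delta> - \<bar>t\<bar> > 0" using t by simp
    show "integrable (lebesgue_on \<Omega>) (\<lambda>X. cmod (g X) * (K * B1))"
      using L2_integrable_self[OF open_dom bounded_dom g] by (intro integrable_mult_left integrable_norm)
    fix s assume "\<bar>s - t\<bar> < \<delta> - \<bar>t\<bar>"
    then have s: "\<bar>s\<bar> < \<delta>" by linarith
    show "integrable (lebesgue_on \<Omega>) (?G s)"
      by (rule L2_integrable_ip(1)[OF g test_L2[OF test_flow[OF f s]]])
    fix X assume "X \<in> space (lebesgue_on \<Omega>)"
    then have X: "X \<in> \<Omega>" by simp
    from has_vector_derivative_mult_right[OF has_vector_derivative_cnj[OF flow_param_deriv[OF f]]]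
    show "((\<lambda>s. ?G s X) has_vector_derivative ?G' s X) (at s)" by (simp add: mul_def)
    have "cmod (mul q (\<lambda>X. partial e f (\<Theta> s X)) X) \<le> K * B1"
      unfolding mul_def norm_mult norm_of_real using K_pos B1 dom_bounds[OF X] by (intro mult_mono) auto
    then show "cmod (?G' s X) \<le> cmod (g X) * (K * B1)"
      unfolding norm_mult complex_mod_cnj by (rule mult_left_mono) simp
  qed
  then have "((\<lambda>s. Re (\<integral>X. ?G s X \<partial>lebesgue_on \<Omega>)) has_vector_derivative Re (\<integral>X. ?G' t X \<partial>lebesgue_on \<Omega>)) (at t)"
    by (rule bounded_linear.has_vector_derivative[OF bounded_linear_Re])
  moreover have "Re (\<integral>X. ?G' t X \<partial>lebesgue_on \<Omega>) = ip \<Omega> g (mul q (\<lambda>X. partial e f (\<Theta> t X)))"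
    by (rule ip_eq_Re[symmetric, OF g mul_L2[OF smooth_q test_L2[OF test_flow[OF pf t]]]])
  ultimately have "((\<lambda>s. Re (\<integral>X. ?G s X \<partial>lebesgue_on \<Omega>)) has_vector_derivative
      ip \<Omega> g (mul q (\<lambda>X. partial e f (\<Theta> t X)))) (at t)" by simp
  then show ?thesis
  proof (rule has_vector_derivative_transform_within_open[where S="{-\<delta><..<\<delta>}"])
    show "Re (\<integral>X. ?G s X \<partial>lebesgue_on \<Omega>) = ip \<Omega> g (\<lambda>X. f (\<Theta> s X))" if "s \<in> {-\<delta><..<\<delta>}" for s
      using that by (intro ip_eq_Re[symmetric] g test_L2 test_flow f) (auto simp: abs_less_iff)
  qed (use t in \<open>auto simp: abs_less_iff\<close>)
qed

lemma nrm_mul_q_le: "u \<in> L2 \<Omega> \<Longrightarrow> nrm \<Omega> (mul q u) \<le> K * nrm \<Omega> u"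
  unfolding mul_def[abs_def]
  by (rule nrm_mult_bounded[OF _ smooth1_measurable[OF smooth_q]])
     (use dom_bounds K_pos in \<open>auto intro!: AE_I2\<close>)

text \<open>The Lipschitz constant in s sees f only through the L2 norm of its axial derivative, so
  it is small for differences of test functions that converge in \<open>H10\<close>;
  \<open>rellich\<close> relies on this uniformity.\<close>

lemma ip_flow_diff_le:
  assumes g: "g \<in> L2 \<Omega>" and f: "test_fun \<Omega> f" and s: "\<bar>s\<bar> < \<delta>"
  shows "\<bar>ip \<Omega> g (\<lambda>X. f (\<Theta> s X)) - ip \<Omega> g f\<bar> \<le> 2 * K * nrm \<Omega> g * nrm \<Omega> (partial e f) * \<bar>s\<bar>"
proof -
  have pf: "test_fun \<Omega> (partial e f)" by (rule test_fun_partial[OF f e_Basis])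
  have "norm (ip \<Omega> g (\<lambda>X. f (\<Theta> s X)) - ip \<Omega> g (\<lambda>X. f (\<Theta> 0 X))) \<le> (2 * K * nrm \<Omega> g * nrm \<Omega> (partial e f)) * \<bar>s - 0\<bar>"
  proof (rule norm_diff_le_of_vector_derivative[where S="{-\<delta><..<\<delta>}"])
    show "((\<lambda>s. ip \<Omega> g (\<lambda>X. f (\<Theta> s X))) has_vector_derivative ip \<Omega> g (mul q (\<lambda>X. partial e f (\<Theta> t X)))) (at t)"
      if "t \<in> {-\<delta><..<\<delta>}" for t
      using that by (intro ip_flow_deriv g f) (auto simp: abs_less_iff)
    fix t assume "t \<in> {-\<delta><..<\<delta>}"
    then have t: "\<bar>t\<bar> < \<delta>" by (auto simp: abs_less_iff)
    note L = test_L2[OF test_flow[OF pf t]]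
    have "\<bar>ip \<Omega> g (mul q (\<lambda>X. partial e f (\<Theta> t X)))\<bar> \<le> nrm \<Omega> g * nrm \<Omega> (mul q (\<lambda>X. partial e f (\<Theta> t X)))"
      by (rule ip_Cauchy_Schwarz[OF g mul_L2[OF smooth_q L]])
    also have "\<dots> \<le> nrm \<Omega> g * (K * (2 * nrm \<Omega> (partial e f)))"
      using nrm_flow_le[OF pf t] K_pos
      by (intro mult_left_mono order_trans[OF nrm_mul_q_le[OF L]] nrm_nonneg) auto
    finally show "norm (ip \<Omega> g (mul q (\<lambda>X. partial e f (\<Theta> t X)))) \<le> 2 * K * nrm \<Omega> g * nrm \<Omega> (partial e f)"
      by (simp add: mult_ac)
  qed (use s \<delta>_pos in \<open>auto simp: abs_less_iff\<close>)
  then show ?thesis by (simp add: flow_def shear_def)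
qed

text \<open>With G the gradient of f, this is the coefficient of s in the bound for the Dirichlet
  integral of f o \<Theta> s.\<close>

definition Q :: "(real \<times> 'b \<Rightarrow> real \<times> 'b \<Rightarrow> complex) \<Rightarrow> real" where
  "Q G = (\<Sum>i\<in>Basis. \<sigma> i * ip \<Omega> (G i) (mul q' (G i)))"

text \<open>Convexity of the Dirichlet integral replaces an integration by parts against
  \<open>q \<partial>\<^sub>e u\<close>, which need not belong to \<open>H\<^sup>1\<^sub>0\<close>.\<close>

lemma flow_test_inequality:
  assumes u: "u \<in> dom_laplacian \<Omega>" and f: "test_fun \<Omega> f" and s: "\<bar>s\<bar> < \<delta>"
  shows "ip \<Omega> (weak_laplacian \<Omega> u) (\<lambda>X. f (\<Theta> s X)) - ip \<Omega> (weak_laplacian \<Omega> u) f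
    \<ge> - (1/2) * (\<Sum>i\<in>Basis. (nrm \<Omega> (\<lambda>X. weak_partial \<Omega> i u X - partial i f X))\<^sup>2)
      - (1/2) * s * Q (\<lambda>i. partial i f) - (1/2) * C * s\<^sup>2 * (\<Sum>i\<in>Basis. (nrm \<Omega> (partial i f))\<^sup>2)"
proof -
  note fs = test_flow[OF f s]
  let ?D = "\<lambda>i. weak_partial \<Omega> i u" and ?fs = "\<lambda>X. f (\<Theta> s X)"
  have DL: "?D i \<in> L2 \<Omega>" if "i \<in> Basis" for i
    by (rule H10_weak_partial_L2[OF dom_laplacian_H10[OF u] that])
  have "ip \<Omega> (?D i) (partial i ?fs) - ip \<Omega> (?D i) (partial i f)
      \<le> (1/2) * (nrm \<Omega> (\<lambda>X. ?D i X - partial i f X))\<^sup>2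
        + (1/2) * s * (\<sigma> i * ip \<Omega> (partial i f) (mul q' (partial i f))) + (1/2) * C * s\<^sup>2 * (nrm \<Omega> (partial i f))\<^sup>2"
    if i: "i \<in> Basis" for i
  proof -
    \<comment> \<open>The square of \<open>?D i\<close> is traded for the distance between
      \<open>?D i\<close> and \<open>partial i f\<close>, which vanishes once f approaches
      u.\<close>
    have "0 \<le> (nrm \<Omega> (\<lambda>X. ?D i X - partial i ?fs X))\<^sup>2" by simp
    then have "2 * ip \<Omega> (?D i) (partial i ?fs) \<le> ip \<Omega> (?D i) (?D i) + (nrm \<Omega> (partial i ?fs))\<^sup>2"
      unfolding nrm_sq ip_diff_self[OF DL[OF i] test_partial_L2[OF fs i]] by simp
    moreover have "(nrm \<Omega> (\<lambda>X. ?D i X - partial i f X))\<^sup>2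
        = ip \<Omega> (?D i) (?D i) - 2 * ip \<Omega> (?D i) (partial i f) + (nrm \<Omega> (partial i f))\<^sup>2"
      unfolding nrm_sq by (rule ip_diff_self[OF DL[OF i] test_partial_L2[OF f i]])
    moreover note nrm_partial_flow[OF f s i]
    ultimately show ?thesis by (simp add: algebra_simps)
  qed
  then have "(\<Sum>i\<in>Basis. ip \<Omega> (?D i) (partial i ?fs) - ip \<Omega> (?D i) (partial i f))
      \<le> (\<Sum>i\<in>Basis. (1/2) * (nrm \<Omega> (\<lambda>X. ?D i X - partial i f X))\<^sup>2
        + (1/2) * s * (\<sigma> i * ip \<Omega> (partial i f) (mul q' (partial i f))) + (1/2) * C * s\<^sup>2 * (nrm \<Omega> (partial i f))\<^sup>2)"
    by (rule sum_mono)
  then show ?thesis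
    unfolding green_test[OF u fs] green_test[OF u f] Q_def
    by (simp add: sum.distrib sum_subtractf sum_distrib_left sum_negf)
qed

lemma Q_tendsto:
  assumes "\<And>i. i \<in> Basis \<Longrightarrow> G i \<in> L2 \<Omega>" "\<And>n i. i \<in> Basis \<Longrightarrow> H n i \<in> L2 \<Omega>"
    "\<And>i. i \<in> Basis \<Longrightarrow> (\<lambda>n::nat. nrm \<Omega> (\<lambda>X. G i X - H n i X)) \<longlonglongrightarrow> 0"
  shows "(\<lambda>n. Q (H n)) \<longlonglongrightarrow> Q G"
  unfolding Q_def
  by (intro tendsto_sum tendsto_mult tendsto_const ip_tendsto_seq mul_tendsto mul_L2 smooth_q' assms)

text \<open>A one-sided form of the Rellich identity. Three limits are taken in turn: n to infinity
  with s and N fixed, which replaces gradients of test functions by those of u; then s to 0 from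
  below; then N to infinity. The smooth \<open>f N\<close> is kept through the second limit because
  differentiability in s is available for test functions.\<close>

lemma rellich:
  assumes u: "u \<in> dom_laplacian \<Omega>"
  shows "ip \<Omega> (weak_laplacian \<Omega> u) (mul q (weak_partial \<Omega> e u)) \<le> - (1/2) * Q (\<lambda>i. weak_partial \<Omega> i u)"
proof -
  let ?g = "weak_laplacian \<Omega> u" and ?D = "\<lambda>i. weak_partial \<Omega> i u"
  have uH: "u \<in> H10 \<Omega>" by (rule dom_laplacian_H10[OF u])
  note g = weak_laplacian_L2[OF u]
  have DL: "?D i \<in> L2 \<Omega>" if "i \<in> Basis" for i
    by (rule H10_weak_partial_L2[OF uH that])
  obtain f where f': "\<forall>n::nat. test_fun \<Omega> (f n)" "(\<lambda>n. nrm \<Omega> (\<lambda>x. u x - f n x)) \<longlonglongrightarrow> 0"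
    "\<forall>i\<in>Basis. (\<lambda>n. nrm \<Omega> (\<lambda>x. ?D i x - partial i (f n) x)) \<longlonglongrightarrow> 0"
    using H10_approx[OF uH] by blast
  have f: "test_fun \<Omega> (f n)" for n using f'(1) by blast
  have lim: "(\<lambda>n. nrm \<Omega> (\<lambda>x. ?D i x - partial i (f n) x)) \<longlonglongrightarrow> 0" if "i \<in> Basis" for i
    using f'(3) that by blast
  note pL = test_partial_L2[OF f]
  let ?R = "\<lambda>N s. ip \<Omega> ?g (\<lambda>X. f N (\<Theta> s X)) - ip \<Omega> ?g (f N)"
  let ?S = "\<Sum>i\<in>Basis. (nrm \<Omega> (?D i))\<^sup>2"
  let ?d = "\<lambda>N. nrm \<Omega> (\<lambda>X. ?D e X - partial e (f N) X)"
  have step1: "- (1/2) * s * Q ?D - (1/2) * C * s\<^sup>2 * ?S \<le> ?R N s + 2 * K * nrm \<Omega> ?g * ?d N * \<bar>s\<bar>"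
    if s: "\<bar>s\<bar> < \<delta>" for N s
  proof -
    have ineq: "- (1/2) * (\<Sum>i\<in>Basis. (nrm \<Omega> (\<lambda>X. ?D i X - partial i (f n) X))\<^sup>2)
      - (1/2) * s * Q (\<lambda>i. partial i (f n)) - (1/2) * C * s\<^sup>2 * (\<Sum>i\<in>Basis. (nrm \<Omega> (partial i (f n)))\<^sup>2)
      \<le> ?R N s + 2 * K * nrm \<Omega> ?g * nrm \<Omega> (\<lambda>X. partial e (f n) X - partial e (f N) X) * \<bar>s\<bar>" for n
    proof -
      let ?h = "\<lambda>X. f n X + (-1) * f N X"
      have h: "test_fun \<Omega> ?h" by (intro test_fun_add test_fun_cmult f)
      have ph: "partial e ?h = (\<lambda>X. partial e (f n) X - partial e (f N) X)"
        by (subst partial_add[OF test_fun_Ck[OF f, of "Suc 0"] test_fun_Ck[OF test_fun_cmult[OF f], of "Suc 0"]])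
           (simp only: partial_cmult[OF f], simp)
      \<comment> \<open>\<open>?R\<close> is linear in the function, so the index n may be changed
        to N at the price of a term bounded by |s| times the distance of the axial
        derivatives.\<close>
      have "?R n s = ?R N s + (ip \<Omega> ?g (\<lambda>X. ?h (\<Theta> s X)) - ip \<Omega> ?g ?h)"
        using ip_diff_right[OF test_L2[OF test_flow[OF f s]] test_L2[OF test_flow[OF f s]] g, of n N]
          ip_diff_right[OF test_L2[OF f] test_L2[OF f] g, of n N] by simp
      also have "\<dots> \<le> ?R N s + 2 * K * nrm \<Omega> ?g * nrm \<Omega> (partial e ?h) * \<bar>s\<bar>"
        using ip_flow_diff_le[OF g h s] by linarith
      finally show ?thesis using flow_test_inequality[OF u f s, of n] unfolding ph by linarith
    qed
    have L1: "(\<lambda>n. nrm \<Omega> (partial i (f n))) \<longlonglongrightarrow> nrm \<Omega> (?D i)" if "i \<in> Basis" for i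
      unfolding nrm_def by (intro tendsto_real_sqrt ip_tendsto_seq DL pL lim that)
    have "(\<lambda>n. nrm \<Omega> (\<lambda>X. partial e (f n) X - partial e (f N) X)) \<longlonglongrightarrow> ?d N"
      unfolding nrm_def
    proof (intro tendsto_real_sqrt ip_tendsto_seq L2_diff DL pL e_Basis)
      show "(\<lambda>n. nrm \<Omega> (\<lambda>x. ?D e x - partial e (f N) x - (partial e (f n) x - partial e (f N) x))) \<longlonglongrightarrow> 0"
        using lim[OF e_Basis] by simp
      then show "(\<lambda>n. nrm \<Omega> (\<lambda>x. ?D e x - partial e (f N) x - (partial e (f n) x - partial e (f N) x))) \<longlonglongrightarrow> 0" .
    qed
    then have rhs: "(\<lambda>n. ?R N s + 2 * K * nrm \<Omega> ?g * nrm \<Omega> (\<lambda>X. partial e (f n) X - partial e (f N) X) * \<bar>s\<bar>)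
        \<longlonglongrightarrow> ?R N s + 2 * K * nrm \<Omega> ?g * ?d N * \<bar>s\<bar>"
      by (intro tendsto_intros)
    have "(\<lambda>n. - (1/2) * (\<Sum>i\<in>Basis. (nrm \<Omega> (\<lambda>X. ?D i X - partial i (f n) X))\<^sup>2)
      - (1/2) * s * Q (\<lambda>i. partial i (f n)) - (1/2) * C * s\<^sup>2 * (\<Sum>i\<in>Basis. (nrm \<Omega> (partial i (f n)))\<^sup>2))
      \<longlonglongrightarrow> - (1/2) * (\<Sum>i\<in>(Basis :: (real \<times> 'b) set). 0\<^sup>2) - (1/2) * s * Q ?D - (1/2) * C * s\<^sup>2 * ?S"
      by (intro tendsto_diff tendsto_mult tendsto_const tendsto_sum tendsto_power Q_tendsto DL pL lim L1)
    then show ?thesis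
      using LIMSEQ_le[OF _ rhs] ineq by (simp add: LIMSEQ_le)
  qed
  have step2: "ip \<Omega> ?g (mul q (partial e (f N))) - 2 * K * nrm \<Omega> ?g * ?d N \<le> - (1/2) * Q ?D" for N
  proof -
    have dR: "((\<lambda>s. (ip \<Omega> ?g (\<lambda>X. f N (\<Theta> (0 + s) X)) - ip \<Omega> ?g (\<lambda>X. f N (\<Theta> 0 X))) /\<^sub>R s) \<longlongrightarrow> ip \<Omega> ?g (mul q (\<lambda>X. partial e (f N) (\<Theta> 0 X)))) (at 0)"
      using ip_flow_deriv[OF g f, of 0 N] \<delta>_pos unfolding has_vector_derivative_iff_quotient by simp
    \<comment> \<open>Negative s is what is needed: \<open>step1\<close> bounds \<open>?R\<close>
      from below, and dividing by s < 0 turns this into an upper bound.\<close>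
    have "((\<lambda>s. ?R N s / s) \<longlongrightarrow> ip \<Omega> ?g (mul q (partial e (f N)))) (at_left 0)"
      using filterlim_mono[OF dR order_refl at_le[of "{..<0}" UNIV]]
      by (simp add: flow_def shear_def divide_inverse mult.commute)
    then have L: "((\<lambda>s. ?R N s / s - 2 * K * nrm \<Omega> ?g * ?d N) \<longlongrightarrow> ip \<Omega> ?g (mul q (partial e (f N))) - 2 * K * nrm \<Omega> ?g * ?d N) (at_left 0)"
      by (intro tendsto_intros)
    have "((\<lambda>s. - (1/2) * Q ?D - (1/2) * C * s * ?S) \<longlongrightarrow> - (1/2) * Q ?D - (1/2) * C * 0 * ?S) (at_left 0)"
      by (intro tendsto_intros)
    then have R: "((\<lambda>s. - (1/2) * Q ?D - (1/2) * C * s * ?S) \<longlongrightarrow> - (1/2) * Q ?D) (at_left 0)" by simp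
    show ?thesis
    proof (rule tendsto_le[OF _ R L])
      show "\<forall>\<^sub>F s in at_left 0. ?R N s / s - 2 * K * nrm \<Omega> ?g * ?d N \<le> - (1/2) * Q ?D - (1/2) * C * s * ?S"
        unfolding eventually_at
      proof (intro exI[of _ \<delta>] conjI ballI impI)
        fix s :: real assume "s \<in> {..<0}" "s \<noteq> 0 \<and> dist s 0 < \<delta>"
        then have s: "s < 0" "\<bar>s\<bar> < \<delta>" by (auto simp: dist_real_def)
        from step1[OF s(2), of N]
        have "?R N s - 2 * K * nrm \<Omega> ?g * ?d N * s \<ge> (- (1/2) * Q ?D - (1/2) * C * s * ?S) * s"
          using s(1) by (simp add: algebra_simps power2_eq_square)
        then have "(?R N s - 2 * K * nrm \<Omega> ?g * ?d N * s) / s \<le> ((- (1/2) * Q ?D - (1/2) * C * s * ?S) * s) / s"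
          using s(1) by (intro divide_right_mono_neg) auto
        then show "?R N s / s - 2 * K * nrm \<Omega> ?g * ?d N \<le> - (1/2) * Q ?D - (1/2) * C * s * ?S"
          using s(1) by (simp add: diff_divide_distrib)
      qed (rule \<delta>_pos)
    qed simp
  qed
  have "(\<lambda>N. ip \<Omega> ?g (mul q (partial e (f N))) - 2 * K * nrm \<Omega> ?g * ?d N)
      \<longlonglongrightarrow> ip \<Omega> ?g (mul q (?D e)) - 2 * K * nrm \<Omega> ?g * 0"
    by (intro tendsto_diff tendsto_mult tendsto_const ip_right_tendsto g mul_tendsto mul_L2 smooth_q DL pL e_Basis lim)
  then show ?thesis
    using step2 by (intro LIMSEQ_le_const2[where a="- (1/2) * Q ?D"]) auto
qed

end

section \<open>The energy norm and the semigroup\<close>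

text \<open>A null set of the line times the whole transverse space has measure 0 times infinity,
  which is 0 in \<open>ennreal\<close>.\<close>

lemma AE_lebesgue_fst:
  fixes P :: "real \<Rightarrow> bool"
  assumes "AE x in lborel. P x"
  shows "AE X in (lebesgue :: (real \<times> 'b::euclidean_space) measure). P (fst X)"
proof -
  obtain N where N: "N \<in> null_sets lborel" "{x. \<not> P x} \<subseteq> N"
    using assms unfolding eventually_ae_filter by auto
  have Ns: "N \<in> sets lborel" "emeasure lborel N = 0" using N(1) by auto
  have "emeasure (lborel \<Otimes>\<^sub>M lborel) (N \<times> (UNIV :: 'b set)) = emeasure lborel N * emeasure lborel (UNIV :: 'b set)"
    using Ns(1) by (intro lborel.emeasure_pair_measure_Times) auto
  then have "N \<times> (UNIV :: 'b set) \<in> null_sets (lborel \<Otimes>\<^sub>M lborel)"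
    using Ns by (intro null_setsI) auto
  then have "N \<times> (UNIV :: 'b set) \<in> null_sets lborel"
    unfolding lborel_prod .
  then have "AE X in (lborel :: (real \<times> 'b) measure). X \<notin> N \<times> UNIV" by (rule AE_not_in)
  then have "AE X in (lborel :: (real \<times> 'b) measure). P (fst X)"
    by eventually_elim (use N(2) in \<open>auto simp: mem_Times_iff\<close>)
  then show ?thesis by (rule AE_completion)
qed

section \<open>Coefficients of the axial variable as functions on the cylinder\<close>

context cylinder
begin

lemma AE_fst:
  assumes "AE x in lebesgue_on S. P x" "S \<in> sets borel"
  shows "AE X in lebesgue_on \<Omega>. fst X \<in> S \<longrightarrow> P (fst X)"
proof -
  have "AE x in lebesgue. x \<in> S \<longrightarrow> P x"
    using assms AE_restrict_space_iff[of S lebesgue P] by auto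
  then have "AE x in lborel. x \<in> S \<longrightarrow> P x" by (simp only: AE_completion_iff)
  then have "AE X in (lebesgue :: (real \<times> 'b) measure). fst X \<in> S \<longrightarrow> P (fst X)"
    by (rule AE_lebesgue_fst)
  then have "AE X in (lebesgue :: (real \<times> 'b) measure). X \<in> \<Omega> \<longrightarrow> (fst X \<in> S \<longrightarrow> P (fst X))"
    by eventually_elim simp
  then show ?thesis
    using AE_restrict_space_iff[of \<Omega> lebesgue "\<lambda>X. fst X \<in> S \<longrightarrow> P (fst X)"] open_dom by auto
qed

text \<open>The coefficient is Lebesgue measurable, so it is first replaced by a Borel function,
  whose composition with \<open>fst\<close> is Borel; the exceptional set lifts to a null
  set.\<close>

lemma Linf_fst:
  assumes "b \<in> Linf {0<..<1}"
  shows "(\<lambda>X. complex_of_real (b (fst X))) \<in> borel_measurable (lebesgue_on \<Omega>)"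
    and "\<exists>M. AE X in lebesgue_on \<Omega>. \<bar>b (fst X)\<bar> \<le> M"
proof -
  let ?I = "{0<..<1::real}"
  have bm: "b \<in> borel_measurable (lebesgue_on ?I)" using assms by (simp add: Linf_def)
  have "(\<lambda>x. indicator ?I x *\<^sub>R b x) \<in> borel_measurable lebesgue"
    using bm borel_measurable_restrict_space_iff[of ?I lebesgue b] by simp
  then obtain g where g: "g \<in> borel_measurable lborel" "AE x in lborel. indicator ?I x *\<^sub>R b x = g x"
    using completion_ex_borel_measurable_real by blast
  have ae: "AE X in (lebesgue :: (real \<times> 'b) measure). indicator ?I (fst X) *\<^sub>R b (fst X) = g (fst X)"
    using AE_lebesgue_fst[OF g(2)] .
  have "(\<lambda>X::real \<times> 'b. g (fst X)) \<in> borel_measurable borel"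
    using g(1) by (intro measurable_compose[OF borel_measurable_continuous_onI[OF continuous_on_fst[OF continuous_on_id]]]) simp
  then have "(\<lambda>X::real \<times> 'b. indicator \<Omega> X *\<^sub>R g (fst X)) \<in> borel_measurable borel"
    using open_dom by (intro borel_measurable_scaleR borel_measurable_indicator) auto
  then have "(\<lambda>X::real \<times> 'b. indicator \<Omega> X *\<^sub>R g (fst X)) \<in> borel_measurable lebesgue"
    by (intro measurable_completion) simp
  moreover have "AE X in lebesgue. indicator \<Omega> X *\<^sub>R g (fst X) = indicator \<Omega> X *\<^sub>R b (fst X)"
    using ae by eventually_elim (use fst_dom in \<open>auto simp: indicator_def\<close>)
  ultimately have "(\<lambda>X. indicator \<Omega> X *\<^sub>R b (fst X)) \<in> borel_measurable lebesgue"
    by (rule borel_measurable_AE)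
  then have "(\<lambda>X. b (fst X)) \<in> borel_measurable (lebesgue_on \<Omega>)"
    using borel_measurable_restrict_space_iff[of \<Omega> lebesgue "\<lambda>X. b (fst X)"] open_dom by auto
  then show "(\<lambda>X. complex_of_real (b (fst X))) \<in> borel_measurable (lebesgue_on \<Omega>)"
    by (rule measurable_compose[OF _ borel_measurable_of_real])
  obtain M where "AE x in lebesgue_on ?I. \<bar>b x\<bar> \<le> M" using assms by (auto simp: Linf_def)
  from AE_fst[OF this] have "AE X in lebesgue_on \<Omega>. fst X \<in> ?I \<longrightarrow> \<bar>b (fst X)\<bar> \<le> M" by simp
  moreover have "AE X in lebesgue_on \<Omega>. fst X \<in> ?I" using fst_dom by (intro AE_I2) auto
  ultimately have "AE X in lebesgue_on \<Omega>. \<bar>b (fst X)\<bar> \<le> M" by eventually_elim simp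
  then show "\<exists>M. AE X in lebesgue_on \<Omega>. \<bar>b (fst X)\<bar> \<le> M" by blast
qed

end

text \<open>Orbits are differentiated from the right only, so the mean value theorem does not apply.
  Instead a line of small positive slope is subtracted; at the last point where the result is at
  most 0 its right derivative is negative, so it stays at most 0 a little longer.\<close>

lemma nonincreasing_of_right_derivative:
  fixes F :: "real \<Rightarrow> real"
  assumes cont: "continuous_on {0..} F"
    and der: "\<And>s. s \<ge> 0 \<Longrightarrow> \<exists>D\<le>0. (F has_real_derivative D) (at_right s)"
    and "t \<ge> 0"
  shows "F t \<le> F 0"
proof (rule ccontr)
  assume "\<not> F t \<le> F 0"
  then have Ft: "F t > F 0" by simp
  then have t: "t > 0" using \<open>t \<ge> 0\<close> by (cases "t = 0") auto
  \<comment> \<open>Half the mean slope: \<open>G\<close> is still positive at t, and its right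
    derivatives are at most -k.\<close>
  define k where "k = (F t - F 0) / (2 * t)"
  have k: "k > 0" using Ft t by (simp add: k_def)
  define G where "G s = F s - F 0 - k * s" for s
  have G0: "G 0 = 0" by (simp add: G_def)
  have Gt: "G t > 0" using Ft t by (simp add: G_def k_def field_simps)
  have contG: "continuous_on {0..t} G"
    unfolding G_def[abs_def] using continuous_on_subset[OF cont, of "{0..t}"]
    by (intro continuous_intros) auto
  define A where "A = {s\<in>{0..t}. G s \<le> 0}"
  have "closed A"
    unfolding A_def using continuous_closed_preimage[OF contG, of "{..0}"]
    by (simp add: vimage_def Int_def conj_commute)
  moreover have "bounded A" by (rule bounded_subset[of "{0..t}"]) (auto simp: A_def)
  ultimately have "compact A" by (simp add: compact_eq_bounded_closed)
  moreover have "0 \<in> A" using G0 t by (simp add: A_def)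
  ultimately obtain s where s: "s \<in> A" "\<And>r. r \<in> A \<Longrightarrow> r \<le> s"
    using compact_attains_sup[of A] by blast
  have sb: "0 \<le> s" "s < t" "G s \<le> 0"
    using s(1) Gt by (auto simp: A_def less_le)
  obtain D where D: "D \<le> 0" "(F has_real_derivative D) (at_right s)" using der[OF sb(1)] by blast
  have "(G has_real_derivative D - k) (at_right s)"
    unfolding G_def[abs_def] by (auto intro!: derivative_eq_intros D(2))
  moreover have "D - k < 0" using D(1) k by simp
  ultimately have "((\<lambda>y. (G y - G s) / (y - s)) \<longlongrightarrow> D - k) (at_right s)"
    by (simp add: has_field_derivative_iff)
  then have "\<forall>\<^sub>F y in at_right s. (G y - G s) / (y - s) < 0"
    using \<open>D - k < 0\<close> by (rule order_tendstoD)
  moreover have "\<forall>\<^sub>F y in at_right s. s < y \<and> y < t"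
    using eventually_at_right_real[OF sb(2)] by eventually_elim simp
  ultimately have "\<forall>\<^sub>F y in at_right s. G y < G s \<and> s < y \<and> y < t"
    by eventually_elim (auto simp: divide_less_0_iff)
  then obtain y where "G y < G s" "s < y" "y < t"
    using eventually_happens[of _ "at_right s"] trivial_limit_at_right_real by blast
  then show False using s(2)[of y] sb by (auto simp: A_def)
qed

text \<open>All assumptions on the coefficients are phrased almost everywhere on the cylinder, with
  one upper bound \<open>M\<close>, and one lower bound \<open>m\<close> for both dampings on the
  strip between \<open>l\<close> and \<open>r\<close>, which carries the coupling. In the theorem
  this strip is \<open>(\<alpha>\<^sub>1, \<alpha>\<^sub>4)\<close>.\<close>

locale wave = cylinder \<omega> \<Omega>
  for \<omega> :: "'b::euclidean_space set" and \<Omega> :: "(real \<times> 'b) set" +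
  fixes a :: real and b c d :: "real \<Rightarrow> real" and T :: "real \<Rightarrow> (real \<times> 'b) state \<Rightarrow> (real \<times> 'b) state"
    and M m l r :: real
  assumes a_pos: "a > 0" and m_pos: "m > 0" and M_pos: "M > 0"
    and l_nonneg: "0 \<le> l" and l_r: "l < r" and r_le: "r \<le> 1"
    and meas: "(\<lambda>X. complex_of_real (b (fst X))) \<in> borel_measurable (lebesgue_on \<Omega>)"
      "(\<lambda>X. complex_of_real (c (fst X))) \<in> borel_measurable (lebesgue_on \<Omega>)"
      "(\<lambda>X. complex_of_real (d (fst X))) \<in> borel_measurable (lebesgue_on \<Omega>)"
    and b_bounds: "AE X in lebesgue_on \<Omega>. 0 \<le> b (fst X) \<and> b (fst X) \<le> M"
    and d_bounds: "AE X in lebesgue_on \<Omega>. 0 \<le> d (fst X) \<and> d (fst X) \<le> M"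
    and c_bounds: "AE X in lebesgue_on \<Omega>. \<bar>c (fst X)\<bar> \<le> M"
    and damped: "AE X in lebesgue_on \<Omega>. fst X \<in> {l<..<r} \<longrightarrow> m \<le> b (fst X) \<and> m \<le> d (fst X)"
    and c_support: "AE X in lebesgue_on \<Omega>. fst X \<notin> {l<..<r} \<longrightarrow> c (fst X) = 0"
    and semigroup: "wave_semigroup \<Omega> a b c d T"
begin

abbreviation E :: "(real \<times> 'b) state set" where "E \<equiv> energy_space \<Omega>"
abbreviation N :: "(real \<times> 'b) state \<Rightarrow> real" where "N \<equiv> energy_norm \<Omega> a"
abbreviation A :: "(real \<times> 'b) state \<Rightarrow> (real \<times> 'b) state" where "A \<equiv> wave_op \<Omega> a b c d"
abbreviation D :: "real \<times> 'b \<Rightarrow> (real \<times> 'b \<Rightarrow> complex) \<Rightarrow> real \<times> 'b \<Rightarrow> complex" where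
  "D \<equiv> weak_partial \<Omega>"

text \<open>The squared energy norm split into norms of components, so that it can be differentiated
  along an orbit term by term; the two agree on \<open>E\<close>.\<close>

definition sq :: "(real \<times> 'b) state \<Rightarrow> real" where
  "sq U = (\<Sum>i\<in>Basis. (nrm \<Omega> (D i (fst U)))\<^sup>2) + (nrm \<Omega> (fst (snd U)))\<^sup>2
    + a * (\<Sum>i\<in>Basis. (nrm \<Omega> (D i (fst (snd (snd U)))))\<^sup>2) + (nrm \<Omega> (snd (snd (snd U))))\<^sup>2"

lemma E_iff: "U \<in> E \<longleftrightarrow> fst U \<in> H10 \<Omega> \<and> fst (snd U) \<in> L2 \<Omega> \<and> fst (snd (snd U)) \<in> H10 \<Omega> \<and> snd (snd (snd U)) \<in> L2 \<Omega>"
  by (cases U) (auto simp: energy_space_def)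

lemma integral_sq_sum:
  assumes "\<phi> \<in> H10 \<Omega>" "v \<in> L2 \<Omega>" "\<psi> \<in> H10 \<Omega>" "z \<in> L2 \<Omega>"
  shows "(\<integral>x. (grad_norm \<Omega> \<phi> x)\<^sup>2 + (cmod (v x))\<^sup>2 + a * (grad_norm \<Omega> \<psi> x)\<^sup>2 + (cmod (z x))\<^sup>2 \<partial>lebesgue_on \<Omega>)
    = sq (\<phi>, v, \<psi>, z)"
proof -
  have D: "integrable (lebesgue_on \<Omega>) (\<lambda>x. (cmod (D i u x))\<^sup>2)" if "u \<in> H10 \<Omega>" "i \<in> Basis" for u i
    by (rule L2_integrable[OF H10_weak_partial_L2[OF that]])
  have g: "integrable (lebesgue_on \<Omega>) (\<lambda>x. (grad_norm \<Omega> u x)\<^sup>2)"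
      "(\<integral>x. (grad_norm \<Omega> u x)\<^sup>2 \<partial>lebesgue_on \<Omega>) = (\<Sum>i\<in>Basis. (nrm \<Omega> (D i u))\<^sup>2)" if "u \<in> H10 \<Omega>" for u
    unfolding grad_norm_sq nrm_sq_integral using D[OF that]
    by (auto simp: Bochner_Integration.integral_sum intro!: Bochner_Integration.integrable_sum)
  show ?thesis
    using g[OF assms(1)] g[OF assms(3)] L2_integrable[OF assms(2)] L2_integrable[OF assms(4)]
    by (simp add: sq_def nrm_sq_integral)
qed

lemma sq_nonneg: "0 \<le> sq U"
  using a_pos by (simp add: sq_def sum_nonneg)

lemma N_eq:
  assumes "U \<in> E" shows "N U = sqrt (sq U)"
proof -
  obtain \<phi> v \<psi> z where U: "U = (\<phi>, v, \<psi>, z)" by (cases U) auto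
  have H: "\<phi> \<in> H10 \<Omega>" "v \<in> L2 \<Omega>" "\<psi> \<in> H10 \<Omega>" "z \<in> L2 \<Omega>" using assms by (auto simp: U energy_space_def)
  have gd: "grad_dot \<Omega> u u x = complex_of_real ((grad_norm \<Omega> u x)\<^sup>2)" for u x
    unfolding grad_dot_def grad_norm_sq of_real_sum complex_norm_square ..
  have "energy_inner \<Omega> a U U
      = (\<integral>x. complex_of_real ((grad_norm \<Omega> \<phi> x)\<^sup>2 + (cmod (v x))\<^sup>2 + a * (grad_norm \<Omega> \<psi> x)\<^sup>2 + (cmod (z x))\<^sup>2) \<partial>lebesgue_on \<Omega>)"
    unfolding U energy_inner.simps gd complex_norm_square[symmetric] of_real_add of_real_mult ..
  then have "Re (energy_inner \<Omega> a U U) = sq U"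
    unfolding integral_complex_of_real integral_sq_sum[OF H] U by simp
  then show ?thesis by (simp add: energy_norm_def)
qed

lemma N_sq: "U \<in> E \<Longrightarrow> (N U)\<^sup>2 = sq U"
  by (simp add: N_eq sq_nonneg)

lemma energy_eq: "U \<in> E \<Longrightarrow> energy \<Omega> a U = 1/2 * sq U"
  by (cases U) (auto simp: energy_space_def integral_sq_sum)

lemma N_nonneg: "U \<in> E \<Longrightarrow> 0 \<le> N U"
  by (simp add: N_eq sq_nonneg)

lemma E_add: "U \<in> E \<Longrightarrow> V \<in> E \<Longrightarrow> state_add U V \<in> E"
  by (cases U; cases V) (auto simp: energy_space_def intro: H10_add L2_add)

lemma E_scale: "U \<in> E \<Longrightarrow> state_scale k U \<in> E"
  by (cases U) (auto simp: energy_space_def intro: H10_cmult L2_cmult)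

lemma E_diff: "U \<in> E \<Longrightarrow> V \<in> E \<Longrightarrow> state_diff U V \<in> E"
  unfolding state_diff_def by (intro E_add E_scale)

section \<open>Vector operations on states modulo null sets\<close>

lemma state_add_simps [simp]:
  "fst (state_add U V) = (\<lambda>x. fst U x + fst V x)"
  "fst (snd (state_add U V)) = (\<lambda>x. fst (snd U) x + fst (snd V) x)"
  "fst (snd (snd (state_add U V))) = (\<lambda>x. fst (snd (snd U)) x + fst (snd (snd V)) x)"
  "snd (snd (snd (state_add U V))) = (\<lambda>x. snd (snd (snd U)) x + snd (snd (snd V)) x)"
  by (cases U; cases V; simp)+

lemma state_scale_simps [simp]:
  "fst (state_scale k U) = (\<lambda>x. k * fst U x)"
  "fst (snd (state_scale k U)) = (\<lambda>x. k * fst (snd U) x)"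
  "fst (snd (snd (state_scale k U))) = (\<lambda>x. k * fst (snd (snd U)) x)"
  "snd (snd (snd (state_scale k U))) = (\<lambda>x. k * snd (snd (snd U)) x)"
  by (cases U; simp)+

lemma state_eq_iff: "state_eq \<Omega> U V \<longleftrightarrow> (AE x in lebesgue_on \<Omega>. fst U x = fst V x \<and>
    fst (snd U) x = fst (snd V) x \<and> fst (snd (snd U)) x = fst (snd (snd V)) x \<and>
    snd (snd (snd U)) x = snd (snd (snd V)) x)"
  by (cases U; cases V) simp

lemma state_eqD:
  assumes "state_eq \<Omega> U V"
  shows "AE x in lebesgue_on \<Omega>. fst U x = fst V x"
    "AE x in lebesgue_on \<Omega>. fst (snd U) x = fst (snd V) x"
    "AE x in lebesgue_on \<Omega>. fst (snd (snd U)) x = fst (snd (snd V)) x"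
    "AE x in lebesgue_on \<Omega>. snd (snd (snd U)) x = snd (snd (snd V)) x"
  using assms unfolding state_eq_iff by (eventually_elim, simp)+

lemma state_eq_refl: "state_eq \<Omega> U U"
  by (simp add: state_eq_iff)

lemma state_eq_sym:
  assumes "state_eq \<Omega> U V" shows "state_eq \<Omega> V U"
  using assms unfolding state_eq_iff by eventually_elim simp

lemma state_eq_trans [trans]:
  assumes "state_eq \<Omega> U V" "state_eq \<Omega> V W" shows "state_eq \<Omega> U W"
  using assms unfolding state_eq_iff by eventually_elim simp

lemma state_eq_add:
  assumes "state_eq \<Omega> U U'" "state_eq \<Omega> V V'" shows "state_eq \<Omega> (state_add U V) (state_add U' V')"
  using assms unfolding state_eq_iff by eventually_elim simp

lemma state_eq_scale:
  assumes "state_eq \<Omega> U V" shows "state_eq \<Omega> (state_scale k U) (state_scale k V)"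
  using assms unfolding state_eq_iff by eventually_elim simp

lemma state_eq_diff: "state_eq \<Omega> U U' \<Longrightarrow> state_eq \<Omega> V V' \<Longrightarrow> state_eq \<Omega> (state_diff U V) (state_diff U' V')"
  unfolding state_diff_def by (intro state_eq_add state_eq_scale)

text \<open>A bounded linear map from the energy space to L2, everything up to null sets: a
  component of the state, one of its derivatives, or a weighted version of these. Continuity and
  differentiability along orbits are proved once for all such maps.\<close>

definition good :: "((real \<times> 'b) state \<Rightarrow> real \<times> 'b \<Rightarrow> complex) \<Rightarrow> bool" where
  "good g \<longleftrightarrow> (\<forall>U\<in>E. g U \<in> L2 \<Omega>) \<and> (\<exists>L\<ge>0. \<forall>U\<in>E. nrm \<Omega> (g U) \<le> L * N U) \<and>
     (\<forall>U\<in>E. \<forall>V\<in>E. AE x in lebesgue_on \<Omega>. g (state_add U V) x = g U x + g V x) \<and>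
     (\<forall>U\<in>E. \<forall>k. AE x in lebesgue_on \<Omega>. g (state_scale k U) x = k * g U x) \<and>
     (\<forall>U\<in>E. \<forall>V\<in>E. state_eq \<Omega> U V \<longrightarrow> (AE x in lebesgue_on \<Omega>. g U x = g V x))"

lemma goodD:
  assumes "good g"
  shows "\<forall>U\<in>E. g U \<in> L2 \<Omega>"
    and "\<exists>L\<ge>0. \<forall>U\<in>E. nrm \<Omega> (g U) \<le> L * N U"
    and "\<forall>U\<in>E. \<forall>V\<in>E. AE x in lebesgue_on \<Omega>. g (state_add U V) x = g U x + g V x"
    and "\<forall>U\<in>E. \<forall>k. AE x in lebesgue_on \<Omega>. g (state_scale k U) x = k * g U x"
    and "\<forall>U\<in>E. \<forall>V\<in>E. state_eq \<Omega> U V \<longrightarrow> (AE x in lebesgue_on \<Omega>. g U x = g V x)"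
proof -
  note g = assms[unfolded good_def]
  show "\<forall>U\<in>E. g U \<in> L2 \<Omega>"
    by (rule g[THEN conjunct1])
  show "\<exists>L\<ge>0. \<forall>U\<in>E. nrm \<Omega> (g U) \<le> L * N U"
    by (rule g[THEN conjunct2, THEN conjunct1])
  show "\<forall>U\<in>E. \<forall>V\<in>E. AE x in lebesgue_on \<Omega>. g (state_add U V) x = g U x + g V x"
    by (rule g[THEN conjunct2, THEN conjunct2, THEN conjunct1])
  show "\<forall>U\<in>E. \<forall>k. AE x in lebesgue_on \<Omega>. g (state_scale k U) x = k * g U x"
    by (rule g[THEN conjunct2, THEN conjunct2, THEN conjunct2, THEN conjunct1])
  show "\<forall>U\<in>E. \<forall>V\<in>E. state_eq \<Omega> U V \<longrightarrow> (AE x in lebesgue_on \<Omega>. g U x = g V x)"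
    by (rule g[THEN conjunct2, THEN conjunct2, THEN conjunct2, THEN conjunct2])
qed

lemmas good_bound = goodD(2)
lemmas good_L2 = goodD(1)[rule_format]
lemmas good_add = goodD(3)[rule_format]
lemmas good_scale = goodD(4)[rule_format]
lemmas good_cong = goodD(5)[rule_format]

lemma nrm_le_N:
  assumes "(nrm \<Omega> u)\<^sup>2 \<le> sq U" "U \<in> E" shows "nrm \<Omega> u \<le> N U"
proof (rule power2_le_imp_le[OF _ N_nonneg[OF assms(2)]])
  show "(nrm \<Omega> u)\<^sup>2 \<le> (N U)\<^sup>2" unfolding N_sq[OF assms(2)] by (rule assms(1))
qed

lemma sum_bound:
  assumes "i \<in> Basis" shows "(nrm \<Omega> (D i u))\<^sup>2 \<le> (\<Sum>i\<in>Basis. (nrm \<Omega> (D i u))\<^sup>2)"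
  by (rule member_le_sum[OF assms]) auto

lemma good_D\<phi>:
  assumes i: "i \<in> Basis" shows "good (\<lambda>U. D i (fst U))"
  unfolding good_def
proof (intro conjI ballI allI impI exI[of _ 1])
  fix U assume U: "U \<in> E"
  then have u: "fst U \<in> H10 \<Omega>" by (simp add: E_iff)
  then show "D i (fst U) \<in> L2 \<Omega>" by (rule H10_weak_partial_L2[OF _ i])
  have "(nrm \<Omega> (D i (fst U)))\<^sup>2 \<le> sq U"
    using sum_bound[OF i, of "fst U"] a_pos unfolding sq_def
    by (smt (verit) mult_nonneg_nonneg sum_nonneg zero_le_power2)
  then show "nrm \<Omega> (D i (fst U)) \<le> 1 * N U" using nrm_le_N[OF _ U] by simp
  show "AE x in lebesgue_on \<Omega>. D i (fst (state_scale k U)) x = k * D i (fst U) x" for k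
    using weak_partial_cmult[OF H10_H1[OF u] i, of k] by simp
  fix V assume V: "V \<in> E"
  then have v: "fst V \<in> H10 \<Omega>" by (simp add: E_iff)
  show "AE x in lebesgue_on \<Omega>. D i (fst (state_add U V)) x = D i (fst U) x + D i (fst V) x"
    using weak_partial_add[OF H10_H1[OF u] H10_H1[OF v] i] by simp
  show "AE x in lebesgue_on \<Omega>. D i (fst U) x = D i (fst V) x" if "state_eq \<Omega> U V"
    using that by (intro weak_partial_cong_AE[OF H10_H1[OF u] H10_H1[OF v] i] state_eqD)
qed simp

lemma good_D\<psi>:
  assumes i: "i \<in> Basis" shows "good (\<lambda>U. D i (fst (snd (snd U))))"
  unfolding good_def
proof (intro conjI ballI allI impI exI[of _ "1 / sqrt a"])
  fix U assume U: "U \<in> E"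
  then have u: "fst (snd (snd U)) \<in> H10 \<Omega>" by (simp add: E_iff)
  then show "D i (fst (snd (snd U))) \<in> L2 \<Omega>" by (rule H10_weak_partial_L2[OF _ i])
  have "a * (nrm \<Omega> (D i (fst (snd (snd U)))))\<^sup>2 \<le> a * (\<Sum>i\<in>Basis. (nrm \<Omega> (D i (fst (snd (snd U)))))\<^sup>2)"
    using sum_bound[OF i] a_pos by (intro mult_left_mono) auto
  then have "a * (nrm \<Omega> (D i (fst (snd (snd U)))))\<^sup>2 \<le> sq U"
    using sum_nonneg[of Basis "\<lambda>i. (nrm \<Omega> (D i (fst U)))\<^sup>2"] unfolding sq_def
    by (smt (verit) zero_le_power2)
  then have "(sqrt a * nrm \<Omega> (D i (fst (snd (snd U)))))\<^sup>2 \<le> (N U)\<^sup>2"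
    using a_pos N_sq[OF U] by (simp add: power_mult_distrib)
  then have "sqrt a * nrm \<Omega> (D i (fst (snd (snd U)))) \<le> N U"
    by (rule power2_le_imp_le) (rule N_nonneg[OF U])
  then show "nrm \<Omega> (D i (fst (snd (snd U)))) \<le> 1 / sqrt a * N U"
    using a_pos by (simp add: field_simps)
  show "AE x in lebesgue_on \<Omega>. D i (fst (snd (snd (state_scale k U)))) x = k * D i (fst (snd (snd U))) x" for k
    using weak_partial_cmult[OF H10_H1[OF u] i, of k] by simp
  fix V assume V: "V \<in> E"
  then have v: "fst (snd (snd V)) \<in> H10 \<Omega>" by (simp add: E_iff)
  show "AE x in lebesgue_on \<Omega>. D i (fst (snd (snd (state_add U V)))) x = D i (fst (snd (snd U))) x + D i (fst (snd (snd V))) x"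
    using weak_partial_add[OF H10_H1[OF u] H10_H1[OF v] i] by simp
  show "AE x in lebesgue_on \<Omega>. D i (fst (snd (snd U))) x = D i (fst (snd (snd V))) x" if "state_eq \<Omega> U V"
    using that by (intro weak_partial_cong_AE[OF H10_H1[OF u] H10_H1[OF v] i] state_eqD)
qed (use a_pos in simp)

lemma good_v: "good (\<lambda>U. fst (snd U))"
  unfolding good_def
proof (intro conjI ballI allI impI exI[of _ 1])
  fix U assume U: "U \<in> E"
  then show "fst (snd U) \<in> L2 \<Omega>" by (simp add: E_iff)
  have "(nrm \<Omega> (fst (snd U)))\<^sup>2 \<le> sq U"
    using a_pos sum_nonneg[of Basis "\<lambda>i. (nrm \<Omega> (D i (fst U)))\<^sup>2"]
      mult_nonneg_nonneg[of a "\<Sum>i\<in>Basis. (nrm \<Omega> (D i (fst (snd (snd U)))))\<^sup>2"]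
      sum_nonneg[of Basis "\<lambda>i. (nrm \<Omega> (D i (fst (snd (snd U)))))\<^sup>2"]
    by (simp add: sq_def)
  then show "nrm \<Omega> (fst (snd U)) \<le> 1 * N U" using nrm_le_N[OF _ U] by simp
qed (auto dest: state_eqD)

lemma good_z: "good (\<lambda>U. snd (snd (snd U)))"
  unfolding good_def
proof (intro conjI ballI allI impI exI[of _ 1])
  fix U assume U: "U \<in> E"
  then show "snd (snd (snd U)) \<in> L2 \<Omega>" by (simp add: E_iff)
  have "(nrm \<Omega> (snd (snd (snd U))))\<^sup>2 \<le> sq U"
    using a_pos sum_nonneg[of Basis "\<lambda>i. (nrm \<Omega> (D i (fst U)))\<^sup>2"]
      mult_nonneg_nonneg[of a "\<Sum>i\<in>Basis. (nrm \<Omega> (D i (fst (snd (snd U)))))\<^sup>2"]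
      sum_nonneg[of Basis "\<lambda>i. (nrm \<Omega> (D i (fst (snd (snd U)))))\<^sup>2"]
    by (simp add: sq_def)
  then show "nrm \<Omega> (snd (snd (snd U))) \<le> 1 * N U" using nrm_le_N[OF _ U] by simp
qed (auto dest: state_eqD)

text \<open>The energy norm contains the gradient of this component but not the component itself;
  the Poincare inequality supplies the bound.\<close>

lemma good_\<phi>: "good (\<lambda>U. fst U)"
proof -
  obtain L where L: "L \<ge> 0" "\<forall>U\<in>E. nrm \<Omega> (D e (fst U)) \<le> L * N U"
    using good_bound[OF good_D\<phi>[OF e_Basis]] by blast
  show ?thesis
    unfolding good_def
  proof (intro conjI ballI allI impI exI[of _ "2 * L"])
    fix U assume U: "U \<in> E"
    then show "fst U \<in> L2 \<Omega>" by (simp add: E_iff H10_L2)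
    show "nrm \<Omega> (fst U) \<le> 2 * L * N U"
      using poincare[of "fst U"] L(2)[rule_format, OF U] U by (simp add: E_iff)
  qed (use L(1) in \<open>auto dest: state_eqD\<close>)
qed

lemma good_\<psi>: "good (\<lambda>U. fst (snd (snd U)))"
proof -
  obtain L where L: "L \<ge> 0" "\<forall>U\<in>E. nrm \<Omega> (D e (fst (snd (snd U)))) \<le> L * N U"
    using good_bound[OF good_D\<psi>[OF e_Basis]] by blast
  show ?thesis
    unfolding good_def
  proof (intro conjI ballI allI impI exI[of _ "2 * L"])
    fix U assume U: "U \<in> E"
    then show "fst (snd (snd U)) \<in> L2 \<Omega>" by (simp add: E_iff H10_L2)
    show "nrm \<Omega> (fst (snd (snd U))) \<le> 2 * L * N U"
      using poincare[of "fst (snd (snd U))"] L(2)[rule_format, OF U] U by (simp add: E_iff)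
  qed (use L(1) in \<open>auto dest: state_eqD\<close>)
qed

lemma good_diff:
  assumes "good g" "U \<in> E" "V \<in> E"
  shows "AE x in lebesgue_on \<Omega>. g (state_diff U V) x = g U x - g V x"
proof -
  have "AE x in lebesgue_on \<Omega>. g (state_diff U V) x = g U x + g (state_scale (-1) V) x"
    unfolding state_diff_def by (rule good_add[OF assms(1,2) E_scale[OF assms(3)]])
  moreover have "AE x in lebesgue_on \<Omega>. g (state_scale (-1) V) x = (-1) * g V x"
    by (rule good_scale[OF assms(1,3)])
  ultimately show ?thesis by eventually_elim simp
qed

lemma good_nrm_diff:
  assumes "good g" "U \<in> E" "V \<in> E"
  shows "nrm \<Omega> (\<lambda>x. g U x - g V x) = nrm \<Omega> (g (state_diff U V))"
  by (rule nrm_cong_AE[symmetric, OF good_L2[OF assms(1) E_diff[OF assms(2,3)]]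
        L2_diff[OF good_L2[OF assms(1,2)] good_L2[OF assms(1,3)]] good_diff[OF assms]])

lemma nrm_sq_add_le:
  assumes "u \<in> L2 \<Omega>" "v \<in> L2 \<Omega>" "w \<in> L2 \<Omega>" "AE x in lebesgue_on \<Omega>. w x = u x + v x"
  shows "(nrm \<Omega> w)\<^sup>2 \<le> 2 * (nrm \<Omega> u)\<^sup>2 + 2 * (nrm \<Omega> v)\<^sup>2"
proof -
  have "nrm \<Omega> w = nrm \<Omega> (\<lambda>x. u x + v x)"
    by (rule nrm_cong_AE[OF assms(3) L2_add[OF assms(1,2)] assms(4)])
  then have "nrm \<Omega> w \<le> nrm \<Omega> u + nrm \<Omega> v" using nrm_triangle[OF assms(1,2)] by simp
  then have "(nrm \<Omega> w)\<^sup>2 \<le> (nrm \<Omega> u + nrm \<Omega> v)\<^sup>2" by (intro power_mono nrm_nonneg)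
  also have "\<dots> \<le> 2 * (nrm \<Omega> u)\<^sup>2 + 2 * (nrm \<Omega> v)\<^sup>2"
    using sum_squares_bound[of "nrm \<Omega> u" "nrm \<Omega> v"] by (simp add: power2_sum)
  finally show ?thesis .
qed

lemma good_sq_add_le:
  assumes "good g" "U \<in> E" "V \<in> E"
  shows "(nrm \<Omega> (g (state_add U V)))\<^sup>2 \<le> 2 * (nrm \<Omega> (g U))\<^sup>2 + 2 * (nrm \<Omega> (g V))\<^sup>2"
  by (rule nrm_sq_add_le[OF good_L2[OF assms(1,2)] good_L2[OF assms(1,3)] good_L2[OF assms(1) E_add[OF assms(2,3)]]
        good_add[OF assms]])

lemma sq_add_le:
  assumes U: "U \<in> E" and V: "V \<in> E"
  shows "sq (state_add U V) \<le> 2 * sq U + 2 * sq V"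
proof -
  note le = good_sq_add_le[OF _ U V]
  have "(\<Sum>i\<in>Basis. (nrm \<Omega> (D i (fst (state_add U V))))\<^sup>2)
      \<le> (\<Sum>i\<in>Basis. 2 * (nrm \<Omega> (D i (fst U)))\<^sup>2 + 2 * (nrm \<Omega> (D i (fst V)))\<^sup>2)"
    by (intro sum_mono le good_D\<phi>)
  moreover have "a * (\<Sum>i\<in>Basis. (nrm \<Omega> (D i (fst (snd (snd (state_add U V))))))\<^sup>2)
      \<le> a * (\<Sum>i\<in>Basis. 2 * (nrm \<Omega> (D i (fst (snd (snd U)))))\<^sup>2 + 2 * (nrm \<Omega> (D i (fst (snd (snd V)))))\<^sup>2)"
    using a_pos by (intro mult_left_mono sum_mono le good_D\<psi>) auto
  moreover note le[OF good_v] le[OF good_z]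
  ultimately show ?thesis
    by (simp add: sq_def sum.distrib sum_distrib_left[symmetric] algebra_simps)
qed

text \<open>The constant 2 is immaterial below, which makes the sharp triangle inequality unnecessary.\<close>

lemma N_add_le:
  assumes U: "U \<in> E" and V: "V \<in> E"
  shows "N (state_add U V) \<le> 2 * (N U + N V)"
proof (rule power2_le_imp_le)
  have "(N (state_add U V))\<^sup>2 \<le> 2 * (N U)\<^sup>2 + 2 * (N V)\<^sup>2"
    using sq_add_le[OF U V] by (simp add: N_sq U V E_add)
  also have "\<dots> \<le> (2 * (N U + N V))\<^sup>2"
    using N_nonneg[OF U] N_nonneg[OF V] by (simp add: power2_eq_square algebra_simps)
  finally show "(N (state_add U V))\<^sup>2 \<le> (2 * (N U + N V))\<^sup>2" .
  show "0 \<le> 2 * (N U + N V)" using N_nonneg[OF U] N_nonneg[OF V] by simp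
qed

lemma N_cong:
  assumes "U \<in> E" "V \<in> E" and n: "\<And>g. good g \<Longrightarrow> nrm \<Omega> (g U) = nrm \<Omega> (g V)"
  shows "N U = N V"
proof -
  have "(\<Sum>i\<in>Basis. (nrm \<Omega> (D i (fst U)))\<^sup>2) = (\<Sum>i\<in>Basis. (nrm \<Omega> (D i (fst V)))\<^sup>2)"
    by (rule sum.cong[OF refl]) (simp only: n[OF good_D\<phi>])
  moreover have "(\<Sum>i\<in>Basis. (nrm \<Omega> (D i (fst (snd (snd U)))))\<^sup>2) = (\<Sum>i\<in>Basis. (nrm \<Omega> (D i (fst (snd (snd V)))))\<^sup>2)"
    by (rule sum.cong[OF refl]) (simp only: n[OF good_D\<psi>])
  ultimately have "sq U = sq V"
    unfolding sq_def n[OF good_v] n[OF good_z] by (simp only:)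
  then show ?thesis by (simp only: N_eq[OF assms(1)] N_eq[OF assms(2)])
qed

lemma N_state_eq:
  assumes "U \<in> E" "V \<in> E" "state_eq \<Omega> U V" shows "N U = N V"
  by (rule N_cong[OF assms(1,2)], rule nrm_cong_AE)
     (rule good_L2[OF _ assms(1)] good_L2[OF _ assms(2)] good_cong[OF _ assms]; assumption)+

lemma state_eqI:
  "fst U = fst V \<Longrightarrow> fst (snd U) = fst (snd V) \<Longrightarrow> fst (snd (snd U)) = fst (snd (snd V)) \<Longrightarrow>
    snd (snd (snd U)) = snd (snd (snd V)) \<Longrightarrow> U = V" for U V :: "(real \<times> 'b) state"
  by (simp add: prod_eq_iff)

lemma state_diff_split: "state_diff U W = state_add (state_diff U V) (state_diff V W)"
  for U V W :: "(real \<times> 'b) state"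
  by (rule state_eqI) (simp_all add: state_diff_def)

lemma N_diff_triangle:
  assumes "U \<in> E" "V \<in> E" "W \<in> E"
  shows "N (state_diff U W) \<le> 2 * (N (state_diff U V) + N (state_diff V W))"
  unfolding state_diff_split[of U W V] by (intro N_add_le E_diff assms)

lemma N_le_diff:
  assumes "U \<in> E" "V \<in> E"
  shows "N U \<le> 2 * (N V + N (state_diff U V))"
proof -
  have "U = state_add V (state_diff U V)"
    by (rule state_eqI) (simp_all add: state_diff_def)
  then show ?thesis using N_add_le[OF assms(2) E_diff[OF assms]] by simp
qed

lemma N_diff_commute:
  assumes "U \<in> E" "V \<in> E" shows "N (state_diff U V) = N (state_diff V U)"
proof (rule N_cong[OF E_diff[OF assms] E_diff[OF assms(2,1)]])
  fix g assume g: "good g"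
  show "nrm \<Omega> (g (state_diff U V)) = nrm \<Omega> (g (state_diff V U))"
    unfolding good_nrm_diff[OF g assms, symmetric] good_nrm_diff[OF g assms(2,1), symmetric]
    by (rule nrm_minus_commute)
qed

end

section \<open>Orbits of the semigroup and their differentiability\<close>

context wave
begin

lemma C0: "C0_semigroup \<Omega> a T"
  by (rule semigroup[unfolded wave_semigroup_def, THEN conjunct1])

lemma generator:
  assumes "U \<in> E" "V \<in> E"
  shows "has_generator_value \<Omega> a T U V \<longleftrightarrow> U \<in> wave_dom \<Omega> \<and> state_eq \<Omega> V (A U)"
  using semigroup[unfolded wave_semigroup_def, THEN conjunct2, rule_format, OF assms] .

lemma C0D:
  shows "\<forall>t\<ge>0. \<forall>U\<in>E. T t U \<in> E"
    and "\<forall>t\<ge>0. \<forall>U\<in>E. \<forall>V\<in>E. state_eq \<Omega> U V \<longrightarrow> state_eq \<Omega> (T t U) (T t V)"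
    and "\<forall>t\<ge>0. \<forall>U\<in>E. \<forall>V\<in>E. state_eq \<Omega> (T t (state_add U V)) (state_add (T t U) (T t V))"
    and "\<forall>t\<ge>0. \<forall>k. \<forall>U\<in>E. state_eq \<Omega> (T t (state_scale k U)) (state_scale k (T t U))"
    and "\<forall>t\<ge>0. \<exists>K. \<forall>U\<in>E. N (T t U) \<le> K * N U"
    and "\<forall>s\<ge>0. \<forall>t\<ge>0. \<forall>U\<in>E. state_eq \<Omega> (T (s + t) U) (T s (T t U))"
    and "\<forall>U\<in>E. ((\<lambda>t. N (state_diff (T t U) U)) \<longlongrightarrow> 0) (at_right 0)"
proof -
  note * = C0[unfolded C0_semigroup_def]
  show "\<forall>t\<ge>0. \<forall>U\<in>E. T t U \<in> E" using * by (elim conjE)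
  show "\<forall>t\<ge>0. \<forall>U\<in>E. \<forall>V\<in>E. state_eq \<Omega> U V \<longrightarrow> state_eq \<Omega> (T t U) (T t V)" using * by (elim conjE)
  show "\<forall>t\<ge>0. \<forall>U\<in>E. \<forall>V\<in>E. state_eq \<Omega> (T t (state_add U V)) (state_add (T t U) (T t V))" using * by (elim conjE)
  show "\<forall>t\<ge>0. \<forall>k. \<forall>U\<in>E. state_eq \<Omega> (T t (state_scale k U)) (state_scale k (T t U))" using * by (elim conjE)
  show "\<forall>t\<ge>0. \<exists>K. \<forall>U\<in>E. N (T t U) \<le> K * N U" using * by (elim conjE)
  show "\<forall>s\<ge>0. \<forall>t\<ge>0. \<forall>U\<in>E. state_eq \<Omega> (T (s + t) U) (T s (T t U))" using * by (elim conjE)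
  show "\<forall>U\<in>E. ((\<lambda>t. N (state_diff (T t U) U)) \<longlongrightarrow> 0) (at_right 0)" using * by (elim conjE)
qed

lemmas T_E = C0D(1)[rule_format]
  and T_cong = C0D(2)[rule_format]
  and T_add = C0D(3)[rule_format]
  and T_scale = C0D(4)[rule_format]
  and T_semigroup = C0D(6)[rule_format]
  and T_right_continuous_0 = C0D(7)[rule_format]

lemma T_bound:
  assumes "t \<ge> 0" shows "\<exists>K\<ge>0. \<forall>U\<in>E. N (T t U) \<le> K * N U"
proof -
  obtain K where K: "\<forall>U\<in>E. N (T t U) \<le> K * N U" using C0D(5) assms by blast
  have "N (T t U) \<le> max K 0 * N U" if U: "U \<in> E" for U
    using K[rule_format, OF U] mult_right_mono[of K "max K 0" "N U"] N_nonneg[OF U] by simp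
  then show ?thesis by (intro exI[of _ "max K 0"]) simp
qed

lemma T_diff:
  assumes "t \<ge> 0" "U \<in> E" "V \<in> E"
  shows "state_eq \<Omega> (T t (state_diff U V)) (state_diff (T t U) (T t V))"
  unfolding state_diff_def
  by (rule state_eq_trans[OF T_add[OF assms(1,2) E_scale[OF assms(3)]]
        state_eq_add[OF state_eq_refl T_scale[OF assms(1,3)]]])

lemma N_T_diff:
  assumes "t \<ge> 0" "U \<in> E" "V \<in> E"
  shows "N (state_diff (T t U) (T t V)) = N (T t (state_diff U V))"
  by (rule N_state_eq[symmetric, OF T_E[OF assms(1) E_diff[OF assms(2,3)]]
        E_diff[OF T_E[OF assms(1,2)] T_E[OF assms(1,3)]] T_diff[OF assms]])

lemma N_T_shift:
  assumes "t \<ge> 0" "h \<ge> 0" "U \<in> E"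
  shows "N (state_diff (T (t + h) U) (T t U)) = N (T t (state_diff (T h U) U))"
proof -
  have E: "T (t + h) U \<in> E" "T t U \<in> E" "T h U \<in> E" "T t (T h U) \<in> E"
    using assms by (simp_all add: T_E)
  have "N (state_diff (T (t + h) U) (T t U)) = N (state_diff (T t (T h U)) (T t U))"
    by (rule N_state_eq[OF E_diff[OF E(1,2)] E_diff[OF E(4,2)]
          state_eq_diff[OF T_semigroup[OF assms] state_eq_refl]])
  then show ?thesis using N_T_diff[OF assms(1) E(3) assms(3)] by simp
qed

lemma wave_dom_E: "U \<in> wave_dom \<Omega> \<Longrightarrow> U \<in> E"
  by (auto simp: wave_dom_def energy_space_def dom_laplacian_H10 H10_L2)

lemma mul_coeff_L2:
  assumes "u \<in> L2 \<Omega>"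
  shows "mul b u \<in> L2 \<Omega>" "mul c u \<in> L2 \<Omega>" "mul d u \<in> L2 \<Omega>"
proof -
  have "AE X in lebesgue_on \<Omega>. cmod (complex_of_real (b (fst X))) \<le> M"
    using b_bounds by eventually_elim simp
  then show "mul b u \<in> L2 \<Omega>" unfolding mul_def[abs_def] by (rule L2_mult_bounded[OF assms meas(1)])
  have "AE X in lebesgue_on \<Omega>. cmod (complex_of_real (c (fst X))) \<le> M"
    using c_bounds by eventually_elim simp
  then show "mul c u \<in> L2 \<Omega>" unfolding mul_def[abs_def] by (rule L2_mult_bounded[OF assms meas(2)])
  have "AE X in lebesgue_on \<Omega>. cmod (complex_of_real (d (fst X))) \<le> M"
    using d_bounds by eventually_elim simp
  then show "mul d u \<in> L2 \<Omega>" unfolding mul_def[abs_def] by (rule L2_mult_bounded[OF assms meas(3)])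
qed

text \<open>Damping and coupling together, read as a forcing of an undamped wave equation.
  \<open>force_le\<close> bounds both forcings by the dissipation.\<close>

definition force1 :: "(real \<times> 'b) state \<Rightarrow> real \<times> 'b \<Rightarrow> complex" where
  "force1 U = (\<lambda>X. mul b (fst (snd U)) X + mul c (snd (snd (snd U))) X)"

definition force2 :: "(real \<times> 'b) state \<Rightarrow> real \<times> 'b \<Rightarrow> complex" where
  "force2 U = (\<lambda>X. mul d (snd (snd (snd U))) X - mul c (fst (snd U)) X)"

lemma A_simps:
  "fst (A U) = fst (snd U)"
  "fst (snd (A U)) = (\<lambda>X. weak_laplacian \<Omega> (fst U) X - force1 U X)"
  "fst (snd (snd (A U))) = snd (snd (snd U))"
  "snd (snd (snd (A U))) = (\<lambda>X. of_real a * weak_laplacian \<Omega> (fst (snd (snd U))) X - force2 U X)"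
  by (cases U; simp add: force1_def force2_def mul_def fun_eq_iff)+

lemma wave_dom_iff: "U \<in> wave_dom \<Omega> \<longleftrightarrow> fst U \<in> dom_laplacian \<Omega> \<and> fst (snd U) \<in> H10 \<Omega> \<and>
    fst (snd (snd U)) \<in> dom_laplacian \<Omega> \<and> snd (snd (snd U)) \<in> H10 \<Omega>"
  by (cases U) (simp add: wave_dom_def)

lemma force_L2:
  assumes "U \<in> E" shows "force1 U \<in> L2 \<Omega>" "force2 U \<in> L2 \<Omega>"
  using assms unfolding force1_def force2_def E_iff
  by (auto intro!: L2_add L2_diff mul_coeff_L2)

lemma A_E: "U \<in> wave_dom \<Omega> \<Longrightarrow> A U \<in> E"
  unfolding E_iff A_simps
  using force_L2[OF wave_dom_E, of U]
  by (auto simp: wave_dom_iff intro!: L2_diff L2_cmult weak_laplacian_L2)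

lemma wave_domI:
  "fst U \<in> dom_laplacian \<Omega> \<Longrightarrow> fst (snd U) \<in> H10 \<Omega> \<Longrightarrow> fst (snd (snd U)) \<in> dom_laplacian \<Omega> \<Longrightarrow>
    snd (snd (snd U)) \<in> H10 \<Omega> \<Longrightarrow> U \<in> wave_dom \<Omega>"
  unfolding wave_dom_iff by (intro conjI)

lemma wave_domD:
  assumes "U \<in> wave_dom \<Omega>"
  shows "fst U \<in> dom_laplacian \<Omega>" "fst (snd U) \<in> H10 \<Omega>" "fst (snd (snd U)) \<in> dom_laplacian \<Omega>"
    "snd (snd (snd U)) \<in> H10 \<Omega>"
  using assms by (simp_all only: wave_dom_iff)

lemma wave_dom_scale: "U \<in> wave_dom \<Omega> \<Longrightarrow> state_scale k U \<in> wave_dom \<Omega>"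
  by (rule wave_domI; unfold state_scale_simps; rule H10_cmult dom_laplacian_cmult; rule wave_domD)

lemma wave_dom_add: "U \<in> wave_dom \<Omega> \<Longrightarrow> V \<in> wave_dom \<Omega> \<Longrightarrow> state_add U V \<in> wave_dom \<Omega>"
  by (rule wave_domI; unfold state_add_simps; rule H10_add dom_laplacian_add; rule wave_domD)

lemma wave_dom_diff: "U \<in> wave_dom \<Omega> \<Longrightarrow> V \<in> wave_dom \<Omega> \<Longrightarrow> state_diff U V \<in> wave_dom \<Omega>"
  unfolding state_diff_def by (rule wave_dom_add[OF _ wave_dom_scale])

text \<open>The difference quotient of an orbit at its start. For U in the domain it approximates
  \<open>A U\<close> while remaining in the domain, which \<open>A U\<close> need not do.\<close>

definition quot :: "real \<Rightarrow> (real \<times> 'b) state \<Rightarrow> (real \<times> 'b) state" where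
  "quot h U = state_scale (of_real (1 / h)) (state_diff (T h U) U)"

lemma quot_E: "h \<ge> 0 \<Longrightarrow> U \<in> E \<Longrightarrow> quot h U \<in> E"
  unfolding quot_def by (intro E_scale E_diff T_E)

lemma has_generator_value_quot:
  "has_generator_value \<Omega> a T U V \<longleftrightarrow> ((\<lambda>h. N (state_diff (quot h U) V)) \<longlongrightarrow> 0) (at_right 0)"
  by (simp add: has_generator_value_def quot_def)

lemma quot_T:
  assumes "t \<ge> 0" "h \<ge> 0" "U \<in> E"
  shows "state_eq \<Omega> (T t (quot h U)) (quot h (T t U))"
proof -
  have "state_eq \<Omega> (T t (quot h U)) (state_scale (of_real (1 / h)) (T t (state_diff (T h U) U)))"
    unfolding quot_def by (intro T_scale E_diff T_E assms)
  also have "state_eq \<Omega> \<dots> (quot h (T t U))"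
    unfolding quot_def
  proof (rule state_eq_scale)
    have "state_eq \<Omega> (T t (T h U)) (T (t + h) U)"
      by (rule state_eq_sym[OF T_semigroup[OF assms]])
    also have "state_eq \<Omega> (T (t + h) U) (T h (T t U))"
      using T_semigroup[OF assms(2,1,3)] by (simp add: add.commute)
    finally have "state_eq \<Omega> (state_diff (T t (T h U)) (T t U)) (state_diff (T h (T t U)) (T t U))"
      by (rule state_eq_diff[OF _ state_eq_refl])
    then show "state_eq \<Omega> (T t (state_diff (T h U) U)) (state_diff (T h (T t U)) (T t U))"
      by (rule state_eq_trans[OF T_diff[OF assms(1) T_E[OF assms(2,3)] assms(3)]])
  qed
  finally show ?thesis .
qed

text \<open>The operators of the semigroup commute with difference quotients, so
  \<open>T t U\<close> has the generator value \<open>T t (A U)\<close>. Because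
  \<open>wave_semigroup\<close> characterises generator values in both directions, this yields the
  invariance of the domain as well.\<close>

lemma generator_T:
  assumes U: "U \<in> wave_dom \<Omega>" and t: "t \<ge> 0"
  shows "T t U \<in> wave_dom \<Omega>" "state_eq \<Omega> (T t (A U)) (A (T t U))"
    "((\<lambda>h. N (state_diff (quot h (T t U)) (A (T t U)))) \<longlongrightarrow> 0) (at_right 0)"
proof -
  have UE: "U \<in> E" and AE: "A U \<in> E" using U wave_dom_E A_E by auto
  have TE: "T t U \<in> E" "T t (A U) \<in> E" using t UE AE by (simp_all add: T_E)
  obtain K where K: "K \<ge> 0" "\<forall>V\<in>E. N (T t V) \<le> K * N V" using T_bound[OF t] by blast
  have "has_generator_value \<Omega> a T U (A U)" using generator[OF UE AE] U state_eq_refl by simp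
  then have lim: "((\<lambda>h. N (state_diff (quot h U) (A U))) \<longlongrightarrow> 0) (at_right 0)"
    by (simp add: has_generator_value_quot)
  have "((\<lambda>h. N (state_diff (quot h (T t U)) (T t (A U)))) \<longlongrightarrow> 0) (at_right 0)"
  proof (rule Lim_null_comparison)
    show "((\<lambda>h. K * N (state_diff (quot h U) (A U))) \<longlongrightarrow> 0) (at_right 0)"
      by (rule tendsto_mult_right_zero[OF lim])
    show "\<forall>\<^sub>F h in at_right 0. norm (N (state_diff (quot h (T t U)) (T t (A U)))) \<le> K * N (state_diff (quot h U) (A U))"
      using eventually_at_right_0
    proof eventually_elim
      case (elim h)
      then have h: "h \<ge> 0" by simp
      have Q: "quot h U \<in> E" "quot h (T t U) \<in> E" using h UE TE by (simp_all add: quot_E)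
      have "N (state_diff (quot h (T t U)) (T t (A U))) = N (state_diff (T t (quot h U)) (T t (A U)))"
        by (rule N_state_eq[OF E_diff[OF Q(2) TE(2)] E_diff[OF T_E[OF t Q(1)] TE(2)]
              state_eq_diff[OF state_eq_sym[OF quot_T[OF t h UE]] state_eq_refl]])
      also have "\<dots> = N (T t (state_diff (quot h U) (A U)))" by (rule N_T_diff[OF t Q(1) AE])
      also have "\<dots> \<le> K * N (state_diff (quot h U) (A U))" using K(2) E_diff[OF Q(1) AE] by blast
      finally show ?case using N_nonneg[OF E_diff[OF Q(2) TE(2)]] by simp
    qed
  qed
  then have "has_generator_value \<Omega> a T (T t U) (T t (A U))" by (simp add: has_generator_value_quot)
  then show dom: "T t U \<in> wave_dom \<Omega>" and "state_eq \<Omega> (T t (A U)) (A (T t U))"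
    using generator[OF TE] by simp_all
  have "has_generator_value \<Omega> a T (T t U) (A (T t U))"
    using generator[OF TE(1) A_E[OF dom]] dom state_eq_refl by simp
  then show "((\<lambda>h. N (state_diff (quot h (T t U)) (A (T t U)))) \<longlongrightarrow> 0) (at_right 0)"
    by (simp add: has_generator_value_quot)
qed

text \<open>A nested interval argument, in place of the uniform boundedness principle: no completeness
  of the energy space is needed.\<close>

lemma T_bounded_somewhere:
  assumes "\<epsilon> > 0"
  shows "\<exists>x y K. 0 < x \<and> x < y \<and> y < \<epsilon> \<and> (\<forall>t\<in>{x..y}. \<forall>U\<in>E. N (T t U) \<le> K * N U)"
proof (rule ccontr)
  assume neg: "\<not> ?thesis"
  have step: "\<exists>x' y'. x \<le> x' \<and> x' < y' \<and> y' \<le> y \<and> (\<forall>s\<in>{x'..y'}. \<exists>U\<in>E. real n * N U < N (T s U))"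
    if xy: "0 < x" "x < y" "y < \<epsilon>" for x y n
  proof -
    have "0 < x \<and> x < (x + y) / 2 \<and> (x + y) / 2 < \<epsilon>" using xy by auto
    then have "\<not> (\<forall>t\<in>{x..(x + y) / 2}. \<forall>U\<in>E. N (T t U) \<le> (2 * real n) * N U)"
      using neg by blast
    then obtain t U where t: "x \<le> t" "t \<le> (x + y) / 2" and U: "U \<in> E" "(2 * real n) * N U < N (T t U)"
      by (auto simp: not_le)
    have t0: "t \<ge> 0" "t < y" using t xy by auto
    \<comment> \<open>\<open>N_le_diff\<close> loses a factor 2, which is why a violation with 2 n
      is taken in order to keep one with n at nearby times; \<gamma> is the margin.\<close>
    define \<gamma> where "\<gamma> = N (T t U) / 2 - real n * N U"
    have \<gamma>: "\<gamma> > 0" using U(2) by (simp add: \<gamma>_def)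
    obtain K where K: "K \<ge> 0" "\<forall>V\<in>E. N (T t V) \<le> K * N V" using T_bound[OF t0(1)] by blast
    have "((\<lambda>h. K * N (state_diff (T h U) U)) \<longlongrightarrow> 0) (at_right 0)"
      by (rule tendsto_mult_right_zero[OF T_right_continuous_0[OF U(1)]])
    then have "\<forall>\<^sub>F h in at_right 0. K * N (state_diff (T h U) U) < \<gamma>"
      using \<gamma> by (rule order_tendstoD)
    then obtain \<eta> where \<eta>: "\<eta> > 0" "\<And>h. 0 < h \<Longrightarrow> h < \<eta> \<Longrightarrow> K * N (state_diff (T h U) U) < \<gamma>"
      unfolding eventually_at_right_field by auto
    define \<kappa> where "\<kappa> = min (\<eta> / 2) (y - t)"
    have \<kappa>: "\<kappa> > 0" "\<kappa> < \<eta>" "t + \<kappa> \<le> y" using \<eta>(1) t0 by (auto simp: \<kappa>_def min_def)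
    \<comment> \<open>The new interval stays strictly to the right of t, where right continuity of
      the orbit propagates the violation.\<close>
    show ?thesis
    proof (rule exI[of _ "t + \<kappa> / 2"], rule exI[of _ "t + \<kappa>"], intro conjI ballI)
      fix s assume s: "s \<in> {t + \<kappa> / 2..t + \<kappa>}"
      define h where "h = s - t"
      have h: "0 < h" "h < \<eta>" "s = t + h" using s \<kappa> by (auto simp: h_def)
      have E: "T t U \<in> E" "T s U \<in> E" "T h U \<in> E" using t0 h U(1) by (simp_all add: T_E)
      have "N (state_diff (T s U) (T t U)) = N (T t (state_diff (T h U) U))"
        using N_T_shift[OF t0(1) _ U(1), of h] h by simp
      also have "\<dots> \<le> K * N (state_diff (T h U) U)" using K(2) E_diff[OF E(3) U(1)] by blast
      also have "\<dots> < \<gamma>" using \<eta>(2) h by simp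
      finally have "N (state_diff (T t U) (T s U)) < \<gamma>" using N_diff_commute[OF E(1,2)] by simp
      then have "N (T t U) < 2 * (N (T s U) + \<gamma>)" using N_le_diff[OF E(1,2)] by simp
      then have "real n * N U < N (T s U)" by (simp add: \<gamma>_def)
      then show "\<exists>U\<in>E. real n * N U < N (T s U)" using U(1) by blast
    qed (use t \<kappa> in auto)
  qed
  have "\<exists>f. \<forall>n. (0 < fst (f n) \<and> fst (f n) < snd (f n) \<and> snd (f n) < \<epsilon>) \<and>
      (fst (f n) \<le> fst (f (Suc n)) \<and> snd (f (Suc n)) \<le> snd (f n) \<and>
       (\<forall>s\<in>{fst (f (Suc n))..snd (f (Suc n))}. \<exists>U\<in>E. real n * N U < N (T s U)))"
  proof (rule dependent_nat_choice)
    show "\<exists>p::real \<times> real. 0 < fst p \<and> fst p < snd p \<and> snd p < \<epsilon>"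
      using assms by (intro exI[of _ "(\<epsilon> / 3, \<epsilon> / 2)"]) simp
    fix p :: "real \<times> real" and n :: nat assume p: "0 < fst p \<and> fst p < snd p \<and> snd p < \<epsilon>"
    then obtain x' y' where "fst p \<le> x'" "x' < y'" "y' \<le> snd p" "\<forall>s\<in>{x'..y'}. \<exists>U\<in>E. real n * N U < N (T s U)"
      using step[of "fst p" "snd p" n] by blast
    then show "\<exists>q. (0 < fst q \<and> fst q < snd q \<and> snd q < \<epsilon>) \<and> fst p \<le> fst q \<and> snd q \<le> snd p \<and>
        (\<forall>s\<in>{fst q..snd q}. \<exists>U\<in>E. real n * N U < N (T s U))"
      using p by (intro exI[of _ "(x', y')"]) auto
  qed
  then obtain f :: "nat \<Rightarrow> real \<times> real" where f: "\<And>n. 0 < fst (f n) \<and> fst (f n) < snd (f n) \<and> snd (f n) < \<epsilon>"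
    "\<And>n. fst (f n) \<le> fst (f (Suc n))" "\<And>n. snd (f (Suc n)) \<le> snd (f n)"
    "\<And>n s. s \<in> {fst (f (Suc n))..snd (f (Suc n))} \<Longrightarrow> \<exists>U\<in>E. real n * N U < N (T s U)"
    by blast
  have inc: "incseq (\<lambda>n. fst (f n))" and dec: "decseq (\<lambda>n. snd (f n))"
    using f(2,3) by (simp_all add: incseq_Suc_iff decseq_Suc_iff)
  have le: "fst (f m) \<le> snd (f n)" for m n
  proof -
    have "fst (f m) \<le> fst (f (max m n))" using inc by (simp add: incseq_def)
    also have "\<dots> \<le> snd (f (max m n))" using f(1) by (simp add: less_imp_le)
    also have "\<dots> \<le> snd (f n)" using dec by (simp add: decseq_def)
    finally show ?thesis .
  qed
  \<comment> \<open>A point common to all intervals: there every bound n is violated, although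
    \<open>T s\<close> is bounded.\<close>
  define s where "s = (SUP n. fst (f n))"
  have bdd: "bdd_above (range (\<lambda>n. fst (f n)))" using le[of _ 0] by (intro bdd_aboveI2)
  have s: "fst (f n) \<le> s" "s \<le> snd (f n)" for n
    unfolding s_def using le by (auto intro: cSUP_upper[OF _ bdd] cSUP_least)
  have "s \<ge> 0" using s(1)[of 0] f(1)[of 0] by simp
  then obtain K where K: "K \<ge> 0" "\<forall>V\<in>E. N (T s V) \<le> K * N V" using T_bound by blast
  obtain n :: nat where n: "K \<le> real n" using real_arch_simple by blast
  obtain U where U: "U \<in> E" "real n * N U < N (T s U)"
    using f(4)[of s n] s[of "Suc n"] by auto
  have "N (T s U) \<le> K * N U" using K(2) U(1) by blast
  also have "\<dots> \<le> real n * N U" using n N_nonneg[OF U(1)] by (rule mult_right_mono)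
  finally show False using U(2) by simp
qed

text \<open>From the right, \<open>T t\<close> carries right continuity at 0 to time t. From the
  left a bound independent of s is needed: writing T s as T (t - y) T (y - h) with h = t - s keeps y
  - h in an interval below t on which \<open>T_bounded_somewhere\<close> bounds the semigroup
  uniformly.\<close>

lemma orbit_continuous:
  assumes U: "U \<in> E" and t: "t \<ge> 0"
  shows "((\<lambda>s. N (state_diff (T s U) (T t U))) \<longlongrightarrow> 0) (at t within {0..})"
proof -
  have "\<exists>C \<eta>. C \<ge> 0 \<and> \<eta> > 0 \<and> (\<forall>s\<ge>0. s \<noteq> t \<and> \<bar>s - t\<bar> < \<eta> \<longrightarrow>
      N (state_diff (T s U) (T t U)) \<le> C * N (state_diff (T \<bar>s - t\<bar> U) U))"
  proof -
    obtain K where K: "K \<ge> 0" "\<forall>V\<in>E. N (T t V) \<le> K * N V" using T_bound[OF t] by blast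
    have right: "N (state_diff (T s U) (T t U)) \<le> K * N (state_diff (T \<bar>s - t\<bar> U) U)" if "s \<ge> t" for s
    proof -
      have "N (state_diff (T s U) (T t U)) = N (T t (state_diff (T (s - t) U) U))"
        using N_T_shift[OF t _ U, of "s - t"] that by simp
      also have "\<dots> \<le> K * N (state_diff (T (s - t) U) U)"
        using K(2) E_diff[OF T_E[OF _ U] U, of "s - t"] that by simp
      finally show ?thesis using that by simp
    qed
    show ?thesis
    proof (cases "t = 0")
      case True
      then show ?thesis using K(1) right by (rule_tac exI[of _ K], rule_tac exI[of _ 1]) auto
    next
      case False
      then obtain x y B where xy: "0 < x" "x < y" "y < t" "\<forall>s\<in>{x..y}. \<forall>U\<in>E. N (T s U) \<le> B * N U"
        using T_bounded_somewhere[of t] t by auto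
      obtain L where L: "L \<ge> 0" "\<forall>V\<in>E. N (T (t - y) V) \<le> L * N V" using T_bound[of "t - y"] xy by auto
      have left: "N (state_diff (T s U) (T t U)) \<le> L * \<bar>B\<bar> * N (state_diff (T \<bar>s - t\<bar> U) U)"
        if s: "s < t" "t - s < y - x" for s
      proof -
        define h where "h = t - s"
        have h: "h > 0" "h < y - x" "s = (t - y) + (y - h)" "s \<ge> 0" "t = s + h" "y - h \<in> {x..y}"
          using s xy by (auto simp: h_def)
        have W: "state_diff (T h U) U \<in> E" by (intro E_diff T_E less_imp_le[OF h(1)] U)
        have "N (state_diff (T t U) (T s U)) = N (T s (state_diff (T h U) U))"
          using N_T_shift[OF h(4) less_imp_le[OF h(1)] U] unfolding h(5)[symmetric] .
        also have "\<dots> = N (T (t - y) (T (y - h) (state_diff (T h U) U)))"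
        proof (rule N_state_eq)
          have nn: "0 \<le> t - y" "0 \<le> y - h" using xy(1-3) h(6) by auto
          show "T s (state_diff (T h U) U) \<in> E" by (rule T_E[OF h(4) W])
          show "T (t - y) (T (y - h) (state_diff (T h U) U)) \<in> E" by (intro T_E nn W)
          show "state_eq \<Omega> (T s (state_diff (T h U) U)) (T (t - y) (T (y - h) (state_diff (T h U) U)))"
            by (subst h(3)) (rule T_semigroup[OF nn W])
        qed
        also have "\<dots> \<le> L * N (T (y - h) (state_diff (T h U) U))"
          using L(2) T_E[OF _ W, of "y - h"] h(6) xy(1) by auto
        also have "\<dots> \<le> L * (\<bar>B\<bar> * N (state_diff (T h U) U))"
        proof (rule mult_left_mono[OF _ L(1)])
          have "N (T (y - h) (state_diff (T h U) U)) \<le> B * N (state_diff (T h U) U)"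
            using xy(4) h(6) W by blast
          also have "\<dots> \<le> \<bar>B\<bar> * N (state_diff (T h U) U)"
            by (intro mult_right_mono N_nonneg W) simp
          finally show "N (T (y - h) (state_diff (T h U) U)) \<le> \<bar>B\<bar> * N (state_diff (T h U) U)" .
        qed
        finally have "N (state_diff (T t U) (T s U)) \<le> L * \<bar>B\<bar> * N (state_diff (T h U) U)" by simp
        moreover have "N (state_diff (T t U) (T s U)) = N (state_diff (T s U) (T t U))"
          by (rule N_diff_commute[OF T_E[OF t U] T_E[OF h(4) U]])
        moreover have "\<bar>s - t\<bar> = h" using h(1) unfolding h(5) by simp
        ultimately show ?thesis by simp
      qed
      show ?thesis
      proof (rule exI[of _ "max K (L * \<bar>B\<bar>)"], rule exI[of _ "y - x"], intro conjI allI impI)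
        show "0 \<le> max K (L * \<bar>B\<bar>)" using K(1) by simp
        show "0 < y - x" using xy by simp
        fix s assume s0: "s \<ge> 0" and s: "s \<noteq> t \<and> \<bar>s - t\<bar> < y - x"
        have nn: "0 \<le> N (state_diff (T \<bar>s - t\<bar> U) U)" using U by (intro N_nonneg E_diff T_E) auto
        show "N (state_diff (T s U) (T t U)) \<le> max K (L * \<bar>B\<bar>) * N (state_diff (T \<bar>s - t\<bar> U) U)"
        proof (cases "s < t")
          case True
          then show ?thesis
            using left[of s] s mult_right_mono[OF max.cobounded2[of "L * \<bar>B\<bar>" K] nn] by simp
        next
          case False
          then show ?thesis
            using right[of s] mult_right_mono[OF max.cobounded1[of K "L * \<bar>B\<bar>"] nn] by simp
        qed
      qed
    qed
  qed
  then obtain C \<eta> where C: "C \<ge> 0" "\<eta> > 0" "\<And>s. s \<ge> 0 \<Longrightarrow> s \<noteq> t \<Longrightarrow> \<bar>s - t\<bar> < \<eta> \<Longrightarrow>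
      N (state_diff (T s U) (T t U)) \<le> C * N (state_diff (T \<bar>s - t\<bar> U) U)" by blast
  have "((\<lambda>s. C * N (state_diff (T \<bar>s - t\<bar> U) U)) \<longlongrightarrow> 0) (at t within {0..})"
  proof (rule tendsto_mult_right_zero, rule filterlim_compose[OF T_right_continuous_0[OF U]])
    have "((\<lambda>s. \<bar>s - t\<bar>) \<longlongrightarrow> \<bar>t - t\<bar>) (at t within {0..})" by (intro tendsto_intros)
    then show "filterlim (\<lambda>s. \<bar>s - t\<bar>) (at_right 0) (at t within {0..})"
      unfolding filterlim_at by (auto simp: eventually_at_filter)
  qed
  then show ?thesis
  proof (rule Lim_null_comparison[rotated])
    show "\<forall>\<^sub>F s in at t within {0..}. norm (N (state_diff (T s U) (T t U))) \<le> C * N (state_diff (T \<bar>s - t\<bar> U) U)"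
      unfolding eventually_at
    proof (intro exI[of _ \<eta>] conjI ballI impI C(2))
      fix s :: real assume "s \<in> {0..}" "s \<noteq> t \<and> dist s t < \<eta>"
      then have s: "s \<ge> 0" "s \<noteq> t" "\<bar>s - t\<bar> < \<eta>" by (auto simp: dist_real_def)
      have "0 \<le> N (state_diff (T s U) (T t U))" using s t U by (intro N_nonneg E_diff T_E) auto
      then show "norm (N (state_diff (T s U) (T t U))) \<le> C * N (state_diff (T \<bar>s - t\<bar> U) U)"
        using C(3)[OF s] by simp
    qed
  qed
qed

lemma good_tendsto:
  assumes g: "good g" and E: "\<forall>\<^sub>F h in F. V h \<in> E" "W \<in> E"
    and lim: "((\<lambda>h. N (state_diff (V h) W)) \<longlongrightarrow> 0) F"
  shows "((\<lambda>h. nrm \<Omega> (\<lambda>x. g (V h) x - g W x)) \<longlongrightarrow> 0) F"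
proof -
  obtain L where L: "L \<ge> 0" "\<forall>U\<in>E. nrm \<Omega> (g U) \<le> L * N U" using good_bound[OF g] by blast
  show ?thesis
  proof (rule Lim_null_comparison)
    show "((\<lambda>h. L * N (state_diff (V h) W)) \<longlongrightarrow> 0) F" by (rule tendsto_mult_right_zero[OF lim])
    show "\<forall>\<^sub>F h in F. norm (nrm \<Omega> (\<lambda>x. g (V h) x - g W x)) \<le> L * N (state_diff (V h) W)"
      using E(1)
    proof eventually_elim
      case (elim h)
      then show ?case
        using L(2) E_diff[OF elim E(2)] by (simp add: good_nrm_diff[OF g elim E(2)] nrm_nonneg)
    qed
  qed
qed

lemma ip_orbit_continuous:
  assumes U: "U \<in> E" and g: "good g" "good k"
  shows "continuous_on {0..} (\<lambda>s. ip \<Omega> (g (T s U)) (k (T s U)))"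
  unfolding continuous_on_def
proof
  fix t :: real assume "t \<in> {0..}"
  then have t: "t \<ge> 0" by simp
  have ev: "\<forall>\<^sub>F s in at t within {0..}. T s U \<in> E"
    unfolding eventually_at_filter using U by (auto intro: T_E always_eventually)
  note lim = orbit_continuous[OF U t]
  have L: "\<forall>\<^sub>F s in at t within {0..}. j (T s U) \<in> L2 \<Omega>" if "good j" for j
    using ev by (rule eventually_mono) (rule good_L2[OF that])
  show "((\<lambda>s. ip \<Omega> (g (T s U)) (k (T s U))) \<longlongrightarrow> ip \<Omega> (g (T t U)) (k (T t U))) (at t within {0..})"
    by (rule ip_tendsto[OF L[OF g(1)] L[OF g(2)] good_L2[OF g(1) T_E[OF t U]] good_L2[OF g(2) T_E[OF t U]]
          good_tendsto[OF g(1) ev T_E[OF t U] lim] good_tendsto[OF g(2) ev T_E[OF t U] lim]])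
qed

lemma good_quot:
  assumes g: "good g" and "t \<ge> 0" "h \<ge> 0" "U \<in> E"
  shows "AE x in lebesgue_on \<Omega>. g (quot h (T t U)) x = of_real (1 / h) * (g (T (t + h) U) x - g (T t U) x)"
proof -
  have E: "T t U \<in> E" "T h (T t U) \<in> E" "T (t + h) U \<in> E" using assms by (simp_all add: T_E)
  have "AE x in lebesgue_on \<Omega>. g (quot h (T t U)) x = of_real (1 / h) * g (state_diff (T h (T t U)) (T t U)) x"
    unfolding quot_def by (rule good_scale[OF g E_diff[OF E(2,1)]])
  moreover have "AE x in lebesgue_on \<Omega>. g (state_diff (T h (T t U)) (T t U)) x = g (T h (T t U)) x - g (T t U) x"
    by (rule good_diff[OF g E(2,1)])
  moreover have "AE x in lebesgue_on \<Omega>. g (T h (T t U)) x = g (T (t + h) U) x"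
    by (rule good_cong[OF g E(2,3) state_eq_sym[OF T_semigroup[OF assms(3,2,4), unfolded add.commute[of h t]]]])
  ultimately show ?thesis by eventually_elim simp
qed

text \<open>Being linear and bounded, g carries the generator limit at \<open>T t U\<close> over to
  L2.\<close>

lemma rder_orbit:
  assumes U: "U \<in> wave_dom \<Omega>" and t: "t \<ge> 0" and g: "good g"
  shows "rder \<Omega> (\<lambda>s. g (T s U)) (g (A (T t U))) t"
  unfolding rder_def
proof (intro conjI allI impI)
  have UE: "U \<in> E" by (rule wave_dom_E[OF U])
  have AE: "A (T t U) \<in> E" by (rule A_E[OF generator_T(1)[OF U t]])
  show L: "g (T s U) \<in> L2 \<Omega>" if "s \<ge> t" for s using that t UE by (intro good_L2[OF g] T_E) auto
  show LA: "g (A (T t U)) \<in> L2 \<Omega>" by (rule good_L2[OF g AE])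
  have ev: "\<forall>\<^sub>F h in at_right 0. quot h (T t U) \<in> E"
    using eventually_at_right_0 by (rule eventually_mono) (intro quot_E T_E t UE, simp)
  have "((\<lambda>h. nrm \<Omega> (\<lambda>x. g (quot h (T t U)) x - g (A (T t U)) x)) \<longlongrightarrow> 0) (at_right 0)"
    by (rule good_tendsto[OF g ev AE generator_T(3)[OF U t]])
  then show "((\<lambda>h. nrm \<Omega> (\<lambda>x. of_real (1 / h) * (g (T (t + h) U) x - g (T t U) x) - g (A (T t U)) x)) \<longlongrightarrow> 0) (at_right 0)"
  proof (rule Lim_transform_eventually)
    show "\<forall>\<^sub>F h in at_right 0. nrm \<Omega> (\<lambda>x. g (quot h (T t U)) x - g (A (T t U)) x)
        = nrm \<Omega> (\<lambda>x. of_real (1 / h) * (g (T (t + h) U) x - g (T t U) x) - g (A (T t U)) x)"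
      using eventually_at_right_0
    proof eventually_elim
      case (elim h)
      then have h: "h \<ge> 0" by simp
      show ?case
      proof (rule nrm_cong_AE)
        show "AE x in lebesgue_on \<Omega>. g (quot h (T t U)) x - g (A (T t U)) x
            = of_real (1 / h) * (g (T (t + h) U) x - g (T t U) x) - g (A (T t U)) x"
          using good_quot[OF g t h UE] by eventually_elim simp
        show "(\<lambda>x. g (quot h (T t U)) x - g (A (T t U)) x) \<in> L2 \<Omega>"
          by (intro L2_diff LA good_L2[OF g] quot_E T_E h t UE)
        show "(\<lambda>x. of_real (1 / h) * (g (T (t + h) U) x - g (T t U) x) - g (A (T t U)) x) \<in> L2 \<Omega>"
          using h by (intro L2_diff L2_cmult LA L) auto
      qed
    qed
  qed
qed

lemma ip_orbit_deriv:
  assumes U: "U \<in> wave_dom \<Omega>" and t: "t \<ge> 0" and g: "good g" "good k"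
  shows "((\<lambda>s. ip \<Omega> (g (T s U)) (k (T s U))) has_real_derivative
      ip \<Omega> (g (A (T t U))) (k (T t U)) + ip \<Omega> (g (T t U)) (k (A (T t U)))) (at_right t)"
  by (rule rder_ip[OF rder_orbit[OF U t g(1)] rder_orbit[OF U t g(2)]])

end

context wave
begin

section \<open>Dissipation\<close>

lemma mul_weight:
  assumes "u \<in> L2 \<Omega>" "mul f u \<in> L2 \<Omega>"
  shows "ip \<Omega> u (mul f u) = (\<integral>X. f (fst X) * (cmod (u X))\<^sup>2 \<partial>lebesgue_on \<Omega>)"
    and "integrable (lebesgue_on \<Omega>) (\<lambda>X. f (fst X) * (cmod (u X))\<^sup>2)"
proof -
  have eq: "Re (u X * cnj (mul f u X)) = f (fst X) * (cmod (u X))\<^sup>2" for X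
  proof -
    have "u X * cnj (mul f u X) = complex_of_real (f (fst X) * (cmod (u X))\<^sup>2)"
      unfolding of_real_mult complex_norm_square by (simp add: mul_def mult_ac)
    then show ?thesis by simp
  qed
  show "ip \<Omega> u (mul f u) = (\<integral>X. f (fst X) * (cmod (u X))\<^sup>2 \<partial>lebesgue_on \<Omega>)"
    unfolding ip_def eq ..
  show "integrable (lebesgue_on \<Omega>) (\<lambda>X. f (fst X) * (cmod (u X))\<^sup>2)"
    using L2_integrable_ip(2)[OF assms] unfolding eq .
qed

lemma ip_mul_mono:
  assumes "u \<in> L2 \<Omega>" "mul f u \<in> L2 \<Omega>" "mul g u \<in> L2 \<Omega>"
    "AE X in lebesgue_on \<Omega>. f (fst X) \<le> k * g (fst X)"
  shows "ip \<Omega> u (mul f u) \<le> k * ip \<Omega> u (mul g u)"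
proof -
  have "(\<integral>X. f (fst X) * (cmod (u X))\<^sup>2 \<partial>lebesgue_on \<Omega>)
      \<le> (\<integral>X. k * (g (fst X) * (cmod (u X))\<^sup>2) \<partial>lebesgue_on \<Omega>)"
  proof (rule integral_mono_AE)
    show "AE X in lebesgue_on \<Omega>. f (fst X) * (cmod (u X))\<^sup>2 \<le> k * (g (fst X) * (cmod (u X))\<^sup>2)"
      using assms(4) by eventually_elim (simp only: mult.assoc[symmetric] mult_right_mono zero_le_power2)
  qed (intro mul_weight(2) integrable_mult_right assms)+
  then show ?thesis by (simp add: mul_weight(1)[OF assms(1,2)] mul_weight(1)[OF assms(1,3)])
qed

lemma ip_mul_nonneg:
  assumes "u \<in> L2 \<Omega>" "mul g u \<in> L2 \<Omega>" "AE X in lebesgue_on \<Omega>. 0 \<le> g (fst X)"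
  shows "0 \<le> ip \<Omega> u (mul g u)"
  unfolding mul_weight(1)[OF assms(1,2)]
  by (rule integral_nonneg_AE) (use assms(3) in eventually_elim, simp)

lemma nrm_mul_sq_le:
  assumes "u \<in> L2 \<Omega>" "mul f u \<in> L2 \<Omega>" "mul g u \<in> L2 \<Omega>"
    "AE X in lebesgue_on \<Omega>. (f (fst X))\<^sup>2 \<le> k * g (fst X)"
  shows "(nrm \<Omega> (mul f u))\<^sup>2 \<le> k * ip \<Omega> u (mul g u)"
proof -
  have "(\<integral>X. (cmod (mul f u X))\<^sup>2 \<partial>lebesgue_on \<Omega>)
      \<le> (\<integral>X. k * (g (fst X) * (cmod (u X))\<^sup>2) \<partial>lebesgue_on \<Omega>)"
  proof (rule integral_mono_AE)
    show "integrable (lebesgue_on \<Omega>) (\<lambda>X. (cmod (mul f u X))\<^sup>2)" by (rule L2_integrable[OF assms(2)])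
    show "integrable (lebesgue_on \<Omega>) (\<lambda>X. k * (g (fst X) * (cmod (u X))\<^sup>2))"
      by (intro mul_weight(2) integrable_mult_right assms)
    show "AE X in lebesgue_on \<Omega>. (cmod (mul f u X))\<^sup>2 \<le> k * (g (fst X) * (cmod (u X))\<^sup>2)"
      using assms(4)
    proof eventually_elim
      case (elim X)
      have "(cmod (mul f u X))\<^sup>2 = (f (fst X))\<^sup>2 * (cmod (u X))\<^sup>2"
        by (simp add: mul_def norm_mult power_mult_distrib)
      also have "\<dots> \<le> (k * g (fst X)) * (cmod (u X))\<^sup>2" by (rule mult_right_mono[OF elim]) simp
      finally show ?case by (simp only: mult.assoc)
    qed
  qed
  then show ?thesis by (simp add: mul_weight(1)[OF assms(1,3)] nrm_sq_integral)
qed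

text \<open>Used with u a displacement of the approximating orbit and v the velocity it is close to:
  the weighted square of the displacement becomes dissipation, up to the approximation
  error.\<close>

lemma ip_mul_perturb:
  assumes "u \<in> L2 \<Omega>" "v \<in> L2 \<Omega>" "mul g u \<in> L2 \<Omega>" "mul g v \<in> L2 \<Omega>"
    "AE X in lebesgue_on \<Omega>. 0 \<le> g (fst X) \<and> g (fst X) \<le> M"
  shows "ip \<Omega> u (mul g u) \<le> 2 * ip \<Omega> v (mul g v) + 2 * M * (nrm \<Omega> (\<lambda>X. u X - v X))\<^sup>2"
proof -
  note d = L2_diff[OF assms(1,2)]
  have "(\<integral>X. g (fst X) * (cmod (u X))\<^sup>2 \<partial>lebesgue_on \<Omega>)
      \<le> (\<integral>X. 2 * (g (fst X) * (cmod (v X))\<^sup>2) + 2 * M * (cmod (u X - v X))\<^sup>2 \<partial>lebesgue_on \<Omega>)"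
  proof (rule integral_mono_AE)
    show "integrable (lebesgue_on \<Omega>) (\<lambda>X. g (fst X) * (cmod (u X))\<^sup>2)" by (rule mul_weight(2)[OF assms(1,3)])
    show "integrable (lebesgue_on \<Omega>) (\<lambda>X. 2 * (g (fst X) * (cmod (v X))\<^sup>2) + 2 * M * (cmod (u X - v X))\<^sup>2)"
      by (intro Bochner_Integration.integrable_add integrable_mult_right mul_weight(2)[OF assms(2,4)] L2_integrable[OF d])
    show "AE X in lebesgue_on \<Omega>. g (fst X) * (cmod (u X))\<^sup>2
        \<le> 2 * (g (fst X) * (cmod (v X))\<^sup>2) + 2 * M * (cmod (u X - v X))\<^sup>2"
      using assms(5)
    proof eventually_elim
      case (elim X)
      have "cmod (u X) \<le> cmod (v X) + cmod (u X - v X)" by (rule norm_triangle_sub)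
      then have "(cmod (u X))\<^sup>2 \<le> (cmod (v X) + cmod (u X - v X))\<^sup>2" by (intro power_mono) auto
      also have "\<dots> \<le> 2 * (cmod (v X))\<^sup>2 + 2 * (cmod (u X - v X))\<^sup>2"
        using sum_squares_bound[of "cmod (v X)" "cmod (u X - v X)"] by (simp add: power2_sum)
      finally have "g (fst X) * (cmod (u X))\<^sup>2 \<le> g (fst X) * (2 * (cmod (v X))\<^sup>2 + 2 * (cmod (u X - v X))\<^sup>2)"
        using elim by (intro mult_left_mono) auto
      moreover have "g (fst X) * (2 * (cmod (u X - v X))\<^sup>2) \<le> M * (2 * (cmod (u X - v X))\<^sup>2)"
        using elim by (intro mult_right_mono) auto
      ultimately show ?case by (simp add: distrib_left)
    qed
  qed
  also have "\<dots> = 2 * ip \<Omega> v (mul g v) + 2 * M * (nrm \<Omega> (\<lambda>X. u X - v X))\<^sup>2"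
    using mul_weight(2)[OF assms(2,4)] L2_integrable[OF d]
    by (simp add: mul_weight(1)[OF assms(2,4)] nrm_sq_integral)
  finally show ?thesis by (simp add: mul_weight(1)[OF assms(1,3)])
qed

definition Dis :: "(real \<times> 'b) state \<Rightarrow> real" where
  "Dis U = ip \<Omega> (fst (snd U)) (mul b (fst (snd U))) + ip \<Omega> (snd (snd (snd U))) (mul d (snd (snd (snd U))))"

text \<open>The dissipation form evaluated on displacements. Since the displacements of
  \<open>A V\<close> are the velocities of V, \<open>Low (A V)\<close> equals
  \<open>Dis V\<close>.\<close>

definition Low :: "(real \<times> 'b) state \<Rightarrow> real" where
  "Low U = ip \<Omega> (fst U) (mul b (fst U)) + ip \<Omega> (fst (snd (snd U))) (mul d (fst (snd (snd U))))"

lemma b_nonneg: "AE X in lebesgue_on \<Omega>. 0 \<le> b (fst X)" and d_nonneg: "AE X in lebesgue_on \<Omega>. 0 \<le> d (fst X)"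
  using b_bounds d_bounds by (eventually_elim, simp)+

lemma E_L2:
  assumes "U \<in> E"
  shows "fst U \<in> L2 \<Omega>" "fst (snd U) \<in> L2 \<Omega>" "fst (snd (snd U)) \<in> L2 \<Omega>" "snd (snd (snd U)) \<in> L2 \<Omega>"
  by (rule good_L2[OF good_\<phi> assms] good_L2[OF good_v assms] good_L2[OF good_\<psi> assms] good_L2[OF good_z assms])+

lemma Dis_parts:
  assumes "U \<in> E"
  shows "0 \<le> ip \<Omega> (fst (snd U)) (mul b (fst (snd U)))" "0 \<le> ip \<Omega> (snd (snd (snd U))) (mul d (snd (snd (snd U))))"
  by (rule ip_mul_nonneg[OF E_L2(2)[OF assms] mul_coeff_L2(1)[OF E_L2(2)[OF assms]] b_nonneg],
      rule ip_mul_nonneg[OF E_L2(4)[OF assms] mul_coeff_L2(3)[OF E_L2(4)[OF assms]] d_nonneg])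

lemma Dis_nonneg: "U \<in> E \<Longrightarrow> 0 \<le> Dis U"
  using Dis_parts[of U] by (simp add: Dis_def)

lemma ip_A_v:
  assumes U: "U \<in> wave_dom \<Omega>" and w: "w \<in> L2 \<Omega>"
  shows "ip \<Omega> (fst (snd (A U))) w = ip \<Omega> (weak_laplacian \<Omega> (fst U)) w - ip \<Omega> (force1 U) w"
    and "ip \<Omega> (snd (snd (snd (A U)))) w = a * ip \<Omega> (weak_laplacian \<Omega> (fst (snd (snd U)))) w - ip \<Omega> (force2 U) w"
  unfolding A_simps
  using weak_laplacian_L2[OF wave_domD(1)[OF U]] weak_laplacian_L2[OF wave_domD(3)[OF U]] force_L2[OF wave_dom_E[OF U]] w
  by (simp_all add: ip_diff_left L2_cmult ip_scale_left)

text \<open>Green's formula cancels the gradient terms against the Laplacians, and the coupling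
  enters the two equations with opposite signs, so only the damping is left.\<close>

lemma dissipation:
  assumes U: "U \<in> wave_dom \<Omega>"
  shows "(\<Sum>i\<in>Basis. ip \<Omega> (D i (fst (A U))) (D i (fst U))) + ip \<Omega> (fst (snd (A U))) (fst (snd U))
    + a * (\<Sum>i\<in>Basis. ip \<Omega> (D i (fst (snd (snd (A U))))) (D i (fst (snd (snd U)))))
    + ip \<Omega> (snd (snd (snd (A U)))) (snd (snd (snd U))) = - Dis U"
proof -
  note L = E_L2[OF wave_dom_E[OF U]]
  have "ip \<Omega> (force1 U) (fst (snd U)) = ip \<Omega> (fst (snd U)) (mul b (fst (snd U))) + ip \<Omega> (snd (snd (snd U))) (mul c (fst (snd U)))"
    unfolding force1_def using L mul_coeff_L2 by (simp add: ip_add_left mul_swap)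
  moreover have "ip \<Omega> (force2 U) (snd (snd (snd U)))
      = ip \<Omega> (snd (snd (snd U))) (mul d (snd (snd (snd U)))) - ip \<Omega> (snd (snd (snd U))) (mul c (fst (snd U)))"
    unfolding force2_def using L mul_coeff_L2
    by (simp add: ip_diff_left mul_swap[of d] ip_commute[of \<Omega> "mul c _"])
  moreover note green[OF wave_domD(1,2)[OF U]] green[OF wave_domD(3,4)[OF U]]
  ultimately show ?thesis
    unfolding ip_A_v[OF U L(2)] ip_A_v[OF U L(4)] Dis_def
    by (simp add: A_simps ip_commute[of \<Omega> "D _ (fst (snd U))"] ip_commute[of \<Omega> "D _ (snd (snd (snd U)))"] algebra_simps)
qed

lemma sq_ip: "sq U = (\<Sum>i\<in>Basis. ip \<Omega> (D i (fst U)) (D i (fst U))) + ip \<Omega> (fst (snd U)) (fst (snd U))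
    + a * (\<Sum>i\<in>Basis. ip \<Omega> (D i (fst (snd (snd U)))) (D i (fst (snd (snd U)))))
    + ip \<Omega> (snd (snd (snd U))) (snd (snd (snd U)))"
  by (simp add: sq_def nrm_sq)

lemma sq_deriv:
  assumes U: "U \<in> wave_dom \<Omega>" and t: "t \<ge> 0"
  shows "((\<lambda>s. sq (T s U)) has_real_derivative - 2 * Dis (T t U)) (at_right t)"
proof -
  let ?V = "T t U"
  have d: "((\<lambda>s. ip \<Omega> (g (T s U)) (g (T s U))) has_real_derivative 2 * ip \<Omega> (g (A ?V)) (g ?V)) (at_right t)" if "good g" for g
    using ip_orbit_deriv[OF U t that that] ip_commute[of \<Omega> "g ?V" "g (A ?V)"] by simp
  have "((\<lambda>s. sq (T s U)) has_real_derivative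
      (\<Sum>i\<in>Basis. 2 * ip \<Omega> (D i (fst (A ?V))) (D i (fst ?V))) + 2 * ip \<Omega> (fst (snd (A ?V))) (fst (snd ?V))
    + a * (\<Sum>i\<in>Basis. 2 * ip \<Omega> (D i (fst (snd (snd (A ?V))))) (D i (fst (snd (snd ?V)))))
    + 2 * ip \<Omega> (snd (snd (snd (A ?V)))) (snd (snd (snd ?V)))) (at_right t)"
    unfolding sq_ip
    by (intro DERIV_add DERIV_cmult DERIV_sum d good_D\<phi> good_D\<psi> good_v good_z)
  moreover have "(\<Sum>i\<in>Basis. 2 * ip \<Omega> (D i (fst (A ?V))) (D i (fst ?V))) + 2 * ip \<Omega> (fst (snd (A ?V))) (fst (snd ?V))
    + a * (\<Sum>i\<in>Basis. 2 * ip \<Omega> (D i (fst (snd (snd (A ?V))))) (D i (fst (snd (snd ?V)))))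
    + 2 * ip \<Omega> (snd (snd (snd (A ?V)))) (snd (snd (snd ?V))) = - 2 * Dis ?V"
    using dissipation[OF generator_T(1)[OF U t]] unfolding sum_distrib_left[symmetric] by (simp add: algebra_simps)
  ultimately show ?thesis by simp
qed

lemma sq_continuous:
  assumes "U \<in> E" shows "continuous_on {0..} (\<lambda>s. sq (T s U))"
  unfolding sq_ip
  by (intro continuous_on_add continuous_on_sum continuous_on_mult continuous_on_const ip_orbit_continuous[OF assms]
      good_D\<phi> good_D\<psi> good_v good_z)

text \<open>Monotonicity of \<open>sq\<close> is read off from the dissipation, hence for states of
  the domain; on the rest of \<open>E\<close> the definition of \<open>C0_semigroup\<close> provides
  a bound at each single time.\<close>

lemma contraction:
  assumes U: "U \<in> wave_dom \<Omega>" and t: "t \<ge> 0"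
  shows "sq (T t U) \<le> sq U" "N (T t U) \<le> N U"
proof -
  have UE: "U \<in> E" by (rule wave_dom_E[OF U])
  have "sq (T t U) \<le> sq (T 0 U)"
  proof (rule nonincreasing_of_right_derivative[OF sq_continuous[OF UE] _ t])
    fix s :: real assume s: "s \<ge> 0"
    show "\<exists>D\<le>0. ((\<lambda>s. sq (T s U)) has_real_derivative D) (at_right s)"
      using sq_deriv[OF U s] Dis_nonneg[OF T_E[OF s UE]] by (intro exI[of _ "- 2 * Dis (T s U)"]) simp
  qed
  also have "sq (T 0 U) = sq U"
    using N_state_eq[OF T_E[OF order_refl UE] UE] C0[unfolded C0_semigroup_def] UE
    by (metis N_sq T_E order_refl)
  finally show "sq (T t U) \<le> sq U" .
  then show "N (T t U) \<le> N U" by (simp add: N_eq UE T_E t)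
qed

text \<open>The bound has to be uniform in t, but \<open>contraction\<close> does not apply to
  \<open>state_diff (quot h U) (A U)\<close>, which need not lie in the domain. A second quotient
  \<open>quot k U\<close> is inserted: the two quotients differ by a state of the domain, and the
  t-dependent bound K only multiplies a term that vanishes as k tends to 0. The 4 stems from two
  triangle inequalities with factor 2.\<close>

lemma quot_orbit_close:
  assumes U: "U \<in> wave_dom \<Omega>" and t: "t \<ge> 0" and h: "h > 0"
  shows "N (state_diff (T t (quot h U)) (A (T t U))) \<le> 4 * N (state_diff (quot h U) (A U))"
proof -
  have UE: "U \<in> E" and AUE: "A U \<in> E" using U wave_dom_E A_E by auto
  have W: "quot k U \<in> wave_dom \<Omega>" if "k \<ge> 0" for k
    unfolding quot_def by (intro wave_dom_scale wave_dom_diff generator_T(1) U that)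
  have WE: "quot k U \<in> E" if "k \<ge> 0" for k by (rule wave_dom_E[OF W[OF that]])
  obtain K where K: "K \<ge> 0" "\<forall>V\<in>E. N (T t V) \<le> K * N V" using T_bound[OF t] by blast
  let ?\<nu> = "\<lambda>k. N (state_diff (quot k U) (A U))"
  have h0: "h \<ge> 0" using h by simp
  have le: "N (T t (state_diff (quot h U) (A U))) \<le> 2 * (2 * (?\<nu> h + ?\<nu> k) + K * ?\<nu> k)" if k: "k > 0" for k
  proof -
    have k0: "k \<ge> 0" using k by simp
    note E = WE[OF h0] WE[OF k0]
    have "N (T t (state_diff (quot h U) (A U))) = N (state_diff (T t (quot h U)) (T t (A U)))"
      by (rule N_T_diff[symmetric, OF t E(1) AUE])
    also have "\<dots> \<le> 2 * (N (state_diff (T t (quot h U)) (T t (quot k U))) + N (state_diff (T t (quot k U)) (T t (A U))))"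
      by (intro N_diff_triangle T_E t E AUE)
    also have "N (state_diff (T t (quot h U)) (T t (quot k U))) = N (T t (state_diff (quot h U) (quot k U)))"
      by (rule N_T_diff[OF t E])
    also have "N (state_diff (T t (quot k U)) (T t (A U))) = N (T t (state_diff (quot k U) (A U)))"
      by (rule N_T_diff[OF t E(2) AUE])
    finally have 1: "N (T t (state_diff (quot h U) (A U)))
        \<le> 2 * (N (T t (state_diff (quot h U) (quot k U))) + N (T t (state_diff (quot k U) (A U))))" .
    have "N (T t (state_diff (quot h U) (quot k U))) \<le> N (state_diff (quot h U) (quot k U))"
      by (rule contraction(2)[OF wave_dom_diff[OF W[OF h0] W[OF k0]] t])
    also have "\<dots> \<le> 2 * (?\<nu> h + N (state_diff (A U) (quot k U)))" by (intro N_diff_triangle E AUE)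
    also have "N (state_diff (A U) (quot k U)) = ?\<nu> k" by (rule N_diff_commute[OF AUE E(2)])
    finally have 2: "N (T t (state_diff (quot h U) (quot k U))) \<le> 2 * (?\<nu> h + ?\<nu> k)" .
    have 3: "N (T t (state_diff (quot k U) (A U))) \<le> K * ?\<nu> k" using K(2) E_diff[OF E(2) AUE] by blast
    show ?thesis using 1 2 3 by simp
  qed
  have "has_generator_value \<Omega> a T U (A U)" using generator[OF UE AUE] U state_eq_refl by blast
  then have \<nu>0: "(?\<nu> \<longlongrightarrow> 0) (at_right 0)" by (simp only: has_generator_value_quot)
  have "((\<lambda>k. 2 * (2 * (?\<nu> h + ?\<nu> k) + K * ?\<nu> k)) \<longlongrightarrow> 2 * (2 * (?\<nu> h + 0) + K * 0)) (at_right 0)"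
    by (intro tendsto_intros \<nu>0)
  then have lim: "N (T t (state_diff (quot h U) (A U))) \<le> 2 * (2 * (?\<nu> h + 0) + K * 0)"
  proof (rule tendsto_lowerbound)
    show "\<forall>\<^sub>F k in at_right 0. N (T t (state_diff (quot h U) (A U))) \<le> 2 * (2 * (?\<nu> h + ?\<nu> k) + K * ?\<nu> k)"
      using eventually_at_right_0 by (rule eventually_mono) (rule le)
  qed simp
  have TE: "T t (quot h U) \<in> E" "T t (A U) \<in> E" "A (T t U) \<in> E"
    using A_E[OF generator_T(1)[OF U t]] by (auto intro: T_E t WE[OF h0] AUE)
  have "N (state_diff (T t (quot h U)) (A (T t U))) = N (state_diff (T t (quot h U)) (T t (A U)))"
    by (rule N_state_eq[OF E_diff[OF TE(1,3)] E_diff[OF TE(1,2)]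
          state_eq_diff[OF state_eq_refl state_eq_sym[OF generator_T(2)[OF U t]]]])
  also have "\<dots> = N (T t (state_diff (quot h U) (A U)))" by (rule N_T_diff[OF t WE[OF h0] AUE])
  finally show ?thesis using lim by simp
qed

lemma good_mul:
  assumes p: "smooth1 p" and g: "good g"
  shows "good (\<lambda>U. mul p (g U))"
  unfolding good_def
proof (intro conjI ballI allI impI)
  obtain L where L: "L \<ge> 0" "\<forall>U\<in>E. nrm \<Omega> (g U) \<le> L * N U" using good_bound[OF g] by blast
  obtain B where B: "B \<ge> 0" "AE X in lebesgue_on \<Omega>. cmod (complex_of_real (p (fst X))) \<le> B"
    using smooth1_AE_bounded[OF p] by blast
  show "\<exists>L\<ge>0. \<forall>U\<in>E. nrm \<Omega> (mul p (g U)) \<le> L * N U"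
  proof (intro exI[of _ "B * L"] conjI ballI)
    fix U assume U: "U \<in> E"
    have "nrm \<Omega> (mul p (g U)) \<le> B * nrm \<Omega> (g U)"
      unfolding mul_def[abs_def] by (rule nrm_mult_bounded[OF good_L2[OF g U] smooth1_measurable[OF p] B(2,1)])
    also have "\<dots> \<le> B * (L * N U)" using L(2) U B(1) by (intro mult_left_mono) auto
    finally show "nrm \<Omega> (mul p (g U)) \<le> B * L * N U" by (simp only: mult.assoc)
  qed (use B L in simp)
  fix U assume U: "U \<in> E"
  show "mul p (g U) \<in> L2 \<Omega>" by (rule mul_L2[OF p good_L2[OF g U]])
  show "AE x in lebesgue_on \<Omega>. mul p (g (state_scale k U)) x = k * mul p (g U) x" for k
    using good_scale[OF g U, of k] by eventually_elim (simp add: mul_def)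
  fix V assume V: "V \<in> E"
  show "AE x in lebesgue_on \<Omega>. mul p (g (state_add U V)) x = mul p (g U) x + mul p (g V) x"
    using good_add[OF g U V] by eventually_elim (simp add: mul_def distrib_left)
  show "AE x in lebesgue_on \<Omega>. mul p (g U) x = mul p (g V) x" if "state_eq \<Omega> U V"
    using good_cong[OF g U V that] by eventually_elim (simp add: mul_def)
qed

lemma good_ip_bound:
  assumes g: "good g" and k: "good k"
  shows "\<exists>B\<ge>0. \<forall>U\<in>E. \<bar>ip \<Omega> (g U) (k U)\<bar> \<le> B * sq U"
proof -
  obtain L where L: "L \<ge> 0" "\<forall>U\<in>E. nrm \<Omega> (g U) \<le> L * N U" using good_bound[OF g] by blast
  obtain L' where L': "L' \<ge> 0" "\<forall>U\<in>E. nrm \<Omega> (k U) \<le> L' * N U" using good_bound[OF k] by blast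
  show ?thesis
  proof (intro exI[of _ "L * L'"] conjI ballI)
    fix U assume U: "U \<in> E"
    have "\<bar>ip \<Omega> (g U) (k U)\<bar> \<le> nrm \<Omega> (g U) * nrm \<Omega> (k U)"
      by (rule ip_Cauchy_Schwarz[OF good_L2[OF g U] good_L2[OF k U]])
    also have "\<dots> \<le> (L * N U) * (L' * N U)"
      using L L' U N_nonneg[OF U] by (intro mult_mono nrm_nonneg mult_nonneg_nonneg) auto
    also have "\<dots> = L * L' * (N U)\<^sup>2" by (simp add: power2_eq_square)
    finally show "\<bar>ip \<Omega> (g U) (k U)\<bar> \<le> L * L' * sq U" by (simp add: N_sq[OF U])
  qed (use L L' in simp)
qed

text \<open>The first part stems from the damping, whose square is at most M times itself; the
  second from the coupling, where c^2 \<le> M^2 \<le> (M^2 / m) b on the strip, and likewise with d.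
  The factors 2 come from squaring a sum.\<close>

definition Kf :: real where "Kf = 2 * M + 2 * M\<^sup>2 / m"

lemma Kf_pos: "Kf > 0"
  using M_pos m_pos by (simp add: Kf_def add_pos_pos)

text \<open>Here the support of the coupling matters: on it b and d are at least m, so each velocity
  that is fed into the other equation through c is paid for by its own damping.\<close>

lemma force_le:
  assumes U: "U \<in> E"
  shows "(nrm \<Omega> (force1 U))\<^sup>2 \<le> Kf * Dis U" "(nrm \<Omega> (force2 U))\<^sup>2 \<le> Kf * Dis U"
proof -
  note L = E_L2[OF U] and nn = Dis_parts[OF U]
  let ?v = "fst (snd U)" and ?z = "snd (snd (snd U))"
  have bb: "AE X in lebesgue_on \<Omega>. (b (fst X))\<^sup>2 \<le> M * b (fst X)"
    using b_bounds by eventually_elim (simp add: power2_eq_square mult_right_mono)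
  have dd: "AE X in lebesgue_on \<Omega>. (d (fst X))\<^sup>2 \<le> M * d (fst X)"
    using d_bounds by eventually_elim (simp add: power2_eq_square mult_right_mono)
  have cb: "AE X in lebesgue_on \<Omega>. (c (fst X))\<^sup>2 \<le> M\<^sup>2 / m * b (fst X) \<and> (c (fst X))\<^sup>2 \<le> M\<^sup>2 / m * d (fst X)"
    using c_bounds c_support damped b_nonneg d_nonneg
  proof eventually_elim
    case (elim X)
    show ?case
    proof (cases "fst X \<in> {l<..<r}")
      case True
      have "(c (fst X))\<^sup>2 \<le> M\<^sup>2" using elim(1) M_pos by (simp add: abs_le_square_iff[symmetric])
      also have "M\<^sup>2 = M\<^sup>2 / m * m" using m_pos by simp
      finally have c: "(c (fst X))\<^sup>2 \<le> M\<^sup>2 / m * m" .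
      have "M\<^sup>2 / m * m \<le> M\<^sup>2 / m * b (fst X)" "M\<^sup>2 / m * m \<le> M\<^sup>2 / m * d (fst X)"
        using elim(3) True m_pos by (intro mult_left_mono; simp)+
      then show ?thesis using c by linarith
    next
      case False
      then show ?thesis using elim m_pos by simp
    qed
  qed
  have cb1: "AE X in lebesgue_on \<Omega>. (c (fst X))\<^sup>2 \<le> M\<^sup>2 / m * b (fst X)"
    and cd1: "AE X in lebesgue_on \<Omega>. (c (fst X))\<^sup>2 \<le> M\<^sup>2 / m * d (fst X)"
    using cb by (eventually_elim, simp)+
  have 1: "(nrm \<Omega> (mul b ?v))\<^sup>2 \<le> M * ip \<Omega> ?v (mul b ?v)"
    by (rule nrm_mul_sq_le[OF L(2) mul_coeff_L2(1)[OF L(2)] mul_coeff_L2(1)[OF L(2)] bb])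
  have 2: "(nrm \<Omega> (mul c ?z))\<^sup>2 \<le> M\<^sup>2 / m * ip \<Omega> ?z (mul d ?z)"
    by (rule nrm_mul_sq_le[OF L(4) mul_coeff_L2(2)[OF L(4)] mul_coeff_L2(3)[OF L(4)] cd1])
  have 3: "(nrm \<Omega> (mul d ?z))\<^sup>2 \<le> M * ip \<Omega> ?z (mul d ?z)"
    by (rule nrm_mul_sq_le[OF L(4) mul_coeff_L2(3)[OF L(4)] mul_coeff_L2(3)[OF L(4)] dd])
  have 4: "(nrm \<Omega> (mul c ?v))\<^sup>2 \<le> M\<^sup>2 / m * ip \<Omega> ?v (mul b ?v)"
    by (rule nrm_mul_sq_le[OF L(2) mul_coeff_L2(2)[OF L(2)] mul_coeff_L2(1)[OF L(2)] cb1])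
  let ?x = "ip \<Omega> ?v (mul b ?v)" and ?y = "ip \<Omega> ?z (mul d ?z)"
  have p: "0 \<le> M * ?x" "0 \<le> M * ?y" "0 \<le> M\<^sup>2 / m * ?x" "0 \<le> M\<^sup>2 / m * ?y"
    using nn M_pos m_pos by (simp_all add: mult_nonneg_nonneg divide_nonneg_pos)
  have K: "Kf * Dis U = 2 * (M * ?x) + 2 * (M * ?y) + 2 * (M\<^sup>2 / m * ?x) + 2 * (M\<^sup>2 / m * ?y)"
    by (simp add: Kf_def Dis_def algebra_simps)
  have "(nrm \<Omega> (force1 U))\<^sup>2 \<le> 2 * (nrm \<Omega> (mul b ?v))\<^sup>2 + 2 * (nrm \<Omega> (mul c ?z))\<^sup>2"
    by (rule nrm_sq_add_le[OF mul_coeff_L2(1)[OF L(2)] mul_coeff_L2(2)[OF L(4)] force_L2(1)[OF U]])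
       (simp add: force1_def)
  then show "(nrm \<Omega> (force1 U))\<^sup>2 \<le> Kf * Dis U" using 1 2 p K by linarith
  have "(nrm \<Omega> (force2 U))\<^sup>2 \<le> 2 * (nrm \<Omega> (mul d ?z))\<^sup>2 + 2 * (nrm \<Omega> (\<lambda>X. (-1) * mul c ?v X))\<^sup>2"
    by (rule nrm_sq_add_le[OF mul_coeff_L2(3)[OF L(4)] L2_cmult[OF mul_coeff_L2(2)[OF L(2)]] force_L2(2)[OF U]])
       (simp add: force2_def)
  then show "(nrm \<Omega> (force2 U))\<^sup>2 \<le> Kf * Dis U" unfolding nrm_cmult using 3 4 p K by simp
qed

lemma young: "x * y \<le> k / 2 * x\<^sup>2 + 1 / (2 * k) * y\<^sup>2" if "k > 0" for x y k :: real
proof -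
  have "0 \<le> (k * x - y)\<^sup>2 / (2 * k)" using that by simp
  also have "\<dots> = k / 2 * x\<^sup>2 + 1 / (2 * k) * y\<^sup>2 - x * y"
    using that by (simp add: power2_eq_square field_simps)
  finally show ?thesis by simp
qed

text \<open>Pairing with u itself yields minus k times the Dirichlet integral; half of it is spent
  on the forcing, through the Poincare and Young inequalities.\<close>

lemma equipartition_term:
  assumes u: "u \<in> dom_laplacian \<Omega>" and F: "F \<in> L2 \<Omega>" and k: "k > 0"
  shows "k * ip \<Omega> (weak_laplacian \<Omega> u) u - ip \<Omega> F u
    \<le> - (k / 2) * (\<Sum>i\<in>Basis. (nrm \<Omega> (D i u))\<^sup>2) + 2 / k * (nrm \<Omega> F)\<^sup>2"
proof -
  have uH: "u \<in> H10 \<Omega>" by (rule dom_laplacian_H10[OF u])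
  let ?S = "\<Sum>i\<in>Basis. (nrm \<Omega> (D i u))\<^sup>2"
  have "ip \<Omega> (weak_laplacian \<Omega> u) u = - ?S" by (simp add: green[OF u uH] nrm_sq)
  moreover have "- ip \<Omega> F u \<le> nrm \<Omega> F * nrm \<Omega> u"
    using ip_Cauchy_Schwarz[OF F H10_L2[OF uH]] by simp
  moreover have "nrm \<Omega> F * nrm \<Omega> u \<le> nrm \<Omega> F * (2 * nrm \<Omega> (D e u))"
    by (intro mult_left_mono poincare uH nrm_nonneg)
  moreover have "nrm \<Omega> (D e u) * (2 * nrm \<Omega> F) \<le> k / 2 * (nrm \<Omega> (D e u))\<^sup>2 + 1 / (2 * k) * (2 * nrm \<Omega> F)\<^sup>2"
    by (rule young[OF k])
  moreover have "k / 2 * (nrm \<Omega> (D e u))\<^sup>2 \<le> k / 2 * ?S"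
    using k by (intro mult_left_mono sum_bound e_Basis) auto
  ultimately show ?thesis by (simp add: power_mult_distrib algebra_simps)
qed

end

section \<open>Lyapunov and virial functionals\<close>

text \<open>\<open>K\<close> is at least 1 so that the same constant bounds q' = 1 - \<rho> and the
  zero order factor p = (1 + \<rho>) / 2.\<close>

locale wave_multiplier = wave \<omega> \<Omega> a b c d T M m l r
  for \<omega> :: "'b::euclidean_space set" and \<Omega> :: "(real \<times> 'b) set"
    and a :: real and b c d :: "real \<Rightarrow> real" and T :: "real \<Rightarrow> (real \<times> 'b) state \<Rightarrow> (real \<times> 'b) state"
    and M m l r :: real +
  fixes \<rho> \<rho>' \<beta> :: "real \<Rightarrow> real" and K :: real
  assumes smooth_\<rho>: "smooth1 \<rho>" and smooth_\<rho>': "smooth1 \<rho>'"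
    and d\<rho>: "\<And>x. (\<rho> has_real_derivative \<rho>' x) (at x)"
    and d\<beta>: "\<And>x. (\<beta> has_real_derivative \<rho> x) (at x)"
    and \<beta>_ends: "\<beta> 0 = 0" "\<beta> 1 = 1"
    and \<rho>_nonneg: "\<And>x. 0 \<le> \<rho> x"
    and \<rho>_support: "\<And>x. x \<notin> {l<..<r} \<Longrightarrow> \<rho> x = 0" "\<And>x. x \<notin> {l<..<r} \<Longrightarrow> \<rho>' x = 0"
    and K_ge: "K \<ge> 1" and \<rho>_le: "\<And>x. \<rho> x \<le> K"
    and K_bounds: "\<And>x. x \<in> {0..1} \<Longrightarrow> \<bar>x - \<beta> x\<bar> \<le> K" "\<And>x. x \<in> {0..1} \<Longrightarrow> \<bar>\<rho>' x\<bar> \<le> K"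

sublocale wave_multiplier \<subseteq> flow: cylinder_flow \<omega> \<Omega> "\<lambda>x. x - \<beta> x" "\<lambda>x. 1 - \<rho> x" "\<lambda>x. - \<rho>' x" K
proof
  show "((\<lambda>x. x - \<beta> x) has_real_derivative 1 - \<rho> x) (at x)" for x
    by (intro DERIV_diff DERIV_ident d\<beta>)
  show "((\<lambda>x. 1 - \<rho> x) has_real_derivative - \<rho>' x) (at x)" for x
    using DERIV_diff[OF DERIV_const d\<rho>] by simp
  show "smooth1 (\<lambda>x. - \<rho>' x)" using smooth1_mult[OF smooth1_const[of "-1"] smooth_\<rho>'] by simp
  show "\<bar>1 - \<rho> x\<bar> \<le> K" for x
    using \<rho>_nonneg[of x] \<rho>_le[of x] K_ge by (simp add: abs_le_iff)
qed (use K_ge K_bounds \<beta>_ends in auto)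

context wave_multiplier
begin

abbreviation q :: "real \<Rightarrow> real" where "q \<equiv> \<lambda>x. x - \<beta> x"
abbreviation q' :: "real \<Rightarrow> real" where "q' \<equiv> \<lambda>x. 1 - \<rho> x"

text \<open>Forced by the balance of coefficients: p - q'/2 = \<rho>, which goes with the kinetic
  terms and the transverse gradient, vanishes off the damped strip, and p + q'/2 = 1 goes with the
  axial derivative.\<close>

definition p :: "real \<Rightarrow> real" where "p x = 1/2 + 1/2 * \<rho> x"

lemma smooth_p: "smooth1 p"
  unfolding p_def[abs_def] by (intro smooth1_add smooth1_mult smooth1_const smooth_\<rho>)

lemma dp: "(p has_real_derivative 1/2 * \<rho>' x) (at x)"
  unfolding p_def[abs_def] by (auto intro!: derivative_eq_intros d\<rho>)

lemma smooth_p': "smooth1 (\<lambda>x. 1/2 * \<rho>' x)"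
  by (intro smooth1_mult smooth1_const smooth_\<rho>')

lemma mul_p: "mul p u = (\<lambda>X. of_real (1/2) * u X + of_real (1/2) * mul \<rho> u X)"
  by (simp add: mul_def p_def fun_eq_iff algebra_simps)

lemma mul_q': "mul q' u = (\<lambda>X. u X - mul \<rho> u X)"
  by (simp add: mul_def fun_eq_iff algebra_simps)

lemma ip_mul_p: "u \<in> L2 \<Omega> \<Longrightarrow> v \<in> L2 \<Omega> \<Longrightarrow> ip \<Omega> u (mul p v) = 1/2 * ip \<Omega> u v + 1/2 * ip \<Omega> u (mul \<rho> v)"
  unfolding mul_p by (simp add: ip_add_right L2_cmult mul_L2[OF smooth_\<rho>] ip_scale_right del: of_real_divide)

lemma ip_mul_q': "u \<in> L2 \<Omega> \<Longrightarrow> v \<in> L2 \<Omega> \<Longrightarrow> ip \<Omega> u (mul q' v) = ip \<Omega> u v - ip \<Omega> u (mul \<rho> v)"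
  unfolding mul_q' by (simp add: ip_diff_right mul_L2[OF smooth_\<rho>])

lemma nrm_mul_p_le: "u \<in> L2 \<Omega> \<Longrightarrow> nrm \<Omega> (mul p u) \<le> K * nrm \<Omega> u"
  unfolding mul_def[abs_def]
proof (rule nrm_mult_bounded[OF _ smooth1_measurable[OF smooth_p]])
  show "AE X in lebesgue_on \<Omega>. cmod (complex_of_real (p (fst X))) \<le> K"
  proof (rule AE_I2)
    fix X show "cmod (complex_of_real (p (fst X))) \<le> K"
      using \<rho>_nonneg[of "fst X"] \<rho>_le[of "fst X"] K_ge unfolding norm_of_real p_def by (simp add: abs_le_iff)
  qed
qed (use K_ge in auto)

text \<open>Direction by direction: along the axis the coefficient q'/2 + p equals 1, across it
  -q'/2 + p equals \<rho>, which is nonnegative and discarded. In the proof the factor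
  \<open>fst i\<close> singles out the axial term.\<close>

lemma Q_ge:
  assumes "\<And>i. i \<in> Basis \<Longrightarrow> G i \<in> L2 \<Omega>"
  shows "1/2 * flow.Q G + (\<Sum>i\<in>Basis. ip \<Omega> (G i) (mul p (G i))) \<ge> (nrm \<Omega> (G e))\<^sup>2"
proof -
  have "(\<Sum>i\<in>Basis. fst i * ip \<Omega> (G i) (G i))
      \<le> (\<Sum>i\<in>Basis. 1/2 * (flow.\<sigma> i * ip \<Omega> (G i) (mul q' (G i))) + ip \<Omega> (G i) (mul p (G i)))"
  proof (rule sum_mono)
    fix i :: "real \<times> 'b" assume i: "i \<in> Basis"
    note L = assms[OF i]
    have nn: "0 \<le> ip \<Omega> (G i) (mul \<rho> (G i))"
      by (rule ip_mul_nonneg[OF L mul_L2[OF smooth_\<rho> L]]) (simp add: \<rho>_nonneg)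
    from i show "fst i * ip \<Omega> (G i) (G i) \<le> 1/2 * (flow.\<sigma> i * ip \<Omega> (G i) (mul q' (G i))) + ip \<Omega> (G i) (mul p (G i))"
      unfolding ip_mul_p[OF L L] ip_mul_q'[OF L L]
      by (cases rule: Basis_prod_cases) (use nn in \<open>simp_all add: flow.\<sigma>_def algebra_simps\<close>)
  qed
  then show ?thesis
    unfolding sum_fst_Basis flow.Q_def nrm_sq by (simp add: sum.distrib sum_distrib_left)
qed

text \<open>The multiplier \<open>q \<partial>\<^sub>e u + p u\<close>: the terms in \<open>\<nabla>\<^sub>\<omega> u\<close> have a sign, and outside the damped
  strip so do all others.\<close>

lemma multiplier_estimate:
  assumes u: "u \<in> dom_laplacian \<Omega>" and v: "v \<in> H10 \<Omega>" and F: "F \<in> L2 \<Omega>" and k: "k > 0"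
  shows "k * ip \<Omega> (weak_laplacian \<Omega> u) (mul q (D e u)) - ip \<Omega> F (mul q (D e u)) + ip \<Omega> v (mul q (D e v))
      + (k * ip \<Omega> (weak_laplacian \<Omega> u) (mul p u) - ip \<Omega> F (mul p u) + ip \<Omega> v (mul p v))
    \<le> ip \<Omega> v (mul \<rho> v) - k/2 * (nrm \<Omega> (D e u))\<^sup>2 + k/4 * (nrm \<Omega> (mul \<rho>' u))\<^sup>2 + 9 * K\<^sup>2 / k * (nrm \<Omega> F)\<^sup>2"
proof -
  have uH: "u \<in> H10 \<Omega>" by (rule dom_laplacian_H10[OF u])
  have uL: "u \<in> L2 \<Omega>" by (rule H10_L2[OF uH])
  have vL: "v \<in> L2 \<Omega>" by (rule H10_L2[OF v])
  have DL: "D i u \<in> L2 \<Omega>" if "i \<in> Basis" for i by (rule H10_weak_partial_L2[OF uH that])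
  note De = DL[OF e_Basis]
  let ?x = "nrm \<Omega> (D e u)" and ?y = "nrm \<Omega> (mul \<rho>' u)" and ?f = "nrm \<Omega> F"
  have R: "ip \<Omega> (weak_laplacian \<Omega> u) (mul q (D e u)) \<le> - (1/2) * flow.Q (\<lambda>i. D i u)"
    by (rule flow.rellich[OF u])
  have G: "ip \<Omega> (weak_laplacian \<Omega> u) (mul p u)
      = - (\<Sum>i\<in>Basis. ip \<Omega> (D i u) (mul p (D i u))) - 1/2 * ip \<Omega> (D e u) (mul \<rho>' u)"
  proof -
    have "mul (\<lambda>x. 1/2 * \<rho>' x) u = (\<lambda>X. of_real (1/2) * mul \<rho>' u X)"
      by (simp add: mul_def fun_eq_iff)
    then show ?thesis
      using green_mult[OF u smooth_p smooth_p' dp] by (simp only: ip_scale_right)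
  qed
  have S: "ip \<Omega> (weak_laplacian \<Omega> u) (mul q (D e u)) + ip \<Omega> (weak_laplacian \<Omega> u) (mul p u)
      \<le> - ?x\<^sup>2 + 1/2 * (?x * ?y)"
    using R G Q_ge[of "\<lambda>i. D i u"] DL ip_Cauchy_Schwarz[OF De mul_L2[OF smooth_\<rho>' uL]] by (simp add: abs_le_iff)
  have kS: "k * (ip \<Omega> (weak_laplacian \<Omega> u) (mul q (D e u)) + ip \<Omega> (weak_laplacian \<Omega> u) (mul p u))
      \<le> k * (- ?x\<^sup>2 + 1/2 * (?x * ?y))"
    using S k by (intro mult_left_mono) auto
  \<comment> \<open>The kinetic part is exact: the coefficient -q'/2 + p of the squared velocity is
    \<rho>.\<close>
  have V: "ip \<Omega> v (mul q (D e v)) + ip \<Omega> v (mul p v) = ip \<Omega> v (mul \<rho> v)"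
    using ip_mult_partial[OF v flow.smooth_q flow.smooth_q' flow.dq] ip_mul_q'[OF vL vL] ip_mul_p[OF vL vL] by simp
  have F1: "- ip \<Omega> F (mul q (D e u)) \<le> ?f * (K * ?x)"
  proof -
    have "- ip \<Omega> F (mul q (D e u)) \<le> ?f * nrm \<Omega> (mul q (D e u))"
      using ip_Cauchy_Schwarz[OF F mul_L2[OF flow.smooth_q De]] by (simp add: abs_le_iff)
    also have "\<dots> \<le> ?f * (K * ?x)" by (intro mult_left_mono flow.nrm_mul_q_le De nrm_nonneg)
    finally show ?thesis .
  qed
  have F2: "- ip \<Omega> F (mul p u) \<le> ?f * (K * (2 * ?x))"
  proof -
    have "- ip \<Omega> F (mul p u) \<le> ?f * nrm \<Omega> (mul p u)"
      using ip_Cauchy_Schwarz[OF F mul_L2[OF smooth_p uL]] by (simp add: abs_le_iff)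
    also have "\<dots> \<le> ?f * (K * nrm \<Omega> u)" by (intro mult_left_mono nrm_mul_p_le uL nrm_nonneg)
    also have "\<dots> \<le> ?f * (K * (2 * ?x))" using K_ge by (intro mult_left_mono poincare uH nrm_nonneg) auto
    finally show ?thesis .
  qed
  \<comment> \<open>Of the full coefficient k of the squared axial derivative, a quarter is spent on
    the forcing, a quarter on the term with \<rho>', and half is left.\<close>
  have Y1: "?x * (3 * K * ?f) \<le> k/4 * ?x\<^sup>2 + 9 * K\<^sup>2 / k * ?f\<^sup>2"
    using young[of "k/2" ?x "3 * K * ?f"] k by (simp add: power_mult_distrib)
  have Y2: "k * (1/2 * (?x * ?y)) \<le> k/4 * ?x\<^sup>2 + k/4 * ?y\<^sup>2"
  proof -
    have "?x * ?y \<le> 1/2 * ?x\<^sup>2 + 1/2 * ?y\<^sup>2" using young[of 1 ?x ?y] by simp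
    then have "k/2 * (?x * ?y) \<le> k/2 * (1/2 * ?x\<^sup>2 + 1/2 * ?y\<^sup>2)" using k by (intro mult_left_mono) auto
    then show ?thesis by (simp add: algebra_simps)
  qed
  have e1: "k * (- ?x\<^sup>2 + 1/2 * (?x * ?y)) = - (k * ?x\<^sup>2) + k * (1/2 * (?x * ?y))"
    "?f * (K * ?x) + ?f * (K * (2 * ?x)) = ?x * (3 * K * ?f)" "k/4 * ?x\<^sup>2 = 1/4 * (k * ?x\<^sup>2)" "k/2 * ?x\<^sup>2 = 1/2 * (k * ?x\<^sup>2)"
    by (simp_all add: algebra_simps)
  have e2: "k * (ip \<Omega> (weak_laplacian \<Omega> u) (mul q (D e u)) + ip \<Omega> (weak_laplacian \<Omega> u) (mul p u))
      = k * ip \<Omega> (weak_laplacian \<Omega> u) (mul q (D e u)) + k * ip \<Omega> (weak_laplacian \<Omega> u) (mul p u)"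
    by (rule distrib_left)
  show ?thesis using kS V F1 F2 Y1 Y2 e1 e2 by linarith
qed

definition Lyap :: "(real \<times> 'b) state \<Rightarrow> real" where
  "Lyap U = (ip \<Omega> (fst (snd U)) (mul q (D e (fst U))) + ip \<Omega> (fst (snd U)) (mul p (fst U)))
    + (ip \<Omega> (snd (snd (snd U))) (mul q (D e (fst (snd (snd U))))) + ip \<Omega> (snd (snd (snd U))) (mul p (fst (snd (snd U)))))"

text \<open>Differentiating it yields kinetic minus gradient terms up to forcing, whence
  equipartition.\<close>

definition Virial :: "(real \<times> 'b) state \<Rightarrow> real" where
  "Virial U = ip \<Omega> (fst (snd U)) (fst U) + ip \<Omega> (snd (snd (snd U))) (fst (snd (snd U)))"

lemmas good_qD\<phi> = good_mul[OF flow.smooth_q good_D\<phi>[OF e_Basis]]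
  and good_qD\<psi> = good_mul[OF flow.smooth_q good_D\<psi>[OF e_Basis]]
  and good_p\<phi> = good_mul[OF smooth_p good_\<phi>]
  and good_p\<psi> = good_mul[OF smooth_p good_\<psi>]

text \<open>\<open>C1\<close> collects the bound of \<rho> by K / m times either damping and the
  forcing terms of the multiplier estimate, taken with k = 1 and k = a. \<open>C2\<close> comes from
  its terms in \<rho>', and \<open>C3\<close> from \<open>equipartition_term\<close> with the same
  two values of k.\<close>

definition C1 :: real where "C1 = K / m + 9 * K\<^sup>2 * Kf * (1 + 1 / a)"
definition C2 :: real where "C2 = K\<^sup>2 / (4 * m) * (1 + a)"
definition C3 :: real where "C3 = (2 + 2 / a) * Kf"

lemma C_nonneg: "C1 \<ge> 0" "C2 \<ge> 0" "C3 \<ge> 0"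
  using K_ge m_pos a_pos Kf_pos by (simp_all add: C1_def C2_def C3_def)

text \<open>Both \<rho> and \<rho>' live on the strip, where the dampings are at least
  \<open>m\<close>; off it they vanish and the dampings are nonnegative.\<close>

lemma weights:
  "AE X in lebesgue_on \<Omega>. \<rho> (fst X) \<le> K / m * b (fst X)"
  "AE X in lebesgue_on \<Omega>. \<rho> (fst X) \<le> K / m * d (fst X)"
  "AE X in lebesgue_on \<Omega>. (\<rho>' (fst X))\<^sup>2 \<le> K\<^sup>2 / m * b (fst X)"
  "AE X in lebesgue_on \<Omega>. (\<rho>' (fst X))\<^sup>2 \<le> K\<^sup>2 / m * d (fst X)"
proof -
  have dom: "AE X in lebesgue_on \<Omega>. X \<in> \<Omega>" by (rule AE_I2) simp
  have "AE X in lebesgue_on \<Omega>. \<rho> (fst X) \<le> K / m * b (fst X) \<and> \<rho> (fst X) \<le> K / m * d (fst X)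
      \<and> (\<rho>' (fst X))\<^sup>2 \<le> K\<^sup>2 / m * b (fst X) \<and> (\<rho>' (fst X))\<^sup>2 \<le> K\<^sup>2 / m * d (fst X)"
    using damped b_nonneg d_nonneg dom
  proof eventually_elim
    case (elim X)
    show ?case
    proof (cases "fst X \<in> {l<..<r}")
      case True
      have w: "k \<le> k / m * b (fst X) \<and> k \<le> k / m * d (fst X)" if "k \<ge> 0" for k
      proof -
        have "k / m * m \<le> k / m * b (fst X)" "k / m * m \<le> k / m * d (fst X)"
          using elim(1) True m_pos that by (intro mult_left_mono; simp)+
        then show ?thesis using m_pos by simp
      qed
      have "\<bar>\<rho>' (fst X)\<bar> \<le> K" using K_bounds(2) fst_dom[OF elim(4)] by simp
      then have "(\<rho>' (fst X))\<^sup>2 \<le> K\<^sup>2" using K_ge by (simp add: abs_le_square_iff[symmetric])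
      moreover have "K \<ge> 0" using K_ge by simp
      ultimately show ?thesis
        using w[of K] w[of "K\<^sup>2"] \<rho>_le[of "fst X"] by (auto intro: order_trans)
    next
      case False
      have "K \<ge> 0" using K_ge by simp
      then show ?thesis using \<rho>_support[OF False] elim(2,3) m_pos by simp
    qed
  qed
  then show "AE X in lebesgue_on \<Omega>. \<rho> (fst X) \<le> K / m * b (fst X)"
    "AE X in lebesgue_on \<Omega>. \<rho> (fst X) \<le> K / m * d (fst X)"
    "AE X in lebesgue_on \<Omega>. (\<rho>' (fst X))\<^sup>2 \<le> K\<^sup>2 / m * b (fst X)"
    "AE X in lebesgue_on \<Omega>. (\<rho>' (fst X))\<^sup>2 \<le> K\<^sup>2 / m * d (fst X)"
    by (eventually_elim, simp)+
qed

text \<open>The multiplier estimate for the two equations, with k = 1 and k = a; apart from the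
  negative axial terms, everything is converted into \<open>Dis\<close> or \<open>Low\<close> by
  means of the damping.\<close>

lemma Lyap_deriv:
  assumes U: "U \<in> wave_dom \<Omega>" and t: "t \<ge> 0"
  shows "\<exists>L. ((\<lambda>s. Lyap (T s U)) has_real_derivative L) (at_right t) \<and>
    L \<le> C1 * Dis (T t U) - 1/2 * (nrm \<Omega> (D e (fst (T t U))))\<^sup>2 - a/2 * (nrm \<Omega> (D e (fst (snd (snd (T t U))))))\<^sup>2
      + C2 * Low (T t U)"
proof -
  let ?V = "T t U"
  have V: "?V \<in> wave_dom \<Omega>" by (rule generator_T(1)[OF U t])
  note VE = wave_dom_E[OF V]
  note L = E_L2[OF VE] and dom = wave_domD[OF V] and FL = force_L2[OF VE]
  let ?u = "fst ?V" and ?v = "fst (snd ?V)" and ?w = "fst (snd (snd ?V))" and ?z = "snd (snd (snd ?V))"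
  have qL: "mul q (D e ?u) \<in> L2 \<Omega>" "mul q (D e ?w) \<in> L2 \<Omega>" "mul p ?u \<in> L2 \<Omega>" "mul p ?w \<in> L2 \<Omega>"
    by (intro good_L2[OF good_qD\<phi> VE] good_L2[OF good_qD\<psi> VE] good_L2[OF good_p\<phi> VE] good_L2[OF good_p\<psi> VE])+
  have der: "((\<lambda>s. Lyap (T s U)) has_real_derivative
      ((ip \<Omega> (fst (snd (A ?V))) (mul q (D e ?u)) + ip \<Omega> ?v (mul q (D e (fst (A ?V)))))
        + (ip \<Omega> (fst (snd (A ?V))) (mul p ?u) + ip \<Omega> ?v (mul p (fst (A ?V)))))
      + ((ip \<Omega> (snd (snd (snd (A ?V)))) (mul q (D e ?w)) + ip \<Omega> ?z (mul q (D e (fst (snd (snd (A ?V)))))))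
        + (ip \<Omega> (snd (snd (snd (A ?V)))) (mul p ?w) + ip \<Omega> ?z (mul p (fst (snd (snd (A ?V)))))))) (at_right t)"
    unfolding Lyap_def
    by (intro DERIV_add ip_orbit_deriv[OF U t good_v good_qD\<phi>] ip_orbit_deriv[OF U t good_v good_p\<phi>]
        ip_orbit_deriv[OF U t good_z good_qD\<psi>] ip_orbit_deriv[OF U t good_z good_p\<psi>])
  have m1: "1 * ip \<Omega> (weak_laplacian \<Omega> ?u) (mul q (D e ?u)) - ip \<Omega> (force1 ?V) (mul q (D e ?u)) + ip \<Omega> ?v (mul q (D e ?v))
      + (1 * ip \<Omega> (weak_laplacian \<Omega> ?u) (mul p ?u) - ip \<Omega> (force1 ?V) (mul p ?u) + ip \<Omega> ?v (mul p ?v))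
    \<le> ip \<Omega> ?v (mul \<rho> ?v) - 1/2 * (nrm \<Omega> (D e ?u))\<^sup>2 + 1/4 * (nrm \<Omega> (mul \<rho>' ?u))\<^sup>2 + 9 * K\<^sup>2 / 1 * (nrm \<Omega> (force1 ?V))\<^sup>2"
    by (rule multiplier_estimate[OF dom(1,2) FL(1)]) simp
  have m2: "a * ip \<Omega> (weak_laplacian \<Omega> ?w) (mul q (D e ?w)) - ip \<Omega> (force2 ?V) (mul q (D e ?w)) + ip \<Omega> ?z (mul q (D e ?z))
      + (a * ip \<Omega> (weak_laplacian \<Omega> ?w) (mul p ?w) - ip \<Omega> (force2 ?V) (mul p ?w) + ip \<Omega> ?z (mul p ?z))
    \<le> ip \<Omega> ?z (mul \<rho> ?z) - a/2 * (nrm \<Omega> (D e ?w))\<^sup>2 + a/4 * (nrm \<Omega> (mul \<rho>' ?w))\<^sup>2 + 9 * K\<^sup>2 / a * (nrm \<Omega> (force2 ?V))\<^sup>2"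
    by (rule multiplier_estimate[OF dom(3,4) FL(2) a_pos])
  have r1: "ip \<Omega> ?v (mul \<rho> ?v) + ip \<Omega> ?z (mul \<rho> ?z) \<le> K / m * Dis ?V"
    using ip_mul_mono[OF L(2) mul_L2[OF smooth_\<rho> L(2)] mul_coeff_L2(1)[OF L(2)] weights(1)]
      ip_mul_mono[OF L(4) mul_L2[OF smooth_\<rho> L(4)] mul_coeff_L2(3)[OF L(4)] weights(2)]
    by (simp add: Dis_def distrib_left)
  have r2: "1/4 * (nrm \<Omega> (mul \<rho>' ?u))\<^sup>2 + a/4 * (nrm \<Omega> (mul \<rho>' ?w))\<^sup>2 \<le> C2 * Low ?V"
  proof -
    let ?x = "ip \<Omega> ?u (mul b ?u)" and ?y = "ip \<Omega> ?w (mul d ?w)"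
    have x: "(nrm \<Omega> (mul \<rho>' ?u))\<^sup>2 \<le> K\<^sup>2 / m * ?x"
      by (rule nrm_mul_sq_le[OF L(1) mul_L2[OF smooth_\<rho>' L(1)] mul_coeff_L2(1)[OF L(1)] weights(3)])
    have y: "(nrm \<Omega> (mul \<rho>' ?w))\<^sup>2 \<le> K\<^sup>2 / m * ?y"
      by (rule nrm_mul_sq_le[OF L(3) mul_L2[OF smooth_\<rho>' L(3)] mul_coeff_L2(3)[OF L(3)] weights(4)])
    have "0 \<le> ?x" "0 \<le> ?y"
      by (rule ip_mul_nonneg[OF L(1) mul_coeff_L2(1)[OF L(1)] b_nonneg],
          rule ip_mul_nonneg[OF L(3) mul_coeff_L2(3)[OF L(3)] d_nonneg])
    then have p: "0 \<le> a * (K\<^sup>2 / m * ?x)" "0 \<le> K\<^sup>2 / m * ?y" using a_pos m_pos by simp_all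
    have "a * (nrm \<Omega> (mul \<rho>' ?w))\<^sup>2 \<le> a * (K\<^sup>2 / m * ?y)" using y a_pos by (intro mult_left_mono) auto
    moreover have "C2 * Low ?V = 1/4 * (K\<^sup>2 / m * ?x) + 1/4 * (a * (K\<^sup>2 / m * ?x)) + 1/4 * (K\<^sup>2 / m * ?y) + 1/4 * (a * (K\<^sup>2 / m * ?y))"
      by (simp add: C2_def Low_def algebra_simps add_divide_distrib)
    ultimately show ?thesis using x p by simp
  qed
  have r3: "9 * K\<^sup>2 * (nrm \<Omega> (force1 ?V))\<^sup>2 + 9 * K\<^sup>2 / a * (nrm \<Omega> (force2 ?V))\<^sup>2 \<le> 9 * K\<^sup>2 * Kf * (1 + 1 / a) * Dis ?V"
  proof -
    have "9 * K\<^sup>2 * (nrm \<Omega> (force1 ?V))\<^sup>2 \<le> 9 * K\<^sup>2 * (Kf * Dis ?V)"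
      "9 * K\<^sup>2 / a * (nrm \<Omega> (force2 ?V))\<^sup>2 \<le> 9 * K\<^sup>2 / a * (Kf * Dis ?V)"
      using a_pos by (intro mult_left_mono force_le VE; simp)+
    then show ?thesis by (simp add: algebra_simps)
  qed
  have C1: "C1 * Dis ?V = K / m * Dis ?V + 9 * K\<^sup>2 * Kf * (1 + 1 / a) * Dis ?V"
    by (simp add: C1_def distrib_right)
  show ?thesis
  proof (intro exI conjI)
    show "((\<lambda>s. Lyap (T s U)) has_real_derivative
      ((ip \<Omega> (fst (snd (A ?V))) (mul q (D e ?u)) + ip \<Omega> ?v (mul q (D e (fst (A ?V)))))
        + (ip \<Omega> (fst (snd (A ?V))) (mul p ?u) + ip \<Omega> ?v (mul p (fst (A ?V)))))
      + ((ip \<Omega> (snd (snd (snd (A ?V)))) (mul q (D e ?w)) + ip \<Omega> ?z (mul q (D e (fst (snd (snd (A ?V)))))))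
        + (ip \<Omega> (snd (snd (snd (A ?V)))) (mul p ?w) + ip \<Omega> ?z (mul p (fst (snd (snd (A ?V)))))))) (at_right t)"
      by (rule der)
    show "((ip \<Omega> (fst (snd (A ?V))) (mul q (D e ?u)) + ip \<Omega> ?v (mul q (D e (fst (A ?V)))))
        + (ip \<Omega> (fst (snd (A ?V))) (mul p ?u) + ip \<Omega> ?v (mul p (fst (A ?V)))))
      + ((ip \<Omega> (snd (snd (snd (A ?V)))) (mul q (D e ?w)) + ip \<Omega> ?z (mul q (D e (fst (snd (snd (A ?V)))))))
        + (ip \<Omega> (snd (snd (snd (A ?V)))) (mul p ?w) + ip \<Omega> ?z (mul p (fst (snd (snd (A ?V)))))))
      \<le> C1 * Dis ?V - 1/2 * (nrm \<Omega> (D e ?u))\<^sup>2 - a/2 * (nrm \<Omega> (D e ?w))\<^sup>2 + C2 * Low ?V"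
      unfolding ip_A_v[OF V qL(1)] ip_A_v[OF V qL(2)] ip_A_v[OF V qL(3)] ip_A_v[OF V qL(4)] A_simps(1,3)
      using m1 m2 r1 r2 r3 C1 by simp
  qed
qed

text \<open>Half of the Dirichlet terms are left by \<open>equipartition_term\<close>; completing
  them to - sq / 2 adds half the kinetic terms to the full ones already present, hence 3/2.\<close>

lemma Virial_deriv:
  assumes U: "U \<in> wave_dom \<Omega>" and t: "t \<ge> 0"
  shows "\<exists>L. ((\<lambda>s. Virial (T s U)) has_real_derivative L) (at_right t) \<and>
    L \<le> - 1/2 * sq (T t U) + 3/2 * ((nrm \<Omega> (fst (snd (T t U))))\<^sup>2 + (nrm \<Omega> (snd (snd (snd (T t U)))))\<^sup>2) + C3 * Dis (T t U)"
proof -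
  let ?V = "T t U"
  have V: "?V \<in> wave_dom \<Omega>" by (rule generator_T(1)[OF U t])
  note VE = wave_dom_E[OF V]
  note L = E_L2[OF VE] and dom = wave_domD[OF V] and FL = force_L2[OF VE]
  let ?u = "fst ?V" and ?v = "fst (snd ?V)" and ?w = "fst (snd (snd ?V))" and ?z = "snd (snd (snd ?V))"
  let ?L = "(ip \<Omega> (fst (snd (A ?V))) ?u + ip \<Omega> ?v (fst (A ?V))) + (ip \<Omega> (snd (snd (snd (A ?V)))) ?w + ip \<Omega> ?z (fst (snd (snd (A ?V)))))"
  have der: "((\<lambda>s. Virial (T s U)) has_real_derivative ?L) (at_right t)"
    unfolding Virial_def
    by (intro DERIV_add ip_orbit_deriv[OF U t good_v good_\<phi>] ip_orbit_deriv[OF U t good_z good_\<psi>])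
  have e1: "1 * ip \<Omega> (weak_laplacian \<Omega> ?u) ?u - ip \<Omega> (force1 ?V) ?u
      \<le> - (1 / 2) * (\<Sum>i\<in>Basis. (nrm \<Omega> (D i ?u))\<^sup>2) + 2 / 1 * (nrm \<Omega> (force1 ?V))\<^sup>2"
    by (rule equipartition_term[OF dom(1) FL(1)]) simp
  have e2: "a * ip \<Omega> (weak_laplacian \<Omega> ?w) ?w - ip \<Omega> (force2 ?V) ?w
      \<le> - (a / 2) * (\<Sum>i\<in>Basis. (nrm \<Omega> (D i ?w))\<^sup>2) + 2 / a * (nrm \<Omega> (force2 ?V))\<^sup>2"
    by (rule equipartition_term[OF dom(3) FL(2) a_pos])
  have *: "2 * (nrm \<Omega> (force1 ?V))\<^sup>2 \<le> 2 * (Kf * Dis ?V)"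
    "2 / a * (nrm \<Omega> (force2 ?V))\<^sup>2 \<le> 2 / a * (Kf * Dis ?V)"
    using a_pos by (intro mult_left_mono force_le VE; simp)+
  have C3: "C3 * Dis ?V = 2 * (Kf * Dis ?V) + 2 / a * (Kf * Dis ?V)" by (simp add: C3_def algebra_simps)
  have "?L \<le> - 1/2 * sq ?V + 3/2 * ((nrm \<Omega> ?v)\<^sup>2 + (nrm \<Omega> ?z)\<^sup>2) + C3 * Dis ?V"
  proof -
    have "sq ?V = (\<Sum>i\<in>Basis. (nrm \<Omega> (D i ?u))\<^sup>2) + (nrm \<Omega> ?v)\<^sup>2 + a * (\<Sum>i\<in>Basis. (nrm \<Omega> (D i ?w))\<^sup>2) + (nrm \<Omega> ?z)\<^sup>2"
      by (simp add: sq_def)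
    moreover note e1[unfolded mult_1 div_by_1] e2
    moreover have "- (a / 2) * (\<Sum>i\<in>Basis. (nrm \<Omega> (D i ?w))\<^sup>2) = - 1/2 * (a * (\<Sum>i\<in>Basis. (nrm \<Omega> (D i ?w))\<^sup>2))"
      by simp
    moreover have "ip \<Omega> ?v ?v = (nrm \<Omega> ?v)\<^sup>2" "ip \<Omega> ?z ?z = (nrm \<Omega> ?z)\<^sup>2" by (simp_all add: nrm_sq)
    ultimately show ?thesis
      unfolding ip_A_v[OF V L(1)] ip_A_v[OF V L(3)] A_simps(1,3) using * C3 by argo
  qed
  then show ?thesis using der by blast
qed

text \<open>Large enough that C4 / 2 and C4 a / 2 are at least 12, the weight with which axial
  derivatives have to be absorbed in \<open>decay_step\<close>. \<open>C5\<close> sums the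
  coefficients of the dissipation terms that arise there; the factor 2 in it is the one in the
  comparison of \<open>Low\<close> with \<open>Dis\<close>.\<close>

definition C4 :: real where "C4 = 24 * (1 + 1 / a)"
definition C5 :: real where "C5 = C4 * C1 + 2 * C4 * C2 + C3"

lemma C45_nonneg: "C4 \<ge> 0" "C5 \<ge> 0"
  using a_pos C_nonneg by (simp_all add: C4_def C5_def)

text \<open>\<open>W t\<close> approximates the time derivative of the orbit of \<open>U\<close>; the lower order term \<open>Low (W t)\<close>
  is then controlled by the dissipation of \<open>U\<close>.\<close>

lemma decay_step:
  assumes U: "U \<in> wave_dom \<Omega>" and W: "W \<in> wave_dom \<Omega>" and t: "t \<ge> 0"
    and close: "\<And>s. s \<ge> 0 \<Longrightarrow> N (state_diff (T s W) (A (T s U))) \<le> \<eta>"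
    and L: "L \<ge> 0" "\<forall>U\<in>E. nrm \<Omega> (fst U) \<le> L * N U" "\<forall>U\<in>E. nrm \<Omega> (fst (snd (snd U))) \<le> L * N U"
    and B: "\<forall>U\<in>E. \<bar>Lyap U\<bar> \<le> B * sq U" "\<forall>U\<in>E. \<bar>Virial U\<bar> \<le> B * sq U" "B \<ge> 0"
  shows "t * (1/2 * sq (T t U)) \<le> 2 * (C4 * B + C5 + B) * (sq U + sq W) + (C4 * C2 * (4 * M) + 6) * L\<^sup>2 * \<eta>\<^sup>2 * t"
proof -
  let ?c6 = "(C4 * C2 * (4 * M) + 6) * L\<^sup>2 * \<eta>\<^sup>2"
  let ?P = "\<lambda>s. C4 * Lyap (T s W) + C5 * (1/2 * sq (T s W) + 1/2 * sq (T s U)) + Virial (T s U)"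
  \<comment> \<open>The term s sq / 2 converts decay into a rate: its derivative produces sq / 2,
    which the virial part compensates, and a dissipation term of the good sign. The last term
    offsets the error of replacing the time derivative by the orbit of W.\<close>
  let ?G = "\<lambda>s. ?P s + s * (1/2 * sq (T s U)) - ?c6 * s"
  have UE: "U \<in> E" and WE: "W \<in> E" by (intro wave_dom_E U W)+
  have "?G t \<le> ?G 0"
  proof (rule nonincreasing_of_right_derivative[OF _ _ t])
    show "continuous_on {0..} ?G"
      unfolding Lyap_def Virial_def
      by (intro continuous_on_add continuous_on_diff continuous_on_mult continuous_on_const continuous_on_id
          sq_continuous UE WE ip_orbit_continuous[OF WE good_v good_qD\<phi>] ip_orbit_continuous[OF WE good_v good_p\<phi>]
          ip_orbit_continuous[OF WE good_z good_qD\<psi>] ip_orbit_continuous[OF WE good_z good_p\<psi>]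
          ip_orbit_continuous[OF UE good_v good_\<phi>] ip_orbit_continuous[OF UE good_z good_\<psi>])
    fix s :: real assume s: "s \<ge> 0"
    let ?V = "T s U" and ?Y = "T s W"
    have VE: "?V \<in> E" and YE: "?Y \<in> E" by (intro T_E s UE WE)+
    have AVE: "A ?V \<in> E" by (rule A_E[OF generator_T(1)[OF U s]])
    have YH: "fst ?Y \<in> H10 \<Omega>" "fst (snd (snd ?Y)) \<in> H10 \<Omega>" using YE by (simp_all add: E_iff)
    note LV = E_L2[OF VE] and LY = E_L2[OF YE]
    let ?v = "fst (snd ?V)" and ?z = "snd (snd (snd ?V))" and ?w = "fst ?Y" and ?y = "fst (snd (snd ?Y))"
    obtain l1 where l1: "((\<lambda>s. Lyap (T s W)) has_real_derivative l1) (at_right s)"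
      "l1 \<le> C1 * Dis ?Y - 1/2 * (nrm \<Omega> (D e ?w))\<^sup>2 - a/2 * (nrm \<Omega> (D e ?y))\<^sup>2 + C2 * Low ?Y"
      using Lyap_deriv[OF W s] by blast
    obtain l2 where l2: "((\<lambda>s. Virial (T s U)) has_real_derivative l2) (at_right s)"
      "l2 \<le> - 1/2 * sq ?V + 3/2 * ((nrm \<Omega> ?v)\<^sup>2 + (nrm \<Omega> ?z)\<^sup>2) + C3 * Dis ?V"
      using Virial_deriv[OF U s] by blast
    have "(?G has_real_derivative
        C4 * l1 + C5 * (1/2 * (- 2 * Dis ?Y) + 1/2 * (- 2 * Dis ?V)) + l2
          + (1 * (1/2 * sq ?V) + 1/2 * (- 2 * Dis ?V) * s) - ?c6 * 1) (at_right s)"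
      by (intro DERIV_add DERIV_diff DERIV_cmult DERIV_mult DERIV_ident l1(1) l2(1) sq_deriv U W s)
    moreover have "C4 * l1 + C5 * (1/2 * (- 2 * Dis ?Y) + 1/2 * (- 2 * Dis ?V)) + l2
          + (1 * (1/2 * sq ?V) + 1/2 * (- 2 * Dis ?V) * s) - ?c6 * 1 \<le> 0"
    proof -
      let ?x1 = "(nrm \<Omega> (D e ?w))\<^sup>2" and ?x2 = "(nrm \<Omega> (D e ?y))\<^sup>2" and ?h = "L\<^sup>2 * \<eta>\<^sup>2"
      have Dn: "0 \<le> Dis ?V" "0 \<le> Dis ?Y" by (intro Dis_nonneg VE YE)+
      have d1: "nrm \<Omega> (\<lambda>X. ?w X - ?v X) \<le> L * \<eta>"
      proof -
        have "nrm \<Omega> (\<lambda>X. ?w X - ?v X) = nrm \<Omega> (fst (state_diff ?Y (A ?V)))"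
          using good_nrm_diff[OF good_\<phi> YE AVE] unfolding A_simps .
        also have "\<dots> \<le> L * N (state_diff ?Y (A ?V))" using L(2) E_diff[OF YE AVE] by blast
        also have "\<dots> \<le> L * \<eta>" by (intro mult_left_mono close s L(1))
        finally show ?thesis .
      qed
      have d2: "nrm \<Omega> (\<lambda>X. ?y X - ?z X) \<le> L * \<eta>"
      proof -
        have "nrm \<Omega> (\<lambda>X. ?y X - ?z X) = nrm \<Omega> (fst (snd (snd (state_diff ?Y (A ?V)))))"
          using good_nrm_diff[OF good_\<psi> YE AVE] unfolding A_simps .
        also have "\<dots> \<le> L * N (state_diff ?Y (A ?V))" using L(3) E_diff[OF YE AVE] by blast
        also have "\<dots> \<le> L * \<eta>" by (intro mult_left_mono close s L(1))
        finally show ?thesis .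
      qed
      have d1s: "(nrm \<Omega> (\<lambda>X. ?w X - ?v X))\<^sup>2 \<le> ?h" and d2s: "(nrm \<Omega> (\<lambda>X. ?y X - ?z X))\<^sup>2 \<le> ?h"
        using power_mono[OF d1 nrm_nonneg, of 2] power_mono[OF d2 nrm_nonneg, of 2] by (simp_all add: power_mult_distrib)
      have low: "Low ?Y \<le> 2 * Dis ?V + 4 * M * ?h"
      proof -
        have "ip \<Omega> ?w (mul b ?w) \<le> 2 * ip \<Omega> ?v (mul b ?v) + 2 * M * (nrm \<Omega> (\<lambda>X. ?w X - ?v X))\<^sup>2"
          by (rule ip_mul_perturb[OF LY(1) LV(2) mul_coeff_L2(1)[OF LY(1)] mul_coeff_L2(1)[OF LV(2)] b_bounds])
        moreover have "ip \<Omega> ?y (mul d ?y) \<le> 2 * ip \<Omega> ?z (mul d ?z) + 2 * M * (nrm \<Omega> (\<lambda>X. ?y X - ?z X))\<^sup>2"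
          by (rule ip_mul_perturb[OF LY(3) LV(4) mul_coeff_L2(3)[OF LY(3)] mul_coeff_L2(3)[OF LV(4)] d_bounds])
        moreover have "2 * M * (nrm \<Omega> (\<lambda>X. ?w X - ?v X))\<^sup>2 \<le> 2 * M * ?h"
          "2 * M * (nrm \<Omega> (\<lambda>X. ?y X - ?z X))\<^sup>2 \<le> 2 * M * ?h"
          using d1s d2s M_pos by (intro mult_left_mono; simp)+
        moreover have "4 * M * ?h = 2 * M * ?h + 2 * M * ?h" by simp
        ultimately show ?thesis unfolding Low_def Dis_def by argo
      qed
      \<comment> \<open>A velocity of the orbit of U is nearly a displacement of the orbit of W, to
        which the Poincare inequality applies: 8 is 2 from squaring a sum times 4 from
        Poincare.\<close>
      have sqb: "(nrm \<Omega> u')\<^sup>2 \<le> 8 * (nrm \<Omega> (D e u))\<^sup>2 + 2 * ?h"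
        if "u \<in> H10 \<Omega>" "u' \<in> L2 \<Omega>" "(nrm \<Omega> (\<lambda>X. u X - u' X))\<^sup>2 \<le> ?h" for u u'
      proof -
        have "(nrm \<Omega> u')\<^sup>2 \<le> 2 * (nrm \<Omega> u)\<^sup>2 + 2 * (nrm \<Omega> (\<lambda>X. u' X - u X))\<^sup>2"
          by (rule nrm_sq_add_le[OF H10_L2[OF that(1)] L2_diff[OF that(2) H10_L2[OF that(1)]] that(2)]) simp
        moreover have "(nrm \<Omega> u)\<^sup>2 \<le> 4 * (nrm \<Omega> (D e u))\<^sup>2"
          using power_mono[OF poincare[OF that(1)] nrm_nonneg, of 2] by (simp add: power_mult_distrib)
        ultimately show ?thesis using that(3) unfolding nrm_minus_commute[of \<Omega> u' u] by argo
      qed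
      have vz: "3/2 * ((nrm \<Omega> ?v)\<^sup>2 + (nrm \<Omega> ?z)\<^sup>2) \<le> 12 * ?x1 + 12 * ?x2 + 6 * ?h"
        using sqb[OF YH(1) LV(2) d1s] sqb[OF YH(2) LV(4) d2s] by argo
      have "C4 * l1 \<le> C4 * (C1 * Dis ?Y - 1/2 * ?x1 - a/2 * ?x2 + C2 * (2 * Dis ?V + 4 * M * ?h))"
        using l1(2) mult_left_mono[OF low C_nonneg(2)] by (intro mult_left_mono C45_nonneg) linarith
      also have "\<dots> = C4 * C1 * Dis ?Y - C4/2 * ?x1 - C4 * a/2 * ?x2 + 2 * C4 * C2 * Dis ?V + C4 * C2 * (4 * M) * ?h"
        by (simp add: algebra_simps)
      finally have c4: "C4 * l1 \<le> C4 * C1 * Dis ?Y - C4/2 * ?x1 - C4 * a/2 * ?x2 + 2 * C4 * C2 * Dis ?V + C4 * C2 * (4 * M) * ?h" .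
      have x: "12 * ?x1 \<le> C4/2 * ?x1" "12 * ?x2 \<le> C4 * a/2 * ?x2"
      proof -
        have k: "12 \<le> C4/2" "12 \<le> C4 * a/2"
          using a_pos unfolding C4_def by (simp_all add: distrib_left distrib_right)
        show "12 * ?x1 \<le> C4/2 * ?x1" "12 * ?x2 \<le> C4 * a/2 * ?x2"
          by (rule mult_right_mono[OF k(1) zero_le_power2], rule mult_right_mono[OF k(2) zero_le_power2])
      qed
      have c5: "C5 * (1/2 * (- 2 * Dis ?Y) + 1/2 * (- 2 * Dis ?V))
          = - (C4 * C1 * Dis ?Y) - 2 * C4 * C2 * Dis ?Y - C3 * Dis ?Y - C4 * C1 * Dis ?V - 2 * C4 * C2 * Dis ?V - C3 * Dis ?V"
        by (simp add: C5_def algebra_simps)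
      have nn: "0 \<le> 2 * C4 * C2 * Dis ?Y" "0 \<le> C3 * Dis ?Y" "0 \<le> C4 * C1 * Dis ?V" "0 \<le> Dis ?V * s"
        using C_nonneg C45_nonneg Dn s by simp_all
      have c6: "?c6 = C4 * C2 * (4 * M) * ?h + 6 * ?h" by (simp add: algebra_simps)
      have c7: "1/2 * (- 2 * Dis ?V) * s = - (Dis ?V * s)" by simp
      show ?thesis using l2(2) c4 x c5 nn c6 c7 vz by argo
    qed
    ultimately show "\<exists>D\<le>0. (?G has_real_derivative D) (at_right s)" by blast
  qed
  then have main: "t * (1/2 * sq (T t U)) \<le> ?P 0 - ?P t + ?c6 * t" by simp
  \<comment> \<open>Applied at 0 and at t, whence the factor 2 in the claim; by contraction the
    states may be replaced by their initial values.\<close>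
  have bound: "\<bar>?P s\<bar> \<le> (C4 * B + C5 + B) * (sq U + sq W)" if s: "s \<ge> 0" for s
  proof -
    have VE: "T s U \<in> E" and YE: "T s W \<in> E" by (intro T_E s UE WE)+
    have le: "sq (T s U) \<le> sq U" "sq (T s W) \<le> sq W" by (intro contraction U W s)+
    have 1: "\<bar>C4 * Lyap (T s W)\<bar> \<le> C4 * (B * sq W)"
    proof -
      have "\<bar>Lyap (T s W)\<bar> \<le> B * sq (T s W)" using B(1) YE by blast
      also have "\<dots> \<le> B * sq W" by (intro mult_left_mono le B)
      finally show ?thesis unfolding abs_mult using C45_nonneg(1) by (simp add: mult_left_mono)
    qed
    have 2: "\<bar>Virial (T s U)\<bar> \<le> B * sq U"
    proof -
      have "\<bar>Virial (T s U)\<bar> \<le> B * sq (T s U)" using B(2) VE by blast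
      also have "\<dots> \<le> B * sq U" by (intro mult_left_mono le B)
      finally show ?thesis .
    qed
    have 3: "\<bar>C5 * (1/2 * sq (T s W) + 1/2 * sq (T s U))\<bar> \<le> C5 * (sq U + sq W)"
      unfolding abs_mult using C45_nonneg(2) le sq_nonneg[of "T s U"] sq_nonneg[of "T s W"] sq_nonneg[of U] sq_nonneg[of W]
      by (simp add: mult_left_mono)
    have p: "0 \<le> C4 * (B * sq U)" "0 \<le> B * sq W" using C45_nonneg B sq_nonneg by simp_all
    have "(C4 * B + C5 + B) * (sq U + sq W) = C4 * (B * sq U) + C4 * (B * sq W) + C5 * (sq U + sq W) + B * sq U + B * sq W"
      by (simp add: algebra_simps)
    then show ?thesis using 1 2 3 p by linarith
  qed
  have "2 * (C4 * B + C5 + B) * (sq U + sq W) = (C4 * B + C5 + B) * (sq U + sq W) + (C4 * B + C5 + B) * (sq U + sq W)"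
    by simp
  then show ?thesis using main abs_le_D1[OF bound[OF order_refl]] abs_le_D2[OF bound[OF t]] by linarith
qed

text \<open>\<open>decay_step\<close> is used with \<open>quot h U\<close> for W, and h tends to 0
  for fixed t: the error term vanishes although it carries the factor t, and the norm of W is
  bounded by twice that of \<open>A U\<close> in the limit. The factor 8 is 2 times the square of
  that 2.\<close>

lemma decay:
  "\<exists>C>0. \<forall>t>0. \<forall>U\<in>wave_dom \<Omega>. energy \<Omega> a (T t U) \<le> C / t * (wave_graph_norm \<Omega> a b c d U)\<^sup>2"
proof -
  obtain B1 where B1: "B1 \<ge> 0" "\<forall>U\<in>E. \<bar>ip \<Omega> (fst (snd U)) (mul q (D e (fst U)))\<bar> \<le> B1 * sq U"
    using good_ip_bound[OF good_v good_qD\<phi>] by blast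
  obtain B2 where B2: "B2 \<ge> 0" "\<forall>U\<in>E. \<bar>ip \<Omega> (fst (snd U)) (mul p (fst U))\<bar> \<le> B2 * sq U"
    using good_ip_bound[OF good_v good_p\<phi>] by blast
  obtain B3 where B3: "B3 \<ge> 0" "\<forall>U\<in>E. \<bar>ip \<Omega> (snd (snd (snd U))) (mul q (D e (fst (snd (snd U)))))\<bar> \<le> B3 * sq U"
    using good_ip_bound[OF good_z good_qD\<psi>] by blast
  obtain B4 where B4: "B4 \<ge> 0" "\<forall>U\<in>E. \<bar>ip \<Omega> (snd (snd (snd U))) (mul p (fst (snd (snd U))))\<bar> \<le> B4 * sq U"
    using good_ip_bound[OF good_z good_p\<psi>] by blast
  obtain B5 where B5: "B5 \<ge> 0" "\<forall>U\<in>E. \<bar>ip \<Omega> (fst (snd U)) (fst U)\<bar> \<le> B5 * sq U"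
    using good_ip_bound[OF good_v good_\<phi>] by blast
  obtain B6 where B6: "B6 \<ge> 0" "\<forall>U\<in>E. \<bar>ip \<Omega> (snd (snd (snd U))) (fst (snd (snd U)))\<bar> \<le> B6 * sq U"
    using good_ip_bound[OF good_z good_\<psi>] by blast
  define B where "B = B1 + B2 + B3 + B4 + B5 + B6"
  have B: "B \<ge> 0" using B1 B2 B3 B4 B5 B6 by (simp add: B_def)
  have BB: "\<bar>Lyap U\<bar> \<le> B * sq U \<and> \<bar>Virial U\<bar> \<le> B * sq U" if U: "U \<in> E" for U
  proof -
    have p: "0 \<le> B1 * sq U" "0 \<le> B2 * sq U" "0 \<le> B3 * sq U" "0 \<le> B4 * sq U" "0 \<le> B5 * sq U" "0 \<le> B6 * sq U"
      using sq_nonneg B1(1) B2(1) B3(1) B4(1) B5(1) B6(1) by simp_all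
    have e: "B * sq U = B1 * sq U + B2 * sq U + B3 * sq U + B4 * sq U + B5 * sq U + B6 * sq U"
      by (simp add: B_def algebra_simps)
    show ?thesis
      unfolding Lyap_def Virial_def
      using p e B1(2)[rule_format, OF U] B2(2)[rule_format, OF U] B3(2)[rule_format, OF U]
        B4(2)[rule_format, OF U] B5(2)[rule_format, OF U] B6(2)[rule_format, OF U] by linarith
  qed
  obtain L1 where L1: "L1 \<ge> 0" "\<forall>U\<in>E. nrm \<Omega> (fst U) \<le> L1 * N U" using good_bound[OF good_\<phi>] by blast
  obtain L2' where L2': "L2' \<ge> 0" "\<forall>U\<in>E. nrm \<Omega> (fst (snd (snd U))) \<le> L2' * N U" using good_bound[OF good_\<psi>] by blast
  define L where "L = L1 + L2'"
  have L: "L \<ge> 0" "\<forall>U\<in>E. nrm \<Omega> (fst U) \<le> L * N U" "\<forall>U\<in>E. nrm \<Omega> (fst (snd (snd U))) \<le> L * N U"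
  proof -
    show "L \<ge> 0" using L1 L2' by (simp add: L_def)
    show "\<forall>U\<in>E. nrm \<Omega> (fst U) \<le> L * N U"
    proof
      fix U assume U: "U \<in> E"
      have "0 \<le> L2' * N U" using L2'(1) N_nonneg[OF U] by simp
      with L1(2)[rule_format, OF U] show "nrm \<Omega> (fst U) \<le> L * N U" unfolding L_def distrib_right by linarith
    qed
    show "\<forall>U\<in>E. nrm \<Omega> (fst (snd (snd U))) \<le> L * N U"
    proof
      fix U assume U: "U \<in> E"
      have "0 \<le> L1 * N U" using L1(1) N_nonneg[OF U] by simp
      with L2'(2)[rule_format, OF U] show "nrm \<Omega> (fst (snd (snd U))) \<le> L * N U" unfolding L_def distrib_right by linarith
    qed
  qed
  define C7 where "C7 = C4 * B + C5 + B"
  have C7: "C7 \<ge> 0" using C45_nonneg B by (simp add: C7_def)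
  define C8 where "C8 = (C4 * C2 * (4 * M) + 6) * L\<^sup>2"
  have main: "t * (1/2 * sq (T t U)) \<le> 8 * C7 * ((N U)\<^sup>2 + (N (A U))\<^sup>2)"
    if U: "U \<in> wave_dom \<Omega>" and t: "t > 0" for U t
  proof -
    have UE: "U \<in> E" and AUE: "A U \<in> E" using U wave_dom_E A_E by auto
    let ?\<nu> = "\<lambda>h. N (state_diff (quot h U) (A U))"
    have step: "t * (1/2 * sq (T t U)) \<le> 2 * C7 * ((N U)\<^sup>2 + (2 * (N (A U) + ?\<nu> h))\<^sup>2) + C8 * (4 * ?\<nu> h)\<^sup>2 * t" if h: "h > 0" for h
    proof -
      have W: "quot h U \<in> wave_dom \<Omega>"
        unfolding quot_def using h by (intro wave_dom_scale wave_dom_diff generator_T(1) U) simp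
      have WE: "quot h U \<in> E" by (rule wave_dom_E[OF W])
      have "t * (1/2 * sq (T t U)) \<le> 2 * C7 * (sq U + sq (quot h U)) + C8 * (4 * ?\<nu> h)\<^sup>2 * t"
        unfolding C7_def C8_def
        by (rule decay_step[OF U W _ _ L]) (use t BB B quot_orbit_close[OF U _ h] in auto)
      moreover have "sq (quot h U) \<le> (2 * (N (A U) + ?\<nu> h))\<^sup>2"
        unfolding N_sq[OF WE, symmetric] by (intro power_mono N_le_diff N_nonneg WE AUE)
      then have "2 * C7 * (sq U + sq (quot h U)) \<le> 2 * C7 * ((N U)\<^sup>2 + (2 * (N (A U) + ?\<nu> h))\<^sup>2)"
        using C7 by (intro mult_left_mono) (auto simp: N_sq[OF UE])
      ultimately show ?thesis by linarith
    qed
    have "has_generator_value \<Omega> a T U (A U)" using generator[OF UE AUE] U state_eq_refl by blast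
    then have \<nu>0: "(?\<nu> \<longlongrightarrow> 0) (at_right 0)" by (simp only: has_generator_value_quot)
    have lim: "((\<lambda>h. 2 * C7 * ((N U)\<^sup>2 + (2 * (N (A U) + ?\<nu> h))\<^sup>2) + C8 * (4 * ?\<nu> h)\<^sup>2 * t)
        \<longlongrightarrow> 2 * C7 * ((N U)\<^sup>2 + (2 * (N (A U) + 0))\<^sup>2) + C8 * (4 * 0)\<^sup>2 * t) (at_right 0)"
      by (intro tendsto_intros \<nu>0)
    have "t * (1/2 * sq (T t U)) \<le> 2 * C7 * ((N U)\<^sup>2 + (2 * (N (A U) + 0))\<^sup>2) + C8 * (4 * 0)\<^sup>2 * t"
    proof (rule tendsto_lowerbound[OF lim])
      show "\<forall>\<^sub>F h in at_right 0. t * (1/2 * sq (T t U)) \<le> 2 * C7 * ((N U)\<^sup>2 + (2 * (N (A U) + ?\<nu> h))\<^sup>2) + C8 * (4 * ?\<nu> h)\<^sup>2 * t"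
        using eventually_at_right_0 by (rule eventually_mono) (rule step)
    qed simp
    also have "\<dots> = 2 * C7 * (N U)\<^sup>2 + 8 * C7 * (N (A U))\<^sup>2"
      by (simp add: power_mult_distrib algebra_simps)
    also have "\<dots> \<le> 8 * C7 * (N U)\<^sup>2 + 8 * C7 * (N (A U))\<^sup>2"
      using C7 by (intro add_right_mono mult_right_mono) auto
    finally show ?thesis by (simp add: distrib_left)
  qed
  show ?thesis
  proof (intro exI[of _ "8 * C7 + 1"] conjI allI impI ballI)
    show "0 < 8 * C7 + 1" using C7 by simp
    fix t :: real and U assume t: "t > 0" and U: "U \<in> wave_dom \<Omega>"
    have "energy \<Omega> a (T t U) = 1/2 * sq (T t U)"
      by (rule energy_eq[OF T_E[OF less_imp_le[OF t] wave_dom_E[OF U]]])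
    then have "t * energy \<Omega> a (T t U) \<le> 8 * C7 * ((N U)\<^sup>2 + (N (A U))\<^sup>2)" using main[OF U t] by (simp only:)
    also have "\<dots> \<le> (8 * C7 + 1) * (wave_graph_norm \<Omega> a b c d U)\<^sup>2"
      by (simp add: wave_graph_norm_def distrib_right)
    finally show "energy \<Omega> a (T t U) \<le> (8 * C7 + 1) / t * (wave_graph_norm \<Omega> a b c d U)\<^sup>2"
      using t by (simp add: pos_le_divide_eq mult.commute)
  qed
qed

end

theorem theorem3p2:
  fixes \<omega> :: "(real ^ 'n) set"
    and \<Omega> :: "(real \<times> (real ^ 'n)) set"
    and a \<alpha>\<^sub>1 \<alpha>\<^sub>2 \<alpha>\<^sub>3 \<alpha>\<^sub>4 b\<^sub>0 c\<^sub>0 d\<^sub>0 :: real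
    and b c d :: "real \<Rightarrow> real"
    and T :: "real \<Rightarrow> (real \<times> (real ^ 'n)) state \<Rightarrow> (real \<times> (real ^ 'n)) state"
  assumes "\<omega> \<noteq> {}" and "bounded \<omega>" and "open \<omega>" and "lipschitz_boundary \<omega>"
    and \<Omega>_def: "\<Omega> = {0<..<1} \<times> \<omega>"
    and "a > 0"
    and "b \<in> Linf {0<..<1}" and "c \<in> Linf {0<..<1}" and "d \<in> Linf {0<..<1}"
    and "0 \<le> \<alpha>\<^sub>1" and "\<alpha>\<^sub>1 < \<alpha>\<^sub>2" and "\<alpha>\<^sub>2 < \<alpha>\<^sub>3" and "\<alpha>\<^sub>3 < \<alpha>\<^sub>4" and "\<alpha>\<^sub>4 \<le> 1"
    and "b\<^sub>0 > 0" and "c\<^sub>0 > 0" and "d\<^sub>0 > 0"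
    and "AE x in lebesgue_on {\<alpha>\<^sub>1<..<\<alpha>\<^sub>4}. b x \<ge> b\<^sub>0"
    and "AE x in lebesgue_on ({0<..<1} - {\<alpha>\<^sub>1<..<\<alpha>\<^sub>4}). b x \<ge> 0"
    and "AE x in lebesgue_on {\<alpha>\<^sub>2<..<\<alpha>\<^sub>3}. \<bar>c x\<bar> \<ge> c\<^sub>0"
    and "AE x in lebesgue_on ({0<..<1} - {\<alpha>\<^sub>2<..<\<alpha>\<^sub>3}). c x = 0"
    and "AE x in lebesgue_on {\<alpha>\<^sub>1<..<\<alpha>\<^sub>4}. d x \<ge> d\<^sub>0"
    and "AE x in lebesgue_on ({0<..<1} - {\<alpha>\<^sub>1<..<\<alpha>\<^sub>4}). d x \<ge> 0"
    and "wave_semigroup \<Omega> a b c d T"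
  shows "\<exists>C>0. \<forall>t>0. \<forall>\<Phi>\<^sub>0\<in>wave_dom \<Omega>.
           energy \<Omega> a (T t \<Phi>\<^sub>0) \<le> C / t * (wave_graph_norm \<Omega> a b c d \<Phi>\<^sub>0)\<^sup>2"
proof -
  note b = assms(7) and c = assms(8) and d = assms(9)
  note order = assms(10-14) and pos = assms(15,17)
  note b_damped = assms(18) and b_nonneg = assms(19) and c_zero = assms(21)
    and d_damped = assms(22) and d_nonneg = assms(23)
  interpret cylinder \<omega> \<Omega>
    by unfold_locales (fact assms)+
  \<comment> \<open>The middle third of the strip: \<rho> then vanishes near every point outside
    \<open>(\<alpha>\<^sub>1, \<alpha>\<^sub>4)\<close>, and so its derivative is zero at such
    points.\<close>
  define l r where "l = (2 * \<alpha>\<^sub>1 + \<alpha>\<^sub>4) / 3" and "r = (\<alpha>\<^sub>1 + 2 * \<alpha>\<^sub>4) / 3"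
  have lr: "\<alpha>\<^sub>1 < l" "0 \<le> l" "l < r" "r \<le> 1" "r < \<alpha>\<^sub>4" using order by (simp_all add: l_def r_def)
  obtain \<rho> \<beta> where \<rho>: "smooth1 \<rho>" "smooth1 \<beta>" "\<And>x. (\<beta> has_real_derivative \<rho> x) (at x)"
    "\<And>x. \<rho> x \<ge> 0" "\<And>x. x \<notin> {l<..<r} \<Longrightarrow> \<rho> x = 0" "\<beta> 0 = 0" "\<beta> 1 = 1"
    using exists_smooth_step[OF lr(2-4)] by metis
  obtain \<rho>' where \<rho>': "\<And>x. (\<rho> has_real_derivative \<rho>' x) (at x)" "smooth1 \<rho>'"
    using smooth1_derivative[OF \<rho>(1)] by metis
  have \<rho>'_0: "\<rho>' x = 0" if x: "x \<notin> {\<alpha>\<^sub>1<..<\<alpha>\<^sub>4}" for x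
  proof (rule DERIV_unique[OF \<rho>'(1)])
    show "(\<rho> has_real_derivative 0) (at x)"
    proof (rule has_real_derivative_cong_open[where g="\<lambda>_. 0" and S="- {l..r}"])
      show "x \<in> - {l..r}" using x lr by auto
      show "\<rho> y = 0" if "y \<in> - {l..r}" for y
        using that by (intro \<rho>(5)) auto
    qed (auto intro: open_Compl)
  qed
  have "smooth1 (\<lambda>x. - 1 * \<beta> x)" by (intro smooth1_mult smooth1_const \<rho>(2))
  then have "smooth1 (\<lambda>x. x + - 1 * \<beta> x)" by (rule smooth1_add[OF smooth1_ident])
  then obtain K1 where K1: "\<forall>x\<in>{0..1}. \<bar>x - \<beta> x\<bar> \<le> K1" "K1 \<ge> 0"
    using smooth1_bounded by auto
  obtain K2 where K2: "\<forall>x\<in>{0..1}. \<bar>\<rho> x\<bar> \<le> K2" "K2 \<ge> 0" using smooth1_bounded[OF \<rho>(1)] by auto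
  obtain K3 where K3: "\<forall>x\<in>{0..1}. \<bar>\<rho>' x\<bar> \<le> K3" "K3 \<ge> 0" using smooth1_bounded[OF \<rho>'(2)] by auto
  define K where "K = 1 + K1 + K2 + K3"
  obtain Mb Mc Md where Mb: "AE X in lebesgue_on \<Omega>. \<bar>b (fst X)\<bar> \<le> Mb"
    and Mc: "AE X in lebesgue_on \<Omega>. \<bar>c (fst X)\<bar> \<le> Mc" and Md: "AE X in lebesgue_on \<Omega>. \<bar>d (fst X)\<bar> \<le> Md"
    using Linf_fst(2)[OF b] Linf_fst(2)[OF c] Linf_fst(2)[OF d] by blast
  define M where "M = 1 + \<bar>Mb\<bar> + \<bar>Mc\<bar> + \<bar>Md\<bar>"
  define m where "m = min b\<^sub>0 d\<^sub>0"
  have in_unit: "AE X in lebesgue_on \<Omega>. fst X \<in> {0<..<1}"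
    by (rule AE_I2) (auto simp: \<Omega>_def)
  have borel: "{u<..<v} \<in> sets borel" "{0<..<1} - {u<..<v} \<in> sets borel" for u v :: real by simp_all
  note in1 = AE_fst[OF b_damped borel(1)] and in2 = AE_fst[OF b_nonneg borel(2)] and in3 = AE_fst[OF c_zero borel(2)]
    and in4 = AE_fst[OF d_damped borel(1)] and in5 = AE_fst[OF d_nonneg borel(2)]
  \<comment> \<open>The strip of the locale is the whole damped strip, not the smaller support of
    \<rho>, so that it contains the support of c.\<close>
  interpret wave_multiplier \<omega> \<Omega> a b c d T M m \<alpha>\<^sub>1 \<alpha>\<^sub>4 \<rho> \<rho>' \<beta> K
  proof
    show "m > 0" using pos by (simp add: m_def)
    show "M > 0" by (simp add: M_def)
    show "AE X in lebesgue_on \<Omega>. 0 \<le> b (fst X) \<and> b (fst X) \<le> M"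
      using in_unit in1 in2 Mb by eventually_elim (use pos in \<open>auto simp: M_def\<close>)
    show "AE X in lebesgue_on \<Omega>. 0 \<le> d (fst X) \<and> d (fst X) \<le> M"
      using in_unit in4 in5 Md by eventually_elim (use pos in \<open>auto simp: M_def\<close>)
    show "AE X in lebesgue_on \<Omega>. \<bar>c (fst X)\<bar> \<le> M"
      using Mc by eventually_elim (auto simp: M_def)
    show "AE X in lebesgue_on \<Omega>. fst X \<in> {\<alpha>\<^sub>1<..<\<alpha>\<^sub>4} \<longrightarrow> m \<le> b (fst X) \<and> m \<le> d (fst X)"
      using in1 in4 by eventually_elim (auto simp: m_def)
    show "AE X in lebesgue_on \<Omega>. fst X \<notin> {\<alpha>\<^sub>1<..<\<alpha>\<^sub>4} \<longrightarrow> c (fst X) = 0"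
      using in_unit in3 by eventually_elim (use order in auto)
    show "\<rho> x = 0" if "x \<notin> {\<alpha>\<^sub>1<..<\<alpha>\<^sub>4}" for x using that lr by (intro \<rho>(5)) auto
    show "1 \<le> K" using K1 K2 K3 by (simp add: K_def)
    \<comment> \<open>The bound is wanted on the whole line; outside [0, 1] it holds because \<rho>
      vanishes there.\<close>
    show "\<rho> x \<le> K" for x
    proof (cases "x \<in> {0..1}")
      case True
      then have "\<bar>\<rho> x\<bar> \<le> K2" using K2 by blast
      then show ?thesis using K1 K2 K3 by (simp add: K_def)
    next
      case False
      then have "\<rho> x = 0" using lr by (intro \<rho>(5)) auto
      then show ?thesis using K1 K2 K3 by (simp add: K_def)
    qed
    show "\<bar>x - \<beta> x\<bar> \<le> K" if "x \<in> {0..1}" for x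
      using K1(1)[rule_format, OF that] K1 K2 K3 by (simp add: K_def)
    show "\<bar>\<rho>' x\<bar> \<le> K" if "x \<in> {0..1}" for x
      using K3(1)[rule_format, OF that] K1 K2 K3 by (simp add: K_def)
  qed (use order \<rho> \<rho>' \<rho>'_0 Linf_fst(1) b c d assms in auto)
  show ?thesis by (rule decay)
qed

end
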